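(* Let $(A,G,\psi)$ be an abstract kernel, i.e. $A$ is a semilattice of groups, $G$ is a group and $\psi:G\to\varsigma(A)$ is a unital partial homomorphism. If $(A,G,\psi)$ has an admissible extension, then the set of equivalence classes of admissible extensions of $(A,G,\psi)$ (i.e. of admissible extensions of $A$ by $G$ whose abstract kernel is $\psi$) is in a one-to-one correspondence with the set $H^2(G,C(A))$, where $C(A)$ is regarded as a partial $G$-module via $\tilde\theta$.
   Context: Conventions. A semilattice of groups is an inverse semigroup whose idempotents are central. Ideals are two-sided. $E(S)$ is the set of idempotents and $C(S)$ the center of a semigroup $S$. In an inverse semigroup every ideal is idempotent and $IJ=I\cap J$ for non-empty ideals $I,J$. Multipliers. A multiplier of a semigroup $S$ is a pair $m$ of maps $s\mapsto ms$, $s\mapsto sm$ from $S$ to $S$ with $m(st)=(ms)t$, $(st)m=s(tm)$, $s(mt)=(sm)t$ for all $s,t\in S$. They form a monoid $\mathcal M(S)$ with $(mn)s=m(ns)$, $s(mn)=(sm)n$. $\mathcal U(M)$ is the group of invertible elements of a monoid $M$. If $S^2=S$ then $(ms)n=m(sn)$, so $msn$ is unambiguous. Multipliers of an ideal $I$ of an inverse semigroup restrict to multipliers of ideals contained in $I$; restrictions are denoted by the same letter. The monoid $\varsigma(A)$. $\Sigma(A)$ is the inverse monoid (under composition of partial maps) of all isomorphisms between ideals of $A$. For $\varphi,\psi\in\Sigma(A)$ put $\psi\sim\varphi$ iff $\operatorname{dom}\varphi=\operatorname{dom}\psi$, $\operatorname{ran}\varphi=\operatorname{ran}\psi$ and there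 is $m\in\mathcal U(\mathcal M(\operatorname{ran}\varphi))$ with $\psi(s)=m\varphi(s)m^{-1}$ for all $s\in\operatorname{dom}\varphi$. This is a congruence and $\varsigma(A)=\Sigma(A)/{\sim}$. A map $f:G\to S$ from a group to a monoid is a unital partial homomorphism if $f(1)=1$, $f(g^{-1})f(g)f(h)=f(g^{-1})f(gh)$ and $f(g)f(h)f(h^{-1})=f(gh)f(h^{-1})$ for all $g,h\in G$. Partial actions and cohomology. A partial action of $G$ on a semigroup $B$ is a family of isomorphisms $\theta_g:B_{g^{-1}}\to B_g$ between two-sided ideals of $B$ with $B_1=B$, $\theta_1=\mathrm{id}_B$, $\theta_g(B_{g^{-1}}\cap B_h)=B_g\cap B_{gh}$, and $\theta_g\circ\theta_h=\theta_{gh}$ on $B_{h^{-1}}\cap B_{h^{-1}g^{-1}}$. A partial $G$-module is a semilattice of abelian groups $B$ (i.e. a commutative inverse semigroup) with a partial action $\theta$ of $G$ on $B$. For $n\ge1$, $C^n(G,B)$ is the abelian group (pointwise multiplication) of functions $f$ on $G^n$ with $f(x_1,\dots,x_n)\in\mathcal U(\mathcal M(B_{x_1}B_{x_1x_2}\cdots B_{x_1\cdots x_n}))$. The coboundary $\delta^n:C^n(G,B)\to C^{n+1}(G,B)$ is $$(\delta^nf)(x_1,\dots,x_{n+1})a=\theta_{x_1}\big(\theta_{x_1}^{-1}(a)f(x_2,\dots,x_{n+1})\big)\prod_{i=1}^nf(x_1,\dots,x_ix_{i+1},\dots,x_{n+1})^{(-1)^i}f(x_1,\dots,x_n)^{(-1)^{n+1}}$$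 for $a\in B_{x_1}B_{x_1x_2}\cdots B_{x_1\cdots x_{n+1}}$. For $n\geq 2$, $Z^n=\ker\delta^n$, $B^n=\operatorname{im}\delta^{n-1}$, $H^n(G,B)=Z^n/B^n$. The partial $G$-module $C(A)$. For $g\in G$ let $\mathcal D_g$ be the common range of the isomorphisms in $\psi(g)$; every $\theta_g\in\psi(g)$ is an isomorphism $\mathcal D_{g^{-1}}\to\mathcal D_g$. The maps $\tilde\theta_g=\theta_g|_{C(\mathcal D_{g^{-1}})}:C(\mathcal D_{g^{-1}})\to C(\mathcal D_g)$ do not depend on the choice of $\theta_g\in\psi(g)$ and form a partial action $\tilde\theta$ of $G$ on $C(A)$. Extensions. An extension of $A$ by an inverse semigroup $S$ is an inverse semigroup $U$ with a monomorphism $i:A\to U$ and an idempotent-separating epimorphism $\pi:U\to S$ such that $i(A)=\pi^{-1}(E(S))$. An extension $A\xrightarrow{i}U\xrightarrow{j}G$ of $A$ by the group $G$ is an inverse semigroup $U$ with a monomorphism $i$ and an epimorphism $j:U\to G$ such that $i(A)=j^{-1}(1)$. Two extensions $A\xrightarrow{i}U\xrightarrow{j}G$ and $A\xrightarrow{i'}U'\xrightarrow{j'}G$ are equivalent if there is an isomorphism $\mu:U\to U'$ with $\mu\circ i=i'$ and $j'\circ\mu=j$. A refinement of $A\xrightarrow{i}U\xrightarrow{j}G$ is $A\xrightarrow{i}U\xrightarrow{\pi}S\xrightarrow{\kappa}G$ with $S$ an $E$-unitary inverse semigroup, $A\xrightarrow{i}U\xrightarrow{\pi}S$ an extension of $A$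 by $S$, $\kappa$ an epimorphism and $j=\kappa\circ\pi$. The extension is admissible if it has a refinement for which there is an order-preserving transversal of $\pi$: a map $\rho:S\to U$ with $\pi\circ\rho=\mathrm{id}_S$, $\rho(E(S))\subseteq E(U)$, preserving the natural partial orders. Given such data, put $\mathcal D_g=\{a\in A:\exists s\in S,\ \kappa(s)=g,\ \rho(ss^{-1})=i(aa^{-1})\}$ and $\theta_g:\mathcal D_{g^{-1}}\to\mathcal D_g$, $\theta_g(a)=i^{-1}(\rho(s)i(a)\rho(s)^{-1})$, where $s$ is the element with $\kappa(s)=g$ and $\rho(s^{-1}s)=i(aa^{-1})$. The abstract kernel of the admissible extension is the unital partial homomorphism $G\to\varsigma(A)$, $g\mapsto[\theta_g]$ (independent of the chosen refinement and transversal). $(A,G,\psi)$ has an admissible extension if $\psi$ is the abstract kernel of some admissible extension of $A$ by $G$. *)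

theory Defs
  imports "HOL-Algebra.Coset" "HOL-Algebra.Product_Groups"
begin

section \<open>Inverse semigroups\<close>

text \<open>A semigroup is a carrier with a multiplication.  It is stored in the record type
  \<^type>\<open>monoid\<close>, so that \<^const>\<open>hom\<close>, \<^const>\<open>mon\<close>, \<^const>\<open>epi\<close>, \<^const>\<open>iso\<close> and
  \<^const>\<open>set_mult\<close> apply; none of these reads the field \<^const>\<open>one\<close>, and neither does anything
  below for a record that stands for a semigroup.  A subsemigroup with carrier \<open>I\<close> is
  \<open>S\<lparr>carrier := I\<rparr>\<close>.\<close>

locale inverse_semigroup =
  fixes S (structure)
  assumes m_closed: "\<lbrakk>x \<in> carrier S; y \<in> carrier S\<rbrakk> \<Longrightarrow> x \<otimes> y \<in> carrier S"
    and m_assoc: "\<lbrakk>x \<in> carrier S; y \<in> carrier S; z \<in> carrier S\<rbrakk>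
      \<Longrightarrow> (x \<otimes> y) \<otimes> z = x \<otimes> (y \<otimes> z)"
    and ex1_inverse: "x \<in> carrier S
      \<Longrightarrow> \<exists>!y. y \<in> carrier S \<and> x \<otimes> y \<otimes> x = x \<and> y \<otimes> x \<otimes> y = y"

definition sg_inv :: "('a, 'm) monoid_scheme \<Rightarrow> 'a \<Rightarrow> 'a" where
  "sg_inv S x = (THE y. y \<in> carrier S \<and> x \<otimes>\<^bsub>S\<^esub> y \<otimes>\<^bsub>S\<^esub> x = x \<and> y \<otimes>\<^bsub>S\<^esub> x \<otimes>\<^bsub>S\<^esub> y = y)"

definition idempotents :: "('a, 'm) monoid_scheme \<Rightarrow> 'a set" where
  "idempotents S = {e \<in> carrier S. e \<otimes>\<^bsub>S\<^esub> e = e}"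

definition sg_center :: "('a, 'm) monoid_scheme \<Rightarrow> 'a set" where
  "sg_center S = {z \<in> carrier S. \<forall>x\<in>carrier S. z \<otimes>\<^bsub>S\<^esub> x = x \<otimes>\<^bsub>S\<^esub> z}"

definition sg_ideal :: "('a, 'm) monoid_scheme \<Rightarrow> 'a set \<Rightarrow> bool" where
  "sg_ideal S I \<longleftrightarrow> I \<subseteq> carrier S
     \<and> (\<forall>x\<in>carrier S. \<forall>a\<in>I. x \<otimes>\<^bsub>S\<^esub> a \<in> I \<and> a \<otimes>\<^bsub>S\<^esub> x \<in> I)"

definition nat_le :: "('a, 'm) monoid_scheme \<Rightarrow> 'a \<Rightarrow> 'a \<Rightarrow> bool" where
  "nat_le S x y \<longleftrightarrow> x \<in> carrier S \<and> y \<in> carrier S \<and> (\<exists>e\<in>idempotents S. x = e \<otimes>\<^bsub>S\<^esub> y)"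

locale semilattice_of_groups = inverse_semigroup A for A (structure) +
  assumes idempotents_central: "idempotents A \<subseteq> sg_center A"

locale E_unitary = inverse_semigroup S for S (structure) +
  assumes E_unitary: "\<lbrakk>e \<in> idempotents S; nat_le S e s\<rbrakk> \<Longrightarrow> s \<in> idempotents S"


section \<open>Multipliers\<close>

text \<open>A multiplier \<open>m\<close> is the pair of its left action \<open>s \<mapsto> ms\<close> and its right action \<open>s \<mapsto> sm\<close>,
  both extensional on the carrier.\<close>

type_synonym 'a multiplier = "('a \<Rightarrow> 'a) \<times> ('a \<Rightarrow> 'a)"

abbreviation lmul :: "'a multiplier \<Rightarrow> 'a \<Rightarrow> 'a" where
  "lmul m s \<equiv> fst m s"

abbreviation rmul :: "'a \<Rightarrow> 'a multiplier \<Rightarrow> 'a" where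
  "rmul s m \<equiv> snd m s"

definition is_multiplier :: "('a, 'm) monoid_scheme \<Rightarrow> 'a multiplier \<Rightarrow> bool" where
  "is_multiplier S m \<longleftrightarrow>
     fst m \<in> carrier S \<rightarrow>\<^sub>E carrier S \<and> snd m \<in> carrier S \<rightarrow>\<^sub>E carrier S \<and>
     (\<forall>s\<in>carrier S. \<forall>t\<in>carrier S.
        lmul m (s \<otimes>\<^bsub>S\<^esub> t) = lmul m s \<otimes>\<^bsub>S\<^esub> t \<and>
        rmul (s \<otimes>\<^bsub>S\<^esub> t) m = s \<otimes>\<^bsub>S\<^esub> rmul t m \<and>
        s \<otimes>\<^bsub>S\<^esub> lmul m t = rmul s m \<otimes>\<^bsub>S\<^esub> t)"

definition multiplier_monoid :: "('a, 'm) monoid_scheme \<Rightarrow> 'a multiplier monoid" where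
  "multiplier_monoid S =
     \<lparr>carrier = {m. is_multiplier S m},
      mult = (\<lambda>m n. (\<lambda>s\<in>carrier S. lmul m (lmul n s), \<lambda>s\<in>carrier S. rmul (rmul s m) n)),
      one = (\<lambda>s\<in>carrier S. s, \<lambda>s\<in>carrier S. s)\<rparr>"


section \<open>The monoid of isomorphisms between ideals modulo inner ones\<close>

definition ideal_isos :: "('a, 'm) monoid_scheme \<Rightarrow> ('a \<rightharpoonup> 'a) set" where
  "ideal_isos A = {\<phi>. sg_ideal A (dom \<phi>) \<and> sg_ideal A (ran \<phi>) \<and>
     (\<lambda>s. the (\<phi> s)) \<in> iso (A\<lparr>carrier := dom \<phi>\<rparr>) (A\<lparr>carrier := ran \<phi>\<rparr>)}"

definition inner_rel :: "('a, 'm) monoid_scheme \<Rightarrow> (('a \<rightharpoonup> 'a) \<times> ('a \<rightharpoonup> 'a)) set" where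
  "inner_rel A = {(\<phi>, \<psi>). \<phi> \<in> ideal_isos A \<and> \<psi> \<in> ideal_isos A \<and>
     dom \<psi> = dom \<phi> \<and> ran \<psi> = ran \<phi> \<and>
     (let M = multiplier_monoid (A\<lparr>carrier := ran \<phi>\<rparr>) in
       \<exists>m\<in>Units M. \<forall>s\<in>dom \<phi>. the (\<psi> s) = rmul (lmul m (the (\<phi> s))) (inv\<^bsub>M\<^esub> m))}"

definition varsigma :: "('a, 'm) monoid_scheme \<Rightarrow> ('a \<rightharpoonup> 'a) set monoid" where
  "varsigma A =
     \<lparr>carrier = ideal_isos A // inner_rel A,
      mult = (\<lambda>X Y. \<Union>\<phi>\<in>X. \<Union>\<psi>\<in>Y. inner_rel A `` {\<phi> \<circ>\<^sub>m \<psi>}),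
      one = inner_rel A `` {Some |` carrier A}\<rparr>"

definition unital_partial_hom ::
  "('g, 'n) monoid_scheme \<Rightarrow> ('s, 'k) monoid_scheme \<Rightarrow> ('g \<Rightarrow> 's) \<Rightarrow> bool" where
  "unital_partial_hom G S f \<longleftrightarrow>
     f \<in> carrier G \<rightarrow> carrier S \<and> f \<one>\<^bsub>G\<^esub> = \<one>\<^bsub>S\<^esub> \<and>
     (\<forall>g\<in>carrier G. \<forall>h\<in>carrier G.
        f (inv\<^bsub>G\<^esub> g) \<otimes>\<^bsub>S\<^esub> f g \<otimes>\<^bsub>S\<^esub> f h = f (inv\<^bsub>G\<^esub> g) \<otimes>\<^bsub>S\<^esub> f (g \<otimes>\<^bsub>G\<^esub> h) \<and>
        f g \<otimes>\<^bsub>S\<^esub> f h \<otimes>\<^bsub>S\<^esub> f (inv\<^bsub>G\<^esub> h) = f (g \<otimes>\<^bsub>G\<^esub> h) \<otimes>\<^bsub>S\<^esub> f (inv\<^bsub>G\<^esub> h))"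

definition abstract_kernel ::
  "('a, 'm) monoid_scheme \<Rightarrow> ('g, 'n) monoid_scheme \<Rightarrow> ('g \<Rightarrow> ('a \<rightharpoonup> 'a) set) \<Rightarrow> bool" where
  "abstract_kernel A G \<psi> \<longleftrightarrow>
     semilattice_of_groups A \<and> group G \<and> unital_partial_hom G (varsigma A) \<psi>"


section \<open>Partial group cohomology\<close>

text \<open>A partial action of \<open>G\<close> on a semigroup \<open>B\<close> is a family of partial maps \<open>\<theta> g\<close>; the ideal
  \<open>B\<^sub>g\<close> is the range of \<open>\<theta> g\<close>.\<close>

locale partial_action = group G for B :: "('b, 'm) monoid_scheme" and G (structure) +
  fixes \<theta> :: "'a \<Rightarrow> 'b \<rightharpoonup> 'b"
  assumes iso_ideals: "g \<in> carrier G \<Longrightarrow> \<theta> g \<in> ideal_isos B"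
    and dom_eq: "g \<in> carrier G \<Longrightarrow> dom (\<theta> g) = ran (\<theta> (inv g))"
    and action_one: "\<theta> \<one> = Some |` carrier B"
    and action_ran: "\<lbrakk>g \<in> carrier G; h \<in> carrier G\<rbrakk> \<Longrightarrow>
      (\<lambda>b. the (\<theta> g b)) ` (ran (\<theta> (inv g)) \<inter> ran (\<theta> h)) = ran (\<theta> g) \<inter> ran (\<theta> (g \<otimes> h))"
    and action_mult: "\<lbrakk>g \<in> carrier G; h \<in> carrier G;
        b \<in> ran (\<theta> (inv h)) \<inter> ran (\<theta> (inv h \<otimes> inv g))\<rbrakk> \<Longrightarrow>
      the (\<theta> g (the (\<theta> h b))) = the (\<theta> (g \<otimes> h) b)"

locale partial_module = partial_action B G \<theta> + B: inverse_semigroup B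
  for B :: "('b, 'm) monoid_scheme" and G (structure) and \<theta> :: "'a \<Rightarrow> 'b \<rightharpoonup> 'b" +
  assumes comm: "sg_center B = carrier B"

text \<open>The cochain groups and coboundaries below are written for the data \<open>B\<close>, \<open>G\<close>, \<open>\<theta>\<close> of a
  \<^locale>\<open>partial_module\<close>.  Elements of \<open>G\<^sup>n\<close> are lists of length \<open>n\<close>.\<close>

definition tuples :: "('g, 'n) monoid_scheme \<Rightarrow> nat \<Rightarrow> 'g list set" where
  "tuples G n = {xs. length xs = n \<and> set xs \<subseteq> carrier G}"

fun ideal_prod :: "('b, 'm) monoid_scheme \<Rightarrow> 'b set list \<Rightarrow> 'b set" where
  "ideal_prod B [] = carrier B"
| "ideal_prod B [I] = I"
| "ideal_prod B (I # J # Is) = I <#>\<^bsub>B\<^esub> ideal_prod B (J # Is)"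

text \<open>The ideal \<open>B\<^bsub>x\<^sub>1\<^esub> B\<^bsub>x\<^sub>1x\<^sub>2\<^esub> \<dots> B\<^bsub>x\<^sub>1\<dots>x\<^sub>n\<^esub>\<close>:\<close>

definition cochain_ideal ::
  "('b, 'm) monoid_scheme \<Rightarrow> ('g, 'n) monoid_scheme \<Rightarrow> ('g \<Rightarrow> 'b \<rightharpoonup> 'b) \<Rightarrow> 'g list \<Rightarrow> 'b set" where
  "cochain_ideal B G \<theta> xs =
     ideal_prod B (map (\<lambda>k. ran (\<theta> (foldr (\<otimes>\<^bsub>G\<^esub>) (take k xs) \<one>\<^bsub>G\<^esub>))) [1..<length xs + 1])"

definition cochain_mult ::
  "('b, 'm) monoid_scheme \<Rightarrow> ('g, 'n) monoid_scheme \<Rightarrow> ('g \<Rightarrow> 'b \<rightharpoonup> 'b) \<Rightarrow> 'g list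
     \<Rightarrow> 'b multiplier monoid" where
  "cochain_mult B G \<theta> xs = multiplier_monoid (B\<lparr>carrier := cochain_ideal B G \<theta> xs\<rparr>)"

definition cochains ::
  "('b, 'm) monoid_scheme \<Rightarrow> ('g, 'n) monoid_scheme \<Rightarrow> ('g \<Rightarrow> 'b \<rightharpoonup> 'b) \<Rightarrow> nat
     \<Rightarrow> ('g list \<Rightarrow> 'b multiplier) monoid" where
  "cochains B G \<theta> n = product_group (tuples G n) (\<lambda>xs. units_of (cochain_mult B G \<theta> xs))"

text \<open>\<open>face G i (x\<^sub>1, \<dots>, x\<^sub>n) = (x\<^sub>1, \<dots>, x\<^sub>i x\<^bsub>i+1\<^esub>, \<dots>, x\<^sub>n)\<close>, with \<open>i\<close> counted from 1 as in the
  coboundary formula.\<close>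

definition face :: "('g, 'n) monoid_scheme \<Rightarrow> nat \<Rightarrow> 'g list \<Rightarrow> 'g list" where
  "face G i xs = take (i - 1) xs @ [xs ! (i - 1) \<otimes>\<^bsub>G\<^esub> xs ! i] @ drop (i + 1) xs"

definition pm_inv :: "('b \<rightharpoonup> 'b) \<Rightarrow> 'b \<Rightarrow> 'b" where
  "pm_inv \<phi> a = (THE b. \<phi> b = Some a)"

text \<open>Each exponent \<open>\<plusminus>1\<close> is taken in the monoid of multipliers in which the value of \<open>f\<close> lives; the
  resulting multipliers of possibly larger ideals are then applied on the right, one after the other.
  Since \<open>B\<close> is commutative and its ideals are idempotent, the left and the right action of a
  multiplier agree, so the map \<open>h\<close> given by the formula is both components of the value.\<close>

definition coboundary ::
  "('b, 'm) monoid_scheme \<Rightarrow> ('g, 'n) monoid_scheme \<Rightarrow> ('g \<Rightarrow> 'b \<rightharpoonup> 'b) \<Rightarrow> nat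
     \<Rightarrow> ('g list \<Rightarrow> 'b multiplier) \<Rightarrow> ('g list \<Rightarrow> 'b multiplier)" where
  "coboundary B G \<theta> n f = (\<lambda>xs\<in>tuples G (Suc n).
     let pow = (\<lambda>ys (k::int). f ys [^]\<^bsub>cochain_mult B G \<theta> ys\<^esub> k);
         h = (\<lambda>a\<in>cochain_ideal B G \<theta> xs.
           rmul
             (foldl (\<lambda>b i. rmul b (pow (face G i xs) ((-1) ^ i)))
                (the (\<theta> (hd xs) (rmul (pm_inv (\<theta> (hd xs)) a) (f (tl xs)))))
                [1..<n + 1])
             (pow (butlast xs) ((-1) ^ (n + 1))))
     in (h, h))"

definition cocycles where
  "cocycles B G \<theta> n = kernel (cochains B G \<theta> n) (cochains B G \<theta> (Suc n)) (coboundary B G \<theta> n)"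

definition coboundaries where
  "coboundaries B G \<theta> n = coboundary B G \<theta> (n - 1) ` carrier (cochains B G \<theta> (n - 1))"

text \<open>Meant for \<open>n \<ge> 2\<close>.\<close>

definition cohomology ::
  "('b, 'm) monoid_scheme \<Rightarrow> ('g, 'n) monoid_scheme \<Rightarrow> ('g \<Rightarrow> 'b \<rightharpoonup> 'b) \<Rightarrow> nat
     \<Rightarrow> ('g list \<Rightarrow> 'b multiplier) set monoid" where
  "cohomology B G \<theta> n =
     (cochains B G \<theta> n)\<lparr>carrier := cocycles B G \<theta> n\<rparr> Mod coboundaries B G \<theta> n"


section \<open>The partial module of central elements\<close>

definition center_sg :: "('a, 'm) monoid_scheme \<Rightarrow> ('a, 'm) monoid_scheme" where
  "center_sg A = A\<lparr>carrier := sg_center A\<rparr>"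

definition ker_ideal :: "('g \<Rightarrow> ('a \<rightharpoonup> 'a) set) \<Rightarrow> 'g \<Rightarrow> 'a set" where
  "ker_ideal \<psi> g = (THE D. \<forall>\<phi>\<in>\<psi> g. ran \<phi> = D)"

text \<open>The restriction to the center does not depend on the representative of \<open>\<psi> g\<close>.\<close>

definition center_action ::
  "('a, 'm) monoid_scheme \<Rightarrow> ('g, 'n) monoid_scheme \<Rightarrow> ('g \<Rightarrow> ('a \<rightharpoonup> 'a) set)
     \<Rightarrow> 'g \<Rightarrow> 'a \<rightharpoonup> 'a" where
  "center_action A G \<psi> g =
     (SOME \<phi>. \<phi> \<in> \<psi> g) |` sg_center (A\<lparr>carrier := ker_ideal \<psi> (inv\<^bsub>G\<^esub> g)\<rparr>)"


section \<open>Extensions\<close>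

definition sg_extension ::
  "('a, 'm) monoid_scheme \<Rightarrow> ('s, 'k) monoid_scheme \<Rightarrow> 'u monoid \<Rightarrow> ('a \<Rightarrow> 'u) \<Rightarrow> ('u \<Rightarrow> 's)
     \<Rightarrow> bool" where
  "sg_extension A S U i \<pi> \<longleftrightarrow>
     inverse_semigroup U \<and> i \<in> mon A U \<and> \<pi> \<in> epi U S \<and> inj_on \<pi> (idempotents U) \<and>
     i ` carrier A = {u \<in> carrier U. \<pi> u \<in> idempotents S}"

text \<open>An extension of \<open>A\<close> by a group is the triple \<open>(U, i, j)\<close>.\<close>

type_synonym ('a, 'u, 'g) ext = "'u monoid \<times> ('a \<Rightarrow> 'u) \<times> ('u \<Rightarrow> 'g)"

fun group_extension ::
  "('a, 'm) monoid_scheme \<Rightarrow> ('g, 'n) monoid_scheme \<Rightarrow> ('a, 'u, 'g) ext \<Rightarrow> bool" where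
  "group_extension A G (U, i, j) \<longleftrightarrow>
     inverse_semigroup U \<and> i \<in> mon A U \<and> j \<in> epi U G \<and>
     i ` carrier A = {u \<in> carrier U. j u = \<one>\<^bsub>G\<^esub>}"

fun equivalent_ext ::
  "('a, 'm) monoid_scheme \<Rightarrow> ('a, 'u, 'g) ext \<Rightarrow> ('a, 'v, 'g) ext \<Rightarrow> bool" where
  "equivalent_ext A (U, i, j) (U', i', j') \<longleftrightarrow>
     (\<exists>\<mu>\<in>iso U U'. (\<forall>a\<in>carrier A. \<mu> (i a) = i' a) \<and> (\<forall>u\<in>carrier U. j' (\<mu> u) = j u))"

fun refinement ::
  "('a, 'm) monoid_scheme \<Rightarrow> ('g, 'n) monoid_scheme \<Rightarrow> ('a, 'u, 'g) ext
     \<Rightarrow> 's monoid \<Rightarrow> ('u \<Rightarrow> 's) \<Rightarrow> ('s \<Rightarrow> 'g) \<Rightarrow> bool" where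
  "refinement A G (U, i, j) S \<pi> \<kappa> \<longleftrightarrow>
     E_unitary S \<and> sg_extension A S U i \<pi> \<and> \<kappa> \<in> epi S G \<and> (\<forall>u\<in>carrier U. j u = \<kappa> (\<pi> u))"

definition order_transversal :: "'s monoid \<Rightarrow> 'u monoid \<Rightarrow> ('u \<Rightarrow> 's) \<Rightarrow> ('s \<Rightarrow> 'u) \<Rightarrow> bool" where
  "order_transversal S U \<pi> \<rho> \<longleftrightarrow>
     \<rho> \<in> carrier S \<rightarrow> carrier U \<and> (\<forall>s\<in>carrier S. \<pi> (\<rho> s) = s) \<and>
     \<rho> ` idempotents S \<subseteq> idempotents U \<and>
     (\<forall>s\<in>carrier S. \<forall>t\<in>carrier S. nat_le S s t \<longrightarrow> nat_le U (\<rho> s) (\<rho> t))"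

definition ext_ideal ::
  "('a, 'm) monoid_scheme \<Rightarrow> ('a \<Rightarrow> 'u) \<Rightarrow> 's monoid \<Rightarrow> ('s \<Rightarrow> 'g) \<Rightarrow> ('s \<Rightarrow> 'u) \<Rightarrow> 'g \<Rightarrow> 'a set" where
  "ext_ideal A i S \<kappa> \<rho> g =
     {a \<in> carrier A. \<exists>s\<in>carrier S. \<kappa> s = g \<and>
        \<rho> (s \<otimes>\<^bsub>S\<^esub> sg_inv S s) = i (a \<otimes>\<^bsub>A\<^esub> sg_inv A a)}"

definition ext_action ::
  "('a, 'm) monoid_scheme \<Rightarrow> ('g, 'n) monoid_scheme \<Rightarrow> 'u monoid \<Rightarrow> ('a \<Rightarrow> 'u)
     \<Rightarrow> 's monoid \<Rightarrow> ('s \<Rightarrow> 'g) \<Rightarrow> ('s \<Rightarrow> 'u) \<Rightarrow> 'g \<Rightarrow> 'a \<rightharpoonup> 'a" where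
  "ext_action A G U i S \<kappa> \<rho> g = (\<lambda>a.
     if a \<in> ext_ideal A i S \<kappa> \<rho> (inv\<^bsub>G\<^esub> g) then
       (let s = (THE s. s \<in> carrier S \<and> \<kappa> s = g \<and>
                   \<rho> (sg_inv S s \<otimes>\<^bsub>S\<^esub> s) = i (a \<otimes>\<^bsub>A\<^esub> sg_inv A a))
        in Some (the_inv_into (carrier A) i (\<rho> s \<otimes>\<^bsub>U\<^esub> i a \<otimes>\<^bsub>U\<^esub> sg_inv U (\<rho> s))))
     else None)"

text \<open>The type of \<open>S\<close> in the existential quantifiers below is that of \<open>U\<close>.  Nothing is lost: a
  transversal embeds any \<open>S\<close> into \<open>U\<close>, and the copy of \<open>S\<close> on its image serves as well
  (lemmas \<open>admissibleI\<close> and \<open>has_abstract_kernelI\<close>).\<close>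

fun admissible ::
  "('a, 'm) monoid_scheme \<Rightarrow> ('g, 'n) monoid_scheme \<Rightarrow> ('a, 'u, 'g) ext \<Rightarrow> bool" where
  "admissible A G (U, i, j) \<longleftrightarrow> group_extension A G (U, i, j) \<and>
     (\<exists>(S :: 'u monoid) \<pi> \<kappa> \<rho>. refinement A G (U, i, j) S \<pi> \<kappa> \<and> order_transversal S U \<pi> \<rho>)"

text \<open>The class of \<open>ext_action\<close> does not depend on the refinement and the transversal.\<close>

fun has_abstract_kernel ::
  "('a, 'm) monoid_scheme \<Rightarrow> ('g, 'n) monoid_scheme \<Rightarrow> ('a, 'u, 'g) ext
     \<Rightarrow> ('g \<Rightarrow> ('a \<rightharpoonup> 'a) set) \<Rightarrow> bool" where
  "has_abstract_kernel A G (U, i, j) \<psi> \<longleftrightarrow>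
     (\<exists>(S :: 'u monoid) \<pi> \<kappa> \<rho>. refinement A G (U, i, j) S \<pi> \<kappa> \<and> order_transversal S U \<pi> \<rho> \<and>
        (\<forall>g\<in>carrier G. \<psi> g = inner_rel A `` {ext_action A G U i S \<kappa> \<rho> g}))"

definition admissible_exts ::
  "('a, 'm) monoid_scheme \<Rightarrow> ('g, 'n) monoid_scheme \<Rightarrow> ('g \<Rightarrow> ('a \<rightharpoonup> 'a) set)
     \<Rightarrow> ('a, 'u, 'g) ext set" where
  "admissible_exts A G \<psi> = {E. admissible A G E \<and> has_abstract_kernel A G E \<psi>}"

text \<open>The classes are formed among extensions whose carrier lies in a given type \<open>'u\<close>.  If \<open>u\<close>, \<open>v\<close> are
  elements of an admissible extension with \<open>u u\<inverse> = v v\<inverse>\<close> and \<open>j u = j v\<close>, then \<open>u = i(a) v\<close> for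
  exactly one \<open>a \<in> A\<close> with \<open>i(a a\<inverse>) = u u\<inverse>\<close>; hence the carrier injects into \<open>A \<times> G\<close>.  So as soon as
  \<open>A \<times> G\<close> embeds into \<open>'u\<close>, every admissible extension, of whatever type, is equivalent to one in \<open>'u\<close>.\<close>

definition admissible_ext_classes ::
  "('a, 'm) monoid_scheme \<Rightarrow> ('g, 'n) monoid_scheme \<Rightarrow> ('g \<Rightarrow> ('a \<rightharpoonup> 'a) set)
     \<Rightarrow> ('a, 'u, 'g) ext set set" where
  "admissible_ext_classes A G \<psi> = admissible_exts A G \<psi> //
     {(E, E'). E \<in> admissible_exts A G \<psi> \<and> E' \<in> admissible_exts A G \<psi> \<and> equivalent_ext A E E'}"


subsection \<open>The type of the middle term of a refinement\<close>

lemma (in inverse_semigroup) sg_inv_props: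
  assumes "x \<in> carrier S"
  shows "sg_inv S x \<in> carrier S" "x \<otimes> sg_inv S x \<otimes> x = x" "sg_inv S x \<otimes> x \<otimes> sg_inv S x = sg_inv S x"
  using theI'[OF ex1_inverse[OF assms]] unfolding sg_inv_def by blast+

lemma (in inverse_semigroup) sg_inv_eqI:
  assumes "x \<in> carrier S" "y \<in> carrier S" "x \<otimes> y \<otimes> x = x" "y \<otimes> x \<otimes> y = y"
  shows "sg_inv S x = y"
  unfolding sg_inv_def using the1_equality[OF ex1_inverse[OF assms(1)]] assms by blast

lemma iso_transport:
  assumes S: "inverse_semigroup S" and h: "h \<in> iso S T"
  shows "inverse_semigroup T"
    and "s \<in> carrier S \<Longrightarrow> sg_inv T (h s) = h (sg_inv S s)"
    and "idempotents T = h ` idempotents S"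
    and "\<lbrakk>s \<in> carrier S; t \<in> carrier S\<rbrakk> \<Longrightarrow> nat_le T (h s) (h t) \<longleftrightarrow> nat_le S s t"
proof -
  interpret S: inverse_semigroup S by fact
  have car: "carrier T = h ` carrier S" and inj: "inj_on h (carrier S)"
    using h by (auto simp: iso_def bij_betw_def)
  have hm: "h (x \<otimes>\<^bsub>S\<^esub> y) = h x \<otimes>\<^bsub>T\<^esub> h y" if "x \<in> carrier S" "y \<in> carrier S" for x y
    using h that by (auto simp: iso_def hom_def)
  have eq: "h x = h y \<longleftrightarrow> x = y" if "x \<in> carrier S" "y \<in> carrier S" for x y
    using inj that by (auto dest: inj_onD)
  have triple: "h x \<otimes>\<^bsub>T\<^esub> h y \<otimes>\<^bsub>T\<^esub> h z = h (x \<otimes>\<^bsub>S\<^esub> y \<otimes>\<^bsub>S\<^esub> z)"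
    if "x \<in> carrier S" "y \<in> carrier S" "z \<in> carrier S" for x y z
    using that by (simp add: hm S.m_closed)
  have inv_iff: "h x \<otimes>\<^bsub>T\<^esub> h y \<otimes>\<^bsub>T\<^esub> h x = h x \<longleftrightarrow> x \<otimes>\<^bsub>S\<^esub> y \<otimes>\<^bsub>S\<^esub> x = x"
    if "x \<in> carrier S" "y \<in> carrier S" for x y
    using that by (simp add: triple eq S.m_closed)
  show T: "inverse_semigroup T"
  proof
    show "x \<otimes>\<^bsub>T\<^esub> y \<in> carrier T" if "x \<in> carrier T" "y \<in> carrier T" for x y
      using that unfolding car by (auto simp: hm[symmetric] S.m_closed)
    show "(x \<otimes>\<^bsub>T\<^esub> y) \<otimes>\<^bsub>T\<^esub> z = x \<otimes>\<^bsub>T\<^esub> (y \<otimes>\<^bsub>T\<^esub> z)"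
      if "x \<in> carrier T" "y \<in> carrier T" "z \<in> carrier T" for x y z
      using that unfolding car by (auto simp: hm[symmetric] S.m_closed S.m_assoc)
    show "\<exists>!y. y \<in> carrier T \<and> x \<otimes>\<^bsub>T\<^esub> y \<otimes>\<^bsub>T\<^esub> x = x \<and> y \<otimes>\<^bsub>T\<^esub> x \<otimes>\<^bsub>T\<^esub> y = y"
      if x: "x \<in> carrier T" for x
    proof -
      obtain s where s: "s \<in> carrier S" "x = h s" using x car by auto
      have "y = h (sg_inv S s)"
        if y: "y \<in> carrier T" "x \<otimes>\<^bsub>T\<^esub> y \<otimes>\<^bsub>T\<^esub> x = x" "y \<otimes>\<^bsub>T\<^esub> x \<otimes>\<^bsub>T\<^esub> y = y" for y
      proof -
        obtain t where t: "t \<in> carrier S" "y = h t" using y car by auto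
        have "s \<otimes>\<^bsub>S\<^esub> t \<otimes>\<^bsub>S\<^esub> s = s" "t \<otimes>\<^bsub>S\<^esub> s \<otimes>\<^bsub>S\<^esub> t = t"
          using y s t inv_iff by auto
        then show ?thesis using S.sg_inv_eqI[of s t] s t by simp
      qed
      moreover have "h (sg_inv S s) \<in> carrier T" "x \<otimes>\<^bsub>T\<^esub> h (sg_inv S s) \<otimes>\<^bsub>T\<^esub> x = x"
        "h (sg_inv S s) \<otimes>\<^bsub>T\<^esub> x \<otimes>\<^bsub>T\<^esub> h (sg_inv S s) = h (sg_inv S s)"
        using s S.sg_inv_props[OF s(1)] by (simp_all add: inv_iff car)
      ultimately show ?thesis by blast
    qed
  qed
  interpret T: inverse_semigroup T by fact
  show "sg_inv T (h s) = h (sg_inv S s)" if "s \<in> carrier S" for s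
    using that S.sg_inv_props[OF that] by (intro T.sg_inv_eqI) (simp_all add: inv_iff car)
  show idem: "idempotents T = h ` idempotents S"
  proof -
    have "h x \<otimes>\<^bsub>T\<^esub> h x = h x \<longleftrightarrow> x \<otimes>\<^bsub>S\<^esub> x = x" if "x \<in> carrier S" for x
      using that by (simp add: hm[symmetric] eq S.m_closed)
    then show ?thesis unfolding idempotents_def car by auto
  qed
  show "nat_le T (h s) (h t) \<longleftrightarrow> nat_le S s t" if "s \<in> carrier S" "t \<in> carrier S" for s t
  proof -
    have "h s = h e \<otimes>\<^bsub>T\<^esub> h t \<longleftrightarrow> s = e \<otimes>\<^bsub>S\<^esub> t" if "e \<in> idempotents S" for e
      using that \<open>s \<in> carrier S\<close> \<open>t \<in> carrier S\<close>
      by (simp add: idempotents_def hm[symmetric] eq S.m_closed)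
    then show ?thesis using that by (auto simp: nat_le_def idem car)
  qed
qed


lemma (in inverse_semigroup) idempotent_mult:
  assumes e: "e \<in> idempotents S" and f: "f \<in> idempotents S"
  shows "e \<otimes> f \<in> idempotents S"
proof -
  have c: "e \<in> carrier S" "f \<in> carrier S" "e \<otimes> f \<in> carrier S" and ee: "e \<otimes> e = e" and ff: "f \<otimes> f = f"
    using e f by (auto simp: idempotents_def m_closed)
  define x where "x = sg_inv S (e \<otimes> f)"
  have x: "x \<in> carrier S" "e \<otimes> f \<otimes> x \<otimes> (e \<otimes> f) = e \<otimes> f" "x \<otimes> (e \<otimes> f) \<otimes> x = x"
    unfolding x_def using sg_inv_props[OF c(3)] by auto
  have ee': "e \<otimes> (e \<otimes> y) = e \<otimes> y" and ff': "f \<otimes> (f \<otimes> y) = f \<otimes> y" if "y \<in> carrier S" for y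
    using that c ee ff by (metis m_assoc)+
  have xx: "x \<otimes> (e \<otimes> (f \<otimes> (x \<otimes> y))) = x \<otimes> y" if "y \<in> carrier S" for y
    using that c x(1,3) by (metis m_assoc m_closed)
  have x3: "x \<otimes> (e \<otimes> (f \<otimes> x)) = x" "e \<otimes> (f \<otimes> (x \<otimes> (e \<otimes> f))) = e \<otimes> f"
    using c x by (simp_all add: m_assoc m_closed)
  have "x = f \<otimes> x \<otimes> e" unfolding x_def
    by (rule sg_inv_eqI) (use c x(1) in
      \<open>simp_all add: m_assoc m_closed ee' ff' xx x3 flip: x_def\<close>)
  moreover have "f \<otimes> x \<otimes> e \<otimes> (f \<otimes> x \<otimes> e) = f \<otimes> x \<otimes> e"
    using c x(1) by (simp add: m_assoc m_closed xx)
  ultimately have "x \<otimes> x = x" by simp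
  then have "sg_inv S x = x" using x(1) by (intro sg_inv_eqI) auto
  moreover have "sg_inv S x = e \<otimes> f" using x c by (intro sg_inv_eqI) auto
  ultimately show ?thesis using \<open>x \<otimes> x = x\<close> c(3) by (simp add: idempotents_def)
qed

lemma (in inverse_semigroup) idempotent_comm:
  assumes e: "e \<in> idempotents S" and f: "f \<in> idempotents S"
  shows "e \<otimes> f = f \<otimes> e"
proof -
  have c: "e \<in> carrier S" "f \<in> carrier S" and ee: "e \<otimes> e = e" and ff: "f \<otimes> f = f"
    using e f by (auto simp: idempotents_def)
  have ef: "e \<otimes> f \<in> carrier S" "e \<otimes> f \<otimes> (e \<otimes> f) = e \<otimes> f"
    and fe: "f \<otimes> e \<in> carrier S" "f \<otimes> e \<otimes> (f \<otimes> e) = f \<otimes> e"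
    using idempotent_mult e f by (auto simp: idempotents_def)
  have ee': "e \<otimes> (e \<otimes> y) = e \<otimes> y" and ff': "f \<otimes> (f \<otimes> y) = f \<otimes> y" if "y \<in> carrier S" for y
    using that c ee ff by (metis m_assoc)+
  have "sg_inv S (e \<otimes> f) = e \<otimes> f" using ef by (intro sg_inv_eqI) auto
  moreover have "sg_inv S (e \<otimes> f) = f \<otimes> e"
    using c ef fe by (intro sg_inv_eqI) (simp_all add: m_assoc m_closed ee' ff')
  ultimately show ?thesis by simp
qed

lemma ex1_coset_rep:
  assumes G: "group G" and ext: "group_extension A G (U, i, j)"
    and ref: "refinement A G (U, i, j) S \<pi> \<kappa>" and \<rho>: "order_transversal S U \<pi> \<rho>"
    and g: "g \<in> carrier G" and a: "a \<in> ext_ideal A i S \<kappa> \<rho> (inv\<^bsub>G\<^esub> g)"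
  shows "\<exists>!s. s \<in> carrier S \<and> \<kappa> s = g
    \<and> \<rho> (sg_inv S s \<otimes>\<^bsub>S\<^esub> s) = i (a \<otimes>\<^bsub>A\<^esub> sg_inv A a)"
proof -
  interpret G: group G by fact
  interpret S: E_unitary S using ref by simp
  have \<kappa>c: "\<kappa> x \<in> carrier G" if "x \<in> carrier S" for x
    using ref that by (auto simp: epi_def hom_def)
  have \<kappa>m: "\<kappa> (x \<otimes>\<^bsub>S\<^esub> y) = \<kappa> x \<otimes>\<^bsub>G\<^esub> \<kappa> y" if "x \<in> carrier S" "y \<in> carrier S" for x y
    using ref that by (auto simp: epi_def hom_def)
  have \<pi>\<rho>: "\<rho> s \<in> carrier U" "\<pi> (\<rho> s) = s" if "s \<in> carrier S" for s
    using \<rho> that by (auto simp: order_transversal_def)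
  have \<kappa>inv: "\<kappa> (sg_inv S x) = inv\<^bsub>G\<^esub> \<kappa> x" if x: "x \<in> carrier S" for x
  proof -
    have "\<kappa> x \<otimes>\<^bsub>G\<^esub> \<kappa> (sg_inv S x) \<otimes>\<^bsub>G\<^esub> \<kappa> x = \<kappa> x"
      using S.sg_inv_props[OF x] x by (metis \<kappa>m S.m_closed)
    then have "\<kappa> (sg_inv S x) \<otimes>\<^bsub>G\<^esub> \<kappa> x = \<one>\<^bsub>G\<^esub>"
      using \<kappa>c[OF x] \<kappa>c[OF S.sg_inv_props(1)[OF x]] by (simp add: G.m_assoc)
    then show ?thesis
      using G.inv_equality[OF _ \<kappa>c[OF x] \<kappa>c[OF S.sg_inv_props(1)[OF x]]] by simp
  qed
  have ker: "s \<in> idempotents S" if s: "s \<in> carrier S" "\<kappa> s = \<one>\<^bsub>G\<^esub>" for s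
  proof -
    have "\<rho> s \<in> {u \<in> carrier U. j u = \<one>\<^bsub>G\<^esub>}" using s ref \<pi>\<rho> by simp
    also have "\<dots> = i ` carrier A" using ext by simp
    also have "\<dots> = {u \<in> carrier U. \<pi> u \<in> idempotents S}"
      using ref unfolding refinement.simps sg_extension_def by blast
    finally have "\<rho> s \<in> {u \<in> carrier U. \<pi> u \<in> idempotents S}" .
    then show ?thesis using s \<pi>\<rho> by simp
  qed
  obtain t where t: "t \<in> carrier S" "\<kappa> t = inv\<^bsub>G\<^esub> g"
    "\<rho> (t \<otimes>\<^bsub>S\<^esub> sg_inv S t) = i (a \<otimes>\<^bsub>A\<^esub> sg_inv A a)"
    using a by (auto simp: ext_ideal_def)
  have "sg_inv S (sg_inv S t) = t"
    using S.sg_inv_props[OF t(1)] t by (intro S.sg_inv_eqI) auto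
  then have ex: "sg_inv S t \<in> carrier S \<and> \<kappa> (sg_inv S t) = g
      \<and> \<rho> (sg_inv S (sg_inv S t) \<otimes>\<^bsub>S\<^esub> sg_inv S t) = i (a \<otimes>\<^bsub>A\<^esub> sg_inv A a)"
    using t g S.sg_inv_props(1)[OF t(1)] by (simp add: \<kappa>inv)
  have "s = s'" if s: "s \<in> carrier S" "\<kappa> s = g" and s': "s' \<in> carrier S" "\<kappa> s' = g"
    and eq: "\<rho> (sg_inv S s \<otimes>\<^bsub>S\<^esub> s) = \<rho> (sg_inv S s' \<otimes>\<^bsub>S\<^esub> s')" for s s'
  proof -
    note p = S.sg_inv_props[OF s(1)] and p' = S.sg_inv_props[OF s'(1)]
    define f f' where "f = s \<otimes>\<^bsub>S\<^esub> sg_inv S s'" and "f' = s' \<otimes>\<^bsub>S\<^esub> sg_inv S s"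
    have f: "f \<in> idempotents S" "f' \<in> idempotents S"
      using s s' p(1) p'(1) g by (auto intro!: ker simp: f_def f'_def S.m_closed \<kappa>m \<kappa>inv)
    then have fc: "f \<in> carrier S" "f' \<in> carrier S" "f \<otimes>\<^bsub>S\<^esub> f = f" "f' \<otimes>\<^bsub>S\<^esub> f' = f'"
      by (auto simp: idempotents_def)
    have d: "sg_inv S s \<otimes>\<^bsub>S\<^esub> s = sg_inv S s' \<otimes>\<^bsub>S\<^esub> s'"
      using arg_cong[OF eq, of \<pi>] s(1) s'(1) p(1) p'(1) by (simp add: \<pi>\<rho>(2) S.m_closed)
    have 1: "s = f \<otimes>\<^bsub>S\<^esub> s'"
      using p(2) p(1) p'(1) s(1) s'(1) by (simp add: f_def S.m_assoc flip: d)
    have 2: "s' = f' \<otimes>\<^bsub>S\<^esub> s"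
      using p'(2) p(1) p'(1) s(1) s'(1) by (simp add: f'_def S.m_assoc d)
    have 3: "f' \<otimes>\<^bsub>S\<^esub> s' = s'" using S.m_assoc[OF fc(2) fc(2) s(1)] fc(4) by (simp flip: 2)
    have "s' = f' \<otimes>\<^bsub>S\<^esub> (f \<otimes>\<^bsub>S\<^esub> s')" using 1 2 by simp
    also have "\<dots> = f \<otimes>\<^bsub>S\<^esub> (f' \<otimes>\<^bsub>S\<^esub> s')"
      using S.idempotent_comm[OF f] fc(1,2) s'(1) by (simp flip: S.m_assoc)
    also have "\<dots> = s" using 1 3 by simp
    finally show "s = s'" by simp
  qed
  then show ?thesis using ex by (intro ex_ex1I) (blast, simp)
qed

lemma refinement_copy:
  fixes S :: "'s monoid" and U :: "'u monoid"
  assumes G: "group G" and gext: "group_extension A G (U, i, j)"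
    and ref: "refinement A G (U, i, j) S \<pi> \<kappa>" and \<rho>: "order_transversal S U \<pi> \<rho>"
  obtains T :: "'u monoid" where "refinement A G (U, i, j) T (\<rho> \<circ> \<pi>) (\<kappa> \<circ> \<pi>)"
    "order_transversal T U (\<rho> \<circ> \<pi>) id"
    "\<And>g. g \<in> carrier G \<Longrightarrow> ext_action A G U i T (\<kappa> \<circ> \<pi>) id g = ext_action A G U i S \<kappa> \<rho> g"
proof -
  define T :: "'u monoid" where
    "T = \<lparr>carrier = \<rho> ` carrier S, mult = (\<lambda>u v. \<rho> (\<pi> u \<otimes>\<^bsub>S\<^esub> \<pi> v)), one = undefined\<rparr>"
  have S: "E_unitary S" and ext: "sg_extension A S U i \<pi>" and \<kappa>: "\<kappa> \<in> epi S G"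
    and j: "\<And>u. u \<in> carrier U \<Longrightarrow> j u = \<kappa> (\<pi> u)"
    using ref by auto
  interpret S: E_unitary S by fact
  have \<pi>: "\<pi> \<in> epi U S" and \<pi>sep: "inj_on \<pi> (idempotents U)"
    and U: "inverse_semigroup U" and i: "i \<in> mon A U"
    and img: "i ` carrier A = {u \<in> carrier U. \<pi> u \<in> idempotents S}"
    using ext by (auto simp: sg_extension_def)
  interpret U: inverse_semigroup U by fact
  have \<rho>c: "\<And>s. s \<in> carrier S \<Longrightarrow> \<rho> s \<in> carrier U" and \<pi>\<rho>: "\<And>s. s \<in> carrier S \<Longrightarrow> \<pi> (\<rho> s) = s"
    using \<rho> by (auto simp: order_transversal_def)
  have \<pi>c: "\<And>u. u \<in> carrier U \<Longrightarrow> \<pi> u \<in> carrier S"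
    and \<pi>m: "\<And>u v. u \<in> carrier U \<Longrightarrow> v \<in> carrier U \<Longrightarrow> \<pi> (u \<otimes>\<^bsub>U\<^esub> v) = \<pi> u \<otimes>\<^bsub>S\<^esub> \<pi> v"
    and \<pi>im: "\<pi> ` carrier U = carrier S"
    using \<pi> by (auto simp: epi_def hom_def)
  have \<rho>inj: "inj_on \<rho> (carrier S)" using \<pi>\<rho> by (metis inj_onI)
  have iso: "\<rho> \<in> iso S T"
    using \<rho>inj by (auto simp: iso_def hom_def bij_betw_def T_def \<pi>\<rho>)
  note tr = iso_transport[OF S.inverse_semigroup_axioms iso]
  have carT: "carrier T = \<rho> ` carrier S" by (simp add: T_def)
  have \<rho>m: "\<rho> x \<otimes>\<^bsub>T\<^esub> \<rho> y = \<rho> (x \<otimes>\<^bsub>S\<^esub> y)" if "x \<in> carrier S" "y \<in> carrier S" for x y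
    using that by (simp add: T_def \<pi>\<rho>)
  have idS: "idempotents S \<subseteq> carrier S" by (auto simp: idempotents_def)
  have \<rho>id: "\<rho> s \<in> idempotents T \<longleftrightarrow> s \<in> idempotents S" if "s \<in> carrier S" for s
    unfolding tr(3) using inj_on_image_mem_iff[OF \<rho>inj that idS] .
  have ET: "E_unitary T"
  proof -
    interpret T: inverse_semigroup T by (fact tr(1))
    show ?thesis
    proof
      fix e s assume e: "e \<in> idempotents T" and le: "nat_le T e s"
      obtain e' where e': "e' \<in> idempotents S" "e = \<rho> e'" using e tr(3) by auto
      obtain s' where s': "s' \<in> carrier S" "s = \<rho> s'" using le by (auto simp: nat_le_def carT)
      have "nat_le S e' s'" using le e' s' tr(4)[of e' s'] idS by auto
      then show "s \<in> idempotents T" using S.E_unitary[OF e'(1)] s' \<rho>id by simp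
    qed
  qed
  have extT: "sg_extension A T U i (\<rho> \<circ> \<pi>)"
    unfolding sg_extension_def
  proof (intro conjI U i)
    show "\<rho> \<circ> \<pi> \<in> epi U T"
      using \<pi>im by (auto simp: epi_def hom_def carT \<pi>c \<pi>m \<rho>m image_image[symmetric])
    have "inj_on \<rho> (\<pi> ` idempotents U)"
      by (rule inj_on_subset[OF \<rho>inj]) (auto simp: idempotents_def \<pi>c)
    then show "inj_on (\<rho> \<circ> \<pi>) (idempotents U)" using comp_inj_on[OF \<pi>sep] by blast
    show "i ` carrier A = {u \<in> carrier U. (\<rho> \<circ> \<pi>) u \<in> idempotents T}"
      using \<rho>id \<pi>c by (auto simp: img)
  qed
  have \<kappa>m: "\<kappa> (x \<otimes>\<^bsub>S\<^esub> y) = \<kappa> x \<otimes>\<^bsub>G\<^esub> \<kappa> y" if "x \<in> carrier S" "y \<in> carrier S" for x y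
    using \<kappa> that by (auto simp: epi_def hom_def)
  have \<kappa>im: "\<kappa> ` carrier S = carrier G" using \<kappa> by (auto simp: epi_def)
  have "\<kappa> \<circ> \<pi> \<in> epi T G"
  proof -
    have "(\<kappa> \<circ> \<pi>) ` carrier T = carrier G"
      by (simp add: carT image_image \<pi>\<rho> \<kappa>im flip: \<kappa>im cong: image_cong)
    moreover have "\<kappa> (\<pi> (x \<otimes>\<^bsub>T\<^esub> y)) = \<kappa> (\<pi> x) \<otimes>\<^bsub>G\<^esub> \<kappa> (\<pi> y)"
      if "x \<in> carrier T" "y \<in> carrier T" for x y
      using that by (auto simp: carT \<rho>m \<pi>\<rho> S.m_closed \<kappa>m)
    ultimately show ?thesis by (auto simp: epi_def hom_def)
  qed
  then have 1: "refinement A G (U, i, j) T (\<rho> \<circ> \<pi>) (\<kappa> \<circ> \<pi>)"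
    using ET extT by (auto simp: j \<pi>\<rho> \<pi>c)
  have 2: "order_transversal T U (\<rho> \<circ> \<pi>) id"
    using \<rho> tr(4) unfolding order_transversal_def tr(3) by (auto simp: carT \<rho>c \<pi>\<rho>)
  have dom: "ext_ideal A i T (\<kappa> \<circ> \<pi>) id g = ext_ideal A i S \<kappa> \<rho> g" for g
    unfolding ext_ideal_def carT
    using S.sg_inv_props(1) by (simp add: \<pi>\<rho> tr(2) \<rho>m)
  have the_eq: "(THE t. t \<in> carrier T \<and> (\<kappa> \<circ> \<pi>) t = g \<and> id (sg_inv T t \<otimes>\<^bsub>T\<^esub> t) = x)
      = \<rho> (THE s. s \<in> carrier S \<and> \<kappa> s = g \<and> \<rho> (sg_inv S s \<otimes>\<^bsub>S\<^esub> s) = x)"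
    if ex: "\<exists>!s. s \<in> carrier S \<and> \<kappa> s = g \<and> \<rho> (sg_inv S s \<otimes>\<^bsub>S\<^esub> s) = x" for g x
  proof -
    note s = theI'[OF ex] let ?s = "THE s. s \<in> carrier S \<and> \<kappa> s = g \<and> \<rho> (sg_inv S s \<otimes>\<^bsub>S\<^esub> s) = x"
    have iff: "\<rho> s \<in> carrier T \<and> (\<kappa> \<circ> \<pi>) (\<rho> s) = g \<and> id (sg_inv T (\<rho> s) \<otimes>\<^bsub>T\<^esub> \<rho> s) = x
        \<longleftrightarrow> s \<in> carrier S \<and> \<kappa> s = g \<and> \<rho> (sg_inv S s \<otimes>\<^bsub>S\<^esub> s) = x" if "s \<in> carrier S" for s
      using that S.sg_inv_props(1)[OF that] by (simp add: \<pi>\<rho> tr(2) \<rho>m carT)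
    show ?thesis
    proof (rule the_equality)
      show "\<rho> ?s \<in> carrier T \<and> (\<kappa> \<circ> \<pi>) (\<rho> ?s) = g \<and> id (sg_inv T (\<rho> ?s) \<otimes>\<^bsub>T\<^esub> \<rho> ?s) = x"
        using s iff by blast
      fix t assume t: "t \<in> carrier T \<and> (\<kappa> \<circ> \<pi>) t = g \<and> id (sg_inv T t \<otimes>\<^bsub>T\<^esub> t) = x"
      then obtain s' where s': "s' \<in> carrier S" "t = \<rho> s'" by (auto simp: carT)
      then show "t = \<rho> ?s" using t iff[of s'] the1_equality[OF ex, of s'] by simp
    qed
  qed
  have "ext_action A G U i T (\<kappa> \<circ> \<pi>) id g = ext_action A G U i S \<kappa> \<rho> g"
    if g: "g \<in> carrier G" for g
    unfolding ext_action_def dom Let_def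
    using the_eq[OF ex1_coset_rep[OF G gext ref \<rho> g]] by (auto simp: fun_eq_iff)
  then show thesis using that[OF 1 2] by blast
qed

lemma admissibleI:
  fixes S :: "'s monoid"
  assumes "group G" "group_extension A G (U, i, j)"
    "refinement A G (U, i, j) S \<pi> \<kappa>" "order_transversal S U \<pi> \<rho>"
  shows "admissible A G (U, i, j)"
proof -
  obtain T where "refinement A G (U, i, j) T (\<rho> \<circ> \<pi>) (\<kappa> \<circ> \<pi>)" "order_transversal T U (\<rho> \<circ> \<pi>) id"
    by (rule refinement_copy[OF assms])
  then show ?thesis unfolding admissible.simps using assms(2) by blast
qed

lemma has_abstract_kernelI:
  fixes S :: "'s monoid"
  assumes "group G" "group_extension A G (U, i, j)"
    "refinement A G (U, i, j) S \<pi> \<kappa>" "order_transversal S U \<pi> \<rho>"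
    and \<psi>: "\<And>g. g \<in> carrier G \<Longrightarrow> \<psi> g = inner_rel A `` {ext_action A G U i S \<kappa> \<rho> g}"
  shows "has_abstract_kernel A G (U, i, j) \<psi>"
proof -
  obtain T where "refinement A G (U, i, j) T (\<rho> \<circ> \<pi>) (\<kappa> \<circ> \<pi>)" "order_transversal T U (\<rho> \<circ> \<pi>) id"
    "\<And>g. g \<in> carrier G \<Longrightarrow>
      ext_action A G U i T (\<kappa> \<circ> \<pi>) id g = ext_action A G U i S \<kappa> \<rho> g"
    by (rule refinement_copy[OF assms(1-4)]) blast
  then show ?thesis unfolding has_abstract_kernel.simps using \<psi> by (metis (lifting))
qed

end

theory Submission
  imports Defs
begin

text \<open>Fix one admissible extension \<open>U\<close>.  The image \<open>N\<close> of \<open>A\<close> is its part of degree \<open>1\<close>, and an element \<open>u\<close>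
  is determined by \<open>u u\<inverse>\<close> and \<open>j u\<close> up to left multiplication by \<open>N\<close>.  If another admissible
  extension has the same abstract kernel, then absorbing the conjugating multipliers into its transversal
  yields an isomorphism of \<open>G\<close>-graded \<open>N\<close>-bimodules between the two.  Hence, up to equivalence, the
  extensions are the inverse semigroup multiplications on the set \<open>U\<close> that keep the bimodule structure
  and the grading.  Such a multiplication has the form \<open>\<gamma>(u,v) u v\<close> with \<open>\<gamma>\<close> taking central values in \<open>N\<close>;
  associativity is the cocycle identity for \<open>\<gamma>\<close>, and an equivalence between two of them has the form
  \<open>u \<mapsto> \<phi>(u) u\<close>, which changes \<open>\<gamma>\<close> by the coboundary of \<open>\<phi>\<close>.  Since a unit multiplier of a commutative
  ideal is determined by its values on idempotents, these \<open>\<gamma>\<close> and \<open>\<phi>\<close> are precisely the cochains with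
  values in \<open>C(A)\<close>.\<close>

section \<open>Inverse semigroups\<close>

text \<open>Two difficulties shape the proof. Cochain values are multipliers, because the ideals
  involved need not contain an identity; and the abstract kernel fixes the isomorphisms
  \<open>\<theta>\<close> only up to inner ones, with no coherence between different degrees. For
  the first: an element of degree 1 has only one idempotent, so two elements of equal degree and
  equal range idempotent also have equal domain idempotents (\<open>rr_match_iv\<close>). Hence
  everything that matters about \<open>u\<close>, up to \<open>N\<close>, is a function of the pair
  \<open>(j u, rr u)\<close>, and these pairs are the places where a partial cochain has a value.
  For the second: only bimodule structures are compared, never products of two transversal elements,
  so one conjugating multiplier for each degree is enough. What the bijection then fails to preserve
  of the products is the cocycle. The correspondence depends on the fixed extension, which plays the
  part of a base point: its own multiplication has the trivial factor set
  \<open>rr (u \<otimes> v)\<close>.\<close>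

lemma inverse_semigroupI:
  fixes S (structure)
  assumes closed: "\<And>x y. \<lbrakk>x \<in> carrier S; y \<in> carrier S\<rbrakk> \<Longrightarrow> x \<otimes> y \<in> carrier S"
    and assoc: "\<And>x y z. \<lbrakk>x \<in> carrier S; y \<in> carrier S; z \<in> carrier S\<rbrakk>
      \<Longrightarrow> (x \<otimes> y) \<otimes> z = x \<otimes> (y \<otimes> z)"
    and reg: "\<And>x. x \<in> carrier S \<Longrightarrow> \<exists>y\<in>carrier S. x \<otimes> y \<otimes> x = x \<and> y \<otimes> x \<otimes> y = y"
    and comm: "\<And>e f. \<lbrakk>e \<in> idempotents S; f \<in> idempotents S\<rbrakk> \<Longrightarrow> e \<otimes> f = f \<otimes> e"
  shows "inverse_semigroup S"
proof
  fix x assume x: "x \<in> carrier S"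
  have "y = z" if y: "y \<in> carrier S" "x \<otimes> y \<otimes> x = x" "y \<otimes> x \<otimes> y = y"
    and z: "z \<in> carrier S" "x \<otimes> z \<otimes> x = x" "z \<otimes> x \<otimes> z = z" for y z
  proof -
    have idem: "x \<otimes> y \<in> idempotents S" "x \<otimes> z \<in> idempotents S"
      "y \<otimes> x \<in> idempotents S" "z \<otimes> x \<in> idempotents S"
      using x y z by (simp_all add: idempotents_def closed flip: assoc)
    \<comment> \<open>All of \<open>x y\<close>, \<open>x z\<close>, \<open>y x\<close>,
      \<open>z x\<close> are idempotent: exchanging the first two turns \<open>y\<close> into
      \<open>y x z\<close>, and exchanging the last two turns this into \<open>z\<close>.\<close>
    have "y = y \<otimes> ((x \<otimes> z) \<otimes> (x \<otimes> y))"
      using x y z by (simp add: closed assoc) (metis assoc closed)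
    also have "\<dots> = y \<otimes> ((x \<otimes> y) \<otimes> (x \<otimes> z))" using comm[OF idem(1,2)] by simp
    also have "\<dots> = (y \<otimes> x) \<otimes> (z \<otimes> x) \<otimes> z"
      using x y z by (simp add: closed assoc) (metis assoc closed)
    also have "\<dots> = (z \<otimes> x) \<otimes> (y \<otimes> x) \<otimes> z" using comm[OF idem(3,4)] by simp
    also have "\<dots> = z" using x y z by (simp add: closed assoc)
    finally show ?thesis .
  qed
  then show "\<exists>!y. y \<in> carrier S \<and> x \<otimes> y \<otimes> x = x \<and> y \<otimes> x \<otimes> y = y"
    using reg[OF x] by blast
qed (fact closed assoc)+

text \<open>The range idempotent, in the picture of partial bijections. The domain idempotent gets
  no name of its own and is written \<open>rr (iv u)\<close>.\<close>

definition rng :: "('a, 'm) monoid_scheme \<Rightarrow> 'a \<Rightarrow> 'a" where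
  "rng S x = x \<otimes>\<^bsub>S\<^esub> sg_inv S x"

definition conjugate :: "('a, 'm) monoid_scheme \<Rightarrow> 'a \<Rightarrow> 'a \<Rightarrow> 'a" where
  "conjugate S u a = u \<otimes>\<^bsub>S\<^esub> a \<otimes>\<^bsub>S\<^esub> sg_inv S u"

context inverse_semigroup
begin

abbreviation iv where "iv \<equiv> sg_inv S"
abbreviation rr where "rr \<equiv> rng S"
abbreviation cj where "cj \<equiv> conjugate S"
abbreviation E where "E \<equiv> idempotents S"

lemma iv_closed [simp]: "x \<in> carrier S \<Longrightarrow> iv x \<in> carrier S"
  by (rule sg_inv_props)

lemma iv_iv [simp]: "x \<in> carrier S \<Longrightarrow> iv (iv x) = x"
  using sg_inv_props[of x] by (intro sg_inv_eqI) auto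

lemma inverse_absorb: "x \<in> carrier S \<Longrightarrow> x \<otimes> (iv x \<otimes> x) = x"
  "\<lbrakk>x \<in> carrier S; y \<in> carrier S\<rbrakk> \<Longrightarrow> x \<otimes> (iv x \<otimes> (x \<otimes> y)) = x \<otimes> y"
  "x \<in> carrier S \<Longrightarrow> iv x \<otimes> (x \<otimes> iv x) = iv x"
  "\<lbrakk>x \<in> carrier S; y \<in> carrier S\<rbrakk> \<Longrightarrow> iv x \<otimes> (x \<otimes> (iv x \<otimes> y)) = iv x \<otimes> y"
  using sg_inv_props[of x] by (metis m_assoc m_closed)+

lemma E_I: "\<lbrakk>e \<in> carrier S; e \<otimes> e = e\<rbrakk> \<Longrightarrow> e \<in> E"
  by (simp add: idempotents_def)

lemma E_idem: "e \<in> E \<Longrightarrow> e \<otimes> e = e" "\<lbrakk>e \<in> E; x \<in> carrier S\<rbrakk> \<Longrightarrow> e \<otimes> (e \<otimes> x) = e \<otimes> x"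
  by (simp_all add: idempotents_def flip: m_assoc)

lemma E_iv [simp]: "e \<in> E \<Longrightarrow> iv e = e"
  by (intro sg_inv_eqI) (auto simp: idempotents_def)

lemma E_closed [simp]: "e \<in> E \<Longrightarrow> e \<in> carrier S"
  by (simp add: idempotents_def)

lemma E_rr [simp]: "e \<in> E \<Longrightarrow> rr e = e"
  by (simp add: rng_def E_idem)

lemma rr_closed [simp]: "x \<in> carrier S \<Longrightarrow> rr x \<in> carrier S"
  by (simp add: rng_def m_closed)

lemma rr_E [simp]: "x \<in> carrier S \<Longrightarrow> rr x \<in> E"
  by (rule E_I) (simp_all add: rng_def m_closed m_assoc inverse_absorb)

lemma rr_mult_self [simp]: "x \<in> carrier S \<Longrightarrow> rr x \<otimes> x = x"
  "\<lbrakk>x \<in> carrier S; y \<in> carrier S\<rbrakk> \<Longrightarrow> rr x \<otimes> (x \<otimes> y) = x \<otimes> y"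
  "x \<in> carrier S \<Longrightarrow> x \<otimes> rr (iv x) = x"
  by (simp_all add: rng_def m_closed m_assoc inverse_absorb)

text \<open>The domain idempotent of \<open>x\<close> and the range idempotent of \<open>y\<close>
  meet in the middle of the product, and they commute.\<close>

lemma iv_mult: assumes "x \<in> carrier S" "y \<in> carrier S"
  shows "iv (x \<otimes> y) = iv y \<otimes> iv x"
proof (rule sg_inv_eqI)
  have c: "rr y \<otimes> rr (iv x) = rr (iv x) \<otimes> rr y"
    using assms by (intro idempotent_comm) auto
  have "x \<otimes> y \<otimes> (iv y \<otimes> iv x) \<otimes> (x \<otimes> y) = x \<otimes> ((rr y \<otimes> rr (iv x)) \<otimes> y)"
    using assms by (simp add: rng_def m_assoc m_closed)
  also have "\<dots> = x \<otimes> y" unfolding c using assms by (simp add: m_assoc m_closed flip: m_assoc[of x])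
  finally show "x \<otimes> y \<otimes> (iv y \<otimes> iv x) \<otimes> (x \<otimes> y) = x \<otimes> y" .
  have "iv y \<otimes> iv x \<otimes> (x \<otimes> y) \<otimes> (iv y \<otimes> iv x) = iv y \<otimes> ((rr (iv x) \<otimes> rr y) \<otimes> iv x)"
    using assms by (simp add: rng_def m_assoc m_closed)
  also have "\<dots> = iv y \<otimes> iv x"
    unfolding c[symmetric] using assms rr_mult_self(1)[of "iv x"] rr_mult_self(3)[of "iv y"]
    by (simp add: m_assoc m_closed flip: m_assoc[of "iv y"])
  finally show "iv y \<otimes> iv x \<otimes> (x \<otimes> y) \<otimes> (iv y \<otimes> iv x) = iv y \<otimes> iv x" .
qed (use assms in \<open>simp_all add: m_closed\<close>)

lemma cj_closed [simp]: "\<lbrakk>u \<in> carrier S; a \<in> carrier S\<rbrakk> \<Longrightarrow> cj u a \<in> carrier S"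
  by (simp add: conjugate_def m_closed)

lemma cj_mult: "\<lbrakk>u \<in> carrier S; v \<in> carrier S; a \<in> carrier S\<rbrakk> \<Longrightarrow> cj (u \<otimes> v) a = cj u (cj v a)"
  by (simp add: conjugate_def m_closed m_assoc iv_mult)

lemma rr_mult: "\<lbrakk>u \<in> carrier S; v \<in> carrier S\<rbrakk> \<Longrightarrow> rr (u \<otimes> v) = cj u (rr v)"
  by (simp add: conjugate_def rng_def m_closed m_assoc iv_mult)

text \<open>The conjugate of \<open>e\<close> by \<open>u\<close> is the range idempotent of
  \<open>u e\<close>.\<close>

lemma cj_E [simp]: assumes "u \<in> carrier S" "e \<in> E" shows "cj u e \<in> E"
proof -
  have "cj u e = rr (u \<otimes> e)" using assms by (simp add: rr_mult)
  then show ?thesis using assms by (simp add: m_closed)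
qed

lemma cj_absorb_left: "\<lbrakk>w \<in> carrier S; z \<in> carrier S\<rbrakk> \<Longrightarrow> cj w (rr (iv w) \<otimes> z) = cj w z"
  by (simp add: conjugate_def m_assoc[symmetric] m_closed)

lemma cj_iv: "\<lbrakk>u \<in> carrier S; a \<in> carrier S\<rbrakk> \<Longrightarrow> iv (cj u a) = cj u (iv a)"
  by (simp add: conjugate_def m_closed m_assoc iv_mult)

lemma cj_rr_iv [simp]: "u \<in> carrier S \<Longrightarrow> cj u (rr (iv u)) = rr u"
  "u \<in> carrier S \<Longrightarrow> cj (iv u) (rr u) = rr (iv u)"
  by (simp_all add: conjugate_def rng_def m_closed m_assoc inverse_absorb)

lemma rr_mult_le: assumes "u \<in> carrier S" "v \<in> carrier S" shows "rr u \<otimes> rr (u \<otimes> v) = rr (u \<otimes> v)"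
  using assms by (simp add: rng_def m_closed m_assoc inverse_absorb iv_mult)

lemma rr_E_mult: assumes "e \<in> E" "u \<in> carrier S" shows "rr (e \<otimes> u) = e \<otimes> rr u"
proof -
  have "rr (e \<otimes> u) = e \<otimes> (rr u \<otimes> e)" using assms by (simp add: rr_mult conjugate_def m_assoc)
  also have "rr u \<otimes> e = e \<otimes> rr u" using assms by (intro idempotent_comm) auto
  finally show ?thesis using assms by (simp add: E_idem)
qed

lemma E_comm3: "\<lbrakk>e \<in> E; f \<in> E; x \<in> carrier S\<rbrakk> \<Longrightarrow> e \<otimes> (f \<otimes> x) = f \<otimes> (e \<otimes> x)"
  by (metis E_closed idempotent_comm m_assoc)

text \<open>Idempotents can be moved past every element of an inverse semigroup; for other elements
  of degree 1 the same exchange rests on \<open>ker_comm\<close>, see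
  \<open>mult_swap\<close>.\<close>

lemma idem_mult_swap: assumes "u \<in> carrier S" "e \<in> E" shows "u \<otimes> e = cj u e \<otimes> u"
proof -
  have "cj u e \<otimes> u = u \<otimes> (e \<otimes> rr (iv u))" using assms by (simp add: conjugate_def rng_def m_assoc m_closed)
  also have "\<dots> = u \<otimes> e" using idempotent_comm[of e "rr (iv u)"] assms
    by (simp add: m_assoc m_closed flip: m_assoc[of u])
  finally show ?thesis by simp
qed

end

section \<open>Inverse semigroups graded by a group\<close>

text \<open>No \<open>A\<close> and no \<open>i\<close> occur yet; \<open>ker_comm\<close> retains
  of them that the part of degree 1 is a semilattice of groups. Over the trivial group this is just
  a semilattice of groups, which thereby inherits the same calculus.\<close>

locale graded = inverse_semigroup U + G: group G
  for U :: "('u, 'k) monoid_scheme" (structure) and G :: "('g, 'n) monoid_scheme" and j :: "'u \<Rightarrow> 'g" +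
  assumes j_hom: "j \<in> hom U G"
    and ker_comm: "\<lbrakk>e \<in> idempotents U; a \<in> kernel U G j\<rbrakk> \<Longrightarrow> e \<otimes> a = a \<otimes> e"
begin

abbreviation N where "N \<equiv> kernel U G j"
text \<open>The center of \<open>N\<close>, which becomes the copy of C(A). Its elements need not
  commute with elements of other degrees; those act on \<open>Z\<close> by conjugation.\<close>

definition Z where "Z = {z \<in> N. \<forall>a\<in>N. z \<otimes> a = a \<otimes> z}"

lemma j_closed [simp]: "u \<in> carrier U \<Longrightarrow> j u \<in> carrier G"
  and j_mult [simp]: "\<lbrakk>u \<in> carrier U; v \<in> carrier U\<rbrakk> \<Longrightarrow> j (u \<otimes> v) = j u \<otimes>\<^bsub>G\<^esub> j v"
  using j_hom by (auto simp: hom_def)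

lemma N_closed [simp]: "a \<in> N \<Longrightarrow> a \<in> carrier U" and N_j [simp]: "a \<in> N \<Longrightarrow> j a = \<one>\<^bsub>G\<^esub>"
  by (auto simp: kernel_def)

lemma N_I: "\<lbrakk>a \<in> carrier U; j a = \<one>\<^bsub>G\<^esub>\<rbrakk> \<Longrightarrow> a \<in> N"
  unfolding kernel_def by blast

lemma E_N [simp]: assumes "e \<in> E" shows "e \<in> N"
proof -
  have "j e \<otimes>\<^bsub>G\<^esub> j e = j e" using assms j_mult[of e e] by (simp add: E_idem)
  then show ?thesis using assms by (intro N_I) simp_all
qed

lemma j_iv [simp]: assumes "u \<in> carrier U" shows "j (iv u) = inv\<^bsub>G\<^esub> j u"
proof -
  have "rr (iv u) \<in> N" using assms by simp
  then have "j (iv u) \<otimes>\<^bsub>G\<^esub> j u = \<one>\<^bsub>G\<^esub>" using assms by (auto simp: rng_def dest: N_j)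
  then show ?thesis using assms by (simp add: G.inv_equality)
qed

lemma N_mult [simp]: "\<lbrakk>a \<in> N; b \<in> N\<rbrakk> \<Longrightarrow> a \<otimes> b \<in> N"
  and N_iv [simp]: "a \<in> N \<Longrightarrow> iv a \<in> N"
  and N_cj [simp]: "\<lbrakk>u \<in> carrier U; a \<in> N\<rbrakk> \<Longrightarrow> cj u a \<in> N"
  by (auto intro!: N_I simp: m_closed conjugate_def)

text \<open>Idempotents commute with \<open>a\<close>, so the product of its range and domain
  idempotents equals either of them. Each element of \<open>N\<close> thus lies in a subgroup and
  has a single idempotent.\<close>

lemma N_rr_iv [simp]: assumes "a \<in> N" shows "rr (iv a) = rr a"
proof -
  have c: "rr a \<otimes> rr (iv a) = rr (iv a) \<otimes> rr a"
    using assms by (intro idempotent_comm) auto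
  have "rr a \<otimes> rr (iv a) = (rr (iv a) \<otimes> a) \<otimes> iv a"
    unfolding c using assms by (simp add: m_assoc rng_def m_closed)
  also have "\<dots> = a \<otimes> rr (iv a) \<otimes> iv a" using assms ker_comm[of "rr (iv a)" a] by simp
  also have "\<dots> = rr a" using assms by (simp add: rng_def m_assoc m_closed inverse_absorb)
  finally have 1: "rr a \<otimes> rr (iv a) = rr a" .
  have "rr (iv a) \<otimes> rr a = (rr a \<otimes> iv a) \<otimes> a"
    unfolding c[symmetric] using assms by (simp add: m_assoc rng_def m_closed)
  also have "\<dots> = iv a \<otimes> rr a \<otimes> a" using assms ker_comm[of "rr a" "iv a"] by simp
  also have "\<dots> = rr (iv a)" using assms by (simp add: rng_def m_assoc m_closed inverse_absorb)
  finally show ?thesis using 1 assms idempotent_comm[of "rr a" "rr (iv a)"] by simp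
qed

text \<open>The domain idempotent of \<open>u\<close>, which appears between the two conjugates,
  commutes with \<open>a\<close> and is absorbed by \<open>u\<close>. This is where degree 1
  matters.\<close>

lemma cj_mult_N: assumes "u \<in> carrier U" "a \<in> N" "b \<in> N" shows "cj u (a \<otimes> b) = cj u a \<otimes> cj u b"
proof -
  have "cj u a \<otimes> cj u b = u \<otimes> ((a \<otimes> rr (iv u)) \<otimes> (b \<otimes> iv u))"
    using assms by (simp add: conjugate_def m_closed m_assoc rng_def)
  also have "a \<otimes> rr (iv u) = rr (iv u) \<otimes> a" using assms ker_comm by simp
  finally show ?thesis using assms by (simp add: conjugate_def m_closed m_assoc flip: m_assoc[of u "rr (iv u)"])
qed

text \<open>Right multiplication by \<open>N\<close> becomes left multiplication by conjugates, so
  the bimodule structure of \<open>U\<close> is known from the left action together with the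
  conjugations.\<close>

lemma mult_swap: assumes "u \<in> carrier U" "a \<in> N" shows "u \<otimes> a = cj u a \<otimes> u"
proof -
  have "cj u a \<otimes> u = u \<otimes> (a \<otimes> rr (iv u))" using assms by (simp add: conjugate_def rng_def m_assoc m_closed)
  also have "a \<otimes> rr (iv u) = rr (iv u) \<otimes> a" using assms ker_comm by simp
  finally show ?thesis using assms by (simp flip: m_assoc)
qed

lemma rr_cj: assumes "u \<in> carrier U" "a \<in> N" shows "rr (cj u a) = cj u (rr a)"
  using assms by (simp add: rng_def cj_iv cj_mult_N)

lemma cj_N_E: assumes "a \<in> N" "e \<in> E" shows "cj a e = e \<otimes> rr a"
  using assms ker_comm[of e a] by (simp add: conjugate_def rng_def flip: m_assoc)

text \<open>\<open>N\<close> acts on its center by mere restriction to an idempotent. This is why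
  \<open>G\<close> acts on C(A) although it acts on \<open>A\<close> only modulo inner
  isomorphisms.\<close>

lemma cj_N_Z: assumes "a \<in> N" "z \<in> Z" shows "cj a z = z \<otimes> rr a"
proof -
  have "a \<otimes> z = z \<otimes> a" "z \<in> carrier U" using assms N_closed unfolding Z_def by force+
  then show ?thesis using assms by (simp add: conjugate_def rng_def m_assoc m_closed)
qed

lemma rr_N_mult: assumes "a \<in> N" "u \<in> carrier U" shows "rr (a \<otimes> u) = rr a \<otimes> rr u"
  using assms idempotent_comm[of "rr a" "rr u"] by (simp add: rr_mult cj_N_E)

text \<open>The quotient \<open>iv u \<otimes> v\<close> has degree 1 and therefore one idempotent
  only; its range and domain idempotents are the domain idempotents of \<open>u\<close> and of
  \<open>v\<close>.\<close>

lemma rr_match_iv: assumes u: "u \<in> carrier U" "v \<in> carrier U" and eq: "j u = j v" "rr u = rr v"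
  shows "rr (iv u) = rr (iv v)"
proof -
  define a where "a = iv u \<otimes> v"
  have a: "a \<in> N" unfolding a_def using u eq by (intro N_I) (auto simp: m_closed)
  have "rr (iv u) = rr a" using u by (simp add: a_def rr_mult flip: eq(2))
  also have "\<dots> = rr (iv a)" using a by simp
  also have "\<dots> = rr (iv v)" using u by (simp add: a_def iv_mult rr_mult eq(2))
  finally show ?thesis .
qed

text \<open>Together with \<open>cancel_right\<close> this says that the elements of a given degree
  and range idempotent, if there are any, form a torsor under the group of those \<open>a\<close> in
  \<open>N\<close> with that idempotent.\<close>

lemma factor: assumes u: "u \<in> carrier U" "v \<in> carrier U" and eq: "j u = j v" "rr u = rr v"
  shows "u = (u \<otimes> iv v) \<otimes> v" "u \<otimes> iv v \<in> N" "rr (u \<otimes> iv v) = rr u"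
proof -
  have "(u \<otimes> iv v) \<otimes> v = u \<otimes> rr (iv v)" using u by (simp add: rng_def m_assoc)
  also have "\<dots> = u" using u rr_match_iv[OF u eq, symmetric] by simp
  finally show "u = (u \<otimes> iv v) \<otimes> v" by simp
  show "u \<otimes> iv v \<in> N" using u eq by (intro N_I) (auto simp: m_closed)
  show "rr (u \<otimes> iv v) = rr u" using u rr_match_iv[OF u eq, symmetric] by (simp add: rr_mult)
qed

text \<open>The range idempotent of \<open>u v\<close> is the conjugate of \<open>rr v\<close> by
  \<open>u\<close>, and replacing \<open>u\<close> by \<open>u'\<close> changes the product only by
  a factor of \<open>N\<close> over \<open>rr u\<close>, which is absorbed.\<close>

lemma rr_match_mult:
  assumes "u \<in> carrier U" "v \<in> carrier U" "u' \<in> carrier U" "v' \<in> carrier U"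
    and eq: "j u = j u'" "rr u = rr u'" "rr v = rr v'"
  shows "rr (u \<otimes> v) = rr (u' \<otimes> v')"
proof -
  define a where "a = u \<otimes> iv u'"
  have a: "u = a \<otimes> u'" "a \<in> N" "rr a = rr u'" using factor[of u u'] assms by (auto simp: a_def)
  have "rr (u \<otimes> v) = rr (a \<otimes> (u' \<otimes> v))" using a assms by (simp add: m_assoc)
  also have "\<dots> = rr a \<otimes> rr (u' \<otimes> v)" using a assms by (subst rr_N_mult) (auto simp: m_closed)
  also have "\<dots> = rr (u' \<otimes> v)" using a assms by (simp add: rr_mult_le)
  finally show ?thesis using assms by (simp add: rr_mult)
qed

lemma Z_N [simp]: "z \<in> Z \<Longrightarrow> z \<in> N" and Z_closed: "z \<in> Z \<Longrightarrow> z \<in> carrier U"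
  unfolding Z_def using N_closed by blast+

lemma Z_comm: "\<lbrakk>z \<in> Z; a \<in> N\<rbrakk> \<Longrightarrow> z \<otimes> a = a \<otimes> z" unfolding Z_def by blast

lemma Z_comm3: "\<lbrakk>z \<in> Z; a \<in> N; u \<in> carrier U\<rbrakk> \<Longrightarrow> z \<otimes> (a \<otimes> u) = a \<otimes> (z \<otimes> u)"
  by (metis N_closed Z_N Z_comm m_assoc)

lemma Z_I: "\<lbrakk>z \<in> N; \<And>a. a \<in> N \<Longrightarrow> z \<otimes> a = a \<otimes> z\<rbrakk> \<Longrightarrow> z \<in> Z"
  unfolding Z_def by blast

lemma E_Z [simp]: "e \<in> E \<Longrightarrow> e \<in> Z" unfolding Z_def using ker_comm E_N by blast

lemma Z_mult [simp]: "\<lbrakk>y \<in> Z; z \<in> Z\<rbrakk> \<Longrightarrow> y \<otimes> z \<in> Z"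
  by (rule Z_I) (simp_all add: m_assoc Z_comm Z_comm3)

lemma Z_iv [simp]: assumes z: "z \<in> Z" shows "iv z \<in> Z"
proof (rule Z_I)
  show "iv z \<in> N" using z by simp
  fix a assume a: "a \<in> N"
  have "iv z \<otimes> a = iv (iv a \<otimes> z)" using a z by (simp add: iv_mult)
  also have "\<dots> = iv (z \<otimes> iv a)" using a z Z_comm[of z "iv a"] by simp
  finally show "iv z \<otimes> a = a \<otimes> iv z" using a z by (simp add: iv_mult)
qed

text \<open>An element \<open>a\<close> of \<open>N\<close>, cut down by \<open>rr u\<close>, is the
  conjugate of \<open>cj (iv u) a\<close>, which commutes with \<open>z\<close>; and
  \<open>rr u\<close> is already contained in \<open>cj u z\<close>.\<close>

lemma Z_cj [simp]: assumes z: "z \<in> Z" "u \<in> carrier U" shows "cj u z \<in> Z"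
proof (rule Z_I)
  show "cj u z \<in> N" using z by simp
  fix a assume a: "a \<in> N"
  have c: "cj (iv u) a \<in> N" using a z by simp
  have "cj u (cj (iv u) a) = rr u \<otimes> a \<otimes> rr u"
    using a z by (simp add: conjugate_def rng_def m_assoc m_closed)
  also have "\<dots> = a \<otimes> rr u" using a z ker_comm[of "rr u" a] by (simp add: m_assoc E_idem)
  finally have ra: "cj u (cj (iv u) a) = a \<otimes> rr u" .
  have "cj u z \<otimes> (a \<otimes> rr u) = cj u (z \<otimes> cj (iv u) a)"
    unfolding ra[symmetric] using z c by (simp add: cj_mult_N)
  also have "z \<otimes> cj (iv u) a = cj (iv u) a \<otimes> z" by (rule Z_comm[OF z(1) c])
  also have "cj u (cj (iv u) a \<otimes> z) = a \<otimes> rr u \<otimes> cj u z" using z c by (simp add: cj_mult_N ra)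
  also have "\<dots> = a \<otimes> cj u z" using a z by (simp add: m_assoc conjugate_def m_closed)
  finally show "cj u z \<otimes> a = a \<otimes> cj u z"
    using a z ker_comm[of "rr u" a] ker_comm[of "rr u" "cj u z"]
    by (simp add: m_assoc[symmetric]) (simp add: conjugate_def m_assoc m_closed)
qed

lemma rr_Z: "\<lbrakk>y \<in> Z; z \<in> Z\<rbrakk> \<Longrightarrow> rr (y \<otimes> z) = rr y \<otimes> rr z"
  by (simp add: rr_N_mult)

end

section \<open>Cochains as functions on the semigroup\<close>

context graded
begin

text \<open>A cochain \<open>f\<close> of degree \<open>1\<close> is encoded by the function sending \<open>u\<close> to the value of \<open>f (j u)\<close> at the
  idempotent \<open>u u\<inverse>\<close>, a cochain of degree \<open>2\<close> by the value of \<open>f (j u, j v)\<close> at the idempotent of \<open>u v\<close>.\<close>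

definition cochain1 :: "('u \<Rightarrow> 'u) \<Rightarrow> bool" where
  "cochain1 \<phi> \<longleftrightarrow> (\<forall>u\<in>carrier U. \<phi> u \<in> Z \<and> rr (\<phi> u) = rr u \<and>
     (\<forall>v\<in>carrier U. j v = j u \<longrightarrow> rr v \<otimes> rr u = rr v \<longrightarrow> \<phi> v = rr v \<otimes> \<phi> u))"

definition cochain2 :: "('u \<Rightarrow> 'u \<Rightarrow> 'u) \<Rightarrow> bool" where
  "cochain2 \<gamma> \<longleftrightarrow> (\<forall>u\<in>carrier U. \<forall>v\<in>carrier U. \<gamma> u v \<in> Z \<and> rr (\<gamma> u v) = rr (u \<otimes> v) \<and>
     (\<forall>u'\<in>carrier U. \<forall>v'\<in>carrier U. j u' = j u \<longrightarrow> j v' = j v \<longrightarrow>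
        rr (u' \<otimes> v') \<otimes> rr (u \<otimes> v) = rr (u' \<otimes> v') \<longrightarrow> \<gamma> u' v' = rr (u' \<otimes> v') \<otimes> \<gamma> u v))"

text \<open>Triviality of the coboundary with the inverses moved to the other side.
  \<open>\<gamma> u v\<close> sits at the idempotent of \<open>u v\<close>, which may lie above that
  of the triple product; the other factor cuts it down.\<close>

definition cocycle2 :: "('u \<Rightarrow> 'u \<Rightarrow> 'u) \<Rightarrow> bool" where
  "cocycle2 \<gamma> \<longleftrightarrow> cochain2 \<gamma> \<and> (\<forall>u\<in>carrier U. \<forall>v\<in>carrier U. \<forall>w\<in>carrier U.
     cj u (\<gamma> v w) \<otimes> \<gamma> u (v \<otimes> w) = \<gamma> (u \<otimes> v) w \<otimes> \<gamma> u v)"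

definition normalized :: "('u \<Rightarrow> 'u \<Rightarrow> 'u) \<Rightarrow> bool" where
  "normalized \<gamma> \<longleftrightarrow> (\<forall>a\<in>N. \<forall>u\<in>carrier U. \<gamma> a u = rr (a \<otimes> u) \<and> \<gamma> u a = rr (u \<otimes> a))"

text \<open>\<open>\<phi> u\<close> sits at \<open>rr u\<close>, above the idempotent of
  \<open>u v\<close>. Multiplying it by the other two factors restricts it, which does the work of
  restricting multipliers to a smaller ideal.\<close>

definition delta1 :: "('u \<Rightarrow> 'u) \<Rightarrow> 'u \<Rightarrow> 'u \<Rightarrow> 'u" where
  "delta1 \<phi> u v = cj u (\<phi> v) \<otimes> iv (\<phi> (u \<otimes> v)) \<otimes> \<phi> u"

lemma Z_mult_comm: "\<lbrakk>y \<in> Z; z \<in> Z\<rbrakk> \<Longrightarrow> y \<otimes> z = z \<otimes> y"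
  by (simp add: Z_comm)

lemma Z_left_comm: "\<lbrakk>y \<in> Z; z \<in> Z; x \<in> carrier U\<rbrakk> \<Longrightarrow> y \<otimes> (z \<otimes> x) = z \<otimes> (y \<otimes> x)"
  by (simp add: Z_comm3)

lemmas Z_ac = m_assoc Z_mult_comm Z_left_comm

lemma Z_iv_cancel: "\<lbrakk>z \<in> Z; x \<in> carrier U\<rbrakk> \<Longrightarrow> z \<otimes> (iv z \<otimes> x) = rr z \<otimes> x"
  "z \<in> Z \<Longrightarrow> z \<otimes> iv z = rr z"
  by (simp_all add: rng_def m_assoc)

lemma Z_rr [simp]: "z \<in> N \<Longrightarrow> z \<otimes> rr z = z"
  using rr_mult_self(3)[of z] by simp

text \<open>Multiplying by \<open>iv u\<close> on the right leaves \<open>x rr u\<close>, which is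
  \<open>x\<close>. This is the uniqueness that complements \<open>factor\<close>.\<close>

lemma cancel_right: assumes "x \<in> N" "y \<in> N" "u \<in> carrier U" "rr x = rr u" "rr y = rr u"
    and eq: "x \<otimes> u = y \<otimes> u"
  shows "x = y"
proof -
  have "x = x \<otimes> rr u" "y = y \<otimes> rr u" using assms Z_rr by metis+
  then show ?thesis using assms by (simp add: rng_def flip: m_assoc)
qed

text \<open>A criterion made for factor sets and for equivalences, of which at first nothing but the
  induced conjugation is known.\<close>

lemma Z_of_cj: assumes z: "z \<in> N" and c: "\<And>b. b \<in> N \<Longrightarrow> cj z (b \<otimes> rr z) = b \<otimes> rr z"
  shows "z \<in> Z"
proof (rule Z_I[OF z])
  fix b assume b: "b \<in> N"
  have "z \<otimes> b = z \<otimes> (rr z \<otimes> b)" using z b by (simp flip: m_assoc)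
  also have "rr z \<otimes> b = b \<otimes> rr z" using ker_comm z b by simp
  also have "z \<otimes> (b \<otimes> rr z) = cj z (b \<otimes> rr z) \<otimes> z" using z b by (intro mult_swap) auto
  also have "\<dots> = b \<otimes> z" using z b by (simp add: c m_assoc)
  finally show "z \<otimes> b = b \<otimes> z" .
qed

lemma cochain1D: assumes "cochain1 \<phi>" "u \<in> carrier U"
  shows "\<phi> u \<in> Z" "rr (\<phi> u) = rr u"
    and "\<And>v. \<lbrakk>v \<in> carrier U; j v = j u; rr v \<otimes> rr u = rr v\<rbrakk> \<Longrightarrow> \<phi> v = rr v \<otimes> \<phi> u"
    and "\<And>v. \<lbrakk>v \<in> carrier U; j v = j u; rr v = rr u\<rbrakk> \<Longrightarrow> \<phi> v = \<phi> u"
    and "\<And>a. a \<in> N \<Longrightarrow> \<phi> (a \<otimes> u) = rr a \<otimes> \<phi> u"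
proof -
  show 1: "\<phi> u \<in> Z" "rr (\<phi> u) = rr u" using assms by (auto simp: cochain1_def)
  show 2: "\<phi> v = rr v \<otimes> \<phi> u" if "v \<in> carrier U" "j v = j u" "rr v \<otimes> rr u = rr v" for v
    using assms that by (auto simp: cochain1_def)
  show "\<phi> v = \<phi> u" if v: "v \<in> carrier U" "j v = j u" "rr v = rr u" for v
  proof -
    have "\<phi> v = rr v \<otimes> \<phi> u" using v by (intro 2) (simp_all add: E_idem assms)
    also have "rr v = rr (\<phi> u)" using v 1 by simp
    finally show ?thesis using 1(1) by simp
  qed
  show "\<phi> (a \<otimes> u) = rr a \<otimes> \<phi> u" if a: "a \<in> N" for a
  proof -
    have "\<phi> (a \<otimes> u) = rr (a \<otimes> u) \<otimes> \<phi> u"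
      using a assms by (intro 2) (simp_all add: m_closed rr_N_mult m_assoc E_idem)
    also have "\<dots> = rr a \<otimes> (rr u \<otimes> \<phi> u)" using a assms 1 by (simp add: rr_N_mult m_assoc)
    also have "rr u \<otimes> \<phi> u = \<phi> u" using 1(1) by (simp flip: 1(2))
    finally show ?thesis .
  qed
qed

text \<open>Compatibility only has to be tested on left multiples by \<open>N\<close>: if
  \<open>v\<close> has the degree of \<open>u\<close> and \<open>rr v\<close> lies below
  \<open>rr u\<close>, then \<open>factor\<close> writes \<open>v\<close> as such a multiple of the
  restriction \<open>rr v \<otimes> u\<close>.\<close>

lemma cochain1I:
  assumes "\<And>u. u \<in> carrier U \<Longrightarrow> \<phi> u \<in> Z" "\<And>u. u \<in> carrier U \<Longrightarrow> rr (\<phi> u) = rr u"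
    and N: "\<And>a u. \<lbrakk>a \<in> N; u \<in> carrier U\<rbrakk> \<Longrightarrow> \<phi> (a \<otimes> u) = rr a \<otimes> \<phi> u"
  shows "cochain1 \<phi>"
  unfolding cochain1_def
proof (intro ballI conjI impI)
  fix u v assume u: "u \<in> carrier U" "v \<in> carrier U" and j: "j v = j u" and le: "rr v \<otimes> rr u = rr v"
  have w: "rr v \<otimes> u \<in> carrier U" "j v = j (rr v \<otimes> u)" "rr v = rr (rr v \<otimes> u)"
    using u j le by (simp_all add: m_closed rr_N_mult)
  note f = factor[OF u(2) w]
  have "\<phi> v = \<phi> ((v \<otimes> iv (rr v \<otimes> u)) \<otimes> (rr v \<otimes> u))" using f(1) by simp
  also have "\<dots> = rr v \<otimes> \<phi> (rr v \<otimes> u)" by (simp only: N[OF f(2) w(1)] f(3))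
  also have "\<dots> = rr v \<otimes> \<phi> u" using u assms by (simp add: N E_idem)
  finally show "\<phi> v = rr v \<otimes> \<phi> u" .
qed (use assms in auto)

lemma cochain2D: assumes "cochain2 \<gamma>" "u \<in> carrier U" "v \<in> carrier U"
  shows "\<gamma> u v \<in> Z" "rr (\<gamma> u v) = rr (u \<otimes> v)"
    and "\<And>u' v'. \<lbrakk>u' \<in> carrier U; v' \<in> carrier U; j u' = j u; j v' = j v;
        rr (u' \<otimes> v') \<otimes> rr (u \<otimes> v) = rr (u' \<otimes> v')\<rbrakk> \<Longrightarrow> \<gamma> u' v' = rr (u' \<otimes> v') \<otimes> \<gamma> u v"
    and "\<And>u' v'. \<lbrakk>u' \<in> carrier U; v' \<in> carrier U; j u' = j u; j v' = j v;
        rr (u' \<otimes> v') = rr (u \<otimes> v)\<rbrakk> \<Longrightarrow> \<gamma> u' v' = \<gamma> u v"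
    and "\<And>a. a \<in> N \<Longrightarrow> \<gamma> (a \<otimes> u) v = rr a \<otimes> \<gamma> u v"
    and "\<And>a. a \<in> N \<Longrightarrow> \<gamma> u (a \<otimes> v) = rr (u \<otimes> (a \<otimes> v)) \<otimes> \<gamma> u v"
proof -
  show 1: "\<gamma> u v \<in> Z" "rr (\<gamma> u v) = rr (u \<otimes> v)" using assms by (auto simp: cochain2_def)
  have 3: "rr (u \<otimes> v) \<otimes> \<gamma> u v = \<gamma> u v" using 1(1) by (simp flip: 1(2))
  show 2: "\<gamma> u' v' = rr (u' \<otimes> v') \<otimes> \<gamma> u v" if "u' \<in> carrier U" "v' \<in> carrier U" "j u' = j u"
    "j v' = j v" "rr (u' \<otimes> v') \<otimes> rr (u \<otimes> v) = rr (u' \<otimes> v')" for u' v'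
    using assms that unfolding cochain2_def by blast
  show "\<gamma> u' v' = \<gamma> u v" if v: "u' \<in> carrier U" "v' \<in> carrier U" "j u' = j u" "j v' = j v"
      "rr (u' \<otimes> v') = rr (u \<otimes> v)" for u' v'
  proof -
    have "\<gamma> u' v' = rr (u' \<otimes> v') \<otimes> \<gamma> u v" using v by (intro 2) (simp_all add: E_idem assms m_closed)
    then show ?thesis using v 3 by simp
  qed
  show "\<gamma> (a \<otimes> u) v = rr a \<otimes> \<gamma> u v" if a: "a \<in> N" for a
  proof -
    have as: "(a \<otimes> u) \<otimes> v = a \<otimes> (u \<otimes> v)" using a assms by (simp add: m_assoc)
    have r: "rr (a \<otimes> (u \<otimes> v)) = rr a \<otimes> rr (u \<otimes> v)" using a assms by (simp add: m_closed rr_N_mult)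
    have "\<gamma> (a \<otimes> u) v = rr ((a \<otimes> u) \<otimes> v) \<otimes> \<gamma> u v"
      unfolding as r using a assms
      by (intro 2[of "a \<otimes> u" v, unfolded as r]) (simp_all add: m_closed m_assoc E_idem)
    also have "\<dots> = rr a \<otimes> (rr (u \<otimes> v) \<otimes> \<gamma> u v)"
      unfolding as r using a assms 1(1) by (simp add: m_assoc m_closed)
    finally show ?thesis by (simp add: 3)
  qed
  show "\<gamma> u (a \<otimes> v) = rr (u \<otimes> (a \<otimes> v)) \<otimes> \<gamma> u v" if a: "a \<in> N" for a
  proof (rule 2)
    have "u \<otimes> (a \<otimes> v) = cj u a \<otimes> (u \<otimes> v)" using a assms by (simp add: mult_swap flip: m_assoc)
    then have "rr (u \<otimes> (a \<otimes> v)) = rr (cj u a) \<otimes> rr (u \<otimes> v)" using a assms by (simp add: rr_N_mult m_closed)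
    then show "rr (u \<otimes> (a \<otimes> v)) \<otimes> rr (u \<otimes> v) = rr (u \<otimes> (a \<otimes> v))"
      using a assms by (simp add: m_assoc m_closed E_idem)
  qed (use a assms in \<open>simp_all add: m_closed\<close>)
qed

text \<open>The arguments are exchanged one after the other. The idempotent of a product controls
  the left argument directly, the right one only after restriction to the domain idempotent of the
  left one.\<close>

lemma cochain2I:
  assumes Z: "\<And>u v. \<lbrakk>u \<in> carrier U; v \<in> carrier U\<rbrakk> \<Longrightarrow> \<gamma> u v \<in> Z"
    and rr: "\<And>u v. \<lbrakk>u \<in> carrier U; v \<in> carrier U\<rbrakk> \<Longrightarrow> rr (\<gamma> u v) = rr (u \<otimes> v)"
    and l: "\<And>a u v. \<lbrakk>a \<in> N; u \<in> carrier U; v \<in> carrier U\<rbrakk> \<Longrightarrow> \<gamma> (a \<otimes> u) v = rr a \<otimes> \<gamma> u v"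
    and r: "\<And>a u v. \<lbrakk>a \<in> N; u \<in> carrier U; v \<in> carrier U\<rbrakk>
      \<Longrightarrow> \<gamma> u (a \<otimes> v) = rr (u \<otimes> (a \<otimes> v)) \<otimes> \<gamma> u v"
  shows "cochain2 \<gamma>"
  unfolding cochain2_def
proof (intro ballI conjI impI)
  fix u v u' v' assume u: "u \<in> carrier U" "v \<in> carrier U" "u' \<in> carrier U" "v' \<in> carrier U"
    and j: "j u' = j u" "j v' = j v" and le: "rr (u' \<otimes> v') \<otimes> rr (u \<otimes> v) = rr (u' \<otimes> v')"
  define e where "e = rr (u' \<otimes> v')"
  have e: "e \<in> E" using u by (simp add: e_def m_closed)
  have e1: "e \<otimes> rr u' = e" "e \<otimes> rr u = e"
  proof -
    have "rr u' \<otimes> e = e" using u by (simp add: e_def rr_mult_le)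
    then show "e \<otimes> rr u' = e" using u e idempotent_comm[of e "rr u'"] by simp
    have "e \<otimes> rr u = e \<otimes> rr (u \<otimes> v) \<otimes> rr u" using le by (simp add: e_def)
    also have "\<dots> = e \<otimes> (rr u \<otimes> rr (u \<otimes> v))"
      using u e idempotent_comm[of "rr u" "rr (u \<otimes> v)"] by (simp add: m_assoc m_closed)
    also have "\<dots> = e" using u le by (simp add: rr_mult_le e_def)
    finally show "e \<otimes> rr u = e" .
  qed
  have euv: "e \<otimes> \<gamma> u' v' = \<gamma> u' v'" using Z[OF u(3,4)] by (simp add: e_def flip: rr[OF u(3,4)])
  \<comment> \<open>Cut down to the range idempotent \<open>e\<close>, \<open>u\<close> and
    \<open>u'\<close> differ by a factor in \<open>N\<close>, so \<open>u'\<close> may be replaced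
    by \<open>w\<close>.\<close>
  define w where "w = e \<otimes> u"
  have w: "w \<in> carrier U" "j w = j u" "rr w = e" using u e e1 by (simp_all add: w_def m_closed rr_N_mult)
  have w': "e \<otimes> u' \<in> carrier U" "j (e \<otimes> u') = j w" "rr (e \<otimes> u') = rr w"
    using u e e1 j by (simp_all add: w m_closed rr_N_mult)
  note f = factor[OF w'(1) w(1) w'(2,3)]
  define a where "a = e \<otimes> u' \<otimes> iv w"
  have a: "e \<otimes> u' = a \<otimes> w" "a \<in> N" "rr a = e" using f w w' by (simp_all add: a_def)
  have "\<gamma> u' v' = \<gamma> (e \<otimes> u') v'" using l[of e u' v'] u e euv by simp
  also have "\<dots> = e \<otimes> \<gamma> w v'" using u a w l by simp
  also have "\<dots> = \<gamma> w v'" using u e l[of e u v'] Z[of u v'] by (simp add: w_def E_idem)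
  finally have 1: "\<gamma> u' v' = \<gamma> w v'" .
  have rw': "rr (w \<otimes> v') = e"
  proof -
    have "e = rr (e \<otimes> (u' \<otimes> v'))" using u e by (simp add: rr_N_mult m_closed E_idem e_def)
    also have "\<dots> = rr ((a \<otimes> w) \<otimes> v')" using u e by (simp add: m_assoc flip: a(1))
    also have "\<dots> = rr a \<otimes> rr (w \<otimes> v')" using u e w a by (simp add: rr_N_mult m_closed m_assoc)
    also have "\<dots> = rr (w \<otimes> v')" using u w a rr_mult_le[of w v'] by simp
    finally show ?thesis by simp
  qed
  have rw: "rr (w \<otimes> v) = e"
    using u e le by (simp add: w_def rr_N_mult m_closed m_assoc flip: e_def)
  \<comment> \<open>The products of \<open>w\<close> with \<open>v\<close> and with
    \<open>v'\<close> have the range idempotent of \<open>w\<close> itself. Hence \<open>v\<close>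
    and \<open>v'\<close>, cut down by \<open>?d\<close>, both have range idempotent
    \<open>?d\<close> and are again comparable by \<open>factor\<close>.\<close>
  let ?d = "rr (iv w)"
  have d: "?d \<in> E" "w \<otimes> ?d = w" using w by simp_all
  have rd: "rr (?d \<otimes> x) = ?d" if x: "x \<in> carrier U" "rr (w \<otimes> x) = e" for x
  proof -
    have "?d \<otimes> x = iv w \<otimes> (w \<otimes> x)" using x w(1) by (simp add: rng_def m_assoc)
    then have "rr (?d \<otimes> x) = cj (iv w) (rr (w \<otimes> x))"
      using x(1) w(1) by (simp add: rr_mult m_closed)
    also have "\<dots> = ?d" unfolding x(2) using w by (simp flip: w(3))
    finally show ?thesis .
  qed
  note f = factor[of "?d \<otimes> v'" "?d \<otimes> v"]
  define b where "b = (?d \<otimes> v') \<otimes> iv (?d \<otimes> v)"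
  have b: "?d \<otimes> v' = b \<otimes> (?d \<otimes> v)" "b \<in> N" using f u w j rd rw rw' by (simp_all add: b_def m_closed)
  have red: "\<gamma> w (?d \<otimes> x) = e \<otimes> \<gamma> w x" if x: "x \<in> carrier U" "rr (w \<otimes> x) = e" for x
    using r[of ?d w x] w x by (simp flip: m_assoc)
  have eg: "e \<otimes> \<gamma> w x = \<gamma> w x" if x: "x \<in> carrier U" "rr (w \<otimes> x) = e" for x
  proof -
    have "rr (\<gamma> w x) = e" using rr[OF w(1) x(1)] x(2) by simp
    then show ?thesis using rr_mult_self(1)[of "\<gamma> w x"] Z[OF w(1) x(1)] by simp
  qed
  have "\<gamma> w v' = \<gamma> w (b \<otimes> (?d \<otimes> v))" using red[of v'] eg[of v'] u rw' b by simp
  also have "\<dots> = rr (w \<otimes> (?d \<otimes> v')) \<otimes> \<gamma> w (?d \<otimes> v)" using b u w by (simp add: r m_closed)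
  also have "\<dots> = \<gamma> w v" using u w rw rw' red eg d by (simp flip: m_assoc)
  also have "\<dots> = e \<otimes> \<gamma> u v" using u e l by (simp add: w_def)
  finally show "\<gamma> u' v' = rr (u' \<otimes> v') \<otimes> \<gamma> u v" using 1 by (simp add: e_def)
qed (use assms in auto)

text \<open>A factor from \<open>N\<close> comes out of each term as its idempotent: in the left
  argument because \<open>N\<close> acts on the center by restriction, in the right one because
  \<open>u a\<close> equals \<open>cj u a\<close> times \<open>u\<close>.\<close>

lemma delta1_cochain2: assumes p: "cochain1 \<phi>" shows "cochain2 (delta1 \<phi>)"
proof (rule cochain2I)
  note D = cochain1D(1,2,5)[OF p]
  fix u v assume u: "u \<in> carrier U" "v \<in> carrier U"
  show "delta1 \<phi> u v \<in> Z" using u by (simp add: D delta1_def m_closed)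
  have "rr (delta1 \<phi> u v) = (rr (u \<otimes> v) \<otimes> rr (u \<otimes> v)) \<otimes> rr u"
    using u by (simp add: D delta1_def m_closed rr_Z rr_cj rr_mult[of u v])
  also have "\<dots> = rr u \<otimes> rr (u \<otimes> v)" using u idempotent_comm[of "rr (u \<otimes> v)" "rr u"] by (simp add: E_idem m_closed)
  finally show "rr (delta1 \<phi> u v) = rr (u \<otimes> v)" using u by (simp add: rr_mult_le)
  fix a assume a: "a \<in> N"
  have "delta1 \<phi> (a \<otimes> u) v = (cj u (\<phi> v) \<otimes> rr a) \<otimes> (iv (\<phi> (u \<otimes> v)) \<otimes> rr a) \<otimes> (rr a \<otimes> \<phi> u)"
    using a u by (simp add: D delta1_def cj_mult cj_N_Z m_assoc m_closed iv_mult)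
  also have "\<dots> = rr a \<otimes> delta1 \<phi> u v" using a u by (simp add: D delta1_def Z_ac m_closed E_idem)
  finally show "delta1 \<phi> (a \<otimes> u) v = rr a \<otimes> delta1 \<phi> u v" .
  have eq: "u \<otimes> (a \<otimes> v) = cj u a \<otimes> (u \<otimes> v)" using a u by (simp add: mult_swap flip: m_assoc)
  have "delta1 \<phi> u (a \<otimes> v) = rr (cj u a) \<otimes> cj u (\<phi> v) \<otimes> iv (rr (cj u a) \<otimes> \<phi> (u \<otimes> v)) \<otimes> \<phi> u"
    unfolding delta1_def eq using a u by (simp add: D cj_mult_N m_closed rr_cj)
  also have "\<dots> = rr (cj u a) \<otimes> delta1 \<phi> u v" using a u by (simp add: D delta1_def Z_ac m_closed E_idem iv_mult)
  also have "\<dots> = rr (u \<otimes> (a \<otimes> v)) \<otimes> delta1 \<phi> u v"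
  proof -
    have "rr (u \<otimes> v) \<otimes> delta1 \<phi> u v = delta1 \<phi> u v"
    proof -
      have "cj u (\<phi> v) = rr (u \<otimes> v) \<otimes> cj u (\<phi> v)"
        using u rr_mult_self(1)[of "cj u (\<phi> v)"] by (simp add: D rr_cj rr_mult)
      then show ?thesis using u by (simp add: D delta1_def m_assoc[symmetric] m_closed)
    qed
    then show ?thesis using a u by (simp add: D eq rr_N_mult m_closed m_assoc delta1_def)
  qed
  finally show "delta1 \<phi> u (a \<otimes> v) = rr (u \<otimes> (a \<otimes> v)) \<otimes> delta1 \<phi> u v" .
qed

lemma cochain2_mult: assumes "cochain2 \<gamma>" "cochain2 \<gamma>'" shows "cochain2 (\<lambda>u v. \<gamma> u v \<otimes> \<gamma>' u v)"
  by (rule cochain2I)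
    (simp_all add: cochain2D(1,2,5,6)[OF assms(1)] cochain2D(1,2,5,6)[OF assms(2)] rr_Z m_closed E_idem Z_ac)

lemma delta1_cocycle2: assumes p: "cochain1 \<phi>" shows "cocycle2 (delta1 \<phi>)"
  unfolding cocycle2_def
proof (intro conjI ballI)
  note D = cochain1D(1,2,5)[OF p]
  fix u v w assume u: "u \<in> carrier U" "v \<in> carrier U" "w \<in> carrier U"
  \<comment> \<open>\<open>B\<close> and \<open>F\<close> stand for inverse values. \<open>B\<close>
    meets its inverse on the left-hand side and \<open>Q\<close> on the right-hand side; the
    idempotents left over are absorbed by \<open>A\<close> and by \<open>C\<close>.\<close>
  define A where "A = cj u (cj v (\<phi> w))"
  define B where "B = iv (cj u (\<phi> (v \<otimes> w)))"
  define C where "C = cj u (\<phi> v)"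
  define F where "F = iv (\<phi> (u \<otimes> (v \<otimes> w)))"
  define P where "P = \<phi> u"
  define Q where "Q = \<phi> (u \<otimes> v)"
  have Z: "A \<in> Z" "B \<in> Z" "C \<in> Z" "F \<in> Z" "P \<in> Z" "Q \<in> Z"
    using u by (simp_all add: D A_def B_def C_def F_def P_def Q_def m_closed)
  have R: "rr A = rr B" "rr C = rr Q"
    using u by (simp_all add: D A_def B_def C_def F_def P_def Q_def m_closed rr_cj rr_mult)
  have "cj u (delta1 \<phi> v w) \<otimes> delta1 \<phi> u (v \<otimes> w) = (A \<otimes> B \<otimes> C) \<otimes> (iv B \<otimes> F \<otimes> P)"
    using u by (simp add: D delta1_def A_def B_def C_def F_def P_def m_closed cj_mult_N cj_iv)
  also have "\<dots> = (A \<otimes> rr B) \<otimes> C \<otimes> F \<otimes> P" using Z by (simp add: Z_ac flip: Z_iv_cancel(2))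
  also have "\<dots> = A \<otimes> F \<otimes> (C \<otimes> rr Q) \<otimes> P" unfolding R[symmetric] using Z by (simp add: Z_ac)
  also have "\<dots> = (A \<otimes> F \<otimes> Q) \<otimes> (C \<otimes> iv Q \<otimes> P)" using Z by (simp add: Z_ac flip: Z_iv_cancel(2))
  also have "\<dots> = delta1 \<phi> (u \<otimes> v) w \<otimes> delta1 \<phi> u v"
    using u by (simp add: D delta1_def A_def Q_def C_def F_def P_def m_closed cj_mult m_assoc)
  finally show "cj u (delta1 \<phi> v w) \<otimes> delta1 \<phi> u (v \<otimes> w) = delta1 \<phi> (u \<otimes> v) w \<otimes> delta1 \<phi> u v" .
qed (rule delta1_cochain2[OF p])

lemma cocycle2_mult: assumes "cocycle2 \<gamma>" "cocycle2 \<gamma>'" shows "cocycle2 (\<lambda>u v. \<gamma> u v \<otimes> \<gamma>' u v)"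
  unfolding cocycle2_def
proof (intro conjI ballI)
  have c: "cochain2 \<gamma>" "cochain2 \<gamma>'" using assms by (auto simp: cocycle2_def)
  note D = cochain2D(1,2)[OF c(1)] cochain2D(1,2)[OF c(2)]
  show "cochain2 (\<lambda>u v. \<gamma> u v \<otimes> \<gamma>' u v)" by (rule cochain2_mult[OF c])
  fix u v w assume u: "u \<in> carrier U" "v \<in> carrier U" "w \<in> carrier U"
  have "cj u (\<gamma> v w \<otimes> \<gamma>' v w) \<otimes> (\<gamma> u (v \<otimes> w) \<otimes> \<gamma>' u (v \<otimes> w))
      = (cj u (\<gamma> v w) \<otimes> \<gamma> u (v \<otimes> w)) \<otimes> (cj u (\<gamma>' v w) \<otimes> \<gamma>' u (v \<otimes> w))"
    using u by (simp add: D cj_mult_N Z_ac m_closed)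
  also have "\<dots> = (\<gamma> (u \<otimes> v) w \<otimes> \<gamma> u v) \<otimes> (\<gamma>' (u \<otimes> v) w \<otimes> \<gamma>' u v)"
    using assms u by (simp add: cocycle2_def)
  also have "\<dots> = \<gamma> (u \<otimes> v) w \<otimes> \<gamma>' (u \<otimes> v) w \<otimes> (\<gamma> u v \<otimes> \<gamma>' u v)"
    using u by (simp add: D Z_ac m_closed)
  finally show "cj u (\<gamma> v w \<otimes> \<gamma>' v w) \<otimes> (\<gamma> u (v \<otimes> w) \<otimes> \<gamma>' u (v \<otimes> w))
    = \<gamma> (u \<otimes> v) w \<otimes> \<gamma>' (u \<otimes> v) w \<otimes> (\<gamma> u v \<otimes> \<gamma>' u v)" .
qed

end

section \<open>Normalization of cocycles\<close>

context graded
begin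

lemma E_of_idem: "\<lbrakk>x \<in> N; x \<otimes> x = x\<rbrakk> \<Longrightarrow> x \<in> E"
  by (rule E_I) simp_all

text \<open>The cocycle identity at \<open>(e, e, w)\<close> and at \<open>(w, f, f)\<close> makes
  the values in question idempotent, and an idempotent is its own \<open>rr\<close>. The remaining
  arguments reduce to these, since a cochain sees only degrees and the idempotent of the
  product.\<close>

lemma normalizedI:
  assumes c: "cocycle2 \<gamma>" and E: "\<And>e. e \<in> E \<Longrightarrow> \<gamma> e e = e"
  shows "normalized \<gamma>"
  unfolding normalized_def
proof (intro ballI conjI)
  have c2: "cochain2 \<gamma>" using c by (simp add: cocycle2_def)
  note D = cochain2D[OF c2]
  have coc: "cj u (\<gamma> v w) \<otimes> \<gamma> u (v \<otimes> w) = \<gamma> (u \<otimes> v) w \<otimes> \<gamma> u v"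
    if "u \<in> carrier U" "v \<in> carrier U" "w \<in> carrier U" for u v w
    using c that by (simp add: cocycle2_def)
  fix a u assume a: "a \<in> N" and u: "u \<in> carrier U"
  show "\<gamma> a u = rr (a \<otimes> u)"
  proof -
    define e where "e = rr (a \<otimes> u)"
    define w where "w = e \<otimes> u"
    have e: "e \<in> E" using a u by (simp add: e_def m_closed)
    have w: "w \<in> carrier U" "e \<otimes> w = w" using u e by (simp_all add: w_def m_closed E_idem)
    have rw: "rr w = e" using a u by (simp add: w_def e_def rr_N_mult m_closed m_assoc E_idem)
    have 1: "\<gamma> a u = \<gamma> e w"
      by (rule D(4)) (use a u e w rw in \<open>simp_all add: w_def e_def[symmetric] m_closed\<close>)
    have x: "\<gamma> e w \<in> Z" "rr (\<gamma> e w) = e" using D(1,2)[of e w] e w rw by simp_all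
    have "cj e (\<gamma> e w) = \<gamma> e w" using x Z_rr[of "\<gamma> e w"] e by (simp add: cj_N_Z)
    then have "\<gamma> e w \<otimes> \<gamma> e w = \<gamma> e w"
      using coc[of e e w] e w x Z_rr[of "\<gamma> e w"] by (simp add: E_idem E)
    then have "rr (\<gamma> e w) = \<gamma> e w" using x(1) by (intro E_rr E_of_idem) simp_all
    then show ?thesis using x 1 e_def by simp
  qed
  show "\<gamma> u a = rr (u \<otimes> a)"
  proof -
    define w where "w = u \<otimes> a"
    define f where "f = rr (iv w)"
    have w: "w \<in> carrier U" using a u by (simp add: w_def m_closed)
    have f: "f \<in> E" "w \<otimes> f = w" "cj w f = rr w" using w by (simp_all add: f_def)
    have 1: "\<gamma> u a = \<gamma> w f"
      by (rule D(4)) (use a u f w in \<open>simp_all add: w_def[symmetric]\<close>, simp add: w_def)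
    have x: "\<gamma> w f \<in> Z" "rr (\<gamma> w f) = rr w" using D(1,2)[of w f] f w by simp_all
    have "rr w \<otimes> \<gamma> w f = \<gamma> w f" using x(1) rr_mult_self(1)[of "\<gamma> w f"] unfolding x(2) by simp
    then have "\<gamma> w f \<otimes> \<gamma> w f = \<gamma> w f"
      using coc[of w f f] f w by (simp add: E_idem E)
    then have "rr (\<gamma> w f) = \<gamma> w f" using x(1) by (intro E_rr E_of_idem) simp_all
    then show ?thesis using x 1 w_def by simp
  qed
qed

text \<open>Only for normalized cocycles does the twisted multiplication agree with the old one on \<open>N\<close>, so that
  \<open>i\<close> stays a homomorphism.\<close>

lemma normalization:
  assumes c: "cocycle2 \<gamma>"
  shows "\<exists>\<phi>. cochain1 \<phi> \<and> cocycle2 (\<lambda>u v. \<gamma> u v \<otimes> delta1 \<phi> u v) \<and>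
    normalized (\<lambda>u v. \<gamma> u v \<otimes> delta1 \<phi> u v)"
proof -
  have c2: "cochain2 \<gamma>" using c by (simp add: cocycle2_def)
  note D = cochain2D(1,2,5,6)[OF c2]
  \<comment> \<open>At \<open>(e, e)\<close> the coboundary of \<open>\<phi>\<close> is
    \<open>\<phi> e\<close>, so \<open>\<phi>\<close> has to invert the diagonal values of
    \<open>\<gamma>\<close> there. In the other degrees the same values, indexed by
    \<open>rr u\<close>, form a cochain.\<close>
  define \<phi> where "\<phi> u = iv (\<gamma> (rr u) (rr u))" for u
  have p: "cochain1 \<phi>"
  proof (rule cochain1I)
    fix a u assume a: "a \<in> N" and u: "u \<in> carrier U"
    have "\<gamma> (rr a \<otimes> rr u) (rr a \<otimes> rr u) = rr a \<otimes> (rr (rr u \<otimes> (rr a \<otimes> rr u)) \<otimes> \<gamma> (rr u) (rr u))"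
      using a u D(3)[of "rr u" "rr a \<otimes> rr u" "rr a"] D(4)[of "rr u" "rr u" "rr a"] by (simp add: m_closed)
    also have "rr u \<otimes> (rr a \<otimes> rr u) = rr a \<otimes> rr u"
      using a u idempotent_comm[of "rr a" "rr u"] by (simp add: E_idem)
    also have "rr (rr a \<otimes> rr u) = rr a \<otimes> rr u" using a u by (simp add: rr_N_mult)
    also have "rr a \<otimes> (rr a \<otimes> rr u \<otimes> \<gamma> (rr u) (rr u)) = rr a \<otimes> (rr u \<otimes> \<gamma> (rr u) (rr u))"
      using a u by (simp add: m_assoc E_idem D)
    also have "rr u \<otimes> \<gamma> (rr u) (rr u) = \<gamma> (rr u) (rr u)"
      using u rr_mult_self(1)[of "\<gamma> (rr u) (rr u)"] by (simp add: D E_idem)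
    finally show "\<phi> (a \<otimes> u) = rr a \<otimes> \<phi> u"
      using a u by (simp add: \<phi>_def rr_N_mult iv_mult D Z_mult_comm)
  qed (simp_all add: \<phi>_def D E_idem)
  have c': "cocycle2 (\<lambda>u v. \<gamma> u v \<otimes> delta1 \<phi> u v)"
    by (rule cocycle2_mult[OF c delta1_cocycle2[OF p]])
  moreover have "normalized (\<lambda>u v. \<gamma> u v \<otimes> delta1 \<phi> u v)"
  proof (rule normalizedI[OF c'])
    fix e assume e: "e \<in> E"
    have r: "rr (\<gamma> e e) = e" "\<gamma> e e \<in> Z" using D(1,2)[of e e] e by (simp_all add: E_idem)
    have "cj e (\<phi> e) = \<phi> e" using e r Z_rr[of "iv (\<gamma> e e)"] by (simp add: \<phi>_def cj_N_Z)
    then have "delta1 \<phi> e e = iv (\<gamma> e e)" using e r inverse_absorb(3)[of "\<gamma> e e"]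
      by (simp add: delta1_def \<phi>_def E_idem m_assoc)
    then show "\<gamma> e e \<otimes> delta1 \<phi> e e = e" using r by (simp add: Z_iv_cancel)
  qed
  ultimately show ?thesis using p by blast
qed

end

section \<open>Twisted multiplications\<close>

text \<open>The coefficient of \<open>s u v\<close> as a multiple of \<open>u v\<close>. It stands
  outside the locale because isomorphisms compare two multiplications at once.\<close>

definition twist_factor :: "('u, 'k) monoid_scheme \<Rightarrow> ('u \<Rightarrow> 'u \<Rightarrow> 'u) \<Rightarrow> 'u \<Rightarrow> 'u \<Rightarrow> 'u" where
  "twist_factor U s u v = s u v \<otimes>\<^bsub>U\<^esub> sg_inv U (u \<otimes>\<^bsub>U\<^esub> v)"

locale twisted = graded U G j
  for U :: "('u, 'k) monoid_scheme" (structure) and G :: "('g, 'n) monoid_scheme" and j :: "'u \<Rightarrow> 'g" +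
  fixes star :: "'u \<Rightarrow> 'u \<Rightarrow> 'u" (infixl "\<star>" 70)
  assumes inverse_star: "inverse_semigroup (U\<lparr>mult := (\<star>)\<rparr>)"
    and star_N: "\<lbrakk>a \<in> N; u \<in> carrier U\<rbrakk> \<Longrightarrow> a \<star> u = a \<otimes> u" "\<lbrakk>a \<in> N; u \<in> carrier U\<rbrakk> \<Longrightarrow> u \<star> a = u \<otimes> a"
    and star_j: "\<lbrakk>u \<in> carrier U; v \<in> carrier U\<rbrakk> \<Longrightarrow> j (u \<star> v) = j u \<otimes>\<^bsub>G\<^esub> j v"
begin

lemma star_closed: "\<lbrakk>u \<in> carrier U; v \<in> carrier U\<rbrakk> \<Longrightarrow> u \<star> v \<in> carrier U"
  using inverse_semigroup.m_closed[OF inverse_star] by simp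

lemma star_E: "idempotents (U\<lparr>mult := (\<star>)\<rparr>) = E"
proof (intro equalityI subsetI)
  fix e assume "e \<in> idempotents (U\<lparr>mult := (\<star>)\<rparr>)"
  then have e: "e \<in> carrier U" "e \<star> e = e"
    by (simp_all add: idempotents_def[of "U\<lparr>mult := (\<star>)\<rparr>"])
  then have "j e \<otimes>\<^bsub>G\<^esub> j e = j e" using star_j[of e e] by simp
  then have "e \<in> N" using e by (intro N_I) simp_all
  then show "e \<in> E" using e star_N[of e e] by (intro E_of_idem) simp_all
next
  fix e assume "e \<in> E"
  then show "e \<in> idempotents (U\<lparr>mult := (\<star>)\<rparr>)"
    using star_N[of e e] by (simp add: idempotents_def[of "U\<lparr>mult := (\<star>)\<rparr>"] E_idem)
qed

lemma star_kernel: "kernel (U\<lparr>mult := (\<star>)\<rparr>) G j = N"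
  unfolding kernel_def by simp

text \<open>Carrier, \<open>E\<close> and \<open>N\<close> are common to both multiplications and
  are identified by the rewrites. Inverses differ in general, so range idempotents and conjugation
  have to be compared separately.\<close>

sublocale T: graded "U\<lparr>mult := (\<star>)\<rparr>" G j
  rewrites "carrier (U\<lparr>mult := (\<star>)\<rparr>) = carrier U" and "mult (U\<lparr>mult := (\<star>)\<rparr>) = (\<star>)"
    and "idempotents (U\<lparr>mult := (\<star>)\<rparr>) = E" and "kernel (U\<lparr>mult := (\<star>)\<rparr>) G j = N"
proof -
  interpret S: inverse_semigroup "U\<lparr>mult := (\<star>)\<rparr>" by (rule inverse_star)
  show "graded (U\<lparr>mult := (\<star>)\<rparr>) G j"
  proof
    show "j \<in> hom (U\<lparr>mult := (\<star>)\<rparr>) G" by (auto simp: hom_def star_j)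
    show "e \<otimes>\<^bsub>U\<lparr>mult := (\<star>)\<rparr>\<^esub> a = a \<otimes>\<^bsub>U\<lparr>mult := (\<star>)\<rparr>\<^esub> e"
      if "e \<in> idempotents (U\<lparr>mult := (\<star>)\<rparr>)" "a \<in> kernel (U\<lparr>mult := (\<star>)\<rparr>) G j" for e a
      using that ker_comm by (simp add: star_N star_E star_kernel)
  qed
qed (simp_all add: star_E star_kernel)

text \<open>Either idempotent fixes \<open>u\<close> from the left, and left multiplication by
  idempotents is the same in both structures; so each lies below the other.\<close>

lemma star_rr: assumes u: "u \<in> carrier U" shows "T.rr u = rr u"
proof -
  let ?p = "T.rr u"
  have p: "?p \<in> E" using u by (rule T.rr_E)
  have "?p \<otimes> u = u" using T.rr_mult_self(1)[OF u] star_N p u by simp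
  then have 1: "?p \<otimes> rr u = rr u" using p u rr_E_mult[of ?p u] by simp
  have "rr u \<star> u = u" using u by (simp add: star_N)
  then have "rr u \<star> ?p = ?p" using T.rr_E_mult[of "rr u" u] u by simp
  then have "rr u \<otimes> ?p = ?p" using star_N u p by simp
  then show ?thesis using 1 idempotent_comm[OF p rr_E[OF u]] by simp
qed

text \<open>Both conjugates solve \<open>x u = u a\<close> with \<open>x\<close> below
  \<open>rr u\<close>. The equation involves the bimodule structure only, and its solution is
  unique.\<close>

lemma star_cj: assumes u: "u \<in> carrier U" and a: "a \<in> N" shows "T.cj u a = cj u a"
proof -
  have x: "T.cj u a \<in> N" using u a by (rule T.N_cj)
  have "T.cj u a \<otimes> u = u \<otimes> a" using T.mult_swap[OF u a] x u a by (simp add: star_N)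
  also have "\<dots> = cj u a \<otimes> u" by (rule mult_swap[OF u a])
  finally have 1: "T.cj u a \<otimes> u = cj u a \<otimes> u" .
  have "T.rr u \<star> T.cj u a = T.cj u a" using u a by (simp add: conjugate_def T.m_assoc T.m_closed)
  then have "T.cj u a = T.cj u a \<otimes> rr u" using u x ker_comm[of "rr u"] by (simp add: star_rr star_N)
  also have "\<dots> = (cj u a \<otimes> u) \<otimes> iv u" using u x by (simp add: rng_def flip: m_assoc 1)
  also have "\<dots> = cj u a \<otimes> rr u" using u a by (simp add: m_assoc rng_def)
  also have "\<dots> = rr u \<otimes> cj u a" using u a ker_comm[of "rr u" "cj u a"] by simp
  also have "\<dots> = cj u a" using u a by (simp add: conjugate_def m_assoc m_closed)
  finally show ?thesis .
qed

abbreviation factor_set where "factor_set \<equiv> twist_factor U (\<star>)"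

lemma star_rr_mult: assumes u: "u \<in> carrier U" "v \<in> carrier U" shows "rr (u \<star> v) = rr (u \<otimes> v)"
proof -
  have "rr (u \<star> v) = T.cj u (rr v)" using T.rr_mult[OF u] u by (simp add: star_rr star_closed)
  then show ?thesis using u by (simp add: star_cj rr_mult)
qed

lemma factor_set_props: assumes u: "u \<in> carrier U" "v \<in> carrier U"
  shows "u \<star> v = factor_set u v \<otimes> (u \<otimes> v)" "factor_set u v \<in> N" "rr (factor_set u v) = rr (u \<otimes> v)"
  using factor[of "u \<star> v" "u \<otimes> v"] u by (simp_all add: star_rr_mult star_j star_closed m_closed twist_factor_def)

text \<open>Conjugation by \<open>u \<star> v\<close> and by \<open>u \<otimes> v\<close> are both
  the conjugation by \<open>v\<close> followed by that by \<open>u\<close>. Their quotient therefore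
  acts trivially below its idempotent, and \<open>Z_of_cj\<close> applies.\<close>

lemma factor_set_Z: assumes u: "u \<in> carrier U" "v \<in> carrier U" shows "factor_set u v \<in> Z"
proof (rule Z_of_cj)
  note f = factor_set_props[OF u]
  show "factor_set u v \<in> N" by (rule f)
  fix b assume b: "b \<in> N"
  let ?w = "u \<otimes> v"
  have w: "?w \<in> carrier U" using u by (simp add: m_closed)
  define a where "a = cj (iv ?w) b"
  have a: "a \<in> N" using b w by (simp add: a_def)
  have "cj ?w a = cj (?w \<otimes> iv ?w) b" unfolding a_def using w b by (subst cj_mult) simp_all
  also have "\<dots> = (b \<otimes> rr ?w) \<otimes> rr ?w" using w b ker_comm[of "rr ?w" b] by (simp add: conjugate_def flip: rng_def)
  also have "\<dots> = b \<otimes> rr (factor_set u v)" using w b by (simp add: f m_assoc E_idem)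
  finally have ba: "b \<otimes> rr (factor_set u v) = cj ?w a" by simp
  have "cj (factor_set u v) (cj ?w a) = cj (u \<star> v) a" unfolding f(1) using w f a by (subst cj_mult) simp_all
  also have "\<dots> = T.cj (u \<star> v) a" using u a by (simp add: star_cj star_closed)
  also have "\<dots> = cj ?w a" using u a by (simp add: T.cj_mult star_cj cj_mult)
  finally show "cj (factor_set u v) (b \<otimes> rr (factor_set u v)) = b \<otimes> rr (factor_set u v)"
    unfolding ba .
qed

text \<open>Associativity with one argument in \<open>N\<close> is enough: \<open>a\<close> can be
  pulled out of the left argument at once, and out of the right one after it has been conjugated
  past \<open>u\<close>.\<close>

lemma factor_set_cochain2: "cochain2 factor_set"
proof (rule cochain2I)
  fix a u v assume a: "a \<in> N" and u: "u \<in> carrier U" "v \<in> carrier U"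
  let ?w = "u \<otimes> v"
  have w: "?w \<in> carrier U" using u by (simp add: m_closed)
  note f = factor_set_props[OF u]
  have key: "(b \<otimes> (u \<star> v)) \<otimes> iv (b \<otimes> ?w) = rr b \<otimes> factor_set u v" if b: "b \<in> N" for b
  proof -
    have "(b \<otimes> (u \<star> v)) \<otimes> iv (b \<otimes> ?w) = cj b (factor_set u v)"
      using b u w by (simp add: twist_factor_def conjugate_def iv_mult m_assoc m_closed star_closed)
    then show ?thesis using b factor_set_Z[OF u] by (simp add: cj_N_Z Z_mult_comm)
  qed
  have "a \<otimes> u \<star> v = (a \<star> u) \<star> v" using a u by (simp add: star_N)
  also have "\<dots> = a \<otimes> (u \<star> v)" using a u T.m_assoc[of a u v] by (simp add: star_N star_closed)
  finally show "factor_set (a \<otimes> u) v = rr a \<otimes> factor_set u v"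
    using key[OF a] a u by (simp add: twist_factor_def m_assoc)
  let ?c = "cj u a"
  have c: "?c \<in> N" using a u by simp
  have "u \<star> (a \<otimes> v) = (u \<star> a) \<star> v" using a u T.m_assoc[of u a v] by (simp add: star_N)
  also have "u \<star> a = ?c \<star> u" using a u c by (simp add: star_N mult_swap)
  also have "?c \<star> u \<star> v = ?c \<otimes> (u \<star> v)" using c u T.m_assoc[of ?c u v] by (simp add: star_N star_closed)
  finally have s: "u \<star> (a \<otimes> v) = ?c \<otimes> (u \<star> v)" .
  have t: "u \<otimes> (a \<otimes> v) = ?c \<otimes> ?w" using a u by (simp add: mult_swap flip: m_assoc)
  have "factor_set u (a \<otimes> v) = rr ?c \<otimes> factor_set u v"
    unfolding twist_factor_def[of _ _ u "a \<otimes> v"] s t by (rule key[OF c])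
  also have "\<dots> = rr (?c \<otimes> ?w) \<otimes> factor_set u v"
    using c w f rr_mult_self(1)[of "factor_set u v"] by (simp add: rr_N_mult m_assoc)
  finally show "factor_set u (a \<otimes> v) = rr (u \<otimes> (a \<otimes> v)) \<otimes> factor_set u v" unfolding t .
qed (simp_all add: factor_set_Z factor_set_props)

lemma factor_set_normalized: "normalized factor_set"
  by (simp add: normalized_def twist_factor_def star_N rng_def)

text \<open>The two bracketings of a triple product are compared as multiples of the old triple
  product.\<close>

lemma factor_set_cocycle2: "cocycle2 factor_set"
  unfolding cocycle2_def
proof (intro conjI ballI)
  show "cochain2 factor_set" by (rule factor_set_cochain2)
  note D = cochain2D[OF factor_set_cochain2]
  fix u v w assume u: "u \<in> carrier U" "v \<in> carrier U" "w \<in> carrier U"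
  have c: "u \<star> v \<in> carrier U" "v \<star> w \<in> carrier U" "u \<otimes> v \<in> carrier U" "v \<otimes> w \<in> carrier U"
    using u by (simp_all add: star_closed m_closed)
  show "cj u (factor_set v w) \<otimes> factor_set u (v \<otimes> w) = factor_set (u \<otimes> v) w \<otimes> factor_set u v"
  proof (rule cancel_right)
    let ?x = "u \<otimes> (v \<otimes> w)"
    have "u \<star> (v \<star> w) = factor_set u (v \<star> w) \<otimes> (u \<otimes> (v \<star> w))" using u c by (simp add: factor_set_props)
    \<comment> \<open>The new and the old product of \<open>v\<close> and \<open>w\<close> have
      equal degree and idempotent, which is all that a cochain sees.\<close>
    also have "factor_set u (v \<star> w) = factor_set u (v \<otimes> w)"
      by (rule D(4)) (use u c in \<open>simp_all add: star_j star_rr_mult rr_mult[of u]\<close>)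
    also have "u \<otimes> (v \<star> w) = (u \<otimes> factor_set v w) \<otimes> (v \<otimes> w)"
      using u D(1)[of v w] by (simp add: factor_set_props(1) m_assoc m_closed)
    also have "\<dots> = cj u (factor_set v w) \<otimes> ?x"
      using u c D(1)[of v w] by (simp add: mult_swap m_assoc)
    also have "factor_set u (v \<otimes> w) \<otimes> (cj u (factor_set v w) \<otimes> ?x)
      = (cj u (factor_set v w) \<otimes> factor_set u (v \<otimes> w)) \<otimes> ?x"
      using u c D(1) by (simp add: Z_left_comm m_assoc m_closed)
    finally have 1: "u \<star> (v \<star> w) = (cj u (factor_set v w) \<otimes> factor_set u (v \<otimes> w)) \<otimes> ?x" .
    have "(u \<star> v) \<star> w = factor_set (u \<star> v) w \<otimes> ((u \<star> v) \<otimes> w)" using u c by (simp add: factor_set_props)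
    also have "factor_set (u \<star> v) w = factor_set (u \<otimes> v) w"
      by (rule D(4)) (use u c in \<open>simp_all add: star_j star_rr_mult, metis rr_match_mult star_j star_rr_mult j_mult\<close>)
    also have "(u \<star> v) \<otimes> w = factor_set u v \<otimes> ?x" using u c D(1)[of u v] by (simp add: factor_set_props(1) m_assoc)
    finally have 2: "(u \<star> v) \<star> w = (factor_set (u \<otimes> v) w \<otimes> factor_set u v) \<otimes> ?x"
      using u c D(1) by (simp add: m_assoc m_closed)
    show "cj u (factor_set v w) \<otimes> factor_set u (v \<otimes> w) \<otimes> ?x = factor_set (u \<otimes> v) w \<otimes> factor_set u v \<otimes> ?x"
      using 1 2 u by (simp add: T.m_assoc)
    show "rr (cj u (factor_set v w) \<otimes> factor_set u (v \<otimes> w)) = rr ?x"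
      using u c D(1,2) by (simp add: rr_Z rr_cj rr_mult[of u] E_idem)
    show "rr (factor_set (u \<otimes> v) w \<otimes> factor_set u v) = rr ?x"
      using u c D(1,2) rr_mult_le[of "u \<otimes> v" w] idempotent_comm[of "rr (u \<otimes> v \<otimes> w)" "rr (u \<otimes> v)"]
      by (simp add: rr_Z m_assoc m_closed)
    show "?x \<in> carrier U" using u by (simp add: m_closed)
  qed (use u c D(1) in simp_all)
qed

end

section \<open>Twisting by a normalized cocycle, and isomorphisms between twists\<close>

context graded
begin

abbreviation twist where "twist \<gamma> \<equiv> \<lambda>u v. \<gamma> u v \<otimes> (u \<otimes> v)"

text \<open>Normalization makes the new product agree with the old one as soon as one argument lies
  in \<open>N\<close>; hence the idempotents are the old ones and commute. Associativity is the
  cocycle identity.\<close>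

lemma twisted_twist: assumes c: "cocycle2 \<gamma>" and n: "normalized \<gamma>" shows "twisted U G j (twist \<gamma>)"
proof -
  let ?s = "twist \<gamma>" and ?V = "U\<lparr>mult := twist \<gamma>\<rparr>"
  have c2: "cochain2 \<gamma>" using c by (simp add: cocycle2_def)
  note D = cochain2D(1,2)[OF c2]
  have sN: "?s a u = a \<otimes> u" "?s u a = u \<otimes> a" if "a \<in> N" "u \<in> carrier U" for a u
    using n that by (simp_all add: normalized_def m_closed)
  have cl: "?s u v \<in> carrier U" if "u \<in> carrier U" "v \<in> carrier U" for u v
    using that D by (simp add: m_closed)
  have sj: "j (?s u v) = j u \<otimes>\<^bsub>G\<^esub> j v" if "u \<in> carrier U" "v \<in> carrier U" for u v
    using that D by (simp add: m_closed)
  have srr: "rr (?s u v) = rr (u \<otimes> v)" if "u \<in> carrier U" "v \<in> carrier U" for u v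
    using that D by (simp add: m_closed rr_N_mult E_idem)
  have assoc: "?s (?s u v) w = ?s u (?s v w)" if u: "u \<in> carrier U" "v \<in> carrier U" "w \<in> carrier U" for u v w
  proof -
    let ?x = "u \<otimes> (v \<otimes> w)"
    have m: "u \<otimes> v \<in> carrier U" "v \<otimes> w \<in> carrier U" "?x \<in> carrier U" using u by (simp_all add: m_closed)
    have 1: "\<gamma> u (?s v w) = \<gamma> u (v \<otimes> w)"
      by (rule cochain2D(4)[OF c2]) (use u m cl sj in \<open>simp_all add: rr_mult[of u] srr\<close>)
    have 2: "\<gamma> (?s u v) w = \<gamma> (u \<otimes> v) w"
      by (rule cochain2D(4)[OF c2]) (use u m cl sj rr_match_mult[of "?s u v" w "u \<otimes> v" w] in \<open>simp_all add: srr\<close>)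
    have "?s u (?s v w) = \<gamma> u (v \<otimes> w) \<otimes> ((u \<otimes> \<gamma> v w) \<otimes> (v \<otimes> w))"
      unfolding 1 using u m D by (simp add: m_assoc)
    also have "\<dots> = (cj u (\<gamma> v w) \<otimes> \<gamma> u (v \<otimes> w)) \<otimes> ?x"
      using u m D by (simp add: mult_swap[of u "\<gamma> v w"] m_assoc Z_left_comm)
    also have "cj u (\<gamma> v w) \<otimes> \<gamma> u (v \<otimes> w) = \<gamma> (u \<otimes> v) w \<otimes> \<gamma> u v"
      using c u by (simp add: cocycle2_def)
    finally show ?thesis unfolding 2 using u m D by (simp add: m_assoc)
  qed
  have idem: "e \<in> E" if "e \<in> idempotents ?V" for e
  proof -
    from that have e: "e \<in> carrier U" "?s e e = e" by (simp_all add: idempotents_def[of ?V])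
    have "j e \<otimes>\<^bsub>G\<^esub> j e = j e" using e(1) sj[of e e] unfolding e(2) by simp
    then have "e \<in> N" using e(1) by (intro N_I) simp_all
    moreover have "e \<otimes> e = e" using sN(1)[of e e] \<open>e \<in> N\<close> unfolding e(2) by simp
    ultimately show "e \<in> E" by (intro E_of_idem)
  qed
  have inv: "inverse_semigroup ?V"
  proof (rule inverse_semigroupI)
    fix u assume "u \<in> carrier ?V"
    then have u: "u \<in> carrier U" by simp
    \<comment> \<open>The old inverse, corrected so that the new product of \<open>u\<close> and
      \<open>y\<close> becomes \<open>rr u\<close>.\<close>
    define y where "y = iv u \<otimes> iv (\<gamma> u (iv u))"
    have g: "\<gamma> u (iv u) \<in> Z" "rr (\<gamma> u (iv u)) = rr u" using u D[of u "iv u"] by (simp_all flip: rng_def)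
    have y: "y \<in> carrier U" "j y = j (iv u)" "rr y = rr (iv u)"
      using u g by (simp_all add: y_def m_closed rr_mult)
    have "\<gamma> u y = \<gamma> u (iv u)"
      by (rule cochain2D(4)[OF c2]) (use u y in \<open>simp_all add: rr_mult[of u]\<close>)
    then have "?s u y = \<gamma> u (iv u) \<otimes> (rr u \<otimes> iv (\<gamma> u (iv u)))"
      using u g by (simp add: y_def rng_def m_assoc)
    also have "\<dots> = rr u" using u g by (simp add: Z_left_comm[of _ "rr u"] Z_iv_cancel E_idem)
    finally have uy: "?s u y = rr u" .
    have "?s (rr u) u = rr u \<otimes> u" by (rule sN(1)) (use u in simp_all)
    then have "?s (rr u) u = u" using u by simp
    moreover have "?s y (rr u) = y"
    proof -
      have "iv (\<gamma> u (iv u)) \<otimes> rr u = iv (\<gamma> u (iv u))" using g Z_rr[of "iv (\<gamma> u (iv u))"] by simp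
      then have "y \<otimes> rr u = y" using u g by (simp add: y_def m_assoc)
      moreover have "?s y (rr u) = y \<otimes> rr u" by (rule sN(2)) (use u y in simp_all)
      ultimately show ?thesis by simp
    qed
    ultimately have "?s (?s u y) u = u" "?s (?s y u) y = y"
      unfolding assoc[OF y(1) u y(1)] uy by simp_all
    then show "\<exists>y\<in>carrier ?V. u \<otimes>\<^bsub>?V\<^esub> y \<otimes>\<^bsub>?V\<^esub> u = u \<and> y \<otimes>\<^bsub>?V\<^esub> u \<otimes>\<^bsub>?V\<^esub> y = y" using y by auto
  next
    fix e f assume "e \<in> idempotents ?V" "f \<in> idempotents ?V"
    then have "e \<in> E" "f \<in> E" by (auto dest: idem)
    then show "e \<otimes>\<^bsub>?V\<^esub> f = f \<otimes>\<^bsub>?V\<^esub> e" using sN(1)[of e f] sN(1)[of f e] idempotent_comm[of e f] by simp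
  qed (use cl assoc in simp_all)
  show ?thesis
  proof (intro twisted.intro graded_axioms twisted_axioms.intro)
    show "inverse_semigroup ?V" by (rule inv)
    show "?s a u = a \<otimes> u" "?s u a = u \<otimes> a" if "a \<in> N" "u \<in> carrier U" for a u
      by (rule sN[OF that])+
    show "j (?s u v) = j u \<otimes>\<^bsub>G\<^esub> j v" if "u \<in> carrier U" "v \<in> carrier U" for u v
      by (rule sj[OF that])
  qed
qed

lemma factor_set_twist:
  assumes "cocycle2 \<gamma>" "u \<in> carrier U" "v \<in> carrier U"
  shows "twist_factor U (twist \<gamma>) u v = \<gamma> u v"
proof -
  have t: "\<gamma> u v \<in> Z" "rr (\<gamma> u v) = rr (u \<otimes> v)" using assms cochain2D(1,2)[of \<gamma> u v] by (simp_all add: cocycle2_def)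
  have "\<gamma> u v \<otimes> (u \<otimes> v) \<otimes> iv (u \<otimes> v) = \<gamma> u v \<otimes> rr (u \<otimes> v)" using assms t by (simp add: rng_def m_assoc m_closed)
  also have "\<dots> = \<gamma> u v" unfolding t(2)[symmetric] using t(1) by simp
  finally show ?thesis by (simp add: twist_factor_def)
qed

text \<open>An isomorphism over \<open>N\<close> and \<open>G\<close> preserves degree and range
  idempotent, so it multiplies each \<open>u\<close> by some \<open>\<phi> u\<close> in
  \<open>N\<close>; it respects conjugation as well, which makes \<open>\<phi> u\<close> central.
  Multiplicativity then compares two coefficients of \<open>u v\<close>.\<close>

lemma twisted_iso_iff:
  assumes "twisted U G j s" "twisted U G j t"
  shows "(\<exists>\<mu>\<in>iso (U\<lparr>mult := s\<rparr>) (U\<lparr>mult := t\<rparr>). (\<forall>a\<in>N. \<mu> a = a) \<and> (\<forall>u\<in>carrier U. j (\<mu> u) = j u))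
    \<longleftrightarrow> (\<exists>\<phi>. cochain1 \<phi> \<and> (\<forall>u\<in>carrier U. \<forall>v\<in>carrier U.
          twist_factor U s u v = twist_factor U t u v \<otimes> delta1 \<phi> u v))" (is "?L \<longleftrightarrow> ?R")
proof -
  interpret S: twisted U G j s by fact
  interpret T: twisted U G j t by fact
  note SD = cochain2D(1,2)[OF S.factor_set_cochain2]
  note TD = cochain2D(1,2)[OF T.factor_set_cochain2]
  \<comment> \<open>Proved for an arbitrary cochain so as to serve in both directions. Both sides of
    the second equation are multiples of \<open>u v\<close>, with coefficients \<open>?X\<close> and
    \<open>?Y\<close>.\<close>
  have key: "S.factor_set u v = T.factor_set u v \<otimes> delta1 \<phi> u v \<longleftrightarrow>
      \<phi> (s u v) \<otimes> s u v = t (\<phi> u \<otimes> u) (\<phi> v \<otimes> v)"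
    if p: "cochain1 \<phi>" and u: "u \<in> carrier U" "v \<in> carrier U" for \<phi> u v
  proof -
    note D = cochain1D(1,2)[OF p]
    have c: "u \<otimes> v \<in> carrier U" "s u v \<in> carrier U" "\<phi> u \<otimes> u \<in> carrier U" "\<phi> v \<otimes> v \<in> carrier U"
      using u D S.star_closed by (simp_all add: m_closed)
    let ?x = "u \<otimes> v"
    let ?X = "\<phi> ?x \<otimes> S.factor_set u v" and ?Y = "T.factor_set u v \<otimes> (\<phi> u \<otimes> cj u (\<phi> v))"
    have 1: "\<phi> (s u v) = \<phi> ?x"
      by (rule cochain1D(4)[OF p]) (use u c in \<open>simp_all add: S.star_j S.star_rr_mult\<close>)
    have r1: "rr (\<phi> u \<otimes> u) = rr u" "rr (\<phi> v \<otimes> v) = rr v" using u D by (simp_all add: rr_N_mult E_idem)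
    have 2: "T.factor_set (\<phi> u \<otimes> u) (\<phi> v \<otimes> v) = T.factor_set u v"
      by (rule cochain2D(4)[OF T.factor_set_cochain2])
        (use u c D r1 rr_match_mult[of "\<phi> u \<otimes> u" "\<phi> v \<otimes> v" u v] in simp_all)
    have "\<phi> (s u v) \<otimes> s u v = ?X \<otimes> ?x"
      unfolding 1 using S.factor_set_props(1)[OF u] u c D SD by (simp add: m_assoc)
    moreover have "t (\<phi> u \<otimes> u) (\<phi> v \<otimes> v) = T.factor_set u v \<otimes> (\<phi> u \<otimes> ((u \<otimes> \<phi> v) \<otimes> v))"
      unfolding T.factor_set_props(1)[OF c(3,4)] 2 using u D TD by (simp add: m_assoc m_closed)
    moreover have "\<dots> = ?Y \<otimes> ?x" using u c D TD by (simp add: m_assoc mult_swap[of u "\<phi> v"])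
    moreover have Z: "?X \<in> Z" "?Y \<in> Z" using u c D SD TD by simp_all
    moreover have "rr ?X = rr ?x" using u c D SD by (simp add: rr_Z E_idem)
    moreover have "rr ?Y = rr ?x" using u c D TD rr_mult_le[OF u]
      by (simp add: rr_Z E_idem rr_cj rr_mult[of u v] m_assoc)
    ultimately have eq: "\<phi> (s u v) \<otimes> s u v = t (\<phi> u \<otimes> u) (\<phi> v \<otimes> v) \<longleftrightarrow> ?X = ?Y"
      using cancel_right[of ?X ?Y ?x] c by auto
    have rS: "rr (\<phi> ?x) \<otimes> S.factor_set u v = S.factor_set u v"
      using u c D SD rr_mult_self(1)[of "S.factor_set u v"] by simp
    have rY: "rr (\<phi> ?x) \<otimes> ?Y = ?Y" using c D \<open>rr ?Y = rr ?x\<close> Z rr_mult_self(1)[of ?Y] by simp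
    have d: "T.factor_set u v \<otimes> delta1 \<phi> u v = iv (\<phi> ?x) \<otimes> ?Y"
      using u c D TD by (simp add: delta1_def Z_ac)
    show ?thesis unfolding eq d
    proof
      assume "S.factor_set u v = iv (\<phi> ?x) \<otimes> ?Y"
      then have "?X = \<phi> ?x \<otimes> (iv (\<phi> ?x) \<otimes> ?Y)" by simp
      also have "\<dots> = ?Y" using c D Z rY Z_iv_cancel(1)[of "\<phi> ?x" ?Y] by simp
      finally show "?X = ?Y" .
    next
      assume "?X = ?Y"
      then have "iv (\<phi> ?x) \<otimes> ?Y = iv (\<phi> ?x) \<otimes> ?X" by simp
      also have "\<dots> = S.factor_set u v" using u c D SD rS Z_iv_cancel(1)[of "\<phi> ?x" "S.factor_set u v"]
        by (simp add: Z_left_comm[of "iv (\<phi> ?x)"])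
      finally show "S.factor_set u v = iv (\<phi> ?x) \<otimes> ?Y" by simp
    qed
  qed
  show ?thesis
  proof
    assume ?L
    then obtain \<mu> where iso: "\<mu> \<in> iso (U\<lparr>mult := s\<rparr>) (U\<lparr>mult := t\<rparr>)" and \<mu>N: "\<And>a. a \<in> N \<Longrightarrow> \<mu> a = a"
      and \<mu>j: "\<And>u. u \<in> carrier U \<Longrightarrow> j (\<mu> u) = j u" by blast
    have \<mu>c: "\<mu> u \<in> carrier U" if "u \<in> carrier U" for u using iso that by (auto simp: iso_def hom_def)
    have \<mu>m: "\<mu> (s u v) = t (\<mu> u) (\<mu> v)" if "u \<in> carrier U" "v \<in> carrier U" for u v
      using iso that by (auto simp: iso_def hom_def)
    have \<mu>iv: "T.T.iv (\<mu> u) = \<mu> (S.T.iv u)" if "u \<in> carrier U" for u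
      using iso_transport(2)[OF S.inverse_star iso, of u] that by simp
    have \<mu>rr: "rr (\<mu> u) = rr u" if u: "u \<in> carrier U" for u
    proof -
      have "rr (\<mu> u) = \<mu> (S.T.rr u)"
        using u \<mu>m[of u "S.T.iv u"] S.T.iv_closed[OF u] T.star_rr[OF \<mu>c[OF u]] \<mu>iv[OF u]
        by (simp add: rng_def[of "U\<lparr>mult := t\<rparr>"] rng_def[of "U\<lparr>mult := s\<rparr>"])
      then show ?thesis using u by (simp add: S.star_rr \<mu>N)
    qed
    define \<phi> where "\<phi> u = \<mu> u \<otimes> iv u" for u
    have f: "\<mu> u = \<phi> u \<otimes> u" "\<phi> u \<in> N" "rr (\<phi> u) = rr u" if "u \<in> carrier U" for u
      using factor[of "\<mu> u" u] that by (simp_all add: \<phi>_def \<mu>c \<mu>j \<mu>rr)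
    have \<mu>l: "\<mu> (a \<otimes> u) = a \<otimes> \<mu> u" if "a \<in> N" "u \<in> carrier U" for a u
      using \<mu>m[of a u] that by (simp add: S.star_N T.star_N \<mu>N \<mu>c)
    have \<phi>Z: "\<phi> u \<in> Z" if u: "u \<in> carrier U" for u
    proof (rule Z_of_cj)
      show "\<phi> u \<in> N" using f u by simp
      fix b assume b: "b \<in> N"
      define a where "a = cj (iv u) b"
      have a: "a \<in> N" using b u by (simp add: a_def)
      have "cj u a = cj (u \<otimes> iv u) b" unfolding a_def using u b by (subst cj_mult) simp_all
      also have "\<dots> = (b \<otimes> rr u) \<otimes> rr u" using u b ker_comm[of "rr u" b] by (simp add: conjugate_def flip: rng_def)
      also have "\<dots> = b \<otimes> rr (\<phi> u)" using u b by (simp add: f m_assoc E_idem)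
      finally have ba: "b \<otimes> rr (\<phi> u) = cj u a" by simp
      have "cj (\<phi> u) (cj u a) = T.T.cj (\<mu> u) a"
        using u a f \<mu>c by (simp add: T.star_cj flip: cj_mult f(1))
      also have "\<dots> = \<mu> (S.T.cj u a)"
        using u a \<mu>c \<mu>m \<mu>N \<mu>iv S.star_closed S.T.iv_closed
        by (simp add: conjugate_def[of "U\<lparr>mult := t\<rparr>"] conjugate_def[of "U\<lparr>mult := s\<rparr>"])
      also have "\<dots> = cj u a" using u a by (simp add: S.star_cj \<mu>N)
      finally show "cj (\<phi> u) (b \<otimes> rr (\<phi> u)) = b \<otimes> rr (\<phi> u)" unfolding ba .
    qed
    have p: "cochain1 \<phi>"
    proof (rule cochain1I)
      fix a u assume a: "a \<in> N" and u: "u \<in> carrier U"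
      have "\<phi> (a \<otimes> u) = cj a (\<phi> u)" using a u \<mu>c by (simp add: \<phi>_def \<mu>l conjugate_def iv_mult m_assoc m_closed)
      then show "\<phi> (a \<otimes> u) = rr a \<otimes> \<phi> u" using a u \<phi>Z by (simp add: cj_N_Z Z_mult_comm)
    qed (use f \<phi>Z in simp_all)
    have "S.factor_set u v = T.factor_set u v \<otimes> delta1 \<phi> u v" if u: "u \<in> carrier U" "v \<in> carrier U" for u v
      unfolding key[OF p u] using u S.star_closed \<mu>m by (simp flip: f(1))
    then show ?R using p by blast
  next
    assume ?R
    then obtain \<phi> where p: "cochain1 \<phi>" and eq: "\<And>u v. \<lbrakk>u \<in> carrier U; v \<in> carrier U\<rbrakk>
      \<Longrightarrow> S.factor_set u v = T.factor_set u v \<otimes> delta1 \<phi> u v" by blast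
    note D = cochain1D(1,2)[OF p]
    define \<mu> where "\<mu> u = \<phi> u \<otimes> u" for u
    have \<mu>c: "\<mu> u \<in> carrier U" and \<mu>j: "j (\<mu> u) = j u" and \<mu>rr: "rr (\<mu> u) = rr u" if "u \<in> carrier U" for u
      using that D by (simp_all add: \<mu>_def m_closed rr_N_mult E_idem)
    have \<mu>m: "\<mu> (s u v) = t (\<mu> u) (\<mu> v)" if "u \<in> carrier U" "v \<in> carrier U" for u v
      using key[OF p that] eq[OF that] by (simp add: \<mu>_def)
    \<comment> \<open>\<open>\<phi>\<close> has the same value at \<open>u\<close> and at its
      multiple by \<open>\<phi> u\<close>, so multiplication by the inverse value undoes
      \<open>\<mu>\<close>.\<close>
    have bij: "bij_betw \<mu> (carrier U) (carrier U)"
    proof (rule bij_betw_byWitness[where f' = "\<lambda>u. iv (\<phi> u) \<otimes> u"])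
      show "\<forall>u\<in>carrier U. iv (\<phi> (\<mu> u)) \<otimes> \<mu> u = u"
      proof
        fix u assume u: "u \<in> carrier U"
        have "\<phi> (\<mu> u) = \<phi> u" by (rule cochain1D(4)[OF p]) (use u \<mu>c \<mu>j \<mu>rr in simp_all)
        then show "iv (\<phi> (\<mu> u)) \<otimes> \<mu> u = u"
          using u D Z_iv_cancel(1)[of "iv (\<phi> u)" u] by (simp add: \<mu>_def)
      qed
      show "\<forall>u\<in>carrier U. \<mu> (iv (\<phi> u) \<otimes> u) = u"
      proof
        fix u assume u: "u \<in> carrier U"
        have "\<phi> (iv (\<phi> u) \<otimes> u) = \<phi> u"
          by (rule cochain1D(4)[OF p]) (use u D in \<open>simp_all add: m_closed rr_N_mult E_idem\<close>)
        then show "\<mu> (iv (\<phi> u) \<otimes> u) = u" using u D Z_iv_cancel(1)[of "\<phi> u" u] by (simp add: \<mu>_def)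
      qed
    qed (use \<mu>c D in \<open>auto simp: m_closed\<close>)
    have iso: "\<mu> \<in> iso (U\<lparr>mult := s\<rparr>) (U\<lparr>mult := t\<rparr>)"
      using bij \<mu>c \<mu>m by (auto simp: iso_def hom_def)
    \<comment> \<open>\<open>?R\<close> does not say that \<open>\<mu>\<close> is the identity on
      \<open>N\<close>. It follows because both factor sets have the value \<open>e\<close> at
      \<open>(e, e)\<close>, where the coboundary is \<open>\<phi> e\<close>.\<close>
    have E1: "\<phi> e = e" if e: "e \<in> E" for e
    proof -
      have pe: "\<phi> e \<in> Z" "rr (\<phi> e) = e" using D[of e] e by simp_all
      have "cj e (\<phi> e) = \<phi> e" "e \<otimes> \<phi> e = \<phi> e"
        using e pe Z_rr[of "\<phi> e"] rr_mult_self(1)[of "\<phi> e"] by (simp_all add: cj_N_Z)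
      then have "\<phi> e = delta1 \<phi> e e" using e pe by (simp add: delta1_def E_idem Z_iv_cancel)
      also have "\<dots> = e \<otimes> delta1 \<phi> e e"
        using e cochain2D(1,2)[OF delta1_cochain2[OF p], of e e] rr_mult_self(1)[of "delta1 \<phi> e e"]
        by (simp add: E_idem)
      also have "\<dots> = e" using eq[of e e] e by (simp add: twist_factor_def twist_factor_def S.star_N T.star_N E_idem)
      finally show ?thesis .
    qed
    have "\<mu> a = a" if a: "a \<in> N" for a
    proof -
      have "\<phi> a = \<phi> (rr a)" by (rule cochain1D(4)[OF p]) (use a in simp_all)
      then show ?thesis using a by (simp add: \<mu>_def E1)
    qed
    then show ?L using iso \<mu>j by blast
  qed
qed

end

section \<open>Multipliers of semilattices of groups\<close>

lemma (in inverse_semigroup) inverse_subsemigroup: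
  assumes B: "B \<subseteq> carrier S" and m: "\<And>x y. \<lbrakk>x \<in> B; y \<in> B\<rbrakk> \<Longrightarrow> x \<otimes> y \<in> B"
    and i: "\<And>x. x \<in> B \<Longrightarrow> iv x \<in> B"
  shows "inverse_semigroup (S\<lparr>carrier := B\<rparr>)" "x \<in> B \<Longrightarrow> sg_inv (S\<lparr>carrier := B\<rparr>) x = iv x"
    "x \<in> B \<Longrightarrow> rng (S\<lparr>carrier := B\<rparr>) x = rr x" "idempotents (S\<lparr>carrier := B\<rparr>) = E \<inter> B"
proof -
  show E: "idempotents (S\<lparr>carrier := B\<rparr>) = E \<inter> B"
    unfolding idempotents_def using B by auto
  show 1: "inverse_semigroup (S\<lparr>carrier := B\<rparr>)"
  proof (rule inverse_semigroupI)
    fix x assume "x \<in> carrier (S\<lparr>carrier := B\<rparr>)"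
    then have x: "x \<in> B" by simp
    then have "iv x \<in> B \<and> x \<otimes> iv x \<otimes> x = x \<and> iv x \<otimes> x \<otimes> iv x = iv x"
      using i[OF x] sg_inv_props[of x] B by auto
    then show "\<exists>y\<in>carrier (S\<lparr>carrier := B\<rparr>). x \<otimes>\<^bsub>S\<lparr>carrier := B\<rparr>\<^esub> y \<otimes>\<^bsub>S\<lparr>carrier := B\<rparr>\<^esub> x = x \<and>
        y \<otimes>\<^bsub>S\<lparr>carrier := B\<rparr>\<^esub> x \<otimes>\<^bsub>S\<lparr>carrier := B\<rparr>\<^esub> y = y" by auto
  next
    fix e f assume "e \<in> idempotents (S\<lparr>carrier := B\<rparr>)" "f \<in> idempotents (S\<lparr>carrier := B\<rparr>)"
    then show "e \<otimes>\<^bsub>S\<lparr>carrier := B\<rparr>\<^esub> f = f \<otimes>\<^bsub>S\<lparr>carrier := B\<rparr>\<^esub> e" using idempotent_comm[of e f] by (simp add: E)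
  qed (use m in simp, use subsetD[OF B] in \<open>simp add: m_assoc\<close>)
  interpret B: inverse_semigroup "S\<lparr>carrier := B\<rparr>" by fact
  show 2: "sg_inv (S\<lparr>carrier := B\<rparr>) x = iv x" if "x \<in> B" for x
    using that i[OF that] sg_inv_props[of x] B by (intro B.sg_inv_eqI) auto
  show "rng (S\<lparr>carrier := B\<rparr>) x = rr x" if "x \<in> B" for x
    using 2[OF that] by (simp add: rng_def)
qed

definition unit_group :: "unit monoid" where
  "unit_group = \<lparr>carrier = UNIV, mult = (\<lambda>_ _. ()), one = ()\<rparr>"

lemma kernel_unit_group: "kernel S unit_group (\<lambda>_. ()) = carrier S"
  by (auto simp: kernel_def)

context semilattice_of_groups
begin

lemma E_central: "\<lbrakk>e \<in> idempotents A; a \<in> carrier A\<rbrakk> \<Longrightarrow> e \<otimes> a = a \<otimes> e"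
  using idempotents_central by (auto simp: sg_center_def)

text \<open>A semilattice of groups is the kernel of its homomorphism to the trivial group.\<close>

lemma graded_unit_group: "graded A unit_group (\<lambda>_. ())"
proof -
  interpret G: group unit_group by (rule groupI) (auto simp: unit_group_def)
  show ?thesis
  proof
    show "(\<lambda>_. ()) \<in> hom A unit_group" by (simp add: hom_def unit_group_def)
    show "e \<otimes> a = a \<otimes> e" if "e \<in> E" "a \<in> kernel A unit_group (\<lambda>_. ())" for e a
      using that by (simp add: kernel_unit_group E_central)
  qed
qed

lemma rr_iv [simp]: "a \<in> carrier A \<Longrightarrow> rr (iv a) = rr a"
  using graded.N_rr_iv[OF graded_unit_group] by (simp add: kernel_unit_group)

lemma mult_rr [simp]: "a \<in> carrier A \<Longrightarrow> a \<otimes> rr a = a"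
  using graded.Z_rr[OF graded_unit_group] by (simp add: kernel_unit_group)

lemma rr_mult_distrib: "\<lbrakk>a \<in> carrier A; b \<in> carrier A\<rbrakk> \<Longrightarrow> rr (a \<otimes> b) = rr a \<otimes> rr b"
  using graded.rr_N_mult[OF graded_unit_group] by (simp add: kernel_unit_group)

lemma semilattice_of_groups_subset:
  assumes B: "B \<subseteq> carrier A" and m: "\<And>x y. \<lbrakk>x \<in> B; y \<in> B\<rbrakk> \<Longrightarrow> x \<otimes> y \<in> B"
    and i: "\<And>x. x \<in> B \<Longrightarrow> iv x \<in> B"
  shows "semilattice_of_groups (A\<lparr>carrier := B\<rparr>)"
proof -
  interpret B: inverse_semigroup "A\<lparr>carrier := B\<rparr>" by (rule inverse_subsemigroup(1)[OF assms])
  show ?thesis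
  proof
    show "idempotents (A\<lparr>carrier := B\<rparr>) \<subseteq> sg_center (A\<lparr>carrier := B\<rparr>)"
      using inverse_subsemigroup(4)[OF assms] B E_central by (auto simp: sg_center_def)
  qed
qed

text \<open>Since \<open>rr x\<close> absorbs into \<open>x\<close> and is itself a multiple of
  \<open>x\<close>, membership in an ideal can be tested on idempotents.\<close>

lemma ideal_sub: assumes I: "sg_ideal A I"
  shows "I \<subseteq> carrier A" "\<And>x y. \<lbrakk>x \<in> I; y \<in> I\<rbrakk> \<Longrightarrow> x \<otimes> y \<in> I" "\<And>x. x \<in> I \<Longrightarrow> iv x \<in> I"
    "\<And>x. x \<in> I \<Longrightarrow> rr x \<in> I" "\<And>x. \<lbrakk>x \<in> carrier A; rr x \<in> I\<rbrakk> \<Longrightarrow> x \<in> I"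
    "\<And>x y. \<lbrakk>x \<in> I; y \<in> carrier A\<rbrakk> \<Longrightarrow> x \<otimes> y \<in> I" "\<And>x y. \<lbrakk>x \<in> I; y \<in> carrier A\<rbrakk> \<Longrightarrow> y \<otimes> x \<in> I"
proof -
  show sub: "I \<subseteq> carrier A" using I by (simp add: sg_ideal_def)
  show l: "\<And>x y. \<lbrakk>x \<in> I; y \<in> carrier A\<rbrakk> \<Longrightarrow> x \<otimes> y \<in> I" and r: "\<And>x y. \<lbrakk>x \<in> I; y \<in> carrier A\<rbrakk> \<Longrightarrow> y \<otimes> x \<in> I"
    using I by (auto simp: sg_ideal_def)
  then show "\<And>x y. \<lbrakk>x \<in> I; y \<in> I\<rbrakk> \<Longrightarrow> x \<otimes> y \<in> I" using sub by blast
  show rr: "\<And>x. x \<in> I \<Longrightarrow> rr x \<in> I" using l sub by (auto simp: rng_def)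
  show "iv x \<in> I" if x: "x \<in> I" for x
    using r[OF rr[OF x], of "iv x"] x sub inverse_absorb(3)[of x] by (auto simp: rng_def)
  show "x \<in> I" if x: "x \<in> carrier A" "rr x \<in> I" for x using l[OF x(2,1)] x by simp
qed

lemma center_sub: "sg_center A \<subseteq> carrier A" "\<And>x y. \<lbrakk>x \<in> sg_center A; y \<in> sg_center A\<rbrakk> \<Longrightarrow> x \<otimes> y \<in> sg_center A"
  "\<And>x. x \<in> sg_center A \<Longrightarrow> iv x \<in> sg_center A" "\<And>x. x \<in> sg_center A \<Longrightarrow> rr x \<in> sg_center A"
proof -
  interpret C: graded A unit_group "\<lambda>_. ()" by (rule graded_unit_group)
  have C: "sg_center A = C.Z" unfolding sg_center_def C.Z_def kernel_unit_group by (rule refl)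
  show "sg_center A \<subseteq> carrier A" unfolding sg_center_def by blast
  show "x \<otimes> y \<in> sg_center A" if "x \<in> sg_center A" "y \<in> sg_center A" for x y
    using that C.Z_mult[of x y] unfolding C by blast
  show "iv x \<in> sg_center A" if "x \<in> sg_center A" for x
    using that C.Z_iv[of x] unfolding C by blast
  show "rr x \<in> sg_center A" if "x \<in> sg_center A" for x
    using that C.E_Z[of "rr x"] rr_E[of x] C.Z_closed[of x] unfolding C by blast
qed

section \<open>Unit multipliers as compatible families on the idempotents\<close>

abbreviation M where "M \<equiv> multiplier_monoid A"

lemma multiplierD: assumes m: "is_multiplier A m"
  shows "\<And>s. s \<in> carrier A \<Longrightarrow> lmul m s \<in> carrier A" "\<And>s. s \<in> carrier A \<Longrightarrow> rmul s m \<in> carrier A"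
    "\<And>s t. \<lbrakk>s \<in> carrier A; t \<in> carrier A\<rbrakk> \<Longrightarrow> lmul m (s \<otimes> t) = lmul m s \<otimes> t"
    "\<And>s t. \<lbrakk>s \<in> carrier A; t \<in> carrier A\<rbrakk> \<Longrightarrow> rmul (s \<otimes> t) m = s \<otimes> rmul t m"
    "\<And>s t. \<lbrakk>s \<in> carrier A; t \<in> carrier A\<rbrakk> \<Longrightarrow> s \<otimes> lmul m t = rmul s m \<otimes> t"
  using m by (auto simp: is_multiplier_def)

lemma multiplier_ext: assumes "is_multiplier A m" "is_multiplier A n"
    and l: "\<And>s. s \<in> carrier A \<Longrightarrow> lmul m s = lmul n s" and r: "\<And>s. s \<in> carrier A \<Longrightarrow> rmul s m = rmul s n"
  shows "m = n"
proof (rule prod_eqI)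
  show "fst m = fst n" using assms by (intro PiE_ext[of _ "carrier A" "\<lambda>_. carrier A"]) (auto simp: is_multiplier_def)
  show "snd m = snd n" using assms by (intro PiE_ext[of _ "carrier A" "\<lambda>_. carrier A"]) (auto simp: is_multiplier_def)
qed

lemma multiplier_mult: assumes m: "is_multiplier A m" and n: "is_multiplier A n"
  shows "is_multiplier A (m \<otimes>\<^bsub>M\<^esub> n)"
  unfolding is_multiplier_def
proof (intro conjI ballI)
  note D = multiplierD[OF m] multiplierD[OF n]
  fix s t assume s: "s \<in> carrier A" "t \<in> carrier A"
  note c = m_closed[OF s]
  show "lmul (m \<otimes>\<^bsub>M\<^esub> n) (s \<otimes> t) = lmul (m \<otimes>\<^bsub>M\<^esub> n) s \<otimes> t"
    using s c by (simp add: multiplier_monoid_def D(1,2,3,4,6,7,8,9))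
  show "rmul (s \<otimes> t) (m \<otimes>\<^bsub>M\<^esub> n) = s \<otimes> rmul t (m \<otimes>\<^bsub>M\<^esub> n)"
    using s c by (simp add: multiplier_monoid_def D(1,2,3,4,6,7,8,9))
  show "s \<otimes> lmul (m \<otimes>\<^bsub>M\<^esub> n) t = rmul s (m \<otimes>\<^bsub>M\<^esub> n) \<otimes> t"
    using s c by (simp add: multiplier_monoid_def D)
qed (use multiplierD(1,2)[OF m] multiplierD(1,2)[OF n] in \<open>auto simp: multiplier_monoid_def\<close>)

lemma multiplier_one: "is_multiplier A \<one>\<^bsub>M\<^esub>"
  by (auto simp: is_multiplier_def multiplier_monoid_def m_closed)

lemma multiplier_monoid: "monoid M"
proof
  have car: "carrier M = {m. is_multiplier A m}" by (simp add: multiplier_monoid_def)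
  show "x \<otimes>\<^bsub>M\<^esub> y \<in> carrier M" if "x \<in> carrier M" "y \<in> carrier M" for x y
    using that multiplier_mult by (simp add: car)
  show "\<one>\<^bsub>M\<^esub> \<in> carrier M" using multiplier_one by (simp add: car)
  fix x assume "x \<in> carrier M" then have x: "is_multiplier A x" by (simp add: car)
  note D = multiplierD(1,2)[OF x]
  show "\<one>\<^bsub>M\<^esub> \<otimes>\<^bsub>M\<^esub> x = x"
    by (rule multiplier_ext) (simp_all add: multiplier_mult multiplier_one x, simp_all add: multiplier_monoid_def D)
  show "x \<otimes>\<^bsub>M\<^esub> \<one>\<^bsub>M\<^esub> = x"
    by (rule multiplier_ext) (simp_all add: multiplier_mult multiplier_one x, simp_all add: multiplier_monoid_def D)
  fix y z assume "y \<in> carrier M" "z \<in> carrier M" then have y: "is_multiplier A y" "is_multiplier A z" by (simp_all add: car)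
  show "x \<otimes>\<^bsub>M\<^esub> y \<otimes>\<^bsub>M\<^esub> z = x \<otimes>\<^bsub>M\<^esub> (y \<otimes>\<^bsub>M\<^esub> z)"
    by (rule multiplier_ext)
      (simp_all add: multiplier_mult x y, simp_all add: multiplier_monoid_def D multiplierD(1,2)[OF y(1)] multiplierD(1,2)[OF y(2)])
qed

text \<open>Both actions at \<open>e\<close> give elements fixed by \<open>e\<close>, and the law
  linking them identifies these because \<open>e\<close> is central. On other elements the two
  actions may differ.\<close>

lemma multiplier_E: assumes m: "is_multiplier A m" and e: "e \<in> E" shows "rmul e m = lmul m e"
proof -
  note D = multiplierD[OF m] and c = E_closed[OF e]
  have "rmul e m = e \<otimes> rmul e m" using D(4)[OF c c] e by (simp add: E_idem)
  also have "\<dots> = rmul e m \<otimes> e" by (rule E_central) (simp_all add: e D)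
  also have "\<dots> = e \<otimes> lmul m e" using D(5)[OF c c] by simp
  also have "\<dots> = lmul m e \<otimes> e" by (rule E_central) (simp_all add: e D)
  also have "\<dots> = lmul m e" using D(3)[OF c c] e by (simp add: E_idem)
  finally show ?thesis .
qed

text \<open>As \<open>s\<close> is \<open>rr s\<close> times \<open>s\<close>, and also
  \<open>s\<close> times \<open>rr s\<close>, both actions are recovered from the values at
  idempotents.\<close>

lemma multiplier_rr: assumes m: "is_multiplier A m" and s: "s \<in> carrier A"
  shows "lmul m s = lmul m (rr s) \<otimes> s" "rmul s m = s \<otimes> lmul m (rr s)"
  using multiplierD(3)[OF m, of "rr s" s] multiplierD(4)[OF m, of s "rr s"] s
  by (simp_all add: multiplier_E[OF m])

lemma multiplier_E_mult: assumes m: "is_multiplier A m" and e: "e \<in> E" "f \<in> E"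
  shows "lmul m (f \<otimes> e) = f \<otimes> lmul m e"
proof -
  have "lmul m (f \<otimes> e) = lmul m (e \<otimes> f)" using e idempotent_comm[of e f] by simp
  also have "\<dots> = f \<otimes> lmul m e"
    using multiplierD(1,3)[OF m] e E_central[of f "lmul m e"] by simp
  finally show ?thesis .
qed

text \<open>The value of \<open>n\<close> at \<open>e\<close> lies under \<open>e\<close>, so
  \<open>m\<close> can be applied to the factor \<open>e\<close> alone. On idempotents the
  composition of multipliers is thus the pointwise product.\<close>

lemma multiplier_mult_E: assumes m: "is_multiplier A m" and n: "is_multiplier A n" and e: "e \<in> E"
  shows "lmul (m \<otimes>\<^bsub>M\<^esub> n) e = lmul m e \<otimes> lmul n e"
proof -
  have "lmul (m \<otimes>\<^bsub>M\<^esub> n) e = lmul m (lmul n (e \<otimes> e))" using e by (simp add: multiplier_monoid_def E_idem)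
  also have "\<dots> = lmul m (e \<otimes> lmul n e)" using e n by (subst multiplier_E_mult[OF n]) simp_all
  also have "\<dots> = lmul m e \<otimes> lmul n e" using e multiplierD(1)[OF n] by (simp add: multiplierD(3)[OF m])
  finally show ?thesis .
qed

text \<open>By \<open>multiplier_mult_E\<close> the values at \<open>e\<close> of \<open>m\<close>
  and of its inverse multiply to \<open>e\<close>, so they are inverse to one another in the maximal
  subgroup at \<open>e\<close>.\<close>

lemma unit_multiplier:
  assumes m: "m \<in> Units M"
  shows "is_multiplier A m" "is_multiplier A (inv\<^bsub>M\<^esub> m)"
    "\<And>e. e \<in> E \<Longrightarrow> rr (lmul m e) = e" "\<And>e. e \<in> E \<Longrightarrow> lmul (inv\<^bsub>M\<^esub> m) e = iv (lmul m e)"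
proof -
  interpret M: monoid M by (rule multiplier_monoid)
  show mm: "is_multiplier A m" "is_multiplier A (inv\<^bsub>M\<^esub> m)"
    using M.Units_closed[OF m] M.Units_inv_closed[OF m] by (simp_all add: multiplier_monoid_def)
  let ?n = "inv\<^bsub>M\<^esub> m"
  fix e assume e: "e \<in> E"
  have c: "lmul m e \<in> carrier A" "lmul ?n e \<in> carrier A" using e multiplierD(1) mm by simp_all
  have "lmul \<one>\<^bsub>M\<^esub> e = e" using e by (simp add: multiplier_monoid_def)
  then have mn: "lmul m e \<otimes> lmul ?n e = e" "lmul ?n e \<otimes> lmul m e = e"
    using multiplier_mult_E[OF mm e] multiplier_mult_E[OF mm(2,1) e] m by simp_all
  have em: "lmul m e \<otimes> e = lmul m e" "lmul ?n e \<otimes> e = lmul ?n e"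
    using multiplierD(3)[OF mm(1), of e e] multiplierD(3)[OF mm(2), of e e] e by (simp_all add: E_idem)
  have "iv (lmul m e) = lmul ?n e"
    by (rule sg_inv_eqI)
      (use c mn em e E_central[of e "lmul m e"] E_central[of e "lmul ?n e"] in simp_all)
  then show "lmul ?n e = iv (lmul m e)" by simp
  then show "rr (lmul m e) = e" using mn by (simp add: rng_def)
qed

definition section_multiplier :: "('a \<Rightarrow> 'a) \<Rightarrow> 'a multiplier" where
  "section_multiplier t = (\<lambda>s\<in>carrier A. t (rr s) \<otimes> s, \<lambda>s\<in>carrier A. s \<otimes> t (rr s))"

text \<open>The pointwise inverse of \<open>t\<close> satisfies the same compatibility and yields
  the inverse multiplier. Unit multipliers are therefore the elements of the inverse limit of the
  maximal subgroups over the semilattice of idempotents.\<close>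

lemma section_multiplier:
  assumes t: "\<And>e. e \<in> E \<Longrightarrow> t e \<in> carrier A" "\<And>e. e \<in> E \<Longrightarrow> rr (t e) = e"
    "\<And>e f. \<lbrakk>e \<in> E; f \<in> E\<rbrakk> \<Longrightarrow> t (f \<otimes> e) = f \<otimes> t e"
  shows "section_multiplier t \<in> Units M" "\<And>e. e \<in> E \<Longrightarrow> lmul (section_multiplier t) e = t e"
proof -
  have mult: "is_multiplier A (section_multiplier t)"
    if t: "\<And>e. e \<in> E \<Longrightarrow> t e \<in> carrier A" "\<And>e f. \<lbrakk>e \<in> E; f \<in> E\<rbrakk> \<Longrightarrow> t (f \<otimes> e) = f \<otimes> t e" for t
    unfolding is_multiplier_def
  proof (intro conjI ballI)
    fix u v assume u: "u \<in> carrier A" "v \<in> carrier A"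
    have uv: "t (rr (u \<otimes> v)) = rr u \<otimes> t (rr v)" "t (rr (u \<otimes> v)) = rr v \<otimes> t (rr u)"
      using u t(2)[of "rr v" "rr u"] t(2)[of "rr u" "rr v"] idempotent_comm[of "rr u" "rr v"]
      by (simp_all add: rr_mult_distrib)
    have "t (rr (u \<otimes> v)) \<otimes> (u \<otimes> v) = (t (rr u) \<otimes> rr v) \<otimes> (u \<otimes> v)"
      unfolding uv(2) using u t E_central[of "rr v" "t (rr u)"] by simp
    also have "\<dots> = t (rr u) \<otimes> ((u \<otimes> rr v) \<otimes> v)" using u t E_central[of "rr v" u]
      by (simp add: m_assoc m_closed flip: E_central[of "rr v" u])
    also have "\<dots> = t (rr u) \<otimes> (u \<otimes> v)" using u by (simp add: m_assoc)
    finally show "lmul (section_multiplier t) (u \<otimes> v) = lmul (section_multiplier t) u \<otimes> v"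
      using u t by (simp add: section_multiplier_def m_closed m_assoc)
    have "u \<otimes> v \<otimes> t (rr (u \<otimes> v)) = (u \<otimes> (v \<otimes> rr u)) \<otimes> t (rr v)"
      using u t by (simp add: uv(1) m_assoc m_closed)
    also have "v \<otimes> rr u = rr u \<otimes> v" using u E_central[of "rr u" v] by simp
    also have "u \<otimes> (rr u \<otimes> v) = u \<otimes> v" using u by (simp flip: m_assoc)
    finally show "rmul (u \<otimes> v) (section_multiplier t) = u \<otimes> rmul v (section_multiplier t)"
      using u t by (simp add: section_multiplier_def m_closed m_assoc)
    have "u \<otimes> (t (rr v) \<otimes> v) = (u \<otimes> rr u) \<otimes> (t (rr v) \<otimes> v)" using u by simp
    also have "\<dots> = u \<otimes> (rr u \<otimes> t (rr v)) \<otimes> v" using u t by (simp only: m_assoc m_closed rr_closed rr_E)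
    also have "rr u \<otimes> t (rr v) = t (rr u) \<otimes> rr v"
      using uv u t E_central[of "rr v" "t (rr u)"] by simp
    also have "u \<otimes> (t (rr u) \<otimes> rr v) \<otimes> v = u \<otimes> t (rr u) \<otimes> v" using u t by (simp add: m_assoc m_closed)
    finally show "u \<otimes> lmul (section_multiplier t) v = rmul u (section_multiplier t) \<otimes> v"
      using u by (simp add: section_multiplier_def)
  qed (use t in \<open>auto simp: section_multiplier_def m_closed\<close>)
  let ?m = "section_multiplier t" and ?n = "section_multiplier (\<lambda>e. iv (t e))"
  have m: "is_multiplier A ?m" by (rule mult) (use t in auto)
  have n: "is_multiplier A ?n" by (rule mult) (use t in \<open>simp_all add: iv_mult E_central[of _ "iv (t _)"]\<close>)
  have te: "t e \<otimes> e = t e" if "e \<in> E" for e using that mult_rr[of "t e"] t by simp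
  show lm: "lmul ?m e = t e" if "e \<in> E" for e using that te by (simp add: section_multiplier_def)
  have ln: "lmul ?n e = iv (t e)" if "e \<in> E" for e
    using that mult_rr[of "iv (t e)"] t by (simp add: section_multiplier_def)
  have one: "x = \<one>\<^bsub>M\<^esub>" if x: "is_multiplier A x" and e: "\<And>e. e \<in> E \<Longrightarrow> lmul x e = e" for x
  proof (rule multiplier_ext[OF x multiplier_one])
    fix s assume s: "s \<in> carrier A"
    show "lmul x s = lmul \<one>\<^bsub>M\<^esub> s" "rmul s x = rmul s \<one>\<^bsub>M\<^esub>"
      using multiplier_rr[OF x s] e[of "rr s"] s by (simp_all add: multiplier_monoid_def)
  qed
  have "?m \<otimes>\<^bsub>M\<^esub> ?n = \<one>\<^bsub>M\<^esub>"
    by (rule one) (use t in \<open>simp_all add: multiplier_mult m n multiplier_mult_E lm ln flip: rng_def\<close>)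
  moreover have "?n \<otimes>\<^bsub>M\<^esub> ?m = \<one>\<^bsub>M\<^esub>"
  proof (rule one)
    fix e assume e: "e \<in> E"
    have "rr (iv (t e)) = e" using e t by simp
    then show "lmul (?n \<otimes>\<^bsub>M\<^esub> ?m) e = e"
      using e t by (simp add: multiplier_mult_E m n lm ln rng_def)
  qed (simp add: multiplier_mult m n)
  moreover have "carrier M = {m. is_multiplier A m}" by (simp add: multiplier_monoid_def)
  ultimately show "?m \<in> Units M" using m n unfolding Units_def by blast
qed

lemma unit_multiplier_eqI: assumes "m \<in> Units M" "n \<in> Units M" "\<And>e. e \<in> E \<Longrightarrow> lmul m e = lmul n e"
  shows "m = n"
proof (rule multiplier_ext[OF unit_multiplier(1)[OF assms(1)] unit_multiplier(1)[OF assms(2)]])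
  fix s assume s: "s \<in> carrier A"
  show "lmul m s = lmul n s" "rmul s m = rmul s n"
    using multiplier_rr[OF unit_multiplier(1)[OF assms(1)] s] assms(3)[of "rr s"]
      multiplier_rr[OF unit_multiplier(1)[OF assms(2)] s] s by simp_all
qed

end

section \<open>Extensions and sections\<close>

lemma hom_sg_inv:
  assumes S: "inverse_semigroup S" and T: "inverse_semigroup T" and h: "h \<in> hom S T" and x: "x \<in> carrier S"
  shows "h (sg_inv S x) = sg_inv T (h x)"
proof -
  interpret S: inverse_semigroup S by fact
  interpret T: inverse_semigroup T by fact
  have c: "h y \<in> carrier T" if "y \<in> carrier S" for y using h that by (auto simp: hom_def)
  have m: "h (y \<otimes>\<^bsub>S\<^esub> z) = h y \<otimes>\<^bsub>T\<^esub> h z" if "y \<in> carrier S" "z \<in> carrier S" for y z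
    using h that by (auto simp: hom_def)
  have "T.iv (h x) = h (S.iv x)"
    using x S.sg_inv_props[OF x] c by (intro T.sg_inv_eqI) (simp_all add: S.m_closed flip: m)
  then show ?thesis by simp
qed

lemma hom_rng:
  assumes "inverse_semigroup S" "inverse_semigroup T" "h \<in> hom S T" "x \<in> carrier S"
  shows "h (rng S x) = rng T (h x)"
  using hom_sg_inv[OF assms] assms inverse_semigroup.sg_inv_props(1)[OF assms(1,4)]
  by (auto simp: rng_def hom_def)

lemma hom_idempotent: "\<lbrakk>h \<in> hom S T; e \<in> idempotents S\<rbrakk> \<Longrightarrow> h e \<in> idempotents T"
  by (auto simp: hom_def idempotents_def) metis

context graded
begin

text \<open>Sections encode order-preserving transversals: \<open>R\<close> plays the role of \<open>\<rho> \<circ> \<pi>\<close>.  In any refinement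
  \<open>\<pi> u\<close> is determined by \<open>u u\<inverse>\<close> and \<open>j u\<close>, so that no \<open>S\<close> is needed.\<close>

definition is_section :: "('u \<Rightarrow> 'u) \<Rightarrow> bool" where
  "is_section R \<longleftrightarrow> (\<forall>u\<in>carrier U. R u \<in> carrier U \<and> j (R u) = j u \<and> rr (R u) = rr u \<and>
     (\<forall>v\<in>carrier U. j v = j u \<longrightarrow> rr v = rr u \<longrightarrow> R v = R u) \<and>
     (\<forall>e\<in>E. R (e \<otimes> u) = e \<otimes> R u)) \<and> (\<forall>e\<in>E. R e = e)"

text \<open>Equality of the domain idempotents comes from \<open>rr_match_iv\<close>, and invariance
  under equal degree and idempotent extends the compatibility with \<open>E\<close> to one with
  \<open>N\<close>.\<close>

lemma sectionD: assumes "is_section R" "u \<in> carrier U"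
  shows "R u \<in> carrier U" "j (R u) = j u" "rr (R u) = rr u"
    "\<And>v. \<lbrakk>v \<in> carrier U; j v = j u; rr v = rr u\<rbrakk> \<Longrightarrow> R v = R u"
    "\<And>e. e \<in> E \<Longrightarrow> R (e \<otimes> u) = e \<otimes> R u" "\<And>e. e \<in> E \<Longrightarrow> R e = e"
    "\<And>a. a \<in> N \<Longrightarrow> R a = rr a" "R (R u) = R u" "\<And>a. a \<in> N \<Longrightarrow> R (a \<otimes> u) = rr a \<otimes> R u"
    "rr (iv (R u)) = rr (iv u)"
proof -
  show c: "R u \<in> carrier U" "j (R u) = j u" "rr (R u) = rr u"
    and eq: "\<And>v. \<lbrakk>v \<in> carrier U; j v = j u; rr v = rr u\<rbrakk> \<Longrightarrow> R v = R u"
    and E: "\<And>e. e \<in> E \<Longrightarrow> R (e \<otimes> u) = e \<otimes> R u" "\<And>e. e \<in> E \<Longrightarrow> R e = e"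
    using assms unfolding is_section_def by blast+
  show "R (R u) = R u" by (rule eq) (use c in simp_all)
  show "rr (iv (R u)) = rr (iv u)" by (rule rr_match_iv) (use assms c in simp_all)
  fix a assume a: "a \<in> N"
  have eq': "R v = R w" if "w \<in> carrier U" "v \<in> carrier U" "j v = j w" "rr v = rr w" for v w
    using assms(1) that unfolding is_section_def by blast
  have "R a = R (rr a)" by (rule eq') (use a in simp_all)
  then show "R a = rr a" using a by (simp add: E)
  have "R (a \<otimes> u) = R (rr a \<otimes> u)"
    by (rule eq') (use a assms(2) in \<open>simp_all add: m_closed rr_N_mult\<close>)
  then show "R (a \<otimes> u) = rr a \<otimes> R u" using a by (simp add: E)
qed

end

locale ext_base = A: semilattice_of_groups A + graded U G j
  for A :: "('a, 'm) monoid_scheme" and U :: "'u monoid" (structure) and G :: "('g, 'n) monoid_scheme"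
    and j :: "'u \<Rightarrow> 'g" +
  fixes i :: "'a \<Rightarrow> 'u"
  assumes i_mon: "i \<in> mon A U" and i_image: "i ` carrier A = N" and j_onto: "j ` carrier U = carrier G"
begin

lemma inverse_U: "inverse_semigroup U" by unfold_locales
lemma inverse_A: "inverse_semigroup A" by unfold_locales

lemma i_hom: "i \<in> hom A U" using i_mon by (simp add: mon_def)

lemma i_inj: "\<lbrakk>a \<in> carrier A; b \<in> carrier A\<rbrakk> \<Longrightarrow> i a = i b \<longleftrightarrow> a = b"
  using i_mon by (auto simp: mon_def inj_on_def)

lemma i_N [simp]: "a \<in> carrier A \<Longrightarrow> i a \<in> N" using i_image by auto

lemma i_mult: "\<lbrakk>a \<in> carrier A; b \<in> carrier A\<rbrakk> \<Longrightarrow> i (a \<otimes>\<^bsub>A\<^esub> b) = i a \<otimes> i b"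
  using i_hom by (auto simp: hom_def)

lemma i_iv: "a \<in> carrier A \<Longrightarrow> i (A.iv a) = iv (i a)"
  by (rule hom_sg_inv[OF inverse_A inverse_U i_hom])

lemma i_rr: "a \<in> carrier A \<Longrightarrow> i (A.rr a) = rr (i a)"
  by (rule hom_rng[OF inverse_A inverse_U i_hom])

lemma i_E [simp]: "e \<in> A.E \<Longrightarrow> i e \<in> E"
  by (rule hom_idempotent[OF i_hom])

definition \<iota> :: "'u \<Rightarrow> 'a" where "\<iota> = the_inv_into (carrier A) i"

lemma inv_props: assumes "n \<in> N" shows "\<iota> n \<in> carrier A" "i (\<iota> n) = n"
proof -
  have inj: "inj_on i (carrier A)" using i_mon by (simp add: mon_def)
  have n: "n \<in> i ` carrier A" using assms i_image by simp
  show "\<iota> n \<in> carrier A" unfolding \<iota>_def by (rule the_inv_into_into[OF inj n subset_refl])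
  show "i (\<iota> n) = n" unfolding \<iota>_def by (rule f_the_inv_into_f[OF inj n])
qed

lemma inv_i: "a \<in> carrier A \<Longrightarrow> \<iota> (i a) = a"
  using inv_props[OF i_N, of a] i_inj by simp

lemma inv_eqI: "\<lbrakk>a \<in> carrier A; i a = n\<rbrakk> \<Longrightarrow> \<iota> n = a"
  using inv_i by blast

lemma inv_mult: "\<lbrakk>a \<in> N; b \<in> N\<rbrakk> \<Longrightarrow> \<iota> (a \<otimes> b) = \<iota> a \<otimes>\<^bsub>A\<^esub> \<iota> b"
  by (rule inv_eqI) (simp_all add: inv_props i_mult A.m_closed)

lemma inv_iv: "a \<in> N \<Longrightarrow> \<iota> (iv a) = A.iv (\<iota> a)"
  by (rule inv_eqI) (simp_all add: inv_props i_iv)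

lemma inv_rr: "a \<in> N \<Longrightarrow> \<iota> (rr a) = A.rr (\<iota> a)"
  by (rule inv_eqI) (simp_all add: inv_props i_rr)

lemma i_E_iff: assumes "a \<in> carrier A" shows "i a \<in> E \<longleftrightarrow> a \<in> A.E"
proof
  assume "i a \<in> E"
  then have "i (a \<otimes>\<^bsub>A\<^esub> a) = i a" using assms by (simp add: i_mult E_idem)
  then show "a \<in> A.E" using assms by (intro A.E_I) (simp_all add: i_inj A.m_closed)
qed simp

lemma inv_E: "e \<in> E \<Longrightarrow> \<iota> e \<in> A.E"
  using i_E_iff[of "\<iota> e"] inv_props[of e] by simp

lemma i_Z_iff: assumes "a \<in> carrier A" shows "i a \<in> Z \<longleftrightarrow> a \<in> sg_center A"
proof
  assume Z: "i a \<in> Z"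
  have "a \<otimes>\<^bsub>A\<^esub> b = b \<otimes>\<^bsub>A\<^esub> a" if b: "b \<in> carrier A" for b
  proof -
    have "i (a \<otimes>\<^bsub>A\<^esub> b) = i (b \<otimes>\<^bsub>A\<^esub> a)" using assms b Z_comm[OF Z i_N[OF b]] by (simp add: i_mult)
    then show ?thesis using assms b by (simp add: i_inj A.m_closed)
  qed
  then show "a \<in> sg_center A" using assms by (simp add: sg_center_def)
next
  assume c: "a \<in> sg_center A"
  show "i a \<in> Z"
  proof (rule Z_I)
    fix b assume b: "b \<in> N"
    have "i (a \<otimes>\<^bsub>A\<^esub> \<iota> b) = i (\<iota> b \<otimes>\<^bsub>A\<^esub> a)" using c inv_props[OF b] by (simp add: sg_center_def)
    then show "i a \<otimes> b = b \<otimes> i a" using assms inv_props[OF b] by (simp add: i_mult)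
  qed (use assms in simp)
qed

lemma group_extension: "group_extension A G (U, i, j)"
  using inverse_U i_mon j_hom j_onto i_image
  unfolding group_extension.simps epi_def kernel_def by blast

text \<open>\<open>acts R g\<close> is the graph of the isomorphism \<open>\<theta>\<^sub>g\<close> defined by the section \<open>R\<close>.\<close>

definition acts :: "('u \<Rightarrow> 'u) \<Rightarrow> 'g \<Rightarrow> 'a \<Rightarrow> 'a \<Rightarrow> bool" where
  "acts R g a b \<longleftrightarrow> a \<in> carrier A \<and> b \<in> carrier A \<and>
     (\<exists>u\<in>carrier U. j u = g \<and> rr (iv u) = i (A.rr a) \<and> i b = cj (R u) (i a))"

text \<open>If \<open>v = a u\<close> with \<open>a\<close> in \<open>N\<close>, then
  \<open>\<pi> a\<close> is idempotent and is the image of \<open>rr a\<close>; so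
  \<open>\<pi>\<close> sees only the degree and the range idempotent. Since it separates
  idempotents, equalities between idempotents of \<open>U\<close> are checked after applying
  it.\<close>

lemma refinement_section:
  fixes S :: "'s monoid"
  assumes ref: "refinement A G (U, i, j) S \<pi> \<kappa>" and ot: "order_transversal S U \<pi> \<rho>"
  shows "is_section (\<rho> \<circ> \<pi>)"
    and "\<And>g a b. g \<in> carrier G \<Longrightarrow> ext_action A G U i S \<kappa> \<rho> g a = Some b \<longleftrightarrow> acts (\<rho> \<circ> \<pi>) g a b"
proof -
  let ?R = "\<rho> \<circ> \<pi>"
  have inverse_S: "inverse_semigroup S" using ref by (simp add: E_unitary_def)
  interpret S: inverse_semigroup S by fact
  have \<pi>: "\<pi> \<in> hom U S" and \<kappa>: "\<kappa> \<in> hom S G" and j: "\<And>u. u \<in> carrier U \<Longrightarrow> j u = \<kappa> (\<pi> u)"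
    and inj: "inj_on \<pi> E" and img: "i ` carrier A = {u \<in> carrier U. \<pi> u \<in> idempotents S}"
    using ref by (auto simp: sg_extension_def epi_def)
  have \<pi>c: "\<pi> u \<in> carrier S" if "u \<in> carrier U" for u using \<pi> that by (auto simp: hom_def)
  have \<pi>m: "\<pi> (u \<otimes> v) = \<pi> u \<otimes>\<^bsub>S\<^esub> \<pi> v" if "u \<in> carrier U" "v \<in> carrier U" for u v
    using \<pi> that by (auto simp: hom_def)
  note \<pi>iv = hom_sg_inv[OF inverse_U inverse_S \<pi>] and \<pi>rr = hom_rng[OF inverse_U inverse_S \<pi>]
    and \<pi>E = hom_idempotent[OF \<pi>]
  have \<rho>: "\<rho> s \<in> carrier U" "\<pi> (\<rho> s) = s" if "s \<in> carrier S" for s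
    using ot that by (auto simp: order_transversal_def)
  have \<rho>E: "\<rho> e \<in> E" if "e \<in> S.E" for e using ot that by (auto simp: order_transversal_def)
  have \<rho>le: "nat_le U (\<rho> s) (\<rho> t)" if "nat_le S s t" for s t
    using ot that by (auto simp: order_transversal_def nat_le_def)
  have injD: "e = f" if "e \<in> E" "f \<in> E" "\<pi> e = \<pi> f" for e f using inj that by (auto dest: inj_onD)
  have RE: "?R e = e" if "e \<in> E" for e
    using that \<rho>E \<pi>E \<rho>(2)[OF \<pi>c] by (intro injD) auto
  have Rc: "?R u \<in> carrier U" "j (?R u) = j u" if "u \<in> carrier U" for u
    using that \<rho> \<pi>c j by auto
  have Rrr: "rr (?R u) = rr u" if u: "u \<in> carrier U" for u
    using u Rc[OF u] \<pi>c \<rho>(2)[OF \<pi>c[OF u]] by (intro injD) (auto simp: \<pi>rr)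
  have Req: "?R v = ?R u" if u: "u \<in> carrier U" "v \<in> carrier U" and eq: "j v = j u" "rr v = rr u" for u v
  proof -
    note f = factor[OF u(2,1) eq]
    define a where "a = v \<otimes> iv u"
    have a: "v = a \<otimes> u" "a \<in> N" "rr a = rr u" using f eq by (simp_all add: a_def)
    have "\<pi> a \<in> S.E" using a(2) i_image img by auto
    then have "\<pi> a = \<pi> (rr u)" using \<pi>rr[of a] a by simp
    then have "\<pi> v = \<pi> (rr u) \<otimes>\<^bsub>S\<^esub> \<pi> u" using a u by (simp add: \<pi>m)
    then show ?thesis using u \<pi>m[of "rr u" u] by simp
  qed
  have RE_mult: "?R (e \<otimes> u) = e \<otimes> ?R u" if e: "e \<in> E" and u: "u \<in> carrier U" for e u
  proof -
    \<comment> \<open>Order preservation provides only some idempotent \<open>f\<close> that cuts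
      the value at \<open>u\<close> down to the value at \<open>e u\<close>; comparing range
      idempotents shows that \<open>f\<close> and \<open>e\<close> agree below
      \<open>rr u\<close>.\<close>
    have "nat_le S (\<pi> (e \<otimes> u)) (\<pi> u)"
      unfolding nat_le_def using e u \<pi>c \<pi>E \<pi>m by (auto intro: S.m_closed)
    then have "nat_le U (?R (e \<otimes> u)) (?R u)" using \<rho>le by simp
    then obtain f where f: "f \<in> E" "?R (e \<otimes> u) = f \<otimes> ?R u" by (auto simp: nat_le_def)
    have c: "?R u = rr u \<otimes> ?R u" using rr_mult_self(1)[OF Rc(1)[OF u]] Rrr[OF u] by simp
    have "f \<otimes> rr u = rr (?R (e \<otimes> u))" unfolding f(2) using f(1) Rc[OF u] by (simp add: rr_E_mult Rrr[OF u] del: o_apply)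
    also have "\<dots> = rr (e \<otimes> u)" by (rule Rrr) (use e u in \<open>simp add: m_closed\<close>)
    also have "\<dots> = e \<otimes> rr u" using e u by (simp add: rr_E_mult)
    finally have fe: "f \<otimes> rr u = e \<otimes> rr u" .
    have "f \<otimes> ?R u = (f \<otimes> rr u) \<otimes> ?R u" using f(1) u Rc(1)[OF u] c by (simp add: m_assoc del: o_apply)
    also have "\<dots> = e \<otimes> ?R u" unfolding fe using e u Rc(1)[OF u] c by (simp add: m_assoc del: o_apply)
    finally show ?thesis using f by simp
  qed
  show "is_section ?R"
    unfolding is_section_def using Rc Rrr Req RE_mult RE by blast
  fix g a b assume g: "g \<in> carrier G"
  \<comment> \<open>\<open>ext_ideal\<close> at the inverse of \<open>g\<close> asks for a range
    idempotent in that degree, \<open>acts\<close> for a domain idempotent in degree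
    \<open>g\<close>; inversion exchanges the two.\<close>
  have dom: "a \<in> ext_ideal A i S \<kappa> \<rho> (inv\<^bsub>G\<^esub> g) \<longleftrightarrow>
      a \<in> carrier A \<and> (\<exists>u\<in>carrier U. j u = g \<and> rr (iv u) = i (A.rr a))"
  proof
    assume "a \<in> ext_ideal A i S \<kappa> \<rho> (inv\<^bsub>G\<^esub> g)"
    then obtain s where a: "a \<in> carrier A" and s: "s \<in> carrier S" "\<kappa> s = inv\<^bsub>G\<^esub> g" "\<rho> (S.rr s) = i (A.rr a)"
      by (auto simp: ext_ideal_def rng_def)
    have "rr (\<rho> s) = \<rho> (S.rr s)" using s(1) \<rho> \<rho>E by (intro injD) (auto simp: \<pi>rr)
    moreover have "j (iv (\<rho> s)) = g" using s g \<rho> j_iv[of "\<rho> s"] j[of "\<rho> s"] by simp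
    ultimately show "a \<in> carrier A \<and> (\<exists>u\<in>carrier U. j u = g \<and> rr (iv u) = i (A.rr a))"
      using a s \<rho> by (intro conjI bexI[of _ "iv (\<rho> s)"]) simp_all
  next
    assume "a \<in> carrier A \<and> (\<exists>u\<in>carrier U. j u = g \<and> rr (iv u) = i (A.rr a))"
    then obtain u where a: "a \<in> carrier A" and u: "u \<in> carrier U" "j u = g" "rr (iv u) = i (A.rr a)" by blast
    have "\<rho> (S.rr (\<pi> (iv u))) = ?R (rr (iv u))" using u(1) by (simp add: \<pi>rr)
    also have "\<dots> = rr (iv u)" by (rule RE) (use u(1) in simp)
    finally have "\<rho> (S.rr (\<pi> (iv u))) = i (A.rr a)" using u(3) by simp
    then show "a \<in> ext_ideal A i S \<kappa> \<rho> (inv\<^bsub>G\<^esub> g)"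
      unfolding ext_ideal_def rng_def[symmetric]
      using a u \<pi>c[of "iv u"] j[of "iv u"] j_iv[OF u(1)] by (auto intro!: bexI[of _ "\<pi> (iv u)"])
  qed
  have val: "ext_action A G U i S \<kappa> \<rho> g a = Some (\<iota> (cj (?R u) (i a)))"
    if a: "a \<in> carrier A" and u: "u \<in> carrier U" "j u = g" "rr (iv u) = i (A.rr a)" for u
  proof -
    have D: "a \<in> ext_ideal A i S \<kappa> \<rho> (inv\<^bsub>G\<^esub> g)" using dom a u by blast
    have "\<rho> (S.iv (\<pi> u) \<otimes>\<^bsub>S\<^esub> \<pi> u) = ?R (rr (iv u))"
      using u(1) by (simp add: \<pi>m \<pi>iv rng_def)
    also have "\<dots> = rr (iv u)" by (rule RE) (use u(1) in simp)
    also have "\<dots> = i (a \<otimes>\<^bsub>A\<^esub> A.iv a)" using u(3) by (simp add: rng_def[of A])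
    finally have "(THE s. s \<in> carrier S \<and> \<kappa> s = g \<and> \<rho> (S.iv s \<otimes>\<^bsub>S\<^esub> s) = i (a \<otimes>\<^bsub>A\<^esub> A.iv a)) = \<pi> u"
      using u \<pi>c j by (intro the1_equality ex1_coset_rep[OF G.group_axioms group_extension ref ot g D]) auto
    then show ?thesis using D by (simp add: ext_action_def \<iota>_def conjugate_def Let_def)
  qed
  show "ext_action A G U i S \<kappa> \<rho> g a = Some b \<longleftrightarrow> acts ?R g a b"
  proof
    assume e: "ext_action A G U i S \<kappa> \<rho> g a = Some b"
    then have "a \<in> ext_ideal A i S \<kappa> \<rho> (inv\<^bsub>G\<^esub> g)" by (auto simp: ext_action_def split: if_splits)
    then obtain u where a: "a \<in> carrier A" and u: "u \<in> carrier U" "j u = g" "rr (iv u) = i (A.rr a)"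
      using dom by blast
    have b: "b = \<iota> (cj (?R u) (i a))" using val[OF a u] e by simp
    have n: "cj (?R u) (i a) \<in> N" using a Rc[OF u(1)] by simp
    show "acts ?R g a b" unfolding acts_def b using a u inv_props[OF n] by blast
  next
    assume "acts ?R g a b"
    then obtain u where a: "a \<in> carrier A" "b \<in> carrier A"
      and u: "u \<in> carrier U" "j u = g" "rr (iv u) = i (A.rr a)" "i b = cj (?R u) (i a)"
      by (auto simp: acts_def)
    then show "ext_action A G U i S \<kappa> \<rho> g a = Some b" using val[OF a(1) u(1-3)] u(4) inv_i[OF a(2)] by simp
  qed
qed

text \<open>The image of \<open>R\<close> with the product \<open>R (x \<otimes> y)\<close> is the
  quotient of \<open>U\<close> by equality of degree and range idempotent. It is E-unitary because
  an element above an idempotent has degree 1, and in degree 1 \<open>R\<close> takes the value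
  \<open>rr s\<close>.\<close>

lemma section_refinement:
  assumes R: "is_section R"
  obtains S :: "'u monoid" where "refinement A G (U, i, j) S R j" "order_transversal S U R id"
proof -
  define T :: "'u monoid" where
    "T = \<lparr>carrier = R ` carrier U, mult = (\<lambda>x y. R (x \<otimes> y)), one = undefined\<rparr>"
  note D = sectionD[OF R]
  have Tc: "carrier T = R ` carrier U" and Tm: "x \<otimes>\<^bsub>T\<^esub> y = R (x \<otimes> y)" for x y by (simp_all add: T_def)
  have Tx: "x \<in> carrier U" "R x = x" if "x \<in> carrier T" for x using that D(1,8) by (auto simp: Tc)
  have RT: "R x \<in> carrier T" if "x \<in> carrier U" for x using that by (simp add: Tc)
  \<comment> \<open>Replacing a factor by its value under \<open>R\<close> changes neither the
    degree nor, by \<open>rr_match_mult\<close>, the idempotent of a product.\<close>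
  have l: "R (R x \<otimes> y) = R (x \<otimes> y)" and r: "R (x \<otimes> R y) = R (x \<otimes> y)"
    if "x \<in> carrier U" "y \<in> carrier U" for x y
    by (rule D(4); use that D(1-3) rr_match_mult[of "R x" y x y] rr_match_mult[of x "R y" x y] in \<open>simp add: m_closed\<close>)+
  have ET: "idempotents T = E"
  proof (intro equalityI subsetI)
    fix e assume "e \<in> idempotents T"
    then have e: "e \<in> carrier T" "R (e \<otimes> e) = e" by (auto simp: idempotents_def Tm)
    have "j e \<otimes>\<^bsub>G\<^esub> j e = j e" using D(2)[of "e \<otimes> e"] Tx[OF e(1)] unfolding e(2) by (simp add: m_closed)
    then have "e \<in> N" using Tx[OF e(1)] by (intro N_I) simp_all
    then have "e = rr e" using D(7)[of e e] Tx[OF e(1)] by simp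
    then show "e \<in> E" using rr_E[of e] Tx[OF e(1)] by simp
  next
    fix e assume "e \<in> E"
    then have "e \<in> carrier T" "R (e \<otimes> e) = e" using RT[of e] D(6)[of e e] by (auto simp: E_idem)
    then show "e \<in> idempotents T" by (simp add: idempotents_def Tm)
  qed
  have inv_T: "inverse_semigroup T"
  proof (rule inverse_semigroupI)
    show "x \<otimes>\<^bsub>T\<^esub> y \<in> carrier T" if "x \<in> carrier T" "y \<in> carrier T" for x y
      using that Tx by (simp add: Tm RT m_closed)
    show "x \<otimes>\<^bsub>T\<^esub> y \<otimes>\<^bsub>T\<^esub> z = x \<otimes>\<^bsub>T\<^esub> (y \<otimes>\<^bsub>T\<^esub> z)" if "x \<in> carrier T" "y \<in> carrier T" "z \<in> carrier T" for x y z
      using that Tx by (simp add: Tm l r m_closed m_assoc)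
    show "e \<otimes>\<^bsub>T\<^esub> f = f \<otimes>\<^bsub>T\<^esub> e" if "e \<in> idempotents T" "f \<in> idempotents T" for e f
      using that idempotent_comm[of e f] by (simp add: Tm ET)
    fix x assume x: "x \<in> carrier T"
    note xc = Tx[OF x]
    have 1: "x \<otimes>\<^bsub>T\<^esub> R (iv x) = rr x" using xc D(6)[of x "rr x"] by (simp add: Tm r flip: rng_def)
    have "R (iv x) \<otimes>\<^bsub>T\<^esub> x = R (rr (iv x))" using xc by (simp add: Tm l rng_def)
    then have 2: "R (iv x) \<otimes>\<^bsub>T\<^esub> x = rr (iv x)" using xc D(6)[of x "rr (iv x)"] by simp
    have 3: "rr x \<otimes>\<^bsub>T\<^esub> x = x" using xc by (simp add: Tm)
    have 4: "rr (iv x) \<otimes>\<^bsub>T\<^esub> R (iv x) = R (iv x)"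
      using xc D(1,3,8)[of "iv x"] rr_mult_self(1)[of "R (iv x)"] by (simp add: Tm)
    show "\<exists>y\<in>carrier T. x \<otimes>\<^bsub>T\<^esub> y \<otimes>\<^bsub>T\<^esub> x = x \<and> y \<otimes>\<^bsub>T\<^esub> x \<otimes>\<^bsub>T\<^esub> y = y"
      using 1 2 3 4 RT[of "iv x"] xc by (intro bexI[of _ "R (iv x)"]) auto
  qed
  interpret T: inverse_semigroup T by (rule inv_T)
  have "E_unitary T"
  proof
    fix e s assume e: "e \<in> idempotents T" and le: "nat_le T e s"
    then obtain f where s: "s \<in> carrier T" "f \<in> E" "e = R (f \<otimes> s)" by (auto simp: nat_le_def Tm ET)
    have "j e = j s" using s Tx[OF s(1)] D(2)[of "f \<otimes> s"] by (simp add: m_closed)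
    then have "s \<in> N" using e Tx[OF s(1)] by (intro N_I) (simp_all add: ET)
    then have "s = rr s" using D(7)[of s s] Tx[OF s(1)] by simp
    then show "s \<in> idempotents T" using rr_E[of s] Tx[OF s(1)] by (simp add: ET)
  qed
  moreover have "R \<in> epi U T"
    by (auto simp: epi_def hom_def Tm RT l r D(1)) (simp add: Tc)
  moreover have "inj_on R E" using D(6) by (metis E_closed inj_onI)
  moreover have "i ` carrier A = {u \<in> carrier U. R u \<in> idempotents T}"
  proof -
    have "u \<in> N \<longleftrightarrow> u \<in> carrier U \<and> R u \<in> E" for u
    proof (intro iffI conjI)
      assume "u \<in> N" then show "u \<in> carrier U" "R u \<in> E" using D(7)[of u u] by simp_all
    next
      assume u: "u \<in> carrier U \<and> R u \<in> E"
      then have "j u = \<one>\<^bsub>G\<^esub>" using D(2)[of u] E_N[of "R u"] by (metis N_j)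
      then show "u \<in> N" using u by (intro N_I) auto
    qed
    then show ?thesis unfolding i_image ET by blast
  qed
  moreover have "j \<in> epi T G"
  proof -
    have "j ` carrier T = j ` carrier U" unfolding Tc image_image using D(2) by (intro image_cong) auto
    then show ?thesis using Tx D(2) j_onto by (auto simp: epi_def hom_def Tm m_closed)
  qed
  ultimately have 1: "refinement A G (U, i, j) T R j"
    using inverse_U i_mon D(2) by (auto simp: sg_extension_def)
  have "nat_le U s t" if "nat_le T s t" for s t
  proof -
    from that obtain e where e: "e \<in> E" "s = R (e \<otimes> t)" "s \<in> carrier T" "t \<in> carrier T"
      by (auto simp: nat_le_def Tm ET)
    then have "s = e \<otimes> t" using D(5)[of t e] Tx[OF e(4)] by simp
    then show ?thesis using e Tx by (auto simp: nat_le_def)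
  qed
  then have 2: "order_transversal T U R id"
    using Tx by (auto simp: order_transversal_def ET)
  show thesis using that[OF 1 2] .
qed

text \<open>A single section replaces the refinements and transversals, which
  \<open>admissible\<close> and \<open>has_abstract_kernel\<close> quantify separately.\<close>

lemma admissible_exts_iff:
  "(U, i, j) \<in> admissible_exts A G \<psi> \<longleftrightarrow> (\<exists>R. is_section R \<and> (\<forall>g\<in>carrier G. \<exists>\<theta>.
     \<psi> g = inner_rel A `` {\<theta>} \<and> (\<forall>a b. \<theta> a = Some b \<longleftrightarrow> acts R g a b)))" (is "?L \<longleftrightarrow> ?R")
proof
  assume ?L
  then obtain S :: "'u monoid" and \<pi> \<kappa> \<rho> where S: "refinement A G (U, i, j) S \<pi> \<kappa>" "order_transversal S U \<pi> \<rho>"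
    and \<psi>: "\<forall>g\<in>carrier G. \<psi> g = inner_rel A `` {ext_action A G U i S \<kappa> \<rho> g}"
    unfolding admissible_exts_def mem_Collect_eq has_abstract_kernel.simps by blast
  show ?R using refinement_section[OF S] \<psi> by blast
next
  assume ?R
  then obtain R where R: "is_section R" and \<psi>: "\<And>g. g \<in> carrier G \<Longrightarrow>
    \<exists>\<theta>. \<psi> g = inner_rel A `` {\<theta>} \<and> (\<forall>a b. \<theta> a = Some b \<longleftrightarrow> acts R g a b)" by blast
  obtain S :: "'u monoid" where S: "refinement A G (U, i, j) S R j" "order_transversal S U R id"
    by (rule section_refinement[OF R])
  have "\<psi> g = inner_rel A `` {ext_action A G U i S j id g}" if g: "g \<in> carrier G" for g
  proof -
    obtain \<theta> where \<theta>: "\<psi> g = inner_rel A `` {\<theta>}" "\<And>a b. \<theta> a = Some b \<longleftrightarrow> acts R g a b" using \<psi>[OF g] by blast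
    have "ext_action A G U i S j id g a = Some b \<longleftrightarrow> \<theta> a = Some b" for a b
      using refinement_section(2)[OF S g] \<theta>(2) by simp
    then have "ext_action A G U i S j id g = \<theta>" by (intro ext) (metis option.exhaust)
    then show ?thesis using \<theta> by simp
  qed
  then show ?L unfolding admissible_exts_def mem_Collect_eq has_abstract_kernel.simps admissible.simps
    using S group_extension by blast
qed

end

text \<open>An idempotent of \<open>U\<close> has degree 1, hence comes from an idempotent of
  \<open>A\<close>, which is central there.\<close>

lemma ext_baseI:
  assumes A: "semilattice_of_groups A" and G: "group G" and ext: "group_extension A G (U, i, j)"
  shows "ext_base A U G j i"
proof -
  interpret A: semilattice_of_groups A by fact
  interpret G: group G by fact
  have U: "inverse_semigroup U" and i: "i \<in> mon A U" and j: "j \<in> epi U G"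
    and img: "i ` carrier A = kernel U G j"
    using ext by (auto simp: kernel_def)
  interpret U: inverse_semigroup U by fact
  have ih: "i (a \<otimes>\<^bsub>A\<^esub> b) = i a \<otimes>\<^bsub>U\<^esub> i b" if "a \<in> carrier A" "b \<in> carrier A" for a b
    using i that by (auto simp: mon_def hom_def)
  have inj: "inj_on i (carrier A)" using i by (simp add: mon_def)
  show ?thesis
  proof
    show jh: "j \<in> hom U G" and "j ` carrier U = carrier G" using j by (auto simp: epi_def)
    fix e a assume e: "e \<in> idempotents U" and a: "a \<in> kernel U G j"
    have "e \<in> carrier U" "e \<otimes>\<^bsub>U\<^esub> e = e" using e unfolding idempotents_def by auto
    moreover have "j (e \<otimes>\<^bsub>U\<^esub> e) = j e \<otimes>\<^bsub>G\<^esub> j e" "j e \<in> carrier G"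
      using jh \<open>e \<in> carrier U\<close> by (auto simp: hom_def)
    ultimately have "j e \<otimes>\<^bsub>G\<^esub> j e = j e" "j e \<in> carrier G" by simp_all
    then have "e \<in> kernel U G j" using \<open>e \<in> carrier U\<close> by (simp add: kernel_def)
    then obtain f b where f: "f \<in> carrier A" "e = i f" "b \<in> carrier A" "a = i b" using img a by blast
    have "i (f \<otimes>\<^bsub>A\<^esub> f) = i f" using f \<open>e \<otimes>\<^bsub>U\<^esub> e = e\<close> by (simp add: ih)
    then have "f \<otimes>\<^bsub>A\<^esub> f = f" using inj f by (auto dest: inj_onD simp: A.m_closed)
    then have "f \<otimes>\<^bsub>A\<^esub> b = b \<otimes>\<^bsub>A\<^esub> f" using f A.E_central A.E_I by blast
    then show "e \<otimes>\<^bsub>U\<^esub> a = a \<otimes>\<^bsub>U\<^esub> e" using f by (simp flip: ih)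
  qed (use i img in auto)
qed

section \<open>The partial module of central elements\<close>

context semilattice_of_groups
begin

text \<open>The common ground of ideals of \<open>A\<close>, which occur in
  \<open>inner_rel\<close>, and ideals of C(A), which occur in cochains; the latter are in general
  not ideals of \<open>A\<close>.\<close>

definition inverse_closed :: "'a set \<Rightarrow> bool" where
  "inverse_closed I \<longleftrightarrow> I \<subseteq> carrier A \<and> (\<forall>x\<in>I. \<forall>y\<in>I. x \<otimes> y \<in> I) \<and> (\<forall>x\<in>I. iv x \<in> I)"

lemma ideal_inverse_closed: "sg_ideal A I \<Longrightarrow> inverse_closed I"
  using ideal_sub(1-3)[of I] unfolding inverse_closed_def by blast

text \<open>Inverses and idempotents of the subsemigroup are those of \<open>A\<close>, so the
  calculus of its unit multipliers can be expressed by the operations of \<open>A\<close>.\<close>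

lemma subsemigroup_multipliers:
  assumes closed: "inverse_closed I"
  defines "MI \<equiv> multiplier_monoid (A\<lparr>carrier := I\<rparr>)"
  shows "monoid MI"
    and "\<And>m a. \<lbrakk>m \<in> Units MI; a \<in> I\<rbrakk> \<Longrightarrow> lmul m a \<in> I \<and> rmul a m \<in> I"
    and "\<And>m e. \<lbrakk>m \<in> Units MI; e \<in> E; e \<in> I\<rbrakk> \<Longrightarrow> rr (lmul m e) = e"
    and "\<And>m e f. \<lbrakk>m \<in> Units MI; e \<in> E; f \<in> E; e \<in> I; f \<in> I\<rbrakk> \<Longrightarrow> lmul m (f \<otimes> e) = f \<otimes> lmul m e"
    and "\<And>m a. \<lbrakk>m \<in> Units MI; a \<in> I\<rbrakk> \<Longrightarrow> lmul m a = lmul m (rr a) \<otimes> a \<and> rmul a m = a \<otimes> lmul m (rr a)"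
    and "\<And>m e. \<lbrakk>m \<in> Units MI; e \<in> E; e \<in> I\<rbrakk> \<Longrightarrow> lmul (inv\<^bsub>MI\<^esub> m) e = iv (lmul m e)"
    and "\<And>m n e. \<lbrakk>m \<in> Units MI; n \<in> Units MI; e \<in> E; e \<in> I\<rbrakk> \<Longrightarrow> lmul (m \<otimes>\<^bsub>MI\<^esub> n) e = lmul m e \<otimes> lmul n e"
    and "\<And>m n. \<lbrakk>m \<in> Units MI; n \<in> Units MI; \<And>e. \<lbrakk>e \<in> E; e \<in> I\<rbrakk> \<Longrightarrow> lmul m e = lmul n e\<rbrakk> \<Longrightarrow> m = n"
    and "\<And>t. \<lbrakk>\<And>e. \<lbrakk>e \<in> E; e \<in> I\<rbrakk> \<Longrightarrow> t e \<in> I \<and> rr (t e) = e;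
        \<And>e f. \<lbrakk>e \<in> E; f \<in> E; e \<in> I; f \<in> I\<rbrakk> \<Longrightarrow> t (f \<otimes> e) = f \<otimes> t e\<rbrakk>
      \<Longrightarrow> \<exists>m\<in>Units MI. \<forall>e\<in>E \<inter> I. lmul m e = t e"
    and "\<And>m. m \<in> Units MI \<Longrightarrow> fst m \<in> extensional I \<and> snd m \<in> extensional I"
proof -
  have I: "I \<subseteq> carrier A" "\<And>x y. \<lbrakk>x \<in> I; y \<in> I\<rbrakk> \<Longrightarrow> x \<otimes> y \<in> I" "\<And>x. x \<in> I \<Longrightarrow> iv x \<in> I"
    using closed by (auto simp: inverse_closed_def)
  note s = inverse_subsemigroup[OF I]
  interpret I: semilattice_of_groups "A\<lparr>carrier := I\<rparr>" by (rule semilattice_of_groups_subset[OF I])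
  have rI: "rr x \<in> I" if "x \<in> I" for x using I(2)[OF that I(3)[OF that]] by (simp add: rng_def)
  show "monoid MI" unfolding MI_def by (rule I.multiplier_monoid)
  note u = I.unit_multiplier[folded MI_def]
  have c: "lmul m a \<in> I" "rmul a m \<in> I" if "m \<in> Units MI" "a \<in> I" for m a
    using I.multiplierD(1,2)[OF u(1)[OF that(1)]] that by simp_all
  show "lmul m a \<in> I \<and> rmul a m \<in> I" if "m \<in> Units MI" "a \<in> I" for m a using c[OF that] by blast
  show "rr (lmul m e) = e" if "m \<in> Units MI" "e \<in> E" "e \<in> I" for m e
    using u(3)[OF that(1), of e] that c[OF that(1,3)] s(3,4) by simp
  show "lmul m (f \<otimes> e) = f \<otimes> lmul m e" if "m \<in> Units MI" "e \<in> E" "f \<in> E" "e \<in> I" "f \<in> I" for m e f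
    using I.multiplier_E_mult[OF u(1)[OF that(1)], of e f] that s(4) by simp
  show "lmul m a = lmul m (rr a) \<otimes> a \<and> rmul a m = a \<otimes> lmul m (rr a)" if "m \<in> Units MI" "a \<in> I" for m a
    using I.multiplier_rr[OF u(1)[OF that(1)], of a] that s(3) by simp
  show "lmul (inv\<^bsub>MI\<^esub> m) e = iv (lmul m e)" if "m \<in> Units MI" "e \<in> E" "e \<in> I" for m e
    using u(4)[OF that(1), of e] that c[OF that(1,3)] s(2,4) by simp
  show "lmul (m \<otimes>\<^bsub>MI\<^esub> n) e = lmul m e \<otimes> lmul n e" if "m \<in> Units MI" "n \<in> Units MI" "e \<in> E" "e \<in> I" for m n e
    using I.multiplier_mult_E[folded MI_def, OF u(1)[OF that(1)] u(1)[OF that(2)], of e] that s(4) by simp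
  show "m = n" if "m \<in> Units MI" "n \<in> Units MI" "\<And>e. \<lbrakk>e \<in> E; e \<in> I\<rbrakk> \<Longrightarrow> lmul m e = lmul n e" for m n
    using I.unit_multiplier_eqI[folded MI_def, OF that(1,2)] that(3) s(4) by simp
  show "\<exists>m\<in>Units MI. \<forall>e\<in>E \<inter> I. lmul m e = t e"
    if t: "\<And>e. \<lbrakk>e \<in> E; e \<in> I\<rbrakk> \<Longrightarrow> t e \<in> I \<and> rr (t e) = e"
      "\<And>e f. \<lbrakk>e \<in> E; f \<in> E; e \<in> I; f \<in> I\<rbrakk> \<Longrightarrow> t (f \<otimes> e) = f \<otimes> t e" for t
  proof -
    have "I.section_multiplier t \<in> Units MI \<and> (\<forall>e\<in>I.E. lmul (I.section_multiplier t) e = t e)"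
      unfolding MI_def using t s(3,4) by (intro conjI ballI I.section_multiplier) auto
    then show ?thesis using s(4) by blast
  qed
  show "fst m \<in> extensional I \<and> snd m \<in> extensional I" if "m \<in> Units MI" for m
    using u(1)[OF that] by (auto simp: is_multiplier_def PiE_def)
qed

text \<open>At each \<open>a\<close> the inner isomorphism given by \<open>m\<close> is conjugation
  by an element of \<open>A\<close>, namely the value of \<open>m\<close> at the idempotent of
  \<open>a\<close>.\<close>

lemma conj_unit_multiplier:
  assumes I: "sg_ideal A I" and m: "m \<in> Units (multiplier_monoid (A\<lparr>carrier := I\<rparr>))" and a: "a \<in> I"
  shows "rmul (lmul m a) (inv\<^bsub>multiplier_monoid (A\<lparr>carrier := I\<rparr>)\<^esub> m)
    = lmul m (rr a) \<otimes> a \<otimes> iv (lmul m (rr a))"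
proof -
  note s = ideal_sub[OF I]
  note sm = subsemigroup_multipliers[OF ideal_inverse_closed[OF I]]
  interpret MI: monoid "multiplier_monoid (A\<lparr>carrier := I\<rparr>)" by (rule sm(1))
  let ?n = "inv\<^bsub>multiplier_monoid (A\<lparr>carrier := I\<rparr>)\<^esub> m" and ?t = "lmul m (rr a)"
  have n: "?n \<in> Units (multiplier_monoid (A\<lparr>carrier := I\<rparr>))" using m by simp
  have c: "a \<in> carrier A" "rr a \<in> I" using a s(1) s(4)[OF a] by auto
  have t: "?t \<in> I" "rr ?t = rr a" "?t \<in> carrier A" using sm(2)[OF m c(2)] sm(3)[OF m _ c(2)] c s(1) by auto
  have ta: "?t \<otimes> a \<in> I" "rr (?t \<otimes> a) = rr a"
    using t c s(2)[OF t(1) a] by (simp_all add: rr_mult_distrib E_idem)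
  have "rmul (lmul m a) ?n = rmul (?t \<otimes> a) ?n" using sm(5)[OF m a] by simp
  also have "\<dots> = ?t \<otimes> a \<otimes> lmul ?n (rr a)" using sm(5)[OF n ta(1)] ta(2) by simp
  also have "lmul ?n (rr a) = iv ?t" using sm(6)[OF m _ c(2)] c(1) by simp
  finally show ?thesis .
qed

text \<open>An element \<open>x\<close> of \<open>I\<close> sees only
  \<open>rr x \<otimes> y\<close> in place of \<open>y\<close>, and that lies in
  \<open>I\<close>.\<close>

lemma center_ideal: assumes I: "sg_ideal A I"
  shows "sg_center (A\<lparr>carrier := I\<rparr>) = sg_center A \<inter> I"
proof (intro equalityI subsetI)
  note s = ideal_sub[OF I]
  fix x assume "x \<in> sg_center (A\<lparr>carrier := I\<rparr>)"
  then have x: "x \<in> I" and c: "\<And>y. y \<in> I \<Longrightarrow> x \<otimes> y = y \<otimes> x" by (auto simp: sg_center_def)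
  have xc: "x \<in> carrier A" using x s(1) by blast
  have "x \<otimes> y = y \<otimes> x" if y: "y \<in> carrier A" for y
  proof -
    have "x \<otimes> y = x \<otimes> (rr x \<otimes> y)" using xc y by (simp flip: m_assoc)
    also have "\<dots> = (rr x \<otimes> y) \<otimes> x" using s(6)[OF s(4)[OF x] y] by (rule c)
    also have "\<dots> = y \<otimes> (rr x \<otimes> x)" using xc y E_central[of "rr x" y] by (simp add: m_assoc flip: m_assoc[of y])
    finally show ?thesis using xc by simp
  qed
  then show "x \<in> sg_center A \<inter> I" using x xc by (simp add: sg_center_def)
next
  fix x assume "x \<in> sg_center A \<inter> I"
  then show "x \<in> sg_center (A\<lparr>carrier := I\<rparr>)" using ideal_sub(1)[OF I] by (auto simp: sg_center_def)
qed

lemma inner_rel_refl: assumes "\<phi> \<in> ideal_isos A" shows "(\<phi>, \<phi>) \<in> inner_rel A"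
proof -
  have I: "sg_ideal A (ran \<phi>)" using assms by (simp add: ideal_isos_def)
  interpret MI: monoid "multiplier_monoid (A\<lparr>carrier := ran \<phi>\<rparr>)"
    by (rule subsemigroup_multipliers(1)[OF ideal_inverse_closed[OF I]])
  have "the (\<phi> s) \<in> ran \<phi>" if "s \<in> dom \<phi>" for s using that by (auto simp: ran_def)
  then have "\<forall>s\<in>dom \<phi>. the (\<phi> s) = rmul (lmul \<one>\<^bsub>multiplier_monoid (A\<lparr>carrier := ran \<phi>\<rparr>)\<^esub> (the (\<phi> s)))
      (inv\<^bsub>multiplier_monoid (A\<lparr>carrier := ran \<phi>\<rparr>)\<^esub> \<one>\<^bsub>multiplier_monoid (A\<lparr>carrier := ran \<phi>\<rparr>)\<^esub>)"
    unfolding MI.inv_one by (simp add: multiplier_monoid_def)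
  then show ?thesis using assms MI.Units_one_closed unfolding inner_rel_def Let_def by blast
qed

end

section \<open>Extensions with a given abstract kernel\<close>

locale kernel_ext = ext_base A U G j i
  for A :: "('a, 'm) monoid_scheme" and U :: "'u monoid" (structure) and G :: "('g, 'n) monoid_scheme"
    and j :: "'u \<Rightarrow> 'g" and i :: "'a \<Rightarrow> 'u" +
  fixes \<psi> :: "'g \<Rightarrow> ('a \<rightharpoonup> 'a) set" and R :: "'u \<Rightarrow> 'u"
  assumes kernel: "abstract_kernel A G \<psi>" and sectionR: "is_section R"
    and kernel_acts: "g \<in> carrier G \<Longrightarrow>
      \<exists>\<theta>. \<psi> g = inner_rel A `` {\<theta>} \<and> (\<forall>a b. \<theta> a = Some b \<longleftrightarrow> acts R g a b)"
begin

text \<open>Computed from \<open>U\<close> and its grading, this is the common range of the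
  isomorphisms in \<open>\<psi> g\<close>, see \<open>ker_ideal_eq\<close>.\<close>

definition D :: "'g \<Rightarrow> 'a set" where
  "D g = {a \<in> carrier A. \<exists>u\<in>carrier U. j u = g \<and> rr u = i (A.rr a)}"

lemma acts_ex: assumes "a \<in> carrier A" "u \<in> carrier U" "rr (iv u) = i (A.rr a)"
  shows "acts R (j u) a (\<iota> (cj (R u) (i a)))"
proof -
  have "cj (R u) (i a) \<in> N" using assms sectionD(1)[OF sectionR] by simp
  then show ?thesis using assms inv_props unfolding acts_def by blast
qed

lemma cj_cj_iv: assumes u: "u \<in> carrier U" and a: "a \<in> N" "rr a = rr u" shows "cj u (cj (iv u) a) = a"
proof -
  have "cj u (cj (iv u) a) = cj (u \<otimes> iv u) a" using u a by (subst cj_mult) simp_all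
  also have "\<dots> = rr u \<otimes> a \<otimes> rr u" using u by (simp add: conjugate_def flip: rng_def)
  also have "\<dots> = a" using a(1) unfolding a(2)[symmetric] by simp
  finally show ?thesis .
qed

lemma acts_dom: "(\<exists>b. acts R g a b) \<longleftrightarrow> a \<in> D (inv\<^bsub>G\<^esub> g)" if g: "g \<in> carrier G"
proof
  assume "\<exists>b. acts R g a b"
  then obtain u where "a \<in> carrier A" "u \<in> carrier U" "j u = g" "rr (iv u) = i (A.rr a)" by (auto simp: acts_def)
  then show "a \<in> D (inv\<^bsub>G\<^esub> g)" unfolding D_def by (auto intro!: bexI[of _ "iv u"])
next
  assume "a \<in> D (inv\<^bsub>G\<^esub> g)"
  then obtain u where "a \<in> carrier A" "u \<in> carrier U" "j u = inv\<^bsub>G\<^esub> g" "rr u = i (A.rr a)" by (auto simp: D_def)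
  then show "\<exists>b. acts R g a b" using acts_ex[of a "iv u"] g by auto
qed

lemma acts_ran: "(\<exists>a. acts R g a b) \<longleftrightarrow> b \<in> D g"
proof
  assume "\<exists>a. acts R g a b"
  then obtain a u where a: "a \<in> carrier A" "b \<in> carrier A" and u: "u \<in> carrier U" "j u = g"
    "rr (iv u) = i (A.rr a)" "i b = cj (R u) (i a)" by (auto simp: acts_def)
  note S = sectionD[OF sectionR u(1)]
  have "rr (i b) = cj (R u) (rr (iv (R u)))" using a u S(1) by (simp add: rr_cj S(10) flip: i_rr)
  also have "\<dots> = rr u" using S(1,3) by simp
  finally show "b \<in> D g" using a u by (auto simp: D_def i_rr)
next
  assume "b \<in> D g"
  then obtain u where b: "b \<in> carrier A" and u: "u \<in> carrier U" "j u = g" "rr u = i (A.rr b)" by (auto simp: D_def)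
  note S = sectionD[OF sectionR u(1)]
  let ?n = "cj (iv (R u)) (i b)"
  have n: "?n \<in> N" using b S(1) by simp
  have rb: "rr (i b) = rr (R u)" using b u S(3) by (simp add: i_rr)
  have "rr ?n = rr (iv u)" using b S(1) rb by (simp add: rr_cj S(10))
  moreover have "cj (R u) ?n = i b" using cj_cj_iv[OF S(1) i_N[OF b] rb] .
  ultimately have "acts R g (\<iota> ?n) b" unfolding acts_def using inv_props[OF n] b u by (auto simp: i_rr)
  then show "\<exists>a. acts R g a b" by blast
qed

text \<open>That the graph \<open>acts\<close> belongs to an isomorphism of ideals follows without
  calculation: \<open>\<psi> g\<close> is a class of such isomorphisms, and being related to one of
  them makes \<open>\<theta>\<close> one as well.\<close>

lemma kernel_representative: assumes g: "g \<in> carrier G"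
  obtains \<theta> where "\<psi> g = inner_rel A `` {\<theta>}" "\<And>a b. \<theta> a = Some b \<longleftrightarrow> acts R g a b"
    "\<theta> \<in> ideal_isos A" "\<theta> \<in> \<psi> g" "dom \<theta> = D (inv\<^bsub>G\<^esub> g)" "ran \<theta> = D g"
proof -
  obtain \<theta> where \<theta>: "\<psi> g = inner_rel A `` {\<theta>}" "\<And>a b. \<theta> a = Some b \<longleftrightarrow> acts R g a b"
    using kernel_acts[OF g] by blast
  have "\<psi> g \<in> ideal_isos A // inner_rel A"
    using kernel g by (auto simp: abstract_kernel_def unital_partial_hom_def varsigma_def)
  then obtain \<phi> where \<phi>: "\<phi> \<in> ideal_isos A" "\<psi> g = inner_rel A `` {\<phi>}" by (auto elim: quotientE)
  have "(\<theta>, \<phi>) \<in> inner_rel A" using \<theta>(1) \<phi> A.inner_rel_refl[OF \<phi>(1)] by blast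
  then have iso: "\<theta> \<in> ideal_isos A" by (auto simp: inner_rel_def)
  then have "\<theta> \<in> \<psi> g" using \<theta>(1) A.inner_rel_refl by blast
  moreover have "dom \<theta> = D (inv\<^bsub>G\<^esub> g)" using \<theta>(2) acts_dom[OF g] by (auto simp: dom_def)
  moreover have "ran \<theta> = D g" using \<theta>(2) acts_ran[of g] by (auto simp: ran_def)
  ultimately show thesis using that \<theta> iso by blast
qed

lemma D_ideal: assumes g: "g \<in> carrier G" shows "sg_ideal A (D g)"
proof -
  obtain \<theta> where "\<theta> \<in> ideal_isos A" "ran \<theta> = D g" by (rule kernel_representative[OF g]) blast
  then show ?thesis by (auto simp: ideal_isos_def)
qed

lemma ker_ideal_eq: assumes g: "g \<in> carrier G" shows "ker_ideal \<psi> g = D g"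
proof -
  obtain \<theta> where \<theta>: "\<psi> g = inner_rel A `` {\<theta>}" "\<theta> \<in> \<psi> g" "ran \<theta> = D g"
    by (rule kernel_representative[OF g]) blast
  have "\<forall>\<phi>\<in>\<psi> g. ran \<phi> = D g" using \<theta> by (auto simp: inner_rel_def)
  then show ?thesis unfolding ker_ideal_def using \<theta>(2) by (intro the_equality) auto
qed

text \<open>\<open>R u\<close> and \<open>u\<close> differ by a factor in \<open>N\<close>, which
  acts on the center by restriction. On C(A) the section therefore disappears and the action is
  conjugation by \<open>u\<close> itself.\<close>

lemma cj_section_Z: assumes z: "z \<in> Z" and u: "u \<in> carrier U" shows "cj (R u) z = cj u z"
proof -
  note S = sectionD(1-3)[OF sectionR u]
  note f = factor[OF S(1) u S(2,3)]
  have "cj (R u) z = cj (R u \<otimes> iv u) (cj u z)" unfolding cj_mult[OF N_closed[OF f(2)] u Z_closed[OF z], symmetric]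
    by (simp flip: f(1))
  also have "\<dots> = cj u z \<otimes> rr u" using f(2,3) S(3) z u by (simp add: cj_N_Z)
  also have "\<dots> = rr u \<otimes> cj u z" using z u by (intro Z_mult_comm) simp_all
  also have "\<dots> = cj u z" using z u Z_closed[OF z] by (simp add: conjugate_def m_assoc m_closed)
  finally show ?thesis .
qed

abbreviation \<Theta> where "\<Theta> \<equiv> center_action A G \<psi>"

text \<open>The representative picked by SOME differs from the isomorphism of the section by
  conjugation with values of a unit multiplier, and this fixes central elements.\<close>

lemma center_action_iff: assumes g: "g \<in> carrier G"
  shows "\<Theta> g a = Some b \<longleftrightarrow> a \<in> sg_center A \<and> b \<in> sg_center A \<and>
    (\<exists>u\<in>carrier U. j u = g \<and> rr (iv u) = i (A.rr a) \<and> i b = cj u (i a))"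
proof -
  obtain \<theta> where \<theta>: "\<psi> g = inner_rel A `` {\<theta>}" "\<And>a b. \<theta> a = Some b \<longleftrightarrow> acts R g a b"
    "\<theta> \<in> ideal_isos A" "\<theta> \<in> \<psi> g" "dom \<theta> = D (inv\<^bsub>G\<^esub> g)" "ran \<theta> = D g"
    by (rule kernel_representative[OF g]) blast
  define \<phi> where "\<phi> = (SOME \<phi>. \<phi> \<in> \<psi> g)"
  have "\<phi> \<in> \<psi> g" unfolding \<phi>_def using \<theta>(4) someI_ex[of "\<lambda>\<phi>. \<phi> \<in> \<psi> g"] by blast
  then obtain m where m: "m \<in> Units (multiplier_monoid (A\<lparr>carrier := D g\<rparr>))" and dom: "dom \<phi> = D (inv\<^bsub>G\<^esub> g)"
    and eq: "\<And>s. s \<in> D (inv\<^bsub>G\<^esub> g) \<Longrightarrow> the (\<phi> s)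
      = rmul (lmul m (the (\<theta> s))) (inv\<^bsub>multiplier_monoid (A\<lparr>carrier := D g\<rparr>)\<^esub> m)"
    using \<theta>(1,5,6) by (auto simp: inner_rel_def Let_def)
  have ca: "\<Theta> g = \<phi> |` (sg_center A \<inter> D (inv\<^bsub>G\<^esub> g))"
    unfolding center_action_def \<phi>_def[symmetric] using g by (simp add: ker_ideal_eq A.center_ideal D_ideal)
  have cen: "b \<in> sg_center A \<and> i b = cj u (i a)"
    if a: "a \<in> sg_center A" "b \<in> carrier A" and u: "u \<in> carrier U" "i b = cj (R u) (i a)" for a b u
  proof -
    have ac: "a \<in> carrier A" using a A.center_sub(1) by blast
    have Z: "i a \<in> Z" using a ac i_Z_iff by simp
    then have "i b = cj u (i a)" using u by (simp add: cj_section_Z)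
    then show ?thesis using Z u a i_Z_iff[of b] by simp
  qed
  have \<phi>\<theta>: "\<phi> a = \<theta> a" if a: "a \<in> sg_center A" "a \<in> D (inv\<^bsub>G\<^esub> g)" for a
  proof -
    obtain b where b: "\<theta> a = Some b" using a \<theta>(5) by (auto simp: dom_def)
    then have bD: "b \<in> D g" using \<theta>(6) by (auto simp: ran_def)
    then have bc: "b \<in> carrier A" by (simp add: D_def)
    have bZ: "b \<in> sg_center A" using b \<theta>(2) cen[OF a(1)] by (auto simp: acts_def)
    note s = A.ideal_sub[OF D_ideal[OF g]]
    note sm = A.subsemigroup_multipliers[OF A.ideal_inverse_closed[OF D_ideal[OF g]]]
    let ?t = "lmul m (A.rr b)"
    have t: "?t \<in> carrier A" "A.rr ?t = A.rr b" using sm(2,3)[OF m, of "A.rr b"] s(1,4) bD bc by auto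
    have "the (\<phi> a) = ?t \<otimes>\<^bsub>A\<^esub> b \<otimes>\<^bsub>A\<^esub> A.iv ?t"
      using eq[OF a(2)] b A.conj_unit_multiplier[OF D_ideal[OF g] m bD] by simp
    also have "?t \<otimes>\<^bsub>A\<^esub> b = b \<otimes>\<^bsub>A\<^esub> ?t" using bZ t by (simp add: sg_center_def)
    also have "b \<otimes>\<^bsub>A\<^esub> ?t \<otimes>\<^bsub>A\<^esub> A.iv ?t = b \<otimes>\<^bsub>A\<^esub> A.rr b" using t bc by (simp add: A.m_assoc rng_def flip: t(2))
    also have "\<dots> = b" using bc by simp
    finally show ?thesis using b dom a by (metis domIff option.collapse option.distinct(1))
  qed
  show ?thesis
  proof
    assume "\<Theta> g a = Some b"
    then have a: "a \<in> sg_center A" "a \<in> D (inv\<^bsub>G\<^esub> g)" "\<phi> a = Some b" by (auto simp: ca restrict_map_def split: if_splits)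
    then have "acts R g a b" using \<phi>\<theta> \<theta>(2) by simp
    then show "a \<in> sg_center A \<and> b \<in> sg_center A \<and>
      (\<exists>u\<in>carrier U. j u = g \<and> rr (iv u) = i (A.rr a) \<and> i b = cj u (i a))"
      using cen[OF a(1)] a unfolding acts_def by blast
  next
    assume h: "a \<in> sg_center A \<and> b \<in> sg_center A \<and>
      (\<exists>u\<in>carrier U. j u = g \<and> rr (iv u) = i (A.rr a) \<and> i b = cj u (i a))"
    then have c: "a \<in> carrier A" "b \<in> carrier A" using A.center_sub(1) by auto
    have "i a \<in> Z" using h c i_Z_iff by simp
    then have act: "acts R g a b" using h c cj_section_Z unfolding acts_def by metis
    then have "a \<in> D (inv\<^bsub>G\<^esub> g)" using acts_dom[OF g] by blast
    then show "\<Theta> g a = Some b" using h \<phi>\<theta> \<theta>(2) act by (simp add: ca)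
  qed
qed

end

section \<open>Cochains with values in the center\<close>

text \<open>Every \<open>x\<close> is the product of \<open>rr x\<close>, which lies in
  \<open>I\<close> together with \<open>x\<close>, and \<open>x\<close>.\<close>

lemma (in inverse_semigroup) ideal_set_mult:
  assumes I: "I \<subseteq> carrier S" "\<And>x y. \<lbrakk>x \<in> I; y \<in> carrier S\<rbrakk> \<Longrightarrow> x \<otimes> y \<in> I"
    and J: "J \<subseteq> carrier S" "\<And>x y. \<lbrakk>x \<in> J; y \<in> carrier S\<rbrakk> \<Longrightarrow> y \<otimes> x \<in> J"
  shows "I <#> J = I \<inter> J"
proof (intro equalityI subsetI)
  fix x assume "x \<in> I <#> J" then show "x \<in> I \<inter> J" using I J by (fastforce simp: set_mult_def)
next
  fix x assume x: "x \<in> I \<inter> J"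
  then have "x = rr x \<otimes> x" "rr x \<in> I" using I(1) I(2)[of x "iv x"] by (auto simp: rng_def[of _ x] sg_inv_props)
  then show "x \<in> I <#> J" using x by (auto simp: set_mult_def)
qed

context semilattice_of_groups
begin

definition center_ideal_set :: "'a set \<Rightarrow> bool" where
  "center_ideal_set I \<longleftrightarrow> I \<subseteq> sg_center A \<and> (\<forall>a\<in>I. \<forall>b\<in>sg_center A. a \<otimes> b \<in> I)"

lemma center_comm: "\<lbrakk>a \<in> sg_center A; b \<in> carrier A\<rbrakk> \<Longrightarrow> a \<otimes> b = b \<otimes> a"
  by (simp add: sg_center_def)

lemma center_closed: "a \<in> sg_center A \<Longrightarrow> a \<in> carrier A"
  by (simp add: sg_center_def)

lemma center_ideal_setD: assumes I: "center_ideal_set I"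
  shows "\<And>a. a \<in> I \<Longrightarrow> a \<in> sg_center A" "\<And>a. a \<in> I \<Longrightarrow> a \<in> carrier A"
    "\<And>a b. \<lbrakk>a \<in> I; b \<in> sg_center A\<rbrakk> \<Longrightarrow> a \<otimes> b \<in> I"
    "inverse_closed I" "\<And>a. a \<in> I \<Longrightarrow> rr a \<in> I" "\<And>a. \<lbrakk>a \<in> sg_center A; rr a \<in> I\<rbrakk> \<Longrightarrow> a \<in> I"
proof -
  show c: "\<And>a. a \<in> I \<Longrightarrow> a \<in> sg_center A" and m: "\<And>a b. \<lbrakk>a \<in> I; b \<in> sg_center A\<rbrakk> \<Longrightarrow> a \<otimes> b \<in> I"
    using I by (auto simp: center_ideal_set_def)
  then show cc: "\<And>a. a \<in> I \<Longrightarrow> a \<in> carrier A" using center_closed by blast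
  show rI: "rr a \<in> I" if a: "a \<in> I" for a using m[OF a center_sub(3)[OF c[OF a]]] by (simp add: rng_def)
  show "a \<in> I" if a: "a \<in> sg_center A" "rr a \<in> I" for a using m[OF a(2,1)] center_closed[OF a(1)] by simp
  have "iv a \<in> I" if a: "a \<in> I" for a
  proof -
    have "iv a = rr a \<otimes> iv a" using cc[OF a] rr_mult_self(1)[of "iv a"] by simp
    then show ?thesis using m[OF rI[OF a] center_sub(3)[OF c[OF a]]] by simp
  qed
  then show "inverse_closed I" unfolding inverse_closed_def using c cc m by blast
qed

end

text \<open>The coboundary takes powers inside a monoid of multipliers, where the exponent -1 has
  its expected meaning on units.\<close>

lemma Units_int_pow:
  assumes "monoid M" "m \<in> Units M"
  shows "m [^]\<^bsub>M\<^esub> (1::int) = m" "m [^]\<^bsub>M\<^esub> (-1::int) = inv\<^bsub>M\<^esub> m"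
proof -
  interpret M: monoid M by fact
  show "m [^]\<^bsub>M\<^esub> (1::int) = m" "m [^]\<^bsub>M\<^esub> (-1::int) = inv\<^bsub>M\<^esub> m"
    using M.Units_closed[OF assms(2)] by (simp_all add: int_pow_def2)
qed

section \<open>Ideals of the center and the encoding of cochains\<close>

context kernel_ext
begin

abbreviation B where "B \<equiv> center_sg A"
abbreviation Mu where "Mu I \<equiv> multiplier_monoid (A\<lparr>carrier := I\<rparr>)"

text \<open>The ideal of C(A) that belongs to \<open>x\<close>. \<open>I2\<close> and
  \<open>I3\<close> are the products of such ideals (\<open>I2_eq\<close>, \<open>I3_eq\<close>),
  described by idempotents of products so that they match \<open>cochain2\<close> and the cocycle
  identity.\<close>

definition I1 :: "'g \<Rightarrow> 'a set" where
  "I1 x = {a \<in> sg_center A. \<exists>u\<in>carrier U. j u = x \<and> rr u = i (A.rr a)}"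

definition I2 :: "'g \<Rightarrow> 'g \<Rightarrow> 'a set" where
  "I2 x y = {a \<in> sg_center A. \<exists>u\<in>carrier U. \<exists>v\<in>carrier U. j u = x \<and> j v = y \<and> rr (u \<otimes> v) = i (A.rr a)}"

definition I3 :: "'g \<Rightarrow> 'g \<Rightarrow> 'g \<Rightarrow> 'a set" where
  "I3 x y z = {a \<in> sg_center A. \<exists>u\<in>carrier U. \<exists>v\<in>carrier U. \<exists>w\<in>carrier U.
     j u = x \<and> j v = y \<and> j w = z \<and> rr (u \<otimes> (v \<otimes> w)) = i (A.rr a)}"

lemma shrink: assumes "a \<in> carrier A" "b \<in> carrier A" "u \<in> carrier U" "rr u = i (A.rr a)"
  shows "rr (i (A.rr b) \<otimes> u) = i (A.rr (a \<otimes>\<^bsub>A\<^esub> b))"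
  using assms A.idempotent_comm[of "A.rr a" "A.rr b"] by (simp add: rr_N_mult A.rr_mult_distrib i_mult)

lemma I1_ideal: "A.center_ideal_set (I1 x)"
  unfolding A.center_ideal_set_def
proof (intro conjI ballI)
  fix a b assume a: "a \<in> I1 x" and b: "b \<in> sg_center A"
  then obtain u where u: "a \<in> sg_center A" "u \<in> carrier U" "j u = x" "rr u = i (A.rr a)" by (auto simp: I1_def)
  have "rr (i (A.rr b) \<otimes> u) = i (A.rr (a \<otimes>\<^bsub>A\<^esub> b))" "j (i (A.rr b) \<otimes> u) = x" "i (A.rr b) \<otimes> u \<in> carrier U"
    using u A.center_closed[OF b] A.center_closed[OF u(1)] by (auto intro: shrink simp: m_closed)
  then show "a \<otimes>\<^bsub>A\<^esub> b \<in> I1 x" using u b A.center_sub(2)[of a b] by (auto simp: I1_def)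
qed (auto simp: I1_def)

lemma I2_ideal: "A.center_ideal_set (I2 x y)"
  unfolding A.center_ideal_set_def
proof (intro conjI ballI)
  fix a b assume a: "a \<in> I2 x y" and b: "b \<in> sg_center A"
  then obtain u v where u: "a \<in> sg_center A" "u \<in> carrier U" "v \<in> carrier U" "j u = x" "j v = y"
    "rr (u \<otimes> v) = i (A.rr a)" by (auto simp: I2_def)
  have "rr ((i (A.rr b) \<otimes> u) \<otimes> v) = i (A.rr (a \<otimes>\<^bsub>A\<^esub> b))" "j (i (A.rr b) \<otimes> u) = x" "i (A.rr b) \<otimes> u \<in> carrier U"
    using u A.center_closed[OF b] A.center_closed[OF u(1)] shrink[of a b "u \<otimes> v"] by (auto simp: m_closed m_assoc)
  then show "a \<otimes>\<^bsub>A\<^esub> b \<in> I2 x y" using u b A.center_sub(2)[of a b] unfolding I2_def by blast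
qed (auto simp: I2_def)

text \<open>Conjugation by \<open>iv u\<close> inverts conjugation by \<open>u\<close> at
  \<open>rr u\<close>, so every central element over such an idempotent is reached.\<close>

lemma ran_center_action: assumes x: "x \<in> carrier G" shows "ran (\<Theta> x) = I1 x"
proof (intro equalityI subsetI)
  fix b assume "b \<in> ran (\<Theta> x)"
  then obtain a u where a: "a \<in> sg_center A" "b \<in> sg_center A" and u: "u \<in> carrier U" "j u = x"
    "rr (iv u) = i (A.rr a)" "i b = cj u (i a)" unfolding ran_def center_action_iff[OF x] by blast
  have c: "a \<in> carrier A" "b \<in> carrier A" using a A.center_closed by auto
  have ra: "rr (i a) = rr (iv u)" using u(3) c by (simp add: i_rr)
  have "i (A.rr b) = cj u (rr (i a))" using c u(1,4) by (simp add: i_rr rr_cj)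
  also have "\<dots> = rr u" unfolding ra using u(1) by simp
  finally show "b \<in> I1 x" using a u by (auto simp: I1_def)
next
  fix b assume "b \<in> I1 x"
  then obtain u where b: "b \<in> sg_center A" and u: "u \<in> carrier U" "j u = x" "rr u = i (A.rr b)" by (auto simp: I1_def)
  have c: "b \<in> carrier A" "i b \<in> Z" using b A.center_closed i_Z_iff by auto
  let ?z = "cj (iv u) (i b)"
  have z: "?z \<in> Z" "?z \<in> N" using c u by simp_all
  have "\<iota> ?z \<in> sg_center A" using inv_props[OF z(2)] z(1) i_Z_iff by metis
  moreover have "rr (iv u) = i (A.rr (\<iota> ?z))"
  proof -
    have "i (A.rr (\<iota> ?z)) = rr ?z" using inv_props[OF z(2)] by (simp add: i_rr)
    also have "\<dots> = cj (iv u) (rr u)" using u c by (simp add: rr_cj i_rr)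
    finally show ?thesis using u(1) by simp
  qed
  moreover have "i b = cj u (i (\<iota> ?z))" using cj_cj_iv[OF u(1) i_N[OF c(1)]] u c inv_props[OF z(2)] by (simp add: i_rr)
  ultimately have "\<Theta> x (\<iota> ?z) = Some b" unfolding center_action_iff[OF x] using b u by blast
  then show "b \<in> ran (\<Theta> x)" by (auto simp: ran_def)
qed

lemma B_simps: "carrier B = sg_center A" "mult B = mult A" "B\<lparr>carrier := I\<rparr> = A\<lparr>carrier := I\<rparr>"
  by (simp_all add: center_sg_def)

lemma inverse_B: "inverse_semigroup B"
  using A.inverse_subsemigroup(1)[OF A.center_sub(1-3)] unfolding center_sg_def by blast

lemma I_mult: assumes "A.center_ideal_set I" "A.center_ideal_set J"
  shows "I <#>\<^bsub>B\<^esub> J = I \<inter> J" "A.center_ideal_set (I \<inter> J)"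
proof -
  interpret B: inverse_semigroup B by (rule inverse_B)
  note s = A.center_ideal_setD(1-3)[OF assms(1)] and t = A.center_ideal_setD(1-3)[OF assms(2)]
  show "I <#>\<^bsub>B\<^esub> J = I \<inter> J"
  proof (rule B.ideal_set_mult)
    show "x \<otimes>\<^bsub>B\<^esub> y \<in> I" if "x \<in> I" "y \<in> carrier B" for x y using s(3) that by (simp add: B_simps)
    show "y \<otimes>\<^bsub>B\<^esub> x \<in> J" if x: "x \<in> J" and y: "y \<in> carrier B" for x y
    proof -
      have "y \<otimes>\<^bsub>A\<^esub> x = x \<otimes>\<^bsub>A\<^esub> y" using y t(2)[OF x] by (intro A.center_comm) (simp_all add: B_simps)
      then show ?thesis using t(3)[OF x] y by (simp add: B_simps)
    qed
  qed (use s(1) t(1) in \<open>auto simp: B_simps\<close>)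
  show "A.center_ideal_set (I \<inter> J)" using assms by (auto simp: A.center_ideal_set_def)
qed

text \<open>If \<open>u\<close> and \<open>w\<close> of degrees \<open>x\<close> and
  \<open>x y\<close> have the same range idempotent, then \<open>w\<close> is \<open>u\<close> times
  \<open>iv u \<otimes> w\<close>. Conversely \<open>u\<close>, cut down by the idempotent of
  \<open>u v\<close>, still has degree \<open>x\<close>.\<close>

lemma I2_eq: assumes x: "x \<in> carrier G" "y \<in> carrier G" shows "I1 x \<inter> I1 (x \<otimes>\<^bsub>G\<^esub> y) = I2 x y"
proof (intro equalityI subsetI)
  fix a assume "a \<in> I1 x \<inter> I1 (x \<otimes>\<^bsub>G\<^esub> y)"
  then obtain u w where a: "a \<in> sg_center A" and u: "u \<in> carrier U" "j u = x" "rr u = i (A.rr a)"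
    and w: "w \<in> carrier U" "j w = x \<otimes>\<^bsub>G\<^esub> y" "rr w = i (A.rr a)" by (auto simp: I1_def)
  have "u \<otimes> (iv u \<otimes> w) = rr u \<otimes> w" using u(1) w(1) by (simp add: rng_def m_assoc)
  also have "\<dots> = w" using rr_mult_self(1)[OF w(1)] u(3) w(3) by simp
  finally have "rr (u \<otimes> (iv u \<otimes> w)) = i (A.rr a)" using w by simp
  moreover have "iv u \<otimes> w \<in> carrier U" "j (iv u \<otimes> w) = y" using u w x by (simp_all add: m_closed flip: G.m_assoc)
  ultimately show "a \<in> I2 x y" using a u unfolding I2_def by blast
next
  fix a assume "a \<in> I2 x y"
  then obtain u v where a: "a \<in> sg_center A" and u: "u \<in> carrier U" "v \<in> carrier U" "j u = x" "j v = y"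
    "rr (u \<otimes> v) = i (A.rr a)" by (auto simp: I2_def)
  have "rr (rr (u \<otimes> v) \<otimes> u) = rr u \<otimes> rr (u \<otimes> v)" using u(1,2) idempotent_comm[of "rr (u \<otimes> v)" "rr u"]
    by (simp add: rr_E_mult m_closed)
  also have "\<dots> = i (A.rr a)" using rr_mult_le[OF u(1,2)] u(5) by simp
  finally have "rr (rr (u \<otimes> v) \<otimes> u) = i (A.rr a)" .
  moreover have "rr (u \<otimes> v) \<otimes> u \<in> carrier U" "j (rr (u \<otimes> v) \<otimes> u) = x"
    using u(1-3) x by (simp_all add: m_closed)
  ultimately have "a \<in> I1 x" using a unfolding I1_def by blast
  moreover have "a \<in> I1 (x \<otimes>\<^bsub>G\<^esub> y)" using a u unfolding I1_def by (auto simp: m_closed intro!: bexI[of _ "u \<otimes> v"])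
  ultimately show "a \<in> I1 x \<inter> I1 (x \<otimes>\<^bsub>G\<^esub> y)" by simp
qed

text \<open>Joining the last two ideals by \<open>I2_eq\<close> leaves the same division by
  \<open>u\<close> as there.\<close>

lemma I3_eq: assumes x: "x \<in> carrier G" "y \<in> carrier G" "z \<in> carrier G"
  shows "I1 x \<inter> (I1 (x \<otimes>\<^bsub>G\<^esub> y) \<inter> I1 (x \<otimes>\<^bsub>G\<^esub> (y \<otimes>\<^bsub>G\<^esub> z))) = I3 x y z"
proof -
  have "I1 x \<inter> (I1 (x \<otimes>\<^bsub>G\<^esub> y) \<inter> I1 (x \<otimes>\<^bsub>G\<^esub> (y \<otimes>\<^bsub>G\<^esub> z))) = I1 x \<inter> I2 (x \<otimes>\<^bsub>G\<^esub> y) z"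
    using x by (simp add: G.m_assoc flip: I2_eq)
  also have "\<dots> = I3 x y z"
  proof (intro equalityI subsetI)
    fix a assume "a \<in> I1 x \<inter> I2 (x \<otimes>\<^bsub>G\<^esub> y) z"
    then obtain u w s where a: "a \<in> sg_center A" and u: "u \<in> carrier U" "j u = x" "rr u = i (A.rr a)"
      and w: "w \<in> carrier U" "s \<in> carrier U" "j w = x \<otimes>\<^bsub>G\<^esub> y" "j s = z" "rr (w \<otimes> s) = i (A.rr a)"
      by (auto simp: I1_def I2_def)
    have ws: "w \<otimes> s \<in> carrier U" using w by (simp add: m_closed)
    have "u \<otimes> ((iv u \<otimes> w) \<otimes> s) = rr u \<otimes> (w \<otimes> s)"
      using u(1) w(1,2) by (simp add: rng_def m_assoc m_closed)
    also have "\<dots> = w \<otimes> s" using rr_mult_self(1)[OF ws] u(3) w(5) by simp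
    finally have "rr (u \<otimes> ((iv u \<otimes> w) \<otimes> s)) = i (A.rr a)" using w by simp
    moreover have "iv u \<otimes> w \<in> carrier U" "j (iv u \<otimes> w) = y" using u w x by (simp_all add: m_closed flip: G.m_assoc)
    ultimately show "a \<in> I3 x y z" using a u w unfolding I3_def by blast
  next
    fix a assume "a \<in> I3 x y z"
    then obtain u v w where a: "a \<in> sg_center A" and u: "u \<in> carrier U" "v \<in> carrier U" "w \<in> carrier U"
      "j u = x" "j v = y" "j w = z" and r: "rr (u \<otimes> (v \<otimes> w)) = i (A.rr a)" by (auto simp: I3_def)
    have c: "v \<otimes> w \<in> carrier U" "j (v \<otimes> w) = y \<otimes>\<^bsub>G\<^esub> z" "u \<otimes> v \<in> carrier U"
      "j (u \<otimes> v) = x \<otimes>\<^bsub>G\<^esub> y" "rr ((u \<otimes> v) \<otimes> w) = i (A.rr a)"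
      using u r by (simp_all add: m_closed m_assoc)
    have "a \<in> I2 x (y \<otimes>\<^bsub>G\<^esub> z)" unfolding I2_def using a u r c by blast
    then have "a \<in> I1 x" using x by (simp flip: I2_eq)
    moreover have "a \<in> I2 (x \<otimes>\<^bsub>G\<^esub> y) z" unfolding I2_def using a u c by blast
    ultimately show "a \<in> I1 x \<inter> I2 (x \<otimes>\<^bsub>G\<^esub> y) z" by simp
  qed
  finally show ?thesis .
qed

lemma cochain_ideal_1: "x \<in> carrier G \<Longrightarrow> cochain_ideal B G \<Theta> [x] = I1 x"
  by (simp add: cochain_ideal_def ran_center_action)

lemma cochain_ideal_2: "\<lbrakk>x \<in> carrier G; y \<in> carrier G\<rbrakk> \<Longrightarrow> cochain_ideal B G \<Theta> [x, y] = I2 x y"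
  by (simp add: cochain_ideal_def upt_conv_Cons ran_center_action I_mult I1_ideal I2_eq)

lemma cochain_ideal_3: "\<lbrakk>x \<in> carrier G; y \<in> carrier G; z \<in> carrier G\<rbrakk>
    \<Longrightarrow> cochain_ideal B G \<Theta> [x, y, z] = I3 x y z"
  by (simp add: cochain_ideal_def upt_conv_Cons ran_center_action I_mult I1_ideal I3_eq)

lemma cochain_mult_1: "x \<in> carrier G \<Longrightarrow> cochain_mult B G \<Theta> [x] = Mu (I1 x)"
  and cochain_mult_2: "\<lbrakk>x \<in> carrier G; y \<in> carrier G\<rbrakk> \<Longrightarrow> cochain_mult B G \<Theta> [x, y] = Mu (I2 x y)"
  and cochain_mult_3: "\<lbrakk>x \<in> carrier G; y \<in> carrier G; z \<in> carrier G\<rbrakk> \<Longrightarrow> cochain_mult B G \<Theta> [x, y, z] = Mu (I3 x y z)"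
  by (simp_all add: cochain_mult_def cochain_ideal_1 cochain_ideal_2 cochain_ideal_3 B_simps)

lemma tuples_1: "tuples G (Suc 0) = {[x] |x. x \<in> carrier G}"
  and tuples_2: "tuples G 2 = {[x, y] |x y. x \<in> carrier G \<and> y \<in> carrier G}"
  and tuples_3: "tuples G 3 = {[x, y, z] |x y z. x \<in> carrier G \<and> y \<in> carrier G \<and> z \<in> carrier G}"
  by (auto simp: tuples_def length_Suc_conv numeral_2_eq_2 numeral_3_eq_3)

text \<open>Passes to the encoding of \<open>cochain1\<close>. Its analogue \<open>\<Gamma>2\<close>
  in degree 2 is surjective and injective on cochains (\<open>\<Gamma>2_surj\<close>,
  \<open>\<Gamma>2_inj\<close>).\<close>

definition \<Gamma>1 :: "('g list \<Rightarrow> 'a multiplier) \<Rightarrow> 'u \<Rightarrow> 'u" where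
  "\<Gamma>1 f u = i (lmul (f [j u]) (\<iota> (rr u)))"

definition \<Gamma>2 :: "('g list \<Rightarrow> 'a multiplier) \<Rightarrow> 'u \<Rightarrow> 'u \<Rightarrow> 'u" where
  "\<Gamma>2 c u v = i (lmul (c [j u, j v]) (\<iota> (rr (u \<otimes> v))))"

abbreviation C1 where "C1 \<equiv> carrier (cochains B G \<Theta> (Suc 0))"
abbreviation C2 where "C2 \<equiv> carrier (cochains B G \<Theta> 2)"

lemma C1_iff: "f \<in> C1 \<longleftrightarrow> f \<in> extensional (tuples G (Suc 0)) \<and> (\<forall>x\<in>carrier G. f [x] \<in> Units (Mu (I1 x)))"
proof -
  have "f \<in> C1 \<longleftrightarrow> f \<in> extensional (tuples G (Suc 0)) \<and> (\<forall>x\<in>carrier G. f [x] \<in> Units (cochain_mult B G \<Theta> [x]))"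
    by (auto simp: cochains_def PiE_iff tuples_1 units_of_def)
  then show ?thesis by (simp add: cochain_mult_1)
qed

lemma C2_iff: "f \<in> C2 \<longleftrightarrow> f \<in> extensional (tuples G 2)
  \<and> (\<forall>x\<in>carrier G. \<forall>y\<in>carrier G. f [x, y] \<in> Units (Mu (I2 x y)))"
proof -
  have "f \<in> C2 \<longleftrightarrow> f \<in> extensional (tuples G 2)
      \<and> (\<forall>x\<in>carrier G. \<forall>y\<in>carrier G. f [x, y] \<in> Units (cochain_mult B G \<Theta> [x, y]))"
    by (auto simp: cochains_def PiE_iff tuples_2 units_of_def)
  then show ?thesis by (simp add: cochain_mult_2)
qed

lemma E_center: "e \<in> E \<Longrightarrow> \<iota> e \<in> sg_center A" "e \<in> E \<Longrightarrow> A.rr (\<iota> e) = \<iota> e" "e \<in> E \<Longrightarrow> i (A.rr (\<iota> e)) = e"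
  using i_Z_iff[of "\<iota> e"] inv_props[of e] inv_E[of e] by simp_all

text \<open>\<open>I\<close> consists of the central \<open>a\<close> whose idempotent is represented by some \<open>p \<in> P\<close>; unit multipliers
  of \<open>I\<close> are the same as compatible families \<open>h\<close> on \<open>P\<close>.\<close>

lemma exists_multiplier:
  assumes I: "A.center_ideal_set I" "I = {a \<in> sg_center A. \<exists>p\<in>P. \<rho> p = i (A.rr a)}"
    and \<rho>: "\<And>p. p \<in> P \<Longrightarrow> \<rho> p \<in> E" and h: "\<And>p. p \<in> P \<Longrightarrow> h p \<in> Z \<and> rr (h p) = \<rho> p"
    and mono: "\<And>p q. \<lbrakk>p \<in> P; q \<in> P; \<rho> q \<otimes> \<rho> p = \<rho> q\<rbrakk> \<Longrightarrow> h q = \<rho> q \<otimes> h p"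
  shows "\<exists>m\<in>Units (Mu I). \<forall>p\<in>P. i (lmul m (\<iota> (\<rho> p))) = h p"
proof -
  note s = A.center_ideal_setD[OF I(1)]
  \<comment> \<open>Several \<open>p\<close> may lie over the same idempotent. Any choice will do,
    because \<open>mono\<close> forces \<open>h\<close> to have the same value at all of
    them.\<close>
  define q where "q e = (SOME p. p \<in> P \<and> \<rho> p = i e)" for e
  define t where "t e = \<iota> (h (q e))" for e
  have q: "q e \<in> P \<and> \<rho> (q e) = i e" if "e \<in> A.E" "e \<in> I" for e
  proof -
    have "\<exists>p. p \<in> P \<and> \<rho> p = i e" using that I(2) by auto
    then show ?thesis unfolding q_def by (rule someI_ex)
  qed
  have t: "t e \<in> carrier A \<and> i (t e) = h (q e)" if "e \<in> A.E" "e \<in> I" for e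
    unfolding t_def using q[OF that] h[of "q e"] inv_props[of "h (q e)"] by simp
  have t1: "t e \<in> I \<and> A.rr (t e) = e" if e: "e \<in> A.E" "e \<in> I" for e
  proof -
    have "i (A.rr (t e)) = i e" using t[OF e] q[OF e] h[of "q e"] by (simp add: i_rr)
    then have r: "A.rr (t e) = e" using t[OF e] e by (simp add: i_inj)
    have "t e \<in> sg_center A" using t[OF e] q[OF e] h[of "q e"] i_Z_iff[of "t e"] by simp
    then show ?thesis using s(6)[of "t e"] r e by simp
  qed
  have t2: "t (f \<otimes>\<^bsub>A\<^esub> e) = f \<otimes>\<^bsub>A\<^esub> t e" if e: "e \<in> A.E" "f \<in> A.E" "e \<in> I" "f \<in> I" for e f
  proof -
    have fe: "f \<otimes>\<^bsub>A\<^esub> e \<in> A.E" "f \<otimes>\<^bsub>A\<^esub> e \<in> I"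
      using e A.idempotent_mult s(1,3) by auto
    have he: "i e \<otimes> h (q e) = h (q e)" using h[of "q e"] q[OF e(1,3)] rr_mult_self(1)[of "h (q e)"] by simp
    have "i (t (f \<otimes>\<^bsub>A\<^esub> e)) = (i f \<otimes> i e) \<otimes> h (q e)"
      using mono[of "q e" "q (f \<otimes>\<^bsub>A\<^esub> e)"] q[OF e(1,3)] q[OF fe] t[OF fe] e by (simp add: i_mult m_assoc E_idem)
    also have "\<dots> = i f \<otimes> h (q e)" using h[of "q e"] q[OF e(1,3)] e by (simp add: m_assoc he)
    also have "\<dots> = i (f \<otimes>\<^bsub>A\<^esub> t e)" using e t[OF e(1,3)] by (simp add: i_mult)
    finally have eq: "i (t (f \<otimes>\<^bsub>A\<^esub> e)) = i (f \<otimes>\<^bsub>A\<^esub> t e)" .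
    show ?thesis
      by (rule i_inj[THEN iffD1, OF _ _ eq]) (use t[OF fe] t[OF e(1,3)] e in \<open>simp_all add: A.m_closed\<close>)
  qed
  obtain m where m: "m \<in> Units (Mu I)" "\<And>e. e \<in> A.E \<inter> I \<Longrightarrow> lmul m e = t e"
    using A.subsemigroup_multipliers(9)[OF s(4), of t] t1 t2 by blast
  have "i (lmul m (\<iota> (\<rho> p))) = h p" if p: "p \<in> P" for p
  proof -
    let ?e = "\<iota> (\<rho> p)"
    have e: "?e \<in> A.E" "?e \<in> I" using p \<rho>[OF p] E_center[of "\<rho> p"] inv_E[of "\<rho> p"] I(2) by auto
    have "\<rho> (q ?e) = \<rho> p" using q[OF e] inv_props[of "\<rho> p"] \<rho>[OF p] by simp
    then have "h (q ?e) = \<rho> p \<otimes> h p" using mono[of p "q ?e"] p q[OF e] \<rho>[OF p] by (simp add: E_idem)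
    also have "\<dots> = h p" using h[OF p] rr_mult_self(1)[of "h p"] by simp
    finally show ?thesis using m(2)[of ?e] e t[OF e] by simp
  qed
  then show ?thesis using m by blast
qed

text \<open>The compatibility required of a cochain is the law that a multiplier commutes with
  multiplication by idempotents.\<close>

lemma \<Gamma>1_cochain: assumes f: "f \<in> C1" shows "cochain1 (\<Gamma>1 f)"
  unfolding cochain1_def
proof (intro ballI conjI impI)
  fix u assume u: "u \<in> carrier U"
  note s = A.center_ideal_setD[OF I1_ideal[of "j u"]]
  note sm = A.subsemigroup_multipliers[OF s(4)]
  have m: "f [j u] \<in> Units (Mu (I1 (j u)))" using f u by (simp add: C1_iff)
  have mem: "\<iota> (rr w) \<in> A.E \<and> \<iota> (rr w) \<in> I1 (j u)" if "w \<in> carrier U" "j w = j u" for w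
    using that E_center[of "rr w"] inv_E[of "rr w"] unfolding I1_def by auto
  note e = mem[OF u refl]
  have l: "lmul (f [j u]) (\<iota> (rr u)) \<in> I1 (j u)" using sm(2)[OF m] e by blast
  then show "\<Gamma>1 f u \<in> Z" using i_Z_iff s(1,2) by (simp add: \<Gamma>1_def)
  have "rr (\<Gamma>1 f u) = i (A.rr (lmul (f [j u]) (\<iota> (rr u))))" using s(2)[OF l] by (simp add: \<Gamma>1_def i_rr)
  then show "rr (\<Gamma>1 f u) = rr u" using sm(3)[OF m] e u inv_props[of "rr u"] by simp
  fix v assume v: "v \<in> carrier U" "j v = j u" and le: "rr v \<otimes> rr u = rr v"
  note e' = mem[OF v]
  have "\<iota> (rr v) = \<iota> (rr v) \<otimes>\<^bsub>A\<^esub> \<iota> (rr u)" using u v inv_mult[of "rr v" "rr u"] by (simp add: le)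
  then have "lmul (f [j u]) (\<iota> (rr v)) = \<iota> (rr v) \<otimes>\<^bsub>A\<^esub> lmul (f [j u]) (\<iota> (rr u))"
    using sm(4)[OF m, of "\<iota> (rr u)" "\<iota> (rr v)"] e e' by simp
  then show "\<Gamma>1 f v = rr v \<otimes> \<Gamma>1 f u" using v inv_props[of "rr v"] s(2)[OF l] by (simp add: \<Gamma>1_def i_mult)
qed

lemma \<Gamma>2_cochain: assumes f: "f \<in> C2" shows "cochain2 (\<Gamma>2 f)"
  unfolding cochain2_def
proof (intro ballI conjI impI)
  fix u v assume u: "u \<in> carrier U" "v \<in> carrier U"
  note s = A.center_ideal_setD[OF I2_ideal[of "j u" "j v"]]
  note sm = A.subsemigroup_multipliers[OF s(4)]
  have m: "f [j u, j v] \<in> Units (Mu (I2 (j u) (j v)))" using f u by (simp add: C2_iff)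
  have mem: "\<iota> (rr (w \<otimes> t)) \<in> A.E \<and> \<iota> (rr (w \<otimes> t)) \<in> I2 (j u) (j v)"
    if "w \<in> carrier U" "t \<in> carrier U" "j w = j u" "j t = j v" for w t
    using that E_center[of "rr (w \<otimes> t)"] inv_E[of "rr (w \<otimes> t)"] unfolding I2_def by (auto simp: m_closed)
  note e = mem[OF u refl refl]
  have c: "u \<otimes> v \<in> carrier U" using u by (simp add: m_closed)
  have l: "lmul (f [j u, j v]) (\<iota> (rr (u \<otimes> v))) \<in> I2 (j u) (j v)" using sm(2)[OF m] e by blast
  then show "\<Gamma>2 f u v \<in> Z" using i_Z_iff s(1,2) by (simp add: \<Gamma>2_def)
  have "rr (\<Gamma>2 f u v) = i (A.rr (lmul (f [j u, j v]) (\<iota> (rr (u \<otimes> v)))))" using s(2)[OF l] by (simp add: \<Gamma>2_def i_rr)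
  then show "rr (\<Gamma>2 f u v) = rr (u \<otimes> v)" using sm(3)[OF m] e c inv_props[of "rr (u \<otimes> v)"] by simp
  fix u' v' assume v: "u' \<in> carrier U" "v' \<in> carrier U" "j u' = j u" "j v' = j v"
    and le: "rr (u' \<otimes> v') \<otimes> rr (u \<otimes> v) = rr (u' \<otimes> v')"
  note e' = mem[OF v]
  have c': "u' \<otimes> v' \<in> carrier U" using v by (simp add: m_closed)
  have "\<iota> (rr (u' \<otimes> v')) = \<iota> (rr (u' \<otimes> v')) \<otimes>\<^bsub>A\<^esub> \<iota> (rr (u \<otimes> v))"
    using c c' inv_mult[of "rr (u' \<otimes> v')" "rr (u \<otimes> v)"] by (simp add: le)
  then have "lmul (f [j u, j v]) (\<iota> (rr (u' \<otimes> v'))) = \<iota> (rr (u' \<otimes> v')) \<otimes>\<^bsub>A\<^esub> lmul (f [j u, j v]) (\<iota> (rr (u \<otimes> v)))"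
    using sm(4)[OF m, of "\<iota> (rr (u \<otimes> v))" "\<iota> (rr (u' \<otimes> v'))"] e e' by simp
  then show "\<Gamma>2 f u' v' = rr (u' \<otimes> v') \<otimes> \<Gamma>2 f u v"
    using v c' inv_props[of "rr (u' \<otimes> v')"] s(2)[OF l] by (simp add: \<Gamma>2_def i_mult)
qed

lemma \<Gamma>1_surj: assumes p: "cochain1 \<phi>" obtains f where "f \<in> C1" "\<And>u. u \<in> carrier U \<Longrightarrow> \<Gamma>1 f u = \<phi> u"
proof -
  have "\<exists>m\<in>Units (Mu (I1 x)). \<forall>u\<in>{u \<in> carrier U. j u = x}. i (lmul m (\<iota> (rr u))) = \<phi> u" for x
  proof (rule exists_multiplier)
    show "I1 x = {a \<in> sg_center A. \<exists>u\<in>{u \<in> carrier U. j u = x}. rr u = i (A.rr a)}" by (auto simp: I1_def)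
  qed (use cochain1D(1-3)[OF p] in \<open>auto simp: I1_ideal\<close>)
  then obtain m where m: "\<And>x. m x \<in> Units (Mu (I1 x))"
    "\<And>x u. \<lbrakk>u \<in> carrier U; j u = x\<rbrakk> \<Longrightarrow> i (lmul (m x) (\<iota> (rr u))) = \<phi> u" by (simp, metis)
  define f where "f = (\<lambda>xs\<in>tuples G (Suc 0). m (hd xs))"
  have fx: "f [x] = m x" if "x \<in> carrier G" for x unfolding f_def tuples_1 using that by auto
  show thesis
  proof (rule that)
    show "f \<in> C1" unfolding C1_iff using m(1) fx by (auto simp: f_def)
    show "\<Gamma>1 f u = \<phi> u" if "u \<in> carrier U" for u using that m(2) fx by (simp add: \<Gamma>1_def)
  qed
qed

lemma \<Gamma>2_surj: assumes p: "cochain2 \<gamma>"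
  obtains f where "f \<in> C2" "\<And>u v. \<lbrakk>u \<in> carrier U; v \<in> carrier U\<rbrakk> \<Longrightarrow> \<Gamma>2 f u v = \<gamma> u v"
proof -
  let ?P = "\<lambda>x y. {p. fst p \<in> carrier U \<and> snd p \<in> carrier U \<and> j (fst p) = x \<and> j (snd p) = y}"
  define Q where "Q x y m \<longleftrightarrow> m \<in> Units (Mu (I2 x y)) \<and>
    (\<forall>p\<in>?P x y. i (lmul m (\<iota> (rr (fst p \<otimes> snd p)))) = \<gamma> (fst p) (snd p))" for x y m
  have "\<exists>m\<in>Units (Mu (I2 x y)). \<forall>p\<in>?P x y. i (lmul m (\<iota> (rr (fst p \<otimes> snd p)))) = \<gamma> (fst p) (snd p)" for x y
  proof (rule exists_multiplier)
    show "I2 x y = {a \<in> sg_center A. \<exists>p\<in>?P x y. rr (fst p \<otimes> snd p) = i (A.rr a)}" by (auto simp: I2_def)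
  qed (use cochain2D(1-3)[OF p] in \<open>auto simp: I2_ideal m_closed\<close>)
  then have "\<forall>x y. \<exists>m. Q x y m" unfolding Q_def by blast
  then obtain m where Q: "\<And>x y. Q x y (m x y)" by metis
  have m: "m x y \<in> Units (Mu (I2 x y))" for x y using Q unfolding Q_def by blast
  have m2: "i (lmul (m (j u) (j v)) (\<iota> (rr (u \<otimes> v)))) = \<gamma> u v" if "u \<in> carrier U" "v \<in> carrier U" for u v
    using Q[of "j u" "j v"] that unfolding Q_def by force
  define f where "f = (\<lambda>xs\<in>tuples G 2. m (hd xs) (hd (tl xs)))"
  have fx: "f [x, y] = m x y" if "x \<in> carrier G" "y \<in> carrier G" for x y unfolding f_def tuples_2 using that by auto
  show thesis
  proof (rule that)
    show "f \<in> C2" unfolding C2_iff using m fx by (auto simp: f_def)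
    show "\<Gamma>2 f u v = \<gamma> u v" if "u \<in> carrier U" "v \<in> carrier U" for u v
      using that m2 fx by (simp add: \<Gamma>2_def)
  qed
qed

text \<open>Every idempotent of \<open>I2 x y\<close> is the idempotent of some product
  \<open>u v\<close>, and a unit multiplier is determined by its values at idempotents.\<close>

lemma \<Gamma>2_inj: assumes c: "c \<in> C2" "d \<in> C2"
  and eq: "\<And>u v. \<lbrakk>u \<in> carrier U; v \<in> carrier U\<rbrakk> \<Longrightarrow> \<Gamma>2 c u v = \<Gamma>2 d u v"
  shows "c = d"
proof (rule extensionalityI)
  show "c \<in> extensional (tuples G 2)" "d \<in> extensional (tuples G 2)" using c by (simp_all add: C2_iff)
  fix xs assume "xs \<in> tuples G 2"
  then obtain x y where xs: "xs = [x, y]" "x \<in> carrier G" "y \<in> carrier G" by (auto simp: tuples_2)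
  note s = A.center_ideal_setD[OF I2_ideal[of x y]]
  note sm = A.subsemigroup_multipliers[OF s(4)]
  have m: "c [x, y] \<in> Units (Mu (I2 x y))" "d [x, y] \<in> Units (Mu (I2 x y))" using c xs by (simp_all add: C2_iff)
  show "c xs = d xs" unfolding xs(1)
  proof (rule sm(8)[OF m])
    fix e assume e: "e \<in> A.E" "e \<in> I2 x y"
    then obtain u v where u: "u \<in> carrier U" "v \<in> carrier U" "j u = x" "j v = y" "rr (u \<otimes> v) = i e" by (auto simp: I2_def)
    have "\<iota> (rr (u \<otimes> v)) = e" unfolding u(5) using e by (simp add: inv_i)
    then have "i (lmul (c [x, y]) e) = i (lmul (d [x, y]) e)" using eq[OF u(1,2)] u by (simp add: \<Gamma>2_def)
    then show "lmul (c [x, y]) e = lmul (d [x, y]) e" using sm(2)[OF m(1) e(2)] sm(2)[OF m(2) e(2)] s(2) by (simp add: i_inj)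
  qed
qed

end

section \<open>The coboundary formulas evaluated in the encoding\<close>

context kernel_ext
begin

text \<open>Seen in \<open>U\<close>, a unit multiplier acts on \<open>b\<close> as multiplication
  by its value at the idempotent of \<open>b\<close>. This turns the nested applications in the
  coboundary formula into products in \<open>Z\<close>.\<close>

lemma multiplier_apply:
  assumes I: "A.center_ideal_set I" and m: "m \<in> Units (Mu I)" and b: "b \<in> I"
  shows "rmul b m \<in> I" "i (rmul b m) = i b \<otimes> i (lmul m (\<iota> (rr (i b))))" "rr (i (rmul b m)) = rr (i b)"
    "lmul m b = rmul b m"
    "rmul b (inv\<^bsub>Mu I\<^esub> m) \<in> I" "i (rmul b (inv\<^bsub>Mu I\<^esub> m)) = i b \<otimes> iv (i (lmul m (\<iota> (rr (i b)))))"
    "rr (i (rmul b (inv\<^bsub>Mu I\<^esub> m))) = rr (i b)"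
proof -
  note s = A.center_ideal_setD[OF I]
  note sm = A.subsemigroup_multipliers[OF s(4)]
  interpret MI: monoid "Mu I" by (rule sm(1))
  have n: "inv\<^bsub>Mu I\<^esub> m \<in> Units (Mu I)" using m by simp
  have e: "\<iota> (rr (i b)) = A.rr b" "A.rr b \<in> A.E" "A.rr b \<in> I"
    using s(2,5)[OF b] by (simp_all add: inv_rr inv_i)
  have bc: "b \<in> carrier A" using s(2)[OF b] .
  let ?t = "lmul m (A.rr b)"
  have t: "?t \<in> I" "?t \<in> carrier A" "A.rr ?t = A.rr b" using sm(2)[OF m e(3)] s(2) sm(3)[OF m e(2,3)] by auto
  have r: "rmul b m = b \<otimes>\<^bsub>A\<^esub> ?t" "lmul m b = ?t \<otimes>\<^bsub>A\<^esub> b" using sm(5)[OF m b] by simp_all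
  show "rmul b m \<in> I" using sm(2)[OF m b] by simp
  show "lmul m b = rmul b m" unfolding r using A.center_comm[OF s(1)[OF b] t(2)] by simp
  show 1: "i (rmul b m) = i b \<otimes> i (lmul m (\<iota> (rr (i b))))" unfolding e(1) r using bc t by (simp add: i_mult)
  have bt: "i b \<in> Z" "i ?t \<in> Z" using s(1)[OF b] s(1)[OF t(1)] bc t i_Z_iff by simp_all
  have rt: "rr (i ?t) = rr (i b)" using t bc by (simp flip: i_rr)
  show "rr (i (rmul b m)) = rr (i b)" unfolding 1 e(1) using bt rt bc by (simp add: rr_Z E_idem)
  have rn: "rmul b (inv\<^bsub>Mu I\<^esub> m) = b \<otimes>\<^bsub>A\<^esub> A.iv ?t" using sm(5)[OF n b] sm(6)[OF m e(2,3)] by simp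
  show "rmul b (inv\<^bsub>Mu I\<^esub> m) \<in> I" using sm(2)[OF n b] by simp
  show 2: "i (rmul b (inv\<^bsub>Mu I\<^esub> m)) = i b \<otimes> iv (i (lmul m (\<iota> (rr (i b)))))"
    unfolding e(1) rn using bc t by (simp add: i_mult i_iv)
  show "rr (i (rmul b (inv\<^bsub>Mu I\<^esub> m))) = rr (i b)" unfolding 2 e(1) using bt rt bc by (simp add: rr_Z E_idem)
qed

text \<open>Passing from \<open>w\<close> to \<open>u\<close> inserts a factor from
  \<open>N\<close>, which merely restricts \<open>z\<close> to the idempotent that it already
  has.\<close>

lemma cj_match: assumes "u \<in> carrier U" "w \<in> carrier U" "j u = j w" "rr u = rr w" and z: "z \<in> Z" "rr z = rr w"
  shows "cj (iv u) z = cj (iv w) z"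
proof -
  note f = factor[OF assms(1-4)]
  define c where "c = u \<otimes> iv w"
  have c: "u = c \<otimes> w" "c \<in> N" "rr c = rr u" using f by (simp_all add: c_def)
  have "cj (iv u) z = cj (iv w \<otimes> iv c) z" unfolding c(1) using c assms(2) by (simp add: iv_mult)
  also have "\<dots> = cj (iv w) (cj (iv c) z)" by (rule cj_mult) (use c z assms(2) Z_closed in simp_all)
  also have "cj (iv c) z = z \<otimes> rr c" using c z by (simp add: cj_N_Z)
  also have "\<dots> = z" unfolding c(3) assms(4) z(2)[symmetric] using z(1) by simp
  finally show ?thesis .
qed

text \<open>Any \<open>w\<close> of degree \<open>x\<close> over the right idempotent computes the
  action. By \<open>cj_match\<close> the preimage does not depend on it, so the description in
  \<open>pm_inv\<close> has exactly one solution.\<close>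

lemma center_action_eval:
  assumes x: "x \<in> carrier G" and w: "w \<in> carrier U" "j w = x" and a: "a \<in> sg_center A"
  shows "rr (iv w) = rr (i a) \<Longrightarrow> the (\<Theta> x a) = \<iota> (cj w (i a))"
    and "rr w = rr (i a) \<Longrightarrow> pm_inv (\<Theta> x) a = \<iota> (cj (iv w) (i a))"
proof -
  have ac: "a \<in> carrier A" "i a \<in> Z" using a A.center_closed i_Z_iff by auto
  have c: "\<iota> z \<in> sg_center A" "i (\<iota> z) = z" if "z \<in> Z" for z
    using that inv_props[of z] i_Z_iff[of "\<iota> z"] by simp_all
  show "the (\<Theta> x a) = \<iota> (cj w (i a))" if r: "rr (iv w) = rr (i a)"
  proof -
    have "\<Theta> x a = Some (\<iota> (cj w (i a)))"
      unfolding center_action_iff[OF x] using a w r ac c[of "cj w (i a)"] by (auto simp: i_rr)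
    then show ?thesis by simp
  qed
  show "pm_inv (\<Theta> x) a = \<iota> (cj (iv w) (i a))" if r: "rr w = rr (i a)"
    unfolding pm_inv_def
  proof (rule the_equality)
    let ?z = "cj (iv w) (i a)"
    have z: "?z \<in> Z" using ac w by simp
    have "rr ?z = rr (iv w)" using ac w by (simp add: rr_cj flip: r)
    moreover have "cj w ?z = i a" using cj_cj_iv[OF w(1) i_N[OF ac(1)]] r by simp
    ultimately show "\<Theta> x (\<iota> ?z) = Some a"
      unfolding center_action_iff[OF x] using a w ac c[OF z] by (auto simp: i_rr A.center_closed)
    fix b assume "\<Theta> x b = Some a"
    then obtain u where b: "b \<in> sg_center A" and u: "u \<in> carrier U" "j u = x" "rr (iv u) = i (A.rr b)" "i a = cj u (i b)"
      unfolding center_action_iff[OF x] by blast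
    have bc: "b \<in> carrier A" "i b \<in> Z" using b A.center_closed i_Z_iff by auto
    have rb: "rr (i b) = rr (iv u)" using u bc by (simp add: i_rr)
    have "rr (i a) = cj u (rr (i b))" unfolding u(4) using bc u(1) by (simp add: rr_cj)
    also have "\<dots> = rr u" unfolding rb using u(1) by simp
    finally have ru: "rr (i a) = rr u" .
    have "i b = cj (iv u) (i a)" unfolding u(4) using cj_cj_iv[of "iv u" "i b"] u(1) rb bc(1) by simp
    also have "\<dots> = ?z" by (rule cj_match) (use u w r ru ac in simp_all)
    finally show "b = \<iota> ?z" using inv_i[OF bc(1)] by simp
  qed
qed

text \<open>This evaluates the leading factor of the coboundary. \<open>z\<close> is a cochain value
  at a possibly larger idempotent; the domain idempotent of \<open>w\<close> restricts it and is
  then absorbed by the conjugation.\<close>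

lemma twisted_apply:
  assumes x: "x \<in> carrier G" and w: "w \<in> carrier U" "j w = x" and a: "a \<in> sg_center A" and r: "rr w = rr (i a)"
    and I: "A.center_ideal_set I" and m: "m \<in> Units (Mu I)" and mem: "\<iota> (rr (iv w)) \<in> I"
    and z: "z \<in> Z" "i (lmul m (\<iota> (rr (iv w)))) = rr (iv w) \<otimes> z"
  defines "b \<equiv> the (\<Theta> x (rmul (pm_inv (\<Theta> x) a) m))"
  shows "b \<in> sg_center A" "i b = i a \<otimes> cj w z" "rr (i b) = rr w"
proof -
  note s = A.center_ideal_setD[OF I]
  have ac: "a \<in> carrier A" "i a \<in> Z" using a A.center_closed i_Z_iff by auto
  let ?z0 = "cj (iv w) (i a)"
  define a0 where "a0 = pm_inv (\<Theta> x) a"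
  have z0: "?z0 \<in> Z" using ac w by simp
  have r0: "rr ?z0 = rr (iv w)" using ac w by (simp add: rr_cj flip: r)
  have "a0 = \<iota> ?z0" unfolding a0_def by (rule center_action_eval(2)[OF x w a r])
  then have a0: "a0 \<in> carrier A" "i a0 = ?z0" using inv_props[of ?z0] z0 by simp_all
  then have "a0 \<in> sg_center A" using z0 i_Z_iff[OF a0(1)] unfolding a0(2) by simp
  moreover have "A.rr a0 = \<iota> (rr (iv w))"
    using a0 inv_i[of "A.rr a0"] by (simp add: i_rr r0)
  ultimately have a0I: "a0 \<in> I" using s(6)[of a0] mem by simp
  note ma = multiplier_apply[OF I m a0I]
  define a1 where "a1 = rmul a0 m"
  have ra0: "rr (i a0) = rr (iv w)" using a0 r0 by simp
  have a1: "a1 \<in> I" "rr (i a1) = rr (iv w)" "i a1 = ?z0 \<otimes> (rr (iv w) \<otimes> z)"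
    using ma(1-3) by (simp_all add: a1_def a0 r0 z(2))
  have a1c: "a1 \<in> sg_center A" "a1 \<in> carrier A" "i a1 \<in> Z" using a1(1) s(1,2) i_Z_iff by auto
  have "b = \<iota> (cj w (i a1))" unfolding b_def a0_def[symmetric] a1_def[symmetric]
    by (rule center_action_eval(1)[OF x w a1c(1)]) (simp only: a1(2))
  then have b: "b \<in> carrier A" "i b = cj w (i a1)" using inv_props[of "cj w (i a1)"] a1c w by simp_all
  then show "b \<in> sg_center A" using a1c w i_Z_iff[of b] by simp
  have "rr (i b) = cj w (rr (i a1))" using a1c w by (simp add: b rr_cj)
  then show "rr (i b) = rr w" unfolding a1(2) using w by simp
  have "i b = cj w ?z0 \<otimes> cj w (rr (iv w) \<otimes> z)" unfolding b(2) a1(3) using w z z0 by (intro cj_mult_N) simp_all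
  also have "cj w ?z0 = i a" using cj_cj_iv[OF w(1) i_N[OF ac(1)]] r by simp
  also have "cj w (rr (iv w) \<otimes> z) = cj w z" using w z by (simp add: cj_absorb_left)
  finally show "i b = i a \<otimes> cj w z" .
qed

text \<open>The signs: the only inner face has exponent -1, the last term exponent 1.\<close>

lemma coboundary1_eq: assumes x: "x \<in> carrier G" "y \<in> carrier G" and f: "f \<in> C1"
  shows "coboundary B G \<Theta> (Suc 0) f [x, y] = (let h = \<lambda>a\<in>I2 x y.
    rmul (rmul (the (\<Theta> x (rmul (pm_inv (\<Theta> x) a) (f [y])))) (inv\<^bsub>Mu (I1 (x \<otimes>\<^bsub>G\<^esub> y))\<^esub> (f [x \<otimes>\<^bsub>G\<^esub> y]))) (f [x])
    in (h, h))"
proof -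
  have m: "f [z] \<in> Units (Mu (I1 z))" if "z \<in> carrier G" for z using f that by (simp add: C1_iff)
  have mon: "monoid (Mu (I1 z))" for z
    by (rule A.subsemigroup_multipliers(1)[OF A.center_ideal_setD(4)[OF I1_ideal]])
  note pow = Units_int_pow[OF mon m]
  have "[x, y] \<in> tuples G (Suc (Suc 0))" using x by (simp add: tuples_def)
  then show ?thesis using x
    by (simp add: coboundary_def Let_def cochain_ideal_2 cochain_mult_1 face_def pow)
qed

text \<open>The signs: the inner faces have exponents -1 and 1, the last term exponent -1.\<close>

lemma coboundary2_eq: assumes x: "x \<in> carrier G" "y \<in> carrier G" "z \<in> carrier G" and f: "f \<in> C2"
  shows "coboundary B G \<Theta> 2 f [x, y, z] = (let h = \<lambda>a\<in>I3 x y z.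
    rmul (rmul (rmul (the (\<Theta> x (rmul (pm_inv (\<Theta> x) a) (f [y, z]))))
      (inv\<^bsub>Mu (I2 (x \<otimes>\<^bsub>G\<^esub> y) z)\<^esub> (f [x \<otimes>\<^bsub>G\<^esub> y, z]))) (f [x, y \<otimes>\<^bsub>G\<^esub> z])) (inv\<^bsub>Mu (I2 x y)\<^esub> (f [x, y]))
    in (h, h))"
proof -
  have m: "f [z, w] \<in> Units (Mu (I2 z w))" if "z \<in> carrier G" "w \<in> carrier G" for z w using f that by (simp add: C2_iff)
  have mon: "monoid (Mu (I2 z w))" for z w
    by (rule A.subsemigroup_multipliers(1)[OF A.center_ideal_setD(4)[OF I2_ideal]])
  note pow = Units_int_pow[OF mon m]
  have "[x, y, z] \<in> tuples G (Suc 2)" using x by (simp add: tuples_def)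
  then show ?thesis using x
    by (simp add: coboundary_def Let_def cochain_ideal_3 cochain_mult_2 face_def pow upt_conv_Cons numeral_2_eq_2 numeral_3_eq_3)
qed

lemma I1_mem: assumes "u \<in> carrier U" "rr u = rr (i a)" "a \<in> sg_center A" shows "a \<in> I1 (j u)"
  using assms A.center_closed[OF assms(3)] by (auto simp: I1_def i_rr)

lemma I2_mem: assumes "u \<in> carrier U" "v \<in> carrier U" "rr (u \<otimes> v) = rr (i a)" "a \<in> sg_center A" shows "a \<in> I2 (j u) (j v)"
  using assms A.center_closed[OF assms(4)] by (auto simp: I2_def i_rr)

text \<open>A central element at the idempotent of \<open>u v\<close> has to be acted on by an
  element with exactly this range idempotent, while that of \<open>u\<close> may be larger.\<close>

lemma restrict_to: assumes u: "u \<in> carrier U" "v \<in> carrier U"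
  defines "w \<equiv> rr (u \<otimes> v) \<otimes> u"
  shows "w \<in> carrier U" "j w = j u" "rr w = rr (u \<otimes> v)" "rr (w \<otimes> v) = rr (u \<otimes> v)"
    "rr (rr (iv w) \<otimes> v) = rr (iv w)" "\<And>z. z \<in> Z \<Longrightarrow> cj w z = rr (u \<otimes> v) \<otimes> cj u z"
proof -
  have c: "u \<otimes> v \<in> carrier U" using u by (simp add: m_closed)
  show w: "w \<in> carrier U" "j w = j u" using u c by (simp_all add: w_def m_closed)
  have "rr w = rr u \<otimes> rr (u \<otimes> v)" using u c idempotent_comm[of "rr u" "rr (u \<otimes> v)"] by (simp add: w_def rr_E_mult)
  then show r: "rr w = rr (u \<otimes> v)" using u by (simp add: rr_mult_le)
  have "w \<otimes> v = u \<otimes> v" using u c by (simp add: w_def m_assoc)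
  then show "rr (w \<otimes> v) = rr (u \<otimes> v)" by simp
  have "rr (iv w) \<otimes> v = iv w \<otimes> (w \<otimes> v)" using w u by (simp add: rng_def m_assoc)
  then have "rr (rr (iv w) \<otimes> v) = cj (iv w) (rr (w \<otimes> v))" using w u by (simp add: rr_mult m_closed)
  also have "\<dots> = rr (iv w)" using \<open>w \<otimes> v = u \<otimes> v\<close> r w by (simp flip: r)
  finally show "rr (rr (iv w) \<otimes> v) = rr (iv w)" .
  fix z assume z: "z \<in> Z"
  have "cj w z = cj (rr (u \<otimes> v)) (cj u z)" unfolding w_def using u c z Z_closed[OF z] by (intro cj_mult) simp_all
  also have "\<dots> = cj u z \<otimes> rr (u \<otimes> v)" using u c z by (simp add: cj_N_Z)
  also have "\<dots> = rr (u \<otimes> v) \<otimes> cj u z" using u c z by (intro Z_mult_comm) simp_all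
  finally show "cj w z = rr (u \<otimes> v) \<otimes> cj u z" .
qed

lemma coboundary1_eval:
  assumes f: "f \<in> C1" and u: "u \<in> carrier U" "v \<in> carrier U" and a: "a \<in> sg_center A" and r: "rr (u \<otimes> v) = rr (i a)"
  shows "fst (coboundary B G \<Theta> (Suc 0) f [j u, j v]) a \<in> carrier A"
    and "i (fst (coboundary B G \<Theta> (Suc 0) f [j u, j v]) a) = i a \<otimes> delta1 (\<Gamma>1 f) u v"
proof -
  note p = \<Gamma>1_cochain[OF f]
  note D = cochain1D[OF p]
  have m: "f [z] \<in> Units (Mu (I1 z))" if "z \<in> carrier G" for z using f that by (simp add: C1_iff)
  have ac: "a \<in> carrier A" "i a \<in> Z" using a A.center_closed i_Z_iff by auto
  have uv: "u \<otimes> v \<in> carrier U" using u by (simp add: m_closed)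
  let ?e = "rr (u \<otimes> v)"
  define w where "w = ?e \<otimes> u"
  note w = restrict_to[OF u, folded w_def]
  \<comment> \<open>\<open>v\<close> cut down to the place where the multiplier of degree
    \<open>j v\<close> is evaluated.\<close>
  let ?v = "rr (iv w) \<otimes> v"
  have v': "?v \<in> carrier U" "j ?v = j v" using w u by (simp_all add: m_closed)
  have mem: "\<iota> (rr (iv w)) \<in> I1 (j v)" using I1_mem[OF v'(1), of "\<iota> (rr (iv w))"] v' w(1,5) E_center[of "rr (iv w)"] inv_props[of "rr (iv w)"] by simp
  have "\<Gamma>1 f ?v = rr (iv w) \<otimes> \<Gamma>1 f v" using D(5)[OF u(2), of "rr (iv w)"] w(1) by simp
  then have z: "i (lmul (f [j v]) (\<iota> (rr (iv w)))) = rr (iv w) \<otimes> \<Gamma>1 f v"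
    using w(5) v' by (simp add: \<Gamma>1_def)
  have rw: "rr w = rr (i a)" using w(3) r by simp
  define b where "b = the (\<Theta> (j u) (rmul (pm_inv (\<Theta> (j u)) a) (f [j v])))"
  have b: "b \<in> sg_center A" "i b = i a \<otimes> cj w (\<Gamma>1 f v)" "rr (i b) = rr w"
    unfolding b_def
    by (rule twisted_apply[OF _ w(1,2) a rw I1_ideal[of "j v"] m mem D(1)[OF u(2)] z]; use u in simp)+
  define b2 where "b2 = rmul b (inv\<^bsub>Mu (I1 (j u \<otimes>\<^bsub>G\<^esub> j v))\<^esub> (f [j u \<otimes>\<^bsub>G\<^esub> j v]))"
  have rb: "rr (i b) = ?e" using b(3) w(3) by simp
  have bI: "b \<in> I1 (j u \<otimes>\<^bsub>G\<^esub> j v)" using I1_mem[OF uv _ b(1)] rb u by simp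
  have juv: "j u \<otimes>\<^bsub>G\<^esub> j v \<in> carrier G" using u by simp
  note ma = multiplier_apply[OF I1_ideal[of "j u \<otimes>\<^bsub>G\<^esub> j v"] m[OF juv] bI, folded b2_def]
  have g: "i (lmul (f [j u \<otimes>\<^bsub>G\<^esub> j v]) (\<iota> ?e)) = \<Gamma>1 f (u \<otimes> v)" using u rb by (simp add: \<Gamma>1_def)
  have b2: "b2 \<in> sg_center A" "i b2 = i b \<otimes> iv (\<Gamma>1 f (u \<otimes> v))" "rr (i b2) = ?e"
    using ma(5-7) A.center_ideal_setD(1)[OF I1_ideal] unfolding g rb by auto
  define b3 where "b3 = rmul b2 (f [j u])"
  have b2I: "b2 \<in> I1 (j u)" using I1_mem[OF w(1) _ b2(1)] w(2,3) b2(3) by simp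
  have ju: "j u \<in> carrier G" using u by simp
  note mb = multiplier_apply[OF I1_ideal[of "j u"] m[OF ju] b2I, folded b3_def]
  have "i (lmul (f [j u]) (\<iota> ?e)) = \<Gamma>1 f w" using w(2,3) by (simp add: \<Gamma>1_def)
  also have "\<dots> = ?e \<otimes> \<Gamma>1 f u" using D(5)[OF u(1), of ?e] uv by (simp add: w_def)
  finally have g': "i (lmul (f [j u]) (\<iota> (rr (i b2)))) = ?e \<otimes> \<Gamma>1 f u" unfolding b2(3) .
  have b3: "b3 \<in> carrier A" "i b3 = i b2 \<otimes> (?e \<otimes> \<Gamma>1 f u)"
    using mb(1,2) A.center_ideal_setD(2)[OF I1_ideal] unfolding g' by auto
  have aI: "a \<in> I2 (j u) (j v)" using I2_mem[OF u r a] .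
  have eq: "fst (coboundary B G \<Theta> (Suc 0) f [j u, j v]) a = b3"
    using aI u f by (simp add: coboundary1_eq Let_def b_def b2_def b3_def)
  show "fst (coboundary B G \<Theta> (Suc 0) f [j u, j v]) a \<in> carrier A" using eq b3 by simp
  have ea: "?e \<otimes> i a = i a" using ac r by simp
  \<comment> \<open>The leading factor and the last one have been restricted to \<open>?e\<close>;
    both restrictions are absorbed by \<open>i a\<close>.\<close>
  have "i b3 = ((?e \<otimes> ?e) \<otimes> i a) \<otimes> (cj u (\<Gamma>1 f v) \<otimes> iv (\<Gamma>1 f (u \<otimes> v)) \<otimes> \<Gamma>1 f u)"
    unfolding b3(2) b2(2) b(2) w(6)[OF D(1)[OF u(2)]]
    using u uv ac D(1) by (simp add: Z_ac)
  also have "\<dots> = i a \<otimes> delta1 (\<Gamma>1 f) u v" using uv ea by (simp add: delta1_def E_idem)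
  finally show "i (fst (coboundary B G \<Theta> (Suc 0) f [j u, j v]) a) = i a \<otimes> delta1 (\<Gamma>1 f) u v" using eq by simp
qed

lemma coboundary2_eval:
  assumes f: "f \<in> C2" and u: "u \<in> carrier U" "v \<in> carrier U" "s \<in> carrier U" and a: "a \<in> sg_center A"
    and r: "rr (u \<otimes> (v \<otimes> s)) = rr (i a)"
  shows "fst (coboundary B G \<Theta> 2 f [j u, j v, j s]) a \<in> carrier A"
    and "i (fst (coboundary B G \<Theta> 2 f [j u, j v, j s]) a) = i a \<otimes> (cj u (\<Gamma>2 f v s) \<otimes> iv (\<Gamma>2 f (u \<otimes> v) s) \<otimes>
      \<Gamma>2 f u (v \<otimes> s) \<otimes> iv (\<Gamma>2 f u v))"
proof -
  note p = \<Gamma>2_cochain[OF f]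
  note D = cochain2D[OF p]
  have m: "f [z, t] \<in> Units (Mu (I2 z t))" if "z \<in> carrier G" "t \<in> carrier G" for z t using f that by (simp add: C2_iff)
  have ac: "a \<in> carrier A" "i a \<in> Z" using a A.center_closed i_Z_iff by auto
  have vs: "v \<otimes> s \<in> carrier U" and uv: "u \<otimes> v \<in> carrier U" using u by (simp_all add: m_closed)
  have uvs: "u \<otimes> (v \<otimes> s) \<in> carrier U" "(u \<otimes> v) \<otimes> s = u \<otimes> (v \<otimes> s)" using u by (simp_all add: m_closed m_assoc)
  have jc: "j u \<in> carrier G" "j v \<in> carrier G" "j s \<in> carrier G" "j u \<otimes>\<^bsub>G\<^esub> j v \<in> carrier G" "j v \<otimes>\<^bsub>G\<^esub> j s \<in> carrier G"
    using u by simp_all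
  let ?e = "rr (u \<otimes> (v \<otimes> s))"
  define w where "w = ?e \<otimes> u"
  note w = restrict_to[OF u(1) vs, folded w_def]
  let ?v = "rr (iv w) \<otimes> v"
  have v': "?v \<in> carrier U" "j ?v = j v" using w u by (simp_all add: m_closed)
  have rv': "rr (?v \<otimes> s) = rr (iv w)" using w(1,5) u by (simp add: m_assoc)
  have mem: "\<iota> (rr (iv w)) \<in> I2 (j v) (j s)"
    using I2_mem[OF v'(1) u(3), of "\<iota> (rr (iv w))"] v' rv' w(1) E_center[of "rr (iv w)"] inv_props[of "rr (iv w)"] by simp
  have "\<Gamma>2 f ?v s = rr (iv w) \<otimes> \<Gamma>2 f v s" using D(5)[OF u(2,3), of "rr (iv w)"] w(1) by simp
  then have z: "i (lmul (f [j v, j s]) (\<iota> (rr (iv w)))) = rr (iv w) \<otimes> \<Gamma>2 f v s"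
    using rv' v' by (simp add: \<Gamma>2_def)
  have rw: "rr w = rr (i a)" using w(3) r by simp
  define b where "b = the (\<Theta> (j u) (rmul (pm_inv (\<Theta> (j u)) a) (f [j v, j s])))"
  have b: "b \<in> sg_center A" "i b = i a \<otimes> cj w (\<Gamma>2 f v s)" "rr (i b) = rr w"
    unfolding b_def
    by (rule twisted_apply[OF jc(1) w(1,2) a rw I2_ideal[of "j v" "j s"] m[OF jc(2,3)] mem D(1)[OF u(2,3)] z])+
  have rb: "rr (i b) = ?e" using b(3) w(3) by simp
  define b2 where "b2 = rmul b (inv\<^bsub>Mu (I2 (j u \<otimes>\<^bsub>G\<^esub> j v) (j s))\<^esub> (f [j u \<otimes>\<^bsub>G\<^esub> j v, j s]))"
  have bI: "b \<in> I2 (j u \<otimes>\<^bsub>G\<^esub> j v) (j s)" using I2_mem[OF uv u(3) _ b(1)] rb u uvs by simp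
  note ma = multiplier_apply[OF I2_ideal m[OF jc(4,3)] bI, folded b2_def]
  have g: "i (lmul (f [j u \<otimes>\<^bsub>G\<^esub> j v, j s]) (\<iota> ?e)) = \<Gamma>2 f (u \<otimes> v) s" using u rb uvs by (simp add: \<Gamma>2_def)
  have b2: "b2 \<in> sg_center A" "i b2 = i b \<otimes> iv (\<Gamma>2 f (u \<otimes> v) s)" "rr (i b2) = ?e"
    using ma(5-7) A.center_ideal_setD(1)[OF I2_ideal] unfolding g rb by auto
  define b3 where "b3 = rmul b2 (f [j u, j v \<otimes>\<^bsub>G\<^esub> j s])"
  have b2I: "b2 \<in> I2 (j u) (j v \<otimes>\<^bsub>G\<^esub> j s)" using I2_mem[OF u(1) vs _ b2(1)] b2(3) u by simp
  note mb = multiplier_apply[OF I2_ideal m[OF jc(1,5)] b2I, folded b3_def]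
  have g': "i (lmul (f [j u, j v \<otimes>\<^bsub>G\<^esub> j s]) (\<iota> (rr (i b2)))) = \<Gamma>2 f u (v \<otimes> s)" using u b2(3) by (simp add: \<Gamma>2_def)
  have b3: "b3 \<in> sg_center A" "i b3 = i b2 \<otimes> \<Gamma>2 f u (v \<otimes> s)" "rr (i b3) = ?e"
    using mb(1-3) A.center_ideal_setD(1)[OF I2_ideal] b2(3) unfolding g' by auto
  \<comment> \<open>The last multiplier belongs to the degrees of \<open>u\<close> and
    \<open>v\<close> but is applied at the smaller idempotent \<open>?e\<close>; \<open>w\<close>
    and \<open>v\<close> exhibit \<open>?e\<close> as the idempotent of a product of these
    degrees.\<close>
  define b4 where "b4 = rmul b3 (inv\<^bsub>Mu (I2 (j u) (j v))\<^esub> (f [j u, j v]))"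
  have rwv: "rr (w \<otimes> v) = ?e"
  proof -
    have "w \<otimes> v = ?e \<otimes> (u \<otimes> v)" using u uvs by (simp add: w_def m_assoc)
    then have "rr (w \<otimes> v) = ?e \<otimes> rr (u \<otimes> v)" using uv uvs by (simp add: rr_E_mult)
    also have "\<dots> = rr (u \<otimes> v) \<otimes> ?e" using uv uvs by (intro idempotent_comm) simp_all
    also have "\<dots> = ?e" using rr_mult_le[OF uv u(3)] uvs by simp
    finally show ?thesis .
  qed
  have b3I: "b3 \<in> I2 (j u) (j v)" using I2_mem[OF w(1) u(2) _ b3(1)] w(2) rwv b3(3) by simp
  note mc = multiplier_apply[OF I2_ideal m[OF jc(1,2)] b3I, folded b4_def]
  have "i (lmul (f [j u, j v]) (\<iota> ?e)) = \<Gamma>2 f w v" using w(2) rwv by (simp add: \<Gamma>2_def)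
  also have "\<dots> = ?e \<otimes> \<Gamma>2 f u v" using D(5)[OF u(1,2), of ?e] uvs by (simp add: w_def)
  finally have g'': "i (lmul (f [j u, j v]) (\<iota> (rr (i b3)))) = ?e \<otimes> \<Gamma>2 f u v" unfolding b3(3) .
  have b4: "b4 \<in> carrier A" "i b4 = i b3 \<otimes> iv (?e \<otimes> \<Gamma>2 f u v)"
    using mc(5,6) A.center_ideal_setD(2)[OF I2_ideal] unfolding g'' by auto
  have aI: "a \<in> I3 (j u) (j v) (j s)" unfolding I3_def using u a r ac by (auto simp: i_rr)
  have eq: "fst (coboundary B G \<Theta> 2 f [j u, j v, j s]) a = b4"
    using aI u f by (simp add: coboundary2_eq Let_def b_def b2_def b3_def b4_def)
  show "fst (coboundary B G \<Theta> 2 f [j u, j v, j s]) a \<in> carrier A" using eq b4 by simp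
  have ea: "?e \<otimes> i a = i a" using ac r by simp
  have "i b4 = ((?e \<otimes> ?e) \<otimes> i a) \<otimes> (cj u (\<Gamma>2 f v s) \<otimes> iv (\<Gamma>2 f (u \<otimes> v) s) \<otimes> \<Gamma>2 f u (v \<otimes> s) \<otimes> iv (\<Gamma>2 f u v))"
    unfolding b4(2) b3(2) b2(2) b(2) w(6)[OF D(1)[OF u(2,3)]]
    using u uv vs uvs(1) ac D(1) by (simp add: Z_ac iv_mult)
  also have "(?e \<otimes> ?e) \<otimes> i a = i a" using uvs ea by (simp add: E_idem)
  finally show "i (fst (coboundary B G \<Theta> 2 f [j u, j v, j s]) a) = i a \<otimes> (cj u (\<Gamma>2 f v s) \<otimes> iv (\<Gamma>2 f (u \<otimes> v) s) \<otimes>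
      \<Gamma>2 f u (v \<otimes> s) \<otimes> iv (\<Gamma>2 f u v))" using eq by simp
qed

lemma monoid_Mu: "A.center_ideal_set I \<Longrightarrow> monoid (Mu I)"
  by (rule A.subsemigroup_multipliers(1)[OF A.center_ideal_setD(4)])

lemma group_C1: "group (cochains B G \<Theta> (Suc 0))" and group_C2: "group (cochains B G \<Theta> 2)"
  unfolding cochains_def
  by (rule product_group;
      force simp: tuples_1 tuples_2 cochain_mult_1 cochain_mult_2 intro: monoid.units_group monoid_Mu I1_ideal I2_ideal)+

text \<open>In place of a check of the multiplier laws for the formula, surjectivity of
  \<open>\<Gamma>2\<close> supplies a cochain with the expected values, and the formula is shown to
  coincide with it.\<close>

lemma coboundary1: assumes f: "f \<in> C1"
  shows "coboundary B G \<Theta> (Suc 0) f \<in> C2"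
    and "\<And>u v. \<lbrakk>u \<in> carrier U; v \<in> carrier U\<rbrakk> \<Longrightarrow> \<Gamma>2 (coboundary B G \<Theta> (Suc 0) f) u v = delta1 (\<Gamma>1 f) u v"
proof -
  let ?d = "coboundary B G \<Theta> (Suc 0) f"
  obtain c where c: "c \<in> C2" "\<And>u v. \<lbrakk>u \<in> carrier U; v \<in> carrier U\<rbrakk> \<Longrightarrow> \<Gamma>2 c u v = delta1 (\<Gamma>1 f) u v"
    using \<Gamma>2_surj[OF delta1_cochain2[OF \<Gamma>1_cochain[OF f]]] by blast
  have "?d = c"
  proof (rule extensionalityI)
    show "?d \<in> extensional (tuples G 2)" by (simp add: coboundary_def numeral_2_eq_2)
    show "c \<in> extensional (tuples G 2)" using c by (simp add: C2_iff)
    fix xs assume "xs \<in> tuples G 2"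
    then obtain x y where xs: "xs = [x, y]" "x \<in> carrier G" "y \<in> carrier G" by (auto simp: tuples_2)
    note s = A.center_ideal_setD[OF I2_ideal[of x y]]
    have m: "c [x, y] \<in> Units (Mu (I2 x y))" using c xs by (simp add: C2_iff)
    have ext: "fst (c [x, y]) \<in> extensional (I2 x y)" "snd (c [x, y]) \<in> extensional (I2 x y)"
      using A.subsemigroup_multipliers(10)[OF s(4) m] by auto
    obtain h where h: "?d [x, y] = (h, h)" "h \<in> extensional (I2 x y)"
      unfolding coboundary1_eq[OF xs(2,3) f] Let_def by (metis restrict_extensional)
    have eq: "h a = rmul a (c [x, y])" if a: "a \<in> I2 x y" for a
    proof -
      obtain u v where u: "u \<in> carrier U" "v \<in> carrier U" "j u = x" "j v = y" "rr (u \<otimes> v) = i (A.rr a)"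
        using a by (auto simp: I2_def)
      have r: "rr (u \<otimes> v) = rr (i a)" using u(5) s(2)[OF a] by (simp add: i_rr)
      note ev = coboundary1_eval[OF f u(1,2) s(1)[OF a] r]
      note ma = multiplier_apply[OF I2_ideal m a]
      have "i (h a) = i (rmul a (c [x, y]))"
        using ev(2) ma(2) c(2)[OF u(1,2)] h u r by (simp add: \<Gamma>2_def)
      then show ?thesis using ev(1) ma(1) s(2) h u by (simp add: i_inj)
    qed
    have "h = fst (c [x, y])"
      by (rule extensionalityI[OF h(2) ext(1)]) (simp add: eq multiplier_apply(4)[OF I2_ideal m])
    moreover have "h = snd (c [x, y])" by (rule extensionalityI[OF h(2) ext(2)]) (simp add: eq)
    ultimately show "?d xs = c xs" using xs h by (simp add: prod_eq_iff)
  qed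
  then show "?d \<in> C2" "\<And>u v. \<lbrakk>u \<in> carrier U; v \<in> carrier U\<rbrakk> \<Longrightarrow> \<Gamma>2 ?d u v = delta1 (\<Gamma>1 f) u v"
    using c by simp_all
qed

lemma \<Gamma>1_mult: assumes f: "f \<in> C1" "g \<in> C1" and u: "u \<in> carrier U"
  shows "\<Gamma>1 (f \<otimes>\<^bsub>cochains B G \<Theta> (Suc 0)\<^esub> g) u = \<Gamma>1 f u \<otimes> \<Gamma>1 g u"
proof -
  let ?e = "\<iota> (rr u)"
  note s = A.center_ideal_setD[OF I1_ideal[of "j u"]]
  note sm = A.subsemigroup_multipliers[OF s(4)]
  have m: "f [j u] \<in> Units (Mu (I1 (j u)))" "g [j u] \<in> Units (Mu (I1 (j u)))" using f u by (simp_all add: C1_iff)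
  have e: "?e \<in> A.E" "?e \<in> I1 (j u)" using u E_center[of "rr u"] inv_E[of "rr u"] by (auto simp: I1_def)
  have "[j u] \<in> tuples G (Suc 0)" using u by (simp add: tuples_def)
  then have "(f \<otimes>\<^bsub>cochains B G \<Theta> (Suc 0)\<^esub> g) [j u] = f [j u] \<otimes>\<^bsub>Mu (I1 (j u))\<^esub> g [j u]"
    using u by (simp add: cochains_def units_of_def cochain_mult_1)
  then show ?thesis using sm(7)[OF m e] sm(2)[OF m(1) e(2)] sm(2)[OF m(2) e(2)] s(2) by (simp add: \<Gamma>1_def i_mult)
qed

lemma \<Gamma>2_mult: assumes f: "f \<in> C2" "g \<in> C2" and u: "u \<in> carrier U" "v \<in> carrier U"
  shows "\<Gamma>2 (f \<otimes>\<^bsub>cochains B G \<Theta> 2\<^esub> g) u v = \<Gamma>2 f u v \<otimes> \<Gamma>2 g u v"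
proof -
  let ?e = "\<iota> (rr (u \<otimes> v))"
  note s = A.center_ideal_setD[OF I2_ideal[of "j u" "j v"]]
  note sm = A.subsemigroup_multipliers[OF s(4)]
  have m: "f [j u, j v] \<in> Units (Mu (I2 (j u) (j v)))" "g [j u, j v] \<in> Units (Mu (I2 (j u) (j v)))"
    using f u by (simp_all add: C2_iff)
  have "rr (u \<otimes> v) \<in> E" using u by (simp add: m_closed)
  note E = E_center[OF this] inv_E[OF this]
  have e: "?e \<in> A.E" "?e \<in> I2 (j u) (j v)" using u E unfolding I2_def by auto
  have "[j u, j v] \<in> tuples G 2" using u by (simp add: tuples_def)
  then have "(f \<otimes>\<^bsub>cochains B G \<Theta> 2\<^esub> g) [j u, j v] = f [j u, j v] \<otimes>\<^bsub>Mu (I2 (j u) (j v))\<^esub> g [j u, j v]"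
    using u by (simp add: cochains_def units_of_def cochain_mult_2)
  then show ?thesis using sm(7)[OF m e] sm(2)[OF m(1) e(2)] sm(2)[OF m(2) e(2)] s(2) by (simp add: \<Gamma>2_def i_mult)
qed

lemma delta1_mult: assumes p: "cochain1 \<phi>" "cochain1 \<phi>'" and u: "u \<in> carrier U" "v \<in> carrier U"
  shows "delta1 (\<lambda>u. \<phi> u \<otimes> \<phi>' u) u v = delta1 \<phi> u v \<otimes> delta1 \<phi>' u v"
  using u cochain1D(1)[OF p(1)] cochain1D(1)[OF p(2)]
  by (simp add: delta1_def cj_mult_N iv_mult Z_ac m_closed)

text \<open>The coboundary is a homomorphism because \<open>delta1\<close> is multiplicative in the
  encoding and \<open>\<Gamma>2\<close> is injective on cochains.\<close>

lemma coboundaries_subgroup: "subgroup (coboundaries B G \<Theta> 2) (cochains B G \<Theta> 2)"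
proof -
  interpret C1: group "cochains B G \<Theta> (Suc 0)" by (rule group_C1)
  interpret C2: group "cochains B G \<Theta> 2" by (rule group_C2)
  have "coboundary B G \<Theta> (Suc 0) \<in> hom (cochains B G \<Theta> (Suc 0)) (cochains B G \<Theta> 2)"
  proof (rule homI)
    show "coboundary B G \<Theta> (Suc 0) f \<in> C2" if "f \<in> C1" for f by (rule coboundary1(1)[OF that])
    fix f g assume f: "f \<in> C1" "g \<in> C1"
    have fg: "f \<otimes>\<^bsub>cochains B G \<Theta> (Suc 0)\<^esub> g \<in> C1" using f by (rule C1.m_closed)
    note d = coboundary1[OF f(1)] coboundary1[OF f(2)] coboundary1[OF fg]
    have "\<Gamma>2 (coboundary B G \<Theta> (Suc 0) (f \<otimes>\<^bsub>cochains B G \<Theta> (Suc 0)\<^esub> g)) u v =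
        \<Gamma>2 (coboundary B G \<Theta> (Suc 0) f \<otimes>\<^bsub>cochains B G \<Theta> 2\<^esub> coboundary B G \<Theta> (Suc 0) g) u v"
      if u: "u \<in> carrier U" "v \<in> carrier U" for u v
    proof -
      have "delta1 (\<Gamma>1 (f \<otimes>\<^bsub>cochains B G \<Theta> (Suc 0)\<^esub> g)) u v = delta1 (\<lambda>u. \<Gamma>1 f u \<otimes> \<Gamma>1 g u) u v"
        using u f by (simp add: delta1_def \<Gamma>1_mult m_closed)
      also have "\<dots> = delta1 (\<Gamma>1 f) u v \<otimes> delta1 (\<Gamma>1 g) u v"
        by (rule delta1_mult[OF \<Gamma>1_cochain[OF f(1)] \<Gamma>1_cochain[OF f(2)] u])
      finally show ?thesis using u d by (simp add: \<Gamma>2_mult)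
    qed
    then show "coboundary B G \<Theta> (Suc 0) (f \<otimes>\<^bsub>cochains B G \<Theta> (Suc 0)\<^esub> g) =
        coboundary B G \<Theta> (Suc 0) f \<otimes>\<^bsub>cochains B G \<Theta> 2\<^esub> coboundary B G \<Theta> (Suc 0) g"
      by (intro \<Gamma>2_inj) (use d C2.m_closed in auto)
  qed
  then interpret h: group_hom "cochains B G \<Theta> (Suc 0)" "cochains B G \<Theta> 2" "coboundary B G \<Theta> (Suc 0)"
    by unfold_locales
  show ?thesis using h.img_is_subgroup by (simp add: coboundaries_def)
qed

text \<open>Multiplying by \<open>c\<close> and \<open>d\<close> removes the inverses.
  \<open>d\<close> may sit above \<open>e\<close>, but \<open>c\<close> sits at \<open>e\<close> and
  cuts it down, so no restriction has to be written in the second equation.\<close>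

lemma Z_cross_cancel:
  assumes Z: "a \<in> Z" "b \<in> Z" "c \<in> Z" "d \<in> Z" and e: "rr a = e" "rr b = e" "rr c = e" "e \<otimes> rr d = e"
  shows "a \<otimes> iv c \<otimes> b \<otimes> iv d = e \<longleftrightarrow> a \<otimes> b = c \<otimes> d"
proof -
  have eE: "e \<in> E" using Z(1) e(1) by auto
  have cd: "c \<otimes> iv c = e" "d \<otimes> iv d = rr d" using Z e by (simp_all add: Z_iv_cancel)
  have ab: "a \<otimes> e = a" "e \<otimes> c = c" using Z e Z_rr[of a] rr_mult_self(1)[of c] by simp_all
  show ?thesis
  proof
    assume h: "a \<otimes> iv c \<otimes> b \<otimes> iv d = e"
    have "a \<otimes> b = (a \<otimes> (e \<otimes> rr d)) \<otimes> b" by (simp add: e(4) ab)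
    also have "\<dots> = (a \<otimes> iv c \<otimes> b \<otimes> iv d) \<otimes> (c \<otimes> d)"
      unfolding cd[symmetric] using Z by (simp add: Z_ac)
    also have "\<dots> = c \<otimes> d" unfolding h using Z eE ab by (simp flip: m_assoc)
    finally show "a \<otimes> b = c \<otimes> d" .
  next
    assume h: "a \<otimes> b = c \<otimes> d"
    have "a \<otimes> iv c \<otimes> b \<otimes> iv d = (a \<otimes> b) \<otimes> (iv c \<otimes> iv d)" using Z by (simp add: Z_ac)
    also have "\<dots> = (c \<otimes> iv c) \<otimes> (d \<otimes> iv d)" unfolding h using Z by (simp add: Z_ac)
    also have "\<dots> = e" unfolding cd by (rule e(4))
    finally show "a \<otimes> iv c \<otimes> b \<otimes> iv d = e" .
  qed
qed

text \<open>The two components of a coboundary are the same map, and so are those of the identity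
  multiplier; one component decides.\<close>

lemma coboundary2_one_iff: assumes c: "c \<in> C2"
  shows "coboundary B G \<Theta> 2 c = \<one>\<^bsub>cochains B G \<Theta> 3\<^esub> \<longleftrightarrow>
    (\<forall>x\<in>carrier G. \<forall>y\<in>carrier G. \<forall>z\<in>carrier G. \<forall>a\<in>I3 x y z. fst (coboundary B G \<Theta> 2 c [x, y, z]) a = a)"
proof -
  have one: "\<one>\<^bsub>cochains B G \<Theta> 3\<^esub> [x, y, z] = (\<lambda>a\<in>I3 x y z. a, \<lambda>a\<in>I3 x y z. a)"
    if "x \<in> carrier G" "y \<in> carrier G" "z \<in> carrier G" for x y z
  proof -
    have "[x, y, z] \<in> tuples G 3" using that by (simp add: tuples_def)
    then show ?thesis using that
      by (simp add: cochains_def units_of_def cochain_mult_3) (simp add: multiplier_monoid_def)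
  qed
  have "coboundary B G \<Theta> 2 c \<in> extensional (tuples G 3)" by (simp add: coboundary_def)
  moreover have "\<one>\<^bsub>cochains B G \<Theta> 3\<^esub> \<in> extensional (tuples G 3)" by (simp add: cochains_def)
  ultimately have "coboundary B G \<Theta> 2 c = \<one>\<^bsub>cochains B G \<Theta> 3\<^esub> \<longleftrightarrow>
      (\<forall>xs\<in>tuples G 3. coboundary B G \<Theta> 2 c xs = \<one>\<^bsub>cochains B G \<Theta> 3\<^esub> xs)"
    by (auto intro: extensionalityI)
  also have "\<dots> \<longleftrightarrow> (\<forall>x\<in>carrier G. \<forall>y\<in>carrier G. \<forall>z\<in>carrier G.
      coboundary B G \<Theta> 2 c [x, y, z] = (\<lambda>a\<in>I3 x y z. a, \<lambda>a\<in>I3 x y z. a))"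
    unfolding tuples_3 by (force simp: one)
  also have "\<dots> \<longleftrightarrow> (\<forall>x\<in>carrier G. \<forall>y\<in>carrier G. \<forall>z\<in>carrier G.
      \<forall>a\<in>I3 x y z. fst (coboundary B G \<Theta> 2 c [x, y, z]) a = a)"
  proof (intro ball_cong refl)
    fix x y z assume x: "x \<in> carrier G" "y \<in> carrier G" "z \<in> carrier G"
    obtain h where h: "coboundary B G \<Theta> 2 c [x, y, z] = (h, h)" "h \<in> extensional (I3 x y z)"
      unfolding coboundary2_eq[OF x c] Let_def by (metis restrict_extensional)
    have "h = (\<lambda>a\<in>I3 x y z. a) \<longleftrightarrow> (\<forall>a\<in>I3 x y z. h a = a)"
      using h(2) by (auto intro!: extensionalityI[OF h(2)] simp: restrict_extensional)
    then show "coboundary B G \<Theta> 2 c [x, y, z] = (\<lambda>a\<in>I3 x y z. a, \<lambda>a\<in>I3 x y z. a) \<longleftrightarrow>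
        (\<forall>a\<in>I3 x y z. fst (coboundary B G \<Theta> 2 c [x, y, z]) a = a)" using h(1) by simp
  qed
  finally show ?thesis .
qed

text \<open>The coboundary multiplies \<open>a\<close> by a value at the idempotent of
  \<open>a\<close>, so \<open>a\<close> cancels and only its idempotent counts. At the idempotent of
  a triple product \<open>u (v s)\<close> the condition becomes the cocycle identity for
  \<open>(u, v, s)\<close>.\<close>

lemma cocycles_iff: "c \<in> cocycles B G \<Theta> 2 \<longleftrightarrow> c \<in> C2 \<and> cocycle2 (\<Gamma>2 c)"
proof -
  have "c \<in> cocycles B G \<Theta> 2 \<longleftrightarrow> c \<in> C2 \<and> coboundary B G \<Theta> 2 c = \<one>\<^bsub>cochains B G \<Theta> 3\<^esub>"
    unfolding cocycles_def kernel_def by (simp add: numeral_3_eq_3 numeral_2_eq_2)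
  moreover have "coboundary B G \<Theta> 2 c = \<one>\<^bsub>cochains B G \<Theta> 3\<^esub> \<longleftrightarrow> cocycle2 (\<Gamma>2 c)" if c: "c \<in> C2"
  proof -
    note p = \<Gamma>2_cochain[OF c] note D = cochain2D(1,2)[OF p]
    have key: "fst (coboundary B G \<Theta> 2 c [j u, j v, j s]) a = a \<longleftrightarrow>
        cj u (\<Gamma>2 c v s) \<otimes> \<Gamma>2 c u (v \<otimes> s) = \<Gamma>2 c (u \<otimes> v) s \<otimes> \<Gamma>2 c u v"
      if u: "u \<in> carrier U" "v \<in> carrier U" "s \<in> carrier U" and a: "a \<in> sg_center A"
        and r: "rr (u \<otimes> (v \<otimes> s)) = rr (i a)" for u v s a
    proof -
      let ?e = "rr (u \<otimes> (v \<otimes> s))"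
      let ?X = "cj u (\<Gamma>2 c v s) \<otimes> iv (\<Gamma>2 c (u \<otimes> v) s) \<otimes> \<Gamma>2 c u (v \<otimes> s) \<otimes> iv (\<Gamma>2 c u v)"
      have cl: "v \<otimes> s \<in> carrier U" "u \<otimes> v \<in> carrier U" "u \<otimes> (v \<otimes> s) \<in> carrier U" "u \<otimes> v \<otimes> s = u \<otimes> (v \<otimes> s)"
        using u by (simp_all add: m_closed m_assoc)
      have Z: "cj u (\<Gamma>2 c v s) \<in> Z" "\<Gamma>2 c u (v \<otimes> s) \<in> Z" "\<Gamma>2 c (u \<otimes> v) s \<in> Z" "\<Gamma>2 c u v \<in> Z" "?X \<in> Z"
        using u cl D(1) by simp_all
      have er: "?e \<otimes> rr (u \<otimes> v) = ?e"
        using rr_mult_le[OF cl(2) u(3)] idempotent_comm[of ?e "rr (u \<otimes> v)"] cl by simp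
      have R: "rr (cj u (\<Gamma>2 c v s)) = ?e" "rr (\<Gamma>2 c u (v \<otimes> s)) = ?e" "rr (\<Gamma>2 c (u \<otimes> v) s) = ?e"
        "?e \<otimes> rr (\<Gamma>2 c u v) = ?e"
        using u cl D by (simp_all add: rr_cj rr_mult[of u "v \<otimes> s"])
          (use er u cl in \<open>simp add: rr_mult[of u "v \<otimes> s"]\<close>)
      have ac: "a \<in> carrier A" using a by (rule A.center_closed)
      note ev = coboundary2_eval[OF c u a r]
      have ia: "i a \<otimes> ?e = i a" unfolding r using ac by simp
      have eX: "?e \<otimes> ?X = ?X"
      proof -
        have "?e \<otimes> cj u (\<Gamma>2 c v s) = cj u (\<Gamma>2 c v s)" using rr_mult_self(1)[of "cj u (\<Gamma>2 c v s)"] Z R(1) by simp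
        then show ?thesis using Z cl by (simp flip: m_assoc)
      qed
      have "fst (coboundary B G \<Theta> 2 c [j u, j v, j s]) a = a \<longleftrightarrow> i a \<otimes> ?X = i a"
        unfolding ev(2)[symmetric] using ev(1) ac by (simp add: i_inj)
      also have "\<dots> \<longleftrightarrow> ?X = ?e"
      proof
        assume h: "i a \<otimes> ?X = i a"
        have "?X = ?e \<otimes> ?X" by (rule eX[symmetric])
        also have "?e = iv (i a) \<otimes> i a" unfolding r using N_rr_iv[OF i_N[OF ac]] ac by (simp add: rng_def)
        also have "iv (i a) \<otimes> i a \<otimes> ?X = iv (i a) \<otimes> (i a \<otimes> ?X)" using ac Z Z_closed[OF Z(5)] by (intro m_assoc) simp_all
        also have "\<dots> = ?e" unfolding h r using N_rr_iv[OF i_N[OF ac]] ac by (simp add: rng_def)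
        finally show "?X = ?e" .
      next
        assume "?X = ?e" then show "i a \<otimes> ?X = i a" using ia by simp
      qed
      also have "\<dots> \<longleftrightarrow> cj u (\<Gamma>2 c v s) \<otimes> \<Gamma>2 c u (v \<otimes> s) = \<Gamma>2 c (u \<otimes> v) s \<otimes> \<Gamma>2 c u v"
        by (rule Z_cross_cancel[OF Z(1-4) R])
      finally show ?thesis .
    qed
    show ?thesis unfolding coboundary2_one_iff[OF c]
    proof
      assume h: "\<forall>x\<in>carrier G. \<forall>y\<in>carrier G. \<forall>z\<in>carrier G. \<forall>a\<in>I3 x y z. fst (coboundary B G \<Theta> 2 c [x, y, z]) a = a"
      show "cocycle2 (\<Gamma>2 c)" unfolding cocycle2_def
      proof (intro conjI ballI p)
        fix u v s assume u: "u \<in> carrier U" "v \<in> carrier U" "s \<in> carrier U"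
        let ?e = "rr (u \<otimes> (v \<otimes> s))"
        have e: "?e \<in> E" using u by (simp add: m_closed)
        \<comment> \<open>The idempotent itself, pulled back to \<open>A\<close>, serves as test
          element.\<close>
        have a: "\<iota> ?e \<in> sg_center A" "?e = rr (i (\<iota> ?e))" "\<iota> ?e \<in> I3 (j u) (j v) (j s)"
          using E_center[OF e] inv_props[of ?e] e u unfolding I3_def by auto
        have "fst (coboundary B G \<Theta> 2 c [j u, j v, j s]) (\<iota> ?e) = \<iota> ?e" using h u a(3) by simp
        then show "cj u (\<Gamma>2 c v s) \<otimes> \<Gamma>2 c u (v \<otimes> s) = \<Gamma>2 c (u \<otimes> v) s \<otimes> \<Gamma>2 c u v" unfolding key[OF u a(1,2)] .
      qed
    next
      assume h: "cocycle2 (\<Gamma>2 c)"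
      show "\<forall>x\<in>carrier G. \<forall>y\<in>carrier G. \<forall>z\<in>carrier G. \<forall>a\<in>I3 x y z. fst (coboundary B G \<Theta> 2 c [x, y, z]) a = a"
      proof (intro ballI)
        fix x y z a assume "a \<in> I3 x y z"
        then obtain u v s where a: "a \<in> sg_center A" and u: "u \<in> carrier U" "v \<in> carrier U" "s \<in> carrier U"
          and x: "j u = x" "j v = y" "j s = z" and r: "rr (u \<otimes> (v \<otimes> s)) = i (A.rr a)" by (auto simp: I3_def)
        have "rr (u \<otimes> (v \<otimes> s)) = rr (i a)" using r A.center_closed[OF a] by (simp add: i_rr)
        from key[OF u a this] h u show "fst (coboundary B G \<Theta> 2 c [x, y, z]) a = a" unfolding x cocycle2_def by blast
      qed
    qed
  qed
  ultimately show ?thesis by blast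
qed

end

section \<open>Comparison of two extensions\<close>

context graded
begin

text \<open>\<open>idem_mult_swap\<close> moves the idempotent to the left, where sections are
  compatible by definition; and \<open>R u\<close> conjugates idempotents as \<open>u\<close>
  does.\<close>

lemma section_right:
  assumes R: "is_section R" and u: "u \<in> carrier U" and f: "f \<in> E"
  shows "R (u \<otimes> f) = R u \<otimes> f"
proof -
  note S = sectionD[OF R u]
  have c: "cj (R u) f = cj u f"
  proof -
    define c where "c = R u \<otimes> iv u"
    have c: "R u = c \<otimes> u" "c \<in> N" "rr c = rr u"
      using factor[OF S(1) u S(2,3)] S(3) by (simp_all add: c_def)
    have "cj (R u) f = cj u f \<otimes> rr u" unfolding c(1) using c(2,3) u f by (subst cj_mult) (simp_all add: cj_N_E)
    also have "\<dots> = rr u \<otimes> cj u f" using u f by (intro idempotent_comm) simp_all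
    also have "\<dots> = cj u f" using u f by (simp add: conjugate_def m_assoc m_closed)
    finally show ?thesis .
  qed
  have "u \<otimes> f = cj u f \<otimes> u" using u f by (intro idem_mult_swap)
  then have "R (u \<otimes> f) = cj u f \<otimes> R u" using S(5)[of "cj u f"] u f by simp
  also have "\<dots> = R u \<otimes> f" using idem_mult_swap[OF S(1) f] by (simp add: c)
  finally show ?thesis .
qed

text \<open>Cutting the conjugating element down to \<open>f\<close> is harmless when the argument
  already lies under \<open>f\<close>.\<close>

lemma cj_mult_E: assumes "w \<in> carrier U" "f \<in> E" "z \<in> N" shows "cj (w \<otimes> f) (f \<otimes> z) = cj w (f \<otimes> z)"
proof -
  have "cj (w \<otimes> f) (f \<otimes> z) = cj w (cj f (f \<otimes> z))" using assms by (intro cj_mult) (simp_all add: m_closed)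
  also have "cj f (f \<otimes> z) = f \<otimes> (f \<otimes> (z \<otimes> f))" using assms by (simp add: conjugate_def m_assoc m_closed)
  also have "\<dots> = f \<otimes> z" using assms ker_comm[of f z] by (simp add: E_idem m_closed flip: ker_comm)
  finally show ?thesis .
qed

end

section \<open>Two extensions with the same abstract kernel\<close>

locale two_kernel_ext = kernel_ext A U G j i \<psi> R + V: kernel_ext A V G j' i' \<psi> R'
  for A :: "('a, 'm) monoid_scheme" and U :: "'u monoid" (structure) and G :: "('g, 'n) monoid_scheme"
    and j :: "'u \<Rightarrow> 'g" and i :: "'a \<Rightarrow> 'u" and \<psi> and R :: "'u \<Rightarrow> 'u"
    and V :: "'v monoid" and j' :: "'v \<Rightarrow> 'g" and i' :: "'a \<Rightarrow> 'v" and R' :: "'v \<Rightarrow> 'v"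
begin

text \<open>Both isomorphisms represent \<open>\<psi> g\<close> and so differ by an inner one;
  \<open>conj_unit_multiplier\<close> makes the conjugating elements explicit.\<close>

lemma kernels_conjugate: assumes g: "g \<in> carrier G"
  shows "D g = V.D g"
    and "\<exists>m\<in>Units (multiplier_monoid (A\<lparr>carrier := D g\<rparr>)). \<forall>a b. acts R g a b \<longrightarrow>
      V.acts R' g a (lmul m (A.rr b) \<otimes>\<^bsub>A\<^esub> b \<otimes>\<^bsub>A\<^esub> A.iv (lmul m (A.rr b)))"
proof -
  obtain \<theta> where \<theta>: "\<psi> g = inner_rel A `` {\<theta>}" "\<And>a b. \<theta> a = Some b \<longleftrightarrow> acts R g a b" "ran \<theta> = D g"
    "dom \<theta> = D (inv\<^bsub>G\<^esub> g)"
    by (rule kernel_representative[OF g]) blast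
  obtain \<theta>' where \<theta>': "\<theta>' \<in> \<psi> g" "\<And>a b. \<theta>' a = Some b \<longleftrightarrow> V.acts R' g a b" "ran \<theta>' = V.D g"
    by (rule V.kernel_representative[OF g]) blast
  have "(\<theta>, \<theta>') \<in> inner_rel A" using \<theta>(1) \<theta>'(1) by blast
  then obtain m where dom: "dom \<theta>' = dom \<theta>" and ran: "ran \<theta>' = ran \<theta>"
    and m: "m \<in> Units (multiplier_monoid (A\<lparr>carrier := D g\<rparr>))"
    and eq: "\<And>s. s \<in> dom \<theta> \<Longrightarrow> the (\<theta>' s) = rmul (lmul m (the (\<theta> s))) (inv\<^bsub>multiplier_monoid (A\<lparr>carrier := D g\<rparr>)\<^esub> m)"
    unfolding inner_rel_def Let_def \<theta>(3)[symmetric] by auto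
  show "D g = V.D g" using ran \<theta>(3) \<theta>'(3) by simp
  have "V.acts R' g a (lmul m (A.rr b) \<otimes>\<^bsub>A\<^esub> b \<otimes>\<^bsub>A\<^esub> A.iv (lmul m (A.rr b)))" if h: "acts R g a b" for a b
  proof -
    have ab: "\<theta> a = Some b" using \<theta>(2) h by simp
    then have a: "a \<in> dom \<theta>" "a \<in> dom \<theta>'" using dom by auto
    then obtain b' where b': "\<theta>' a = Some b'" by auto
    have "b \<in> D g" using ab \<theta>(3) by (auto simp: ran_def)
    then have "b' = lmul m (A.rr b) \<otimes>\<^bsub>A\<^esub> b \<otimes>\<^bsub>A\<^esub> A.iv (lmul m (A.rr b))"
      using eq[OF a(1)] ab b' A.conj_unit_multiplier[OF D_ideal[OF g] m] by simp
    then show ?thesis using b' \<theta>'(2) by simp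
  qed
  then show "\<exists>m\<in>Units (multiplier_monoid (A\<lparr>carrier := D g\<rparr>)). \<forall>a b. acts R g a b \<longrightarrow>
      V.acts R' g a (lmul m (A.rr b) \<otimes>\<^bsub>A\<^esub> b \<otimes>\<^bsub>A\<^esub> A.iv (lmul m (A.rr b)))" using m by blast
qed

lemma kernel_conjugators:
  obtains t where "\<And>g e. \<lbrakk>g \<in> carrier G; e \<in> A.E; e \<in> D g\<rbrakk> \<Longrightarrow> t g e \<in> carrier A \<and> A.rr (t g e) = e"
    "\<And>g e f. \<lbrakk>g \<in> carrier G; e \<in> A.E; f \<in> A.E; e \<in> D g; f \<in> D g\<rbrakk> \<Longrightarrow> t g (f \<otimes>\<^bsub>A\<^esub> e) = f \<otimes>\<^bsub>A\<^esub> t g e"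
    "\<And>e. t \<one>\<^bsub>G\<^esub> e = e"
    "\<And>g a b. \<lbrakk>g \<in> carrier G; acts R g a b\<rbrakk>
      \<Longrightarrow> V.acts R' g a (t g (A.rr b) \<otimes>\<^bsub>A\<^esub> b \<otimes>\<^bsub>A\<^esub> A.iv (t g (A.rr b)))"
proof -
  have "\<forall>g\<in>carrier G. \<exists>m. m \<in> Units (multiplier_monoid (A\<lparr>carrier := D g\<rparr>)) \<and> (\<forall>a b. acts R g a b \<longrightarrow>
      V.acts R' g a (lmul m (A.rr b) \<otimes>\<^bsub>A\<^esub> b \<otimes>\<^bsub>A\<^esub> A.iv (lmul m (A.rr b))))"
    using kernels_conjugate(2) by blast
  from bchoice[OF this] obtain m where m': "\<forall>g\<in>carrier G. m g \<in> Units (multiplier_monoid (A\<lparr>carrier := D g\<rparr>)) \<and>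
    (\<forall>a b. acts R g a b \<longrightarrow>
      V.acts R' g a (lmul (m g) (A.rr b) \<otimes>\<^bsub>A\<^esub> b \<otimes>\<^bsub>A\<^esub> A.iv (lmul (m g) (A.rr b))))" ..
  then have m: "\<And>g. g \<in> carrier G \<Longrightarrow> m g \<in> Units (multiplier_monoid (A\<lparr>carrier := D g\<rparr>))"
    "\<And>g a b. \<lbrakk>g \<in> carrier G; acts R g a b\<rbrakk>
      \<Longrightarrow> V.acts R' g a (lmul (m g) (A.rr b) \<otimes>\<^bsub>A\<^esub> b \<otimes>\<^bsub>A\<^esub> A.iv (lmul (m g) (A.rr b)))" by blast+
  \<comment> \<open>In degree 1 both families consist of identities, so the multiplier can be
    replaced by the trivial one. This is what lets the adjusted section fix idempotents.\<close>
  define t where "t g e = (if g = \<one>\<^bsub>G\<^esub> then e else lmul (m g) e)" for g e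
  have sm: "lmul (m g) e \<in> carrier A \<and> A.rr (lmul (m g) e) = e"
    if "g \<in> carrier G" "e \<in> A.E" "e \<in> D g" for g e
    using A.subsemigroup_multipliers(2,3)[OF A.ideal_inverse_closed[OF D_ideal[OF that(1)]] m(1)[OF that(1)]]
      A.ideal_sub(1)[OF D_ideal[OF that(1)]] that by blast
  have act1: "V.acts R' \<one>\<^bsub>G\<^esub> a (t \<one>\<^bsub>G\<^esub> (A.rr b) \<otimes>\<^bsub>A\<^esub> b \<otimes>\<^bsub>A\<^esub> A.iv (t \<one>\<^bsub>G\<^esub> (A.rr b)))"
    if h: "acts R \<one>\<^bsub>G\<^esub> a b" for a b
  proof -
    obtain u where a: "a \<in> carrier A" "b \<in> carrier A" and u: "u \<in> carrier U" "j u = \<one>\<^bsub>G\<^esub>"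
      "rr (iv u) = i (A.rr a)" "i b = cj (R u) (i a)" using h by (auto simp: acts_def)
    have uN: "u \<in> N" using u by (intro N_I)
    have "R u = rr (i a)" using sectionD(7)[OF sectionR u(1) uN] N_rr_iv[OF uN] u a by (simp add: i_rr)
    then have "i b = rr (i a) \<otimes> i a \<otimes> rr (i a)" using u a by (simp add: conjugate_def)
    then have "i b = i a" using a by simp
    then have ab: "b = a" using a by (simp add: i_inj)
    have "i' (A.rr a) \<in> V.E" using a by simp
    then have "V.acts R' \<one>\<^bsub>G\<^esub> a a" unfolding V.acts_def using a V.sectionD(6)[OF V.sectionR, of "i' (A.rr a)" "i' (A.rr a)"]
      by (intro conjI bexI[of _ "i' (A.rr a)"]) (simp_all add: conjugate_def V.i_rr)
    moreover have "A.rr a \<otimes>\<^bsub>A\<^esub> a \<otimes>\<^bsub>A\<^esub> A.iv (A.rr a) = a" using a by simp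
    ultimately show ?thesis using ab by (simp add: t_def)
  qed
  show thesis
  proof (rule that[of t])
    show "t g e \<in> carrier A \<and> A.rr (t g e) = e" if "g \<in> carrier G" "e \<in> A.E" "e \<in> D g" for g e
      using sm[OF that] that by (simp add: t_def)
    show "t g (f \<otimes>\<^bsub>A\<^esub> e) = f \<otimes>\<^bsub>A\<^esub> t g e" if "g \<in> carrier G" "e \<in> A.E" "f \<in> A.E" "e \<in> D g" "f \<in> D g" for g e f
      using A.subsemigroup_multipliers(4)[OF A.ideal_inverse_closed[OF D_ideal[OF that(1)]] m(1)[OF that(1)] that(2-5)]
      by (simp add: t_def)
    show "t \<one>\<^bsub>G\<^esub> e = e" for e by (simp add: t_def)
    show "V.acts R' g a (t g (A.rr b) \<otimes>\<^bsub>A\<^esub> b \<otimes>\<^bsub>A\<^esub> A.iv (t g (A.rr b)))" if "g \<in> carrier G" "acts R g a b" for g a b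
      using m(2)[OF that] act1[of a b] that by (cases "g = \<one>\<^bsub>G\<^esub>") (simp_all add: t_def)
  qed
qed

text \<open>Multiplying the section of \<open>V\<close> by the inverses of the conjugating multipliers makes the two
  families of isomorphisms agree on the nose.\<close>

lemma adjusted_section:
  obtains S where "V.is_section S" "\<And>g a b. \<lbrakk>g \<in> carrier G; acts R g a b\<rbrakk> \<Longrightarrow> V.acts S g a b"
proof -
  obtain t where t: "\<And>g e. \<lbrakk>g \<in> carrier G; e \<in> A.E; e \<in> D g\<rbrakk> \<Longrightarrow> t g e \<in> carrier A \<and> A.rr (t g e) = e"
    "\<And>g e f. \<lbrakk>g \<in> carrier G; e \<in> A.E; f \<in> A.E; e \<in> D g; f \<in> D g\<rbrakk> \<Longrightarrow> t g (f \<otimes>\<^bsub>A\<^esub> e) = f \<otimes>\<^bsub>A\<^esub> t g e"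
    "\<And>e. t \<one>\<^bsub>G\<^esub> e = e"
    "\<And>g a b. \<lbrakk>g \<in> carrier G; acts R g a b\<rbrakk>
      \<Longrightarrow> V.acts R' g a (t g (A.rr b) \<otimes>\<^bsub>A\<^esub> b \<otimes>\<^bsub>A\<^esub> A.iv (t g (A.rr b)))" by (rule kernel_conjugators) blast
  note VS = V.sectionD[OF V.sectionR]
  define S where "S v = i' (A.iv (t (j' v) (V.\<iota> (V.rr v)))) \<otimes>\<^bsub>V\<^esub> R' v" for v
  have mem: "V.\<iota> (V.rr v) \<in> A.E \<and> V.\<iota> (V.rr v) \<in> D (j' v)" if v: "v \<in> carrier V" for v
    using v V.inv_E[of "V.rr v"] V.E_center(3)[of "V.rr v"] V.inv_props[of "V.rr v"]
    unfolding kernels_conjugate(1)[OF V.j_closed[OF v]] V.D_def by auto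
  have tv: "t (j' v) (V.\<iota> (V.rr v)) \<in> carrier A" "A.rr (t (j' v) (V.\<iota> (V.rr v))) = V.\<iota> (V.rr v)" if v: "v \<in> carrier V" for v
    using t(1)[of "j' v" "V.\<iota> (V.rr v)"] mem[OF v] v by auto
  have itN: "i' (A.iv (t (j' v) (V.\<iota> (V.rr v)))) \<in> V.N"
    and itr: "V.rr (i' (A.iv (t (j' v) (V.\<iota> (V.rr v))))) = V.rr v" if v: "v \<in> carrier V" for v
    using tv[OF v] v V.inv_props[of "V.rr v"] by (simp_all flip: V.i_rr)
  have sec: "V.is_section S"
    unfolding V.is_section_def
  proof (intro conjI ballI impI)
    fix v assume v: "v \<in> carrier V"
    show "S v \<in> carrier V" "j' (S v) = j' v" using VS(1,2)[OF v] itN[OF v] v by (simp_all add: S_def V.m_closed)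
    show "V.rr (S v) = V.rr v" using VS(1,3)[OF v] itN[OF v] itr[OF v] v by (simp add: S_def V.rr_N_mult V.E_idem)
    show "S w = S v" if "w \<in> carrier V" "j' w = j' v" "V.rr w = V.rr v" for w
      using VS(4)[OF v that] that by (simp add: S_def)
    fix e assume e: "e \<in> V.E"
    let ?f = "V.\<iota> (V.rr (e \<otimes>\<^bsub>V\<^esub> v))" and ?g = "V.\<iota> (V.rr v)"
    have ev: "e \<otimes>\<^bsub>V\<^esub> v \<in> carrier V" "j' (e \<otimes>\<^bsub>V\<^esub> v) = j' v" "V.rr (e \<otimes>\<^bsub>V\<^esub> v) = e \<otimes>\<^bsub>V\<^esub> V.rr v"
      using e v by (simp_all add: V.m_closed V.rr_E_mult)
    \<comment> \<open>\<open>?f\<close> lies below \<open>?g\<close>, so the compatibility of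
      \<open>t\<close> expresses its value at \<open>?f\<close> through the one at
      \<open>?g\<close>.\<close>
    have "V.rr (e \<otimes>\<^bsub>V\<^esub> v) = V.rr (e \<otimes>\<^bsub>V\<^esub> v) \<otimes>\<^bsub>V\<^esub> V.rr v" using e v by (simp add: ev V.m_assoc V.E_idem)
    then have "?f = V.\<iota> (V.rr (e \<otimes>\<^bsub>V\<^esub> v) \<otimes>\<^bsub>V\<^esub> V.rr v)" by simp
    also have "\<dots> = ?f \<otimes>\<^bsub>A\<^esub> ?g" by (rule V.inv_mult) (use ev(1) v in simp_all)
    finally have fg: "?f = ?f \<otimes>\<^bsub>A\<^esub> ?g" .
    have "t (j' v) (?f \<otimes>\<^bsub>A\<^esub> ?g) = ?f \<otimes>\<^bsub>A\<^esub> t (j' v) ?g"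
      by (rule t(2)) (use mem[OF v] mem[OF ev(1)] ev(2) v in simp_all)
    then have tf: "t (j' v) ?f = ?f \<otimes>\<^bsub>A\<^esub> t (j' v) ?g" using fg by simp
    have fE: "?f \<in> A.E" using mem[OF ev(1)] by simp
    have "A.iv (t (j' v) ?f) = A.iv (t (j' v) ?g) \<otimes>\<^bsub>A\<^esub> ?f" unfolding tf using tv(1)[OF v] fE by (simp add: A.iv_mult)
    also have "\<dots> = ?f \<otimes>\<^bsub>A\<^esub> A.iv (t (j' v) ?g)" using tv(1)[OF v] fE by (intro A.E_central[symmetric]) simp_all
    finally have ivf: "A.iv (t (j' v) ?f) = ?f \<otimes>\<^bsub>A\<^esub> A.iv (t (j' v) ?g)" .
    have itf: "i' (A.iv (t (j' v) ?f)) = (e \<otimes>\<^bsub>V\<^esub> V.rr v) \<otimes>\<^bsub>V\<^esub> i' (A.iv (t (j' v) ?g))"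
    proof -
      have "V.rr (e \<otimes>\<^bsub>V\<^esub> v) \<in> V.N" using ev(1) by (intro V.E_N V.rr_E)
      then have "i' ?f = e \<otimes>\<^bsub>V\<^esub> V.rr v" using V.inv_props(2) ev(3) by metis
      then show ?thesis using ivf tv(1)[OF v] fE
        by (simp add: V.i_mult)
    qed
    have n: "i' (A.iv (t (j' v) ?g)) \<in> V.N" by (rule itN[OF v])
    have "S (e \<otimes>\<^bsub>V\<^esub> v) = ((e \<otimes>\<^bsub>V\<^esub> V.rr v) \<otimes>\<^bsub>V\<^esub> i' (A.iv (t (j' v) ?g))) \<otimes>\<^bsub>V\<^esub> (e \<otimes>\<^bsub>V\<^esub> R' v)"
      unfolding S_def ev(2) itf VS(5)[OF v e] by (rule refl)
    also have "\<dots> = e \<otimes>\<^bsub>V\<^esub> (V.rr v \<otimes>\<^bsub>V\<^esub> ((i' (A.iv (t (j' v) ?g)) \<otimes>\<^bsub>V\<^esub> e) \<otimes>\<^bsub>V\<^esub> R' v))"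
      using e v n VS(1)[OF v] by (simp add: V.m_assoc V.m_closed)
    also have "i' (A.iv (t (j' v) ?g)) \<otimes>\<^bsub>V\<^esub> e = e \<otimes>\<^bsub>V\<^esub> i' (A.iv (t (j' v) ?g))" using V.ker_comm[OF e n] by simp
    also have "e \<otimes>\<^bsub>V\<^esub> (V.rr v \<otimes>\<^bsub>V\<^esub> ((e \<otimes>\<^bsub>V\<^esub> i' (A.iv (t (j' v) ?g))) \<otimes>\<^bsub>V\<^esub> R' v))
      = e \<otimes>\<^bsub>V\<^esub> ((V.rr v \<otimes>\<^bsub>V\<^esub> i' (A.iv (t (j' v) ?g))) \<otimes>\<^bsub>V\<^esub> R' v)"
      using e v n VS(1)[OF v] V.E_comm3[of "V.rr v" e "i' (A.iv (t (j' v) ?g)) \<otimes>\<^bsub>V\<^esub> R' v"]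
      by (simp add: V.m_assoc V.m_closed V.E_idem)
    also have "V.rr v \<otimes>\<^bsub>V\<^esub> i' (A.iv (t (j' v) ?g)) = i' (A.iv (t (j' v) ?g))"
      using V.rr_mult_self(1)[OF V.N_closed[OF n]] itr[OF v] by simp
    finally show "S (e \<otimes>\<^bsub>V\<^esub> v) = e \<otimes>\<^bsub>V\<^esub> S v" unfolding S_def .
  next
    fix e assume e: "e \<in> V.E"
    then have "j' e = \<one>\<^bsub>G\<^esub>" "R' e = e" "i' (A.iv (V.\<iota> e)) = e"
      using VS(6)[of e e] V.inv_props[of e] V.inv_E[of e] by simp_all
    then show "S e = e" using e by (simp add: S_def t(3) V.E_idem)
  qed
  have "V.acts S g a b" if g: "g \<in> carrier G" and h: "acts R g a b" for g a b
  proof -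
    have bc: "b \<in> carrier A" "b \<in> D g" using h acts_ran[of g b] by (auto simp: acts_def)
    let ?e = "A.rr b" let ?t = "t g ?e"
    have e: "?e \<in> D g" by (rule A.ideal_sub(4)[OF D_ideal[OF g] bc(2)])
    have tt: "?t \<in> carrier A" "A.rr ?t = ?e" using t(1)[OF g _ e] bc by simp_all
    have tt': "A.iv ?t \<otimes>\<^bsub>A\<^esub> ?t = ?e" using A.rr_iv[OF tt(1)] tt by (simp add: rng_def)
    let ?b = "?t \<otimes>\<^bsub>A\<^esub> b \<otimes>\<^bsub>A\<^esub> A.iv ?t"
    have b': "?b \<in> carrier A" "A.rr ?b = ?e" using tt bc by (simp_all add: A.m_closed A.rr_mult_distrib A.E_idem)
    obtain w where w: "a \<in> carrier A" "w \<in> carrier V" "j' w = g" "V.rr (V.iv w) = i' (A.rr a)" "i' ?b = V.cj (R' w) (i' a)"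
      using t(4)[OF g h] by (auto simp: V.acts_def)
    note W = VS[OF w(2)]
    have ra: "V.rr (i' a) = V.rr (V.iv w)" using w by (simp add: V.i_rr)
    have "i' ?e = V.rr (i' ?b)" using b' by (simp flip: V.i_rr)
    also have "\<dots> = V.cj (R' w) (V.rr (V.iv w))" unfolding w(5) using W(1) w(1) by (simp add: V.rr_cj ra)
    also have "\<dots> = V.rr w" using W(1,3,10) V.cj_rr_iv(1)[OF W(1)] by simp
    finally have we: "V.rr w = i' ?e" by simp
    then have ie: "V.\<iota> (V.rr w) = ?e" using bc by (simp add: V.inv_i)
    \<comment> \<open>Conjugation by \<open>R' w\<close> yields the conjugate of \<open>b\<close> by
      \<open>?t\<close>, and the inverse of \<open>?t\<close> in front undoes this.\<close>
    have "V.cj (S w) (i' a) = V.cj (i' (A.iv ?t)) (i' ?b)"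
      unfolding S_def w(5) ie w(3) using W(1) w(1) tt by (intro V.cj_mult) simp_all
    also have "\<dots> = i' (A.iv ?t \<otimes>\<^bsub>A\<^esub> ?b \<otimes>\<^bsub>A\<^esub> ?t)" using tt b' bc by (simp add: conjugate_def V.i_mult V.i_iv A.m_closed)
    also have "A.iv ?t \<otimes>\<^bsub>A\<^esub> ?b \<otimes>\<^bsub>A\<^esub> ?t = (A.iv ?t \<otimes>\<^bsub>A\<^esub> ?t) \<otimes>\<^bsub>A\<^esub> b \<otimes>\<^bsub>A\<^esub> (A.iv ?t \<otimes>\<^bsub>A\<^esub> ?t)"
      using tt bc by (simp add: A.m_assoc A.m_closed)
    also have "\<dots> = b" unfolding tt' using bc by simp
    finally show "V.acts S g a b" unfolding V.acts_def using w bc by auto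
  qed
  then show thesis using that[OF sec] by blast
qed

definition \<sigma> :: "'u \<Rightarrow> 'v" where "\<sigma> n = i' (\<iota> n)"

lemma \<sigma>_props:
  "n \<in> N \<Longrightarrow> \<sigma> n \<in> V.N" "n \<in> N \<Longrightarrow> \<sigma> n \<in> carrier V" "\<lbrakk>n \<in> N; m \<in> N\<rbrakk> \<Longrightarrow> \<sigma> (n \<otimes> m) = \<sigma> n \<otimes>\<^bsub>V\<^esub> \<sigma> m"
  "n \<in> N \<Longrightarrow> \<sigma> (iv n) = V.iv (\<sigma> n)" "n \<in> N \<Longrightarrow> \<sigma> (rr n) = V.rr (\<sigma> n)" "e \<in> E \<Longrightarrow> \<sigma> e \<in> V.E"
  "\<lbrakk>n \<in> N; m \<in> N; \<sigma> n = \<sigma> m\<rbrakk> \<Longrightarrow> n = m" "a \<in> carrier A \<Longrightarrow> \<sigma> (i a) = i' a"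
  using inv_props inv_E
  by (auto simp: \<sigma>_def inv_mult inv_iv inv_rr V.i_mult V.i_iv V.i_rr V.i_inj inv_i) (metis inv_props(2))

end

section \<open>The bimodule isomorphism between two extensions\<close>

context two_kernel_ext
begin

text \<open>A relation and not a map, because \<open>w\<close> is determined only up to a factor of
  degree 1 in \<open>V\<close>; the value of a section at \<open>w\<close> no longer depends on the
  choice.\<close>

definition match :: "'u \<Rightarrow> 'v \<Rightarrow> bool" where
  "match u w \<longleftrightarrow> w \<in> carrier V \<and> j' w = j u \<and> V.rr w = \<sigma> (rr u)"

text \<open>The ideals with index \<open>j u\<close> coincide for the two extensions, so the
  idempotent of \<open>u\<close> occurs in \<open>V\<close> in the same degree.\<close>

lemma match_ex: assumes u: "u \<in> carrier U" shows "\<exists>w. match u w"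
proof -
  have "\<iota> (rr u) \<in> D (j u)" using u E_center[of "rr u"] inv_props[of "rr u"] unfolding D_def by auto
  then obtain w where w: "w \<in> carrier V" "j' w = j u" "V.rr w = i' (A.rr (\<iota> (rr u)))"
    using u kernels_conjugate(1)[of "j u"] by (auto simp: V.D_def)
  then have "V.rr w = \<sigma> (rr u)" using E_center(2)[of "rr u"] u by (simp add: \<sigma>_def)
  then show ?thesis using w by (auto simp: match_def)
qed

lemma match_ex_left: assumes v: "v \<in> carrier V" obtains u where "u \<in> carrier U" "match u v"
proof -
  have e: "V.rr v \<in> V.E" using v by simp
  have "V.\<iota> (V.rr v) \<in> V.D (j' v)" using v V.E_center[OF e] V.inv_props[of "V.rr v"] unfolding V.D_def by auto
  then obtain u where u: "u \<in> carrier U" "j u = j' v" "rr u = i (A.rr (V.\<iota> (V.rr v)))"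
    using v kernels_conjugate(1)[of "j' v"] by (auto simp: D_def)
  have "\<sigma> (rr u) = V.rr v" unfolding u(3) V.E_center(2)[OF e]
    using V.inv_props[of "V.rr v"] v by (simp add: \<sigma>_props(8))
  then show thesis using that u v by (auto simp: match_def)
qed

lemma match_mult: assumes m: "match u w" and u: "u \<in> carrier U" and a: "a \<in> N"
  shows "match (a \<otimes> u) (\<sigma> (rr a) \<otimes>\<^bsub>V\<^esub> w)"
  using assms \<sigma>_props(6)[of "rr a"] \<sigma>_props(3)[of "rr a" "rr u"]
  by (simp add: match_def V.m_closed V.rr_E_mult rr_N_mult)

text \<open>The gradings alone do not relate domain idempotents of \<open>U\<close> and
  \<open>V\<close>; the equal actions do. They provide a \<open>v\<close> with the corresponding
  domain idempotent, whose range idempotent turns out to be that of \<open>w\<close>, and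
  \<open>rr_match_iv\<close> passes the result on to \<open>w\<close>.\<close>

lemma match_acts:
  assumes S: "V.is_section S" and act: "\<And>g a b. \<lbrakk>g \<in> carrier G; acts R g a b\<rbrakk> \<Longrightarrow> V.acts S g a b"
    and m: "match u w" and u: "u \<in> carrier U" and a: "a \<in> N" "rr a = rr (iv u)"
  shows "V.rr (V.iv w) = \<sigma> (rr (iv u))" "V.cj (S w) (\<sigma> a) = \<sigma> (cj (R u) a)"
proof -
  note RD = sectionD[OF sectionR u]
  have w: "w \<in> carrier V" "j' w = j u" "V.rr w = \<sigma> (rr u)" using m by (auto simp: match_def)
  let ?z = "cj (R u) a"
  have z: "?z \<in> N" using a RD(1) by simp
  have ia: "\<iota> a \<in> carrier A" "i (\<iota> a) = a" using a inv_props by simp_all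
  have "acts R (j u) (\<iota> a) (\<iota> ?z)" using acts_ex[OF ia(1) u] a ia by (simp add: i_rr)
  then have "V.acts S (j u) (\<iota> a) (\<iota> ?z)" using act u by simp
  then obtain v where v: "v \<in> carrier V" "j' v = j u" "V.rr (V.iv v) = i' (A.rr (\<iota> a))" "i' (\<iota> ?z) = V.cj (S v) (i' (\<iota> a))"
    by (auto simp: V.acts_def)
  note SD = V.sectionD[OF S v(1)]
  have rv: "V.rr (V.iv v) = \<sigma> (rr (iv u))" using v(3) a by (simp add: \<sigma>_def inv_rr flip: a(2))
  have "rr ?z = cj (R u) (rr (iv (R u)))" using RD(1,10) a by (simp add: rr_cj)
  also have "\<dots> = rr u" using RD(1,3) by simp
  finally have rz: "rr ?z = rr u" .
  have "\<sigma> (rr u) = V.rr (\<sigma> ?z)" using z by (simp add: \<sigma>_props(5) flip: rz)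
  also have "\<dots> = V.cj (S v) (V.rr (V.iv (S v)))"
    using v(3,4) SD(1,10) ia by (simp add: \<sigma>_def V.rr_cj V.i_rr)
  also have "\<dots> = V.rr v" using SD(1,3) by simp
  finally have rvw: "V.rr v = V.rr w" using w by simp
  then show "V.rr (V.iv w) = \<sigma> (rr (iv u))" using V.rr_match_iv[OF v(1) w(1)] v w rv by simp
  have "S w = S v" using SD(4)[OF w(1)] w v rvw by simp
  then show "V.cj (S w) (\<sigma> a) = \<sigma> ?z" using v(4) by (simp add: \<sigma>_def)
qed

text \<open>\<open>match_acts\<close> covers those \<open>a\<close> whose idempotent is the domain
  idempotent of \<open>u\<close>. In general \<open>u\<close> is cut down on the right by
  \<open>rr a\<close> and \<open>a\<close> by the domain idempotent of \<open>u\<close>; neither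
  changes the conjugate.\<close>

lemma match_conj:
  assumes S: "V.is_section S" and act: "\<And>g a b. \<lbrakk>g \<in> carrier G; acts R g a b\<rbrakk> \<Longrightarrow> V.acts S g a b"
    and m: "match u w" and u: "u \<in> carrier U" and a: "a \<in> N"
  shows "V.cj (S w) (\<sigma> a) = \<sigma> (cj (R u) a)"
proof -
  note RD = sectionD[OF sectionR u]
  have w: "w \<in> carrier V" "j' w = j u" "V.rr w = \<sigma> (rr u)" using m by (auto simp: match_def)
  note SD = V.sectionD[OF S w(1)]
  have dw: "V.rr (V.iv w) = \<sigma> (rr (iv u))" by (rule match_acts(1)[OF S act m u, of "rr (iv u)"]) (use u in simp_all)
  define f where "f = rr a"
  define d where "d = rr (iv u)"
  have f: "f \<in> E" "d \<in> E" "f \<otimes> a = a" using a u by (simp_all add: f_def d_def)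
  have \<sigma>f: "\<sigma> f \<in> V.E" "\<sigma> d \<in> V.E" using f \<sigma>_props(6) by simp_all
  have uf: "u \<otimes> f \<in> carrier U" "j (u \<otimes> f) = j u" using u f by (simp_all add: m_closed)
  have ruf: "rr (iv (u \<otimes> f)) = f \<otimes> d" using u f by (simp add: iv_mult rr_E_mult d_def)
  have wf: "w \<otimes>\<^bsub>V\<^esub> \<sigma> f \<in> carrier V" "j' (w \<otimes>\<^bsub>V\<^esub> \<sigma> f) = j u" using w \<sigma>f u by (simp_all add: V.m_closed)
  have rwf: "V.rr (V.iv (w \<otimes>\<^bsub>V\<^esub> \<sigma> f)) = \<sigma> (f \<otimes> d)"
    using w(1) \<sigma>f f by (simp add: V.iv_mult V.rr_E_mult dw \<sigma>_props(3) flip: d_def)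
  \<comment> \<open>Restriction on the right is visible in domain idempotents. These correspond, and
    \<open>rr_match_iv\<close> applied to inverses transfers this to the range idempotents.\<close>
  have "match (u \<otimes> f) (w \<otimes>\<^bsub>V\<^esub> \<sigma> f)"
  proof -
    obtain v where v: "match (u \<otimes> f) v" using match_ex[OF uf(1)] by blast
    then have vc: "v \<in> carrier V" "j' v = j u" "V.rr v = \<sigma> (rr (u \<otimes> f))" using uf by (auto simp: match_def)
    have "V.rr (V.iv v) = \<sigma> (f \<otimes> d)" unfolding ruf[symmetric]
      by (rule match_acts(1)[OF S act v uf(1), of "rr (iv (u \<otimes> f))"]) (use uf in simp_all)
    then have "V.rr (V.iv v) = V.rr (V.iv (w \<otimes>\<^bsub>V\<^esub> \<sigma> f))" using rwf by simp
    then have "V.rr v = V.rr (w \<otimes>\<^bsub>V\<^esub> \<sigma> f)"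
      using V.rr_match_iv[of "V.iv v" "V.iv (w \<otimes>\<^bsub>V\<^esub> \<sigma> f)"] vc(1,2) wf by simp
    then show ?thesis using vc wf uf by (simp add: match_def)
  qed
  note mf = match_acts(2)[OF S act this uf(1)]
  have da: "d \<otimes> a \<in> N" "rr (d \<otimes> a) = f \<otimes> d"
    using f a idempotent_comm[of d f] by (simp_all add: rr_E_mult flip: f_def)
  have "V.cj (S (w \<otimes>\<^bsub>V\<^esub> \<sigma> f)) (\<sigma> (d \<otimes> a)) = \<sigma> (cj (R (u \<otimes> f)) (d \<otimes> a))"
    by (rule mf) (use da ruf in simp_all)
  moreover have fda: "d \<otimes> a = f \<otimes> (d \<otimes> a)" using f a E_comm3[of f d a] by simp
  moreover have "cj (R (u \<otimes> f)) (f \<otimes> (d \<otimes> a)) = cj (R u) a"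
  proof -
    have 1: "cj (R (u \<otimes> f)) (f \<otimes> (d \<otimes> a)) = cj (R u) (f \<otimes> (d \<otimes> a))"
      unfolding section_right[OF sectionR u f(1)] by (rule cj_mult_E[OF RD(1) f(1) da(1)])
    have 2: "f \<otimes> (d \<otimes> a) = rr (iv (R u)) \<otimes> a"
      by (subst fda[symmetric]) (simp only: RD(10) d_def)
    show ?thesis unfolding 1 unfolding 2 by (rule cj_absorb_left[OF RD(1) N_closed[OF a]])
  qed
  moreover have "V.cj (S (w \<otimes>\<^bsub>V\<^esub> \<sigma> f)) (\<sigma> (f \<otimes> (d \<otimes> a))) = V.cj (S w) (\<sigma> a)"
  proof -
    have 1: "V.cj (S (w \<otimes>\<^bsub>V\<^esub> \<sigma> f)) (\<sigma> f \<otimes>\<^bsub>V\<^esub> \<sigma> (d \<otimes> a)) = V.cj (S w) (\<sigma> f \<otimes>\<^bsub>V\<^esub> \<sigma> (d \<otimes> a))"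
      unfolding V.section_right[OF S w(1) \<sigma>f(1)] by (rule V.cj_mult_E[OF SD(1) \<sigma>f(1) \<sigma>_props(1)[OF da(1)]])
    have 2: "\<sigma> f \<otimes>\<^bsub>V\<^esub> \<sigma> (d \<otimes> a) = \<sigma> (f \<otimes> (d \<otimes> a))" using f(1) da(1) by (intro \<sigma>_props(3)[symmetric]) simp_all
    have "\<sigma> (f \<otimes> (d \<otimes> a)) = \<sigma> (d \<otimes> a)" by (simp only: fda[symmetric])
    also have "\<dots> = V.rr (V.iv (S w)) \<otimes>\<^bsub>V\<^esub> \<sigma> a" unfolding SD(10) dw d_def[symmetric] using f a by (simp add: \<sigma>_props(3))
    finally have 3: "\<sigma> (f \<otimes> (d \<otimes> a)) = V.rr (V.iv (S w)) \<otimes>\<^bsub>V\<^esub> \<sigma> a" .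
    show ?thesis using 1 unfolding 2 unfolding 3 V.cj_absorb_left[OF SD(1) \<sigma>_props(2)[OF a]] .
  qed
  ultimately show ?thesis by simp
qed

text \<open>Each \<open>u\<close> is \<open>c u\<close> times \<open>R u\<close>; \<open>F\<close>
  replaces the first factor by its copy and the second by the value of the adjusted section. Left
  linearity is formal, right linearity is where the equality of the two actions enters, through
  \<open>match_conj\<close>.\<close>

lemma exists_bimodule_bijection:
  obtains F where "bij_betw F (carrier U) (carrier V)" "\<And>u. u \<in> carrier U \<Longrightarrow> j' (F u) = j u"
    "\<And>n. n \<in> N \<Longrightarrow> F n = \<sigma> n"
    "\<And>a u. \<lbrakk>a \<in> N; u \<in> carrier U\<rbrakk> \<Longrightarrow> F (a \<otimes> u) = \<sigma> a \<otimes>\<^bsub>V\<^esub> F u"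
    "\<And>a u. \<lbrakk>a \<in> N; u \<in> carrier U\<rbrakk> \<Longrightarrow> F (u \<otimes> a) = F u \<otimes>\<^bsub>V\<^esub> \<sigma> a"
proof -
  obtain S where S: "V.is_section S" and act: "\<And>g a b. \<lbrakk>g \<in> carrier G; acts R g a b\<rbrakk> \<Longrightarrow> V.acts S g a b"
    by (rule adjusted_section) blast
  note VD = V.sectionD[OF S] and UD = sectionD[OF sectionR]
  define w where "w u = (SOME w. match u w)" for u
  define c where "c u = u \<otimes> iv (R u)" for u
  define F where "F u = \<sigma> (c u) \<otimes>\<^bsub>V\<^esub> S (w u)" for u
  have w: "match u (w u)" if "u \<in> carrier U" for u unfolding w_def using match_ex[OF that] by (rule someI_ex)
  have wc: "w u \<in> carrier V" "j' (w u) = j u" "V.rr (w u) = \<sigma> (rr u)" if "u \<in> carrier U" for u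
    using w[OF that] by (auto simp: match_def)
  have c: "u = c u \<otimes> R u" "c u \<in> N" "rr (c u) = rr u" if u: "u \<in> carrier U" for u
    using factor[OF u UD(1)[OF u]] UD(2,3)[OF u] by (simp_all add: c_def)
  have Sc: "S (w u) \<in> carrier V" "j' (S (w u)) = j u" "V.rr (S (w u)) = \<sigma> (rr u)" if "u \<in> carrier U" for u
    using VD(1-3)[OF wc(1)[OF that]] wc[OF that] by simp_all
  have F_eval: "F u = \<sigma> (c u) \<otimes>\<^bsub>V\<^esub> S v" if u: "u \<in> carrier U" and m: "match u v" for u v
    using VD(4)[OF wc(1)[OF u], of v] m wc[OF u] by (simp add: F_def match_def)
  have Fc: "F u \<in> carrier V" "j' (F u) = j u" "V.rr (F u) = \<sigma> (rr u)" if u: "u \<in> carrier U" for u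
    using Sc[OF u] c[OF u] \<sigma>_props(1,2)[OF c(2)[OF u]] \<sigma>_props(6)[of "rr u"] u
    by (simp_all add: F_def V.m_closed V.rr_N_mult V.E_idem flip: \<sigma>_props(5))
  have Fl: "F (a \<otimes> u) = \<sigma> a \<otimes>\<^bsub>V\<^esub> F u" if a: "a \<in> N" and u: "u \<in> carrier U" for a u
  proof -
    have au: "a \<otimes> u \<in> carrier U" using a u by (simp add: m_closed)
    have "c (a \<otimes> u) = a \<otimes> (c u \<otimes> rr a)"
      unfolding c_def UD(9)[OF u a] using a u UD(1)[OF u] by (simp add: iv_mult m_assoc m_closed)
    also have "c u \<otimes> rr a = rr a \<otimes> c u" using a c(2)[OF u] ker_comm by simp
    also have "a \<otimes> (rr a \<otimes> c u) = a \<otimes> c u" using a c(2)[OF u] by (simp flip: m_assoc)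
    finally have cau: "c (a \<otimes> u) = a \<otimes> c u" .
    have "F (a \<otimes> u) = \<sigma> (a \<otimes> c u) \<otimes>\<^bsub>V\<^esub> S (\<sigma> (rr a) \<otimes>\<^bsub>V\<^esub> w u)"
      using F_eval[OF au match_mult[OF w[OF u] u a]] cau by simp
    also have "S (\<sigma> (rr a) \<otimes>\<^bsub>V\<^esub> w u) = \<sigma> (rr a) \<otimes>\<^bsub>V\<^esub> S (w u)"
      using VD(5)[OF wc(1)[OF u]] \<sigma>_props(6) a by simp
    also have "\<sigma> (a \<otimes> c u) \<otimes>\<^bsub>V\<^esub> (\<sigma> (rr a) \<otimes>\<^bsub>V\<^esub> S (w u)) = \<sigma> ((a \<otimes> c u) \<otimes> rr a) \<otimes>\<^bsub>V\<^esub> S (w u)"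
      using a c(2)[OF u] Sc[OF u] \<sigma>_props(2) by (simp add: \<sigma>_props(3)[of "a \<otimes> c u" "rr a"] V.m_assoc)
    also have "(a \<otimes> c u) \<otimes> rr a = a \<otimes> c u"
    proof -
      have "(a \<otimes> c u) \<otimes> rr a = rr a \<otimes> (a \<otimes> c u)" using a c(2)[OF u] ker_comm[of "rr a" "a \<otimes> c u"] by simp
      then show ?thesis using a c(2)[OF u] by simp
    qed
    also have "\<sigma> (a \<otimes> c u) \<otimes>\<^bsub>V\<^esub> S (w u) = \<sigma> a \<otimes>\<^bsub>V\<^esub> F u"
      using a c(2)[OF u] Sc[OF u] \<sigma>_props(2) by (simp add: F_def \<sigma>_props(3) V.m_assoc)
    finally show ?thesis .
  qed
  have FN: "F n = \<sigma> n" if n: "n \<in> N" for n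
  proof -
    have e: "\<sigma> (rr n) \<in> V.E" using n by (intro \<sigma>_props(6)) simp
    have "match n (\<sigma> (rr n))" using n e by (simp add: match_def)
    then have "F n = \<sigma> (c n) \<otimes>\<^bsub>V\<^esub> S (\<sigma> (rr n))" using n by (intro F_eval) simp_all
    also have "S (\<sigma> (rr n)) = \<sigma> (rr n)" using VD(6)[OF V.E_closed[OF e]] e by simp
    also have "c n = n" using UD(7)[OF N_closed[OF n] n] n by (simp add: c_def)
    also have "\<sigma> n \<otimes>\<^bsub>V\<^esub> \<sigma> (rr n) = \<sigma> n" using n by (simp flip: \<sigma>_props(3))
    finally show ?thesis .
  qed
  have Fr: "F (u \<otimes> a) = F u \<otimes>\<^bsub>V\<^esub> \<sigma> a" if a: "a \<in> N" and u: "u \<in> carrier U" for a u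
  proof -
    note n = c(2)[OF u] and s = Sc(1)[OF u] and Ru = UD(1)[OF u]
    let ?y = "cj (R u) a"
    have y: "?y \<in> N" using a Ru by simp
    have sn: "\<sigma> (c u) \<in> V.N" "\<sigma> ?y \<in> V.N" using \<sigma>_props(1) n y by simp_all
    have "cj u a = cj (c u \<otimes> R u) a" using c(1)[OF u] by simp
    also have "\<dots> = c u \<otimes> ?y \<otimes> iv (c u)" using n a Ru cj_mult[of "c u" "R u" a] by (simp add: conjugate_def[of _ "c u"])
    finally have cu: "cj u a = c u \<otimes> ?y \<otimes> iv (c u)" .
    have "F (u \<otimes> a) = \<sigma> (cj u a) \<otimes>\<^bsub>V\<^esub> F u" unfolding mult_swap[OF u a] using a u by (simp add: Fl)
    also have "\<dots> = \<sigma> (c u) \<otimes>\<^bsub>V\<^esub> \<sigma> ?y \<otimes>\<^bsub>V\<^esub> V.iv (\<sigma> (c u)) \<otimes>\<^bsub>V\<^esub> (\<sigma> (c u) \<otimes>\<^bsub>V\<^esub> S (w u))"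
      unfolding cu F_def using n y by (simp add: \<sigma>_props(3,4))
    also have "\<dots> = \<sigma> (c u) \<otimes>\<^bsub>V\<^esub> \<sigma> ?y \<otimes>\<^bsub>V\<^esub> (V.rr (V.iv (\<sigma> (c u))) \<otimes>\<^bsub>V\<^esub> S (w u))"
      using sn s by (simp add: rng_def V.m_assoc V.m_closed)
    also have "V.rr (V.iv (\<sigma> (c u))) \<otimes>\<^bsub>V\<^esub> S (w u) = S (w u)"
      using V.rr_mult_self(1)[OF s] Sc(3)[OF u] sn n c(3)[OF u] by (simp flip: \<sigma>_props(5))
    also have "\<sigma> ?y = V.cj (S (w u)) (\<sigma> a)" by (rule match_conj[OF S act w[OF u] u a, symmetric])
    also have "\<sigma> (c u) \<otimes>\<^bsub>V\<^esub> V.cj (S (w u)) (\<sigma> a) \<otimes>\<^bsub>V\<^esub> S (w u) = \<sigma> (c u) \<otimes>\<^bsub>V\<^esub> (S (w u) \<otimes>\<^bsub>V\<^esub> \<sigma> a)"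
      using sn s a \<sigma>_props(1)[OF a] by (simp add: V.mult_swap[OF s \<sigma>_props(1)[OF a]] V.m_assoc)
    also have "\<dots> = F u \<otimes>\<^bsub>V\<^esub> \<sigma> a" using sn s \<sigma>_props(2)[OF a] by (simp add: F_def V.m_assoc)
    finally show ?thesis .
  qed
  have "inj_on F (carrier U)"
  proof (rule inj_onI)
    fix u v assume u: "u \<in> carrier U" "v \<in> carrier U" and eq: "F u = F v"
    have jv: "j v = j u" using Fc(2)[OF u(1)] Fc(2)[OF u(2)] eq by simp
    have "\<sigma> (rr v) = \<sigma> (rr u)" using Fc(3)[OF u(1)] Fc(3)[OF u(2)] eq by simp
    then have rv: "rr v = rr u" using u by (intro \<sigma>_props(7)[of "rr v" "rr u"]) simp_all
    have Rv: "R v = R u" by (rule UD(4)[OF u jv rv])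
    have "match v (w u)" using w[OF u(1)] jv rv by (simp add: match_def)
    then have "\<sigma> (c u) \<otimes>\<^bsub>V\<^esub> S (w u) = \<sigma> (c v) \<otimes>\<^bsub>V\<^esub> S (w u)" using F_eval[OF u(2)] eq by (simp add: F_def)
    then have "\<sigma> (c u) = \<sigma> (c v)"
      by (intro V.cancel_right[of "\<sigma> (c u)" "\<sigma> (c v)" "S (w u)"])
        (use \<sigma>_props(1) c u Sc[OF u(1)] rv in \<open>simp_all flip: \<sigma>_props(5)\<close>)
    then have "c u = c v" using c(2) u by (intro \<sigma>_props(7)) simp_all
    then show "u = v" using c(1)[OF u(1)] c(1)[OF u(2)] Rv by simp
  qed
  moreover have "F ` carrier U = carrier V"
  proof (intro equalityI subsetI)
    fix v assume v: "v \<in> carrier V"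
    obtain u where u: "u \<in> carrier U" "match u v" by (rule match_ex_left[OF v])
    then have uv: "j' v = j u" "V.rr v = \<sigma> (rr u)" by (auto simp: match_def)
    note SD = VD(1-3)[OF v] and Ru = UD(1-3,8)[OF u(1)]
    \<comment> \<open>\<open>S v\<close> is the image of \<open>R u\<close>, and the remaining
      factor \<open>d\<close> comes from \<open>N\<close>.\<close>
    define d where "d = v \<otimes>\<^bsub>V\<^esub> V.iv (S v)"
    have d: "v = d \<otimes>\<^bsub>V\<^esub> S v" "d \<in> V.N"
      using V.factor[OF v SD(1)] SD(2,3) by (simp_all add: d_def)
    define n where "n = i (V.\<iota> d)"
    have n: "n \<in> N" "\<sigma> n = d" using V.inv_props[OF d(2)] by (simp_all add: n_def \<sigma>_props(8))
    have "match (R u) v" using u Ru by (simp add: match_def)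
    then have "F (R u) = \<sigma> (c (R u)) \<otimes>\<^bsub>V\<^esub> S v" using Ru by (intro F_eval) simp_all
    also have "c (R u) = rr u" using Ru by (simp add: c_def flip: rng_def)
    also have "\<sigma> (rr u) \<otimes>\<^bsub>V\<^esub> S v = S v" using V.rr_mult_self(1)[OF SD(1)] SD(3) uv by simp
    finally have "F (n \<otimes> R u) = v" using Fl[OF n(1) Ru(1)] n(2) d(1) by simp
    then show "v \<in> F ` carrier U" using n(1) Ru(1) by (auto intro!: image_eqI[of _ _ "n \<otimes> R u"] simp: m_closed)
  qed (use Fc in auto)
  ultimately have "bij_betw F (carrier U) (carrier V)" by (simp add: bij_betw_def)
  then show thesis using that[of F] Fc(2) FN Fl Fr by blast
qed

text \<open>The multiplication of \<open>V\<close> is pulled back along the bijection; linearity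
  over \<open>N\<close> on both sides is what \<open>twisted\<close> demands of the result.\<close>

lemma equivalent_to_twisted:
  obtains s where "twisted U G j s" "equivalent_ext A (V, i', j') (U\<lparr>mult := s\<rparr>, i, j)"
proof -
  obtain F where bij: "bij_betw F (carrier U) (carrier V)" and Fj: "\<And>u. u \<in> carrier U \<Longrightarrow> j' (F u) = j u"
    and FN: "\<And>n. n \<in> N \<Longrightarrow> F n = \<sigma> n"
    and Fl: "\<And>a u. \<lbrakk>a \<in> N; u \<in> carrier U\<rbrakk> \<Longrightarrow> F (a \<otimes> u) = \<sigma> a \<otimes>\<^bsub>V\<^esub> F u"
    and Fr: "\<And>a u. \<lbrakk>a \<in> N; u \<in> carrier U\<rbrakk> \<Longrightarrow> F (u \<otimes> a) = F u \<otimes>\<^bsub>V\<^esub> \<sigma> a"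
    by (rule exists_bimodule_bijection) blast
  define H where "H = inv_into (carrier U) F"
  have HF: "H (F u) = u" if "u \<in> carrier U" for u
    unfolding H_def using bij that by (simp add: bij_betw_inv_into_left)
  have FH: "F (H v) = v" "H v \<in> carrier U" if "v \<in> carrier V" for v
    unfolding H_def using bij that bij_betw_inv_into[OF bij] by (auto simp: bij_betw_inv_into_right bij_betw_def)
  have Fc: "F u \<in> carrier V" if "u \<in> carrier U" for u using bij that by (auto simp: bij_betw_def)
  define s where "s u v = H (F u \<otimes>\<^bsub>V\<^esub> F v)" for u v
  have iso: "H \<in> iso V (U\<lparr>mult := s\<rparr>)"
    using bij_betw_inv_into[OF bij] FH by (auto simp: iso_def hom_def s_def simp flip: H_def)
  have inv: "inverse_semigroup (U\<lparr>mult := s\<rparr>)" by (rule iso_transport(1)[OF V.inverse_U iso])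
  have tw: "twisted U G j s"
  proof (intro twisted.intro twisted_axioms.intro graded_axioms inv)
    fix a u assume a: "a \<in> N" and u: "u \<in> carrier U"
    show "s a u = a \<otimes> u" "s u a = u \<otimes> a"
      using a u HF[of "a \<otimes> u"] HF[of "u \<otimes> a"] by (simp_all add: s_def FN m_closed flip: Fl Fr)
  next
    fix u v assume u: "u \<in> carrier U" "v \<in> carrier U"
    have "j (s u v) = j' (F (s u v))" using u Fc FH(2) by (simp add: s_def Fj V.m_closed)
    then show "j (s u v) = j u \<otimes>\<^bsub>G\<^esub> j v" using u Fc FH by (simp add: s_def Fj V.m_closed)
  qed
  have "H (i' a) = i a" if "a \<in> carrier A" for a
    using that HF[of "i a"] FN[of "i a"] by (simp add: \<sigma>_props(8))
  moreover have "j (H v) = j' v" if "v \<in> carrier V" for v using Fj[OF FH(2)[OF that]] FH(1)[OF that] by simp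
  ultimately have "equivalent_ext A (V, i', j') (U\<lparr>mult := s\<rparr>, i, j)" using iso by auto
  then show thesis using that tw by blast
qed

end

section \<open>Classification\<close>

lemma iso_inverse:
  assumes U: "inverse_semigroup U" and h: "h \<in> iso U V"
  shows "inv_into (carrier U) h \<in> iso V U"
proof -
  interpret U: inverse_semigroup U by fact
  have bij: "bij_betw h (carrier U) (carrier V)" and m: "\<And>x y. \<lbrakk>x \<in> carrier U; y \<in> carrier U\<rbrakk> \<Longrightarrow> h (x \<otimes>\<^bsub>U\<^esub> y) = h x \<otimes>\<^bsub>V\<^esub> h y"
    using h by (auto simp: iso_def hom_def)
  let ?k = "inv_into (carrier U) h"
  have k: "?k v \<in> carrier U" "h (?k v) = v" if "v \<in> carrier V" for v
    using that bij_betw_inv_into[OF bij] bij by (auto simp: bij_betw_def f_inv_into_f)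
  have "?k (v \<otimes>\<^bsub>V\<^esub> w) = ?k v \<otimes>\<^bsub>U\<^esub> ?k w" if "v \<in> carrier V" "w \<in> carrier V" for v w
  proof -
    have "v \<otimes>\<^bsub>V\<^esub> w = h (?k v \<otimes>\<^bsub>U\<^esub> ?k w)" using that k by (simp add: m)
    then show ?thesis using that k bij by (simp add: bij_betw_inv_into_left U.m_closed)
  qed
  then show ?thesis using bij_betw_inv_into[OF bij] k by (auto simp: iso_def hom_def)
qed

lemma equivalent_ext_sym:
  assumes E: "group_extension A G E" and eq: "equivalent_ext A E F"
  shows "equivalent_ext A F E"
proof -
  obtain U i j where E_def: "E = (U, i, j)" by (cases E)
  obtain V i' j' where F_def: "F = (V, i', j')" by (cases F)
  have U: "inverse_semigroup U" and i: "i \<in> carrier A \<rightarrow> carrier U"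
    using E by (auto simp: E_def mon_def hom_def)
  obtain \<mu> where \<mu>: "\<mu> \<in> iso U V" "\<And>a. a \<in> carrier A \<Longrightarrow> \<mu> (i a) = i' a" "\<And>u. u \<in> carrier U \<Longrightarrow> j' (\<mu> u) = j u"
    using eq by (auto simp: E_def F_def)
  have bij: "bij_betw \<mu> (carrier U) (carrier V)" using \<mu>(1) by (simp add: iso_def)
  let ?k = "inv_into (carrier U) \<mu>"
  have "?k (i' a) = i a" if "a \<in> carrier A" for a
    using that i bij bij_betw_inv_into_left[OF bij, of "i a"] by (auto simp flip: \<mu>(2))
  moreover have "j (?k v) = j' v" if "v \<in> carrier V" for v
  proof -
    have "?k v \<in> carrier U" "\<mu> (?k v) = v"
      using that bij_betw_apply[OF bij_betw_inv_into[OF bij]] bij_betw_inv_into_right[OF bij] by auto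
    then show ?thesis using \<mu>(3)[of "?k v"] by simp
  qed
  ultimately show ?thesis unfolding E_def F_def using iso_inverse[OF U \<mu>(1)] by auto
qed

lemma equivalent_ext_trans:
  assumes eq: "equivalent_ext A E F" "equivalent_ext A F H" and E: "group_extension A G E"
  shows "equivalent_ext A E H"
proof -
  obtain U i j where E_def: "E = (U, i, j)" by (cases E)
  obtain V i' j' where F_def: "F = (V, i', j')" by (cases F)
  obtain W i'' j'' where H_def: "H = (W, i'', j'')" by (cases H)
  obtain \<mu> where \<mu>: "\<mu> \<in> iso U V" "\<And>a. a \<in> carrier A \<Longrightarrow> \<mu> (i a) = i' a" "\<And>u. u \<in> carrier U \<Longrightarrow> j' (\<mu> u) = j u"
    using eq(1) by (auto simp: E_def F_def)
  obtain \<nu> where \<nu>: "\<nu> \<in> iso V W" "\<And>a. a \<in> carrier A \<Longrightarrow> \<nu> (i' a) = i'' a" "\<And>u. u \<in> carrier V \<Longrightarrow> j'' (\<nu> u) = j' u"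
    using eq(2) by (auto simp: F_def H_def)
  have "\<nu> \<circ> \<mu> \<in> iso U W"
    using \<mu>(1) \<nu>(1) by (auto simp: iso_def hom_def Pi_iff intro: bij_betw_trans)
  moreover have "\<mu> u \<in> carrier V" if "u \<in> carrier U" for u using \<mu>(1) that by (auto simp: iso_def hom_def)
  ultimately show ?thesis unfolding E_def H_def using \<mu>(2,3) \<nu>(2,3) by (auto intro!: bexI[of _ "\<nu> \<circ> \<mu>"])
qed

lemma kernel_ext_of_admissible:
  assumes k: "abstract_kernel A G \<psi>" and E: "(U, i, j) \<in> admissible_exts A G \<psi>"
  obtains R where "kernel_ext A U G j i \<psi> R"
proof -
  have A: "semilattice_of_groups A" "group G" using k by (auto simp: abstract_kernel_def)
  have ge: "group_extension A G (U, i, j)" using E by (simp add: admissible_exts_def)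
  interpret ext_base A U G j i by (rule ext_baseI[OF A ge])
  show thesis using E that unfolding admissible_exts_iff
    by (auto intro!: kernel_ext.intro kernel_ext_axioms.intro ext_base_axioms k)
qed

section \<open>Twisted extensions and cohomology classes\<close>

context kernel_ext
begin

lemma admissible: "(U, i, j) \<in> admissible_exts A G \<psi>"
  unfolding admissible_exts_iff using sectionR kernel_acts by blast

text \<open>The old section still serves: it and its action are expressed by degrees, idempotents,
  multiplication by \<open>E\<close> and conjugation on \<open>N\<close>, and none of these changes
  under the twist.\<close>

lemma twisted_admissible:
  assumes tw: "twisted U G j s"
  shows "(U\<lparr>mult := s\<rparr>, i, j) \<in> admissible_exts A G \<psi>"
proof -
  interpret T: twisted U G j s by fact
  have s_i: "s (i a) (i b) = i a \<otimes> i b" if "a \<in> carrier A" "b \<in> carrier A" for a b using that by (simp add: T.star_N)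
  have "group_extension A G (U\<lparr>mult := s\<rparr>, i, j)"
    using T.inverse_star i_mon T.T.j_hom j_onto i_image s_i
    unfolding group_extension.simps mon_def epi_def kernel_def hom_def by auto
  then interpret W: ext_base A "U\<lparr>mult := s\<rparr>" G j i
    by (rule ext_baseI[OF A.semilattice_of_groups_axioms G.group_axioms])
  have rr: "rng (U\<lparr>mult := s\<rparr>) u = rr u" if "u \<in> carrier U" for u by (rule T.star_rr[OF that])
  have iv: "sg_inv (U\<lparr>mult := s\<rparr>) u \<in> carrier U" "j (sg_inv (U\<lparr>mult := s\<rparr>) u) = inv\<^bsub>G\<^esub> j u" if "u \<in> carrier U" for u
    using T.T.iv_closed[OF that] T.T.j_iv[OF that] by simp_all
  have sN: "s e u = e \<otimes> u" if "e \<in> E" "u \<in> carrier U" for e u using that by (simp add: T.star_N)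
  have sec: "T.T.is_section R"
    unfolding T.T.is_section_def
  proof (intro conjI ballI impI)
    fix u assume u: "u \<in> carrier U"
    note RD = sectionD(1-5)[OF sectionR u]
    show "R u \<in> carrier U" "j (R u) = j u" by (rule RD)+
    show "T.T.rr (R u) = T.T.rr u" unfolding rr[OF u] rr[OF RD(1)] by (rule RD)
    show "R v = R u" if v: "v \<in> carrier U" "j v = j u" "T.T.rr v = T.T.rr u" for v
      using v(3) unfolding rr[OF u] rr[OF v(1)] by (rule RD(4)[OF v(1,2)])
    show "R (s e u) = s e (R u)" if e: "e \<in> E" for e
      unfolding sN[OF e u] sN[OF e RD(1)] by (rule RD(5)[OF e])
  next
    show "R e = e" if "e \<in> E" for e by (rule sectionD(6)[OF sectionR E_closed[OF that] that])
  qed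
  have "W.acts R g a b \<longleftrightarrow> acts R g a b" for g a b
  proof -
    have "rng (U\<lparr>mult := s\<rparr>) (sg_inv (U\<lparr>mult := s\<rparr>) u) = rr (iv u)" if u: "u \<in> carrier U" for u
    proof -
      \<comment> \<open>The two inverses of \<open>u\<close> may differ, but both domain idempotents
        fix \<open>u\<close> from the right, so each lies below the other.\<close>
      let ?y = "T.T.iv u" and ?f = "T.T.rr (T.T.iv u)" and ?d = "rr (iv u)"
      have y: "?y \<in> carrier U" by (rule iv(1)[OF u])
      have f: "?f \<in> E" "?d \<in> E" using y u T.T.rr_E by simp_all
      have "u \<otimes> ?f = u" using T.T.rr_mult_self(3)[OF u] u f by (simp add: T.star_N)
      then have "iv u \<otimes> (u \<otimes> ?f) = iv u \<otimes> u" by simp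
      then have df: "?d \<otimes> ?f = ?d" using u f by (simp add: rng_def[of U] m_assoc)
      have fy: "?f = s ?y u" using T.T.iv_iv[OF u] by (simp add: rng_def)
      have "s ?f ?d = s ?y (s u ?d)" unfolding fy using T.T.m_assoc[OF y u] u by simp
      also have "s u ?d = u" using u by (simp add: T.star_N)
      finally have "?f \<otimes> ?d = ?f" using f by (simp add: T.star_N flip: fy)
      then show ?thesis using df idempotent_comm[OF f] by simp
    qed
    moreover have "conjugate (U\<lparr>mult := s\<rparr>) (R u) (i a) = cj (R u) (i a)" if "u \<in> carrier U" "a \<in> carrier A" for u
      using T.star_cj[of "R u" "i a"] sectionD(1)[OF sectionR] that by simp
    ultimately show ?thesis unfolding W.acts_def acts_def by (auto cong: conj_cong)
  qed
  then show ?thesis unfolding W.admissible_exts_iff using sec kernel_acts by auto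
qed

text \<open>The section is carried along by \<open>h\<close>, while the action on \<open>A\<close>
  stays literally the same because \<open>h\<close> is composed into the embedding.\<close>

lemma transport:
  assumes h: "h \<in> iso U V"
  defines "E' \<equiv> (V, h \<circ> i, j \<circ> inv_into (carrier U) h)"
  shows "E' \<in> admissible_exts A G \<psi>" "equivalent_ext A (U, i, j) E'"
proof -
  define k where "k = inv_into (carrier U) h"
  note tr = iso_transport[OF inverse_U h]
  have bij: "bij_betw h (carrier U) (carrier V)" and hm: "\<And>x y. \<lbrakk>x \<in> carrier U; y \<in> carrier U\<rbrakk> \<Longrightarrow> h (x \<otimes> y) = h x \<otimes>\<^bsub>V\<^esub> h y"
    using h by (auto simp: iso_def hom_def)
  have V: "carrier V = h ` carrier U" using bij by (simp add: bij_betw_def)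
  have kh: "k (h u) = u" if "u \<in> carrier U" for u using that bij by (simp add: k_def bij_betw_inv_into_left)
  have heq: "h u = h v \<longleftrightarrow> u = v" if "u \<in> carrier U" "v \<in> carrier U" for u v using kh that by metis
  have hrr: "rng V (h u) = h (rr u)" if "u \<in> carrier U" for u using that by (simp add: rng_def tr(2) hm)
  have hcj: "conjugate V (h u) (h v) = h (cj u v)" if "u \<in> carrier U" "v \<in> carrier U" for u v
    using that by (simp add: conjugate_def tr(2) hm m_closed)
  have "h \<circ> i \<in> mon A V"
    using i_hom hm heq by (auto simp: mon_def hom_def inj_on_def V i_mult i_inj)
  moreover have "j \<circ> k \<in> epi V G"
  proof -
    have "(j \<circ> k) ` carrier V = j ` carrier U" unfolding V image_image using kh by (intro image_cong) simp_all
    then show ?thesis using j_onto by (auto simp: epi_def hom_def V kh m_closed simp flip: hm)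
  qed
  moreover have "(h \<circ> i) ` carrier A = {v \<in> carrier V. (j \<circ> k) v = \<one>\<^bsub>G\<^esub>}"
  proof -
    have "(h \<circ> i) ` carrier A = h ` N" by (simp only: image_comp i_image[symmetric])
    also have "\<dots> = {v \<in> carrier V. (j \<circ> k) v = \<one>\<^bsub>G\<^esub>}" unfolding kernel_def V using kh by auto
    finally show ?thesis .
  qed
  ultimately have "group_extension A G (V, h \<circ> i, j \<circ> k)" using tr(1) by simp
  then interpret W: ext_base A V G "j \<circ> k" "h \<circ> i"
    by (rule ext_baseI[OF A.semilattice_of_groups_axioms G.group_axioms])
  let ?R = "h \<circ> R \<circ> k"
  note RD = sectionD[OF sectionR]
  have sec: "W.is_section ?R"
    unfolding W.is_section_def V tr(3)
  proof (intro conjI ballI impI)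
    fix v assume "v \<in> h ` carrier U"
    then obtain u where u: "u \<in> carrier U" "v = h u" by blast
    note R = RD(1-5)[OF u(1)]
    have v: "?R v = h (R u)" using u kh by simp
    show "?R v \<in> h ` carrier U" unfolding v using R(1) by blast
    show "(j \<circ> k) (?R v) = (j \<circ> k) v" unfolding v using u(2) kh[OF u(1)] kh[OF R(1)] R(2) by simp
    show "rng V (?R v) = rng V v" unfolding v unfolding u(2) hrr[OF R(1)] hrr[OF u(1)] R(3) ..
    show "?R v' = ?R v" if v': "v' \<in> h ` carrier U" "(j \<circ> k) v' = (j \<circ> k) v" "rng V v' = rng V v" for v'
    proof -
      obtain u' where u': "u' \<in> carrier U" "v' = h u'" using v'(1) by blast
      have "R u' = R u"
        by (rule R(4)[OF u'(1)]) (use v'(2,3) u u' kh hrr heq in \<open>simp_all\<close>)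
      then show ?thesis using u u' kh by simp
    qed
    show "?R (f \<otimes>\<^bsub>V\<^esub> v) = f \<otimes>\<^bsub>V\<^esub> ?R v" if f: "f \<in> h ` E" for f
    proof -
      obtain e where e: "e \<in> E" "f = h e" using f by blast
      have "f \<otimes>\<^bsub>V\<^esub> v = h (e \<otimes> u)" using e u hm by simp
      then have "?R (f \<otimes>\<^bsub>V\<^esub> v) = h (e \<otimes> R u)" using kh[of "e \<otimes> u"] e u R(5) by (simp add: m_closed)
      then show ?thesis unfolding v using e R(1) hm by simp
    qed
  next
    fix f assume "f \<in> h ` E"
    then obtain e where e: "e \<in> E" "f = h e" by blast
    then show "?R f = f" using kh[of e] RD(6)[of e e] by simp
  qed
  have "W.acts ?R g a b \<longleftrightarrow> acts R g a b" for g a b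
  proof -
    have "(j \<circ> k) (h u) = g \<and> rng V (sg_inv V (h u)) = (h \<circ> i) (A.rr a) \<and> (h \<circ> i) b = conjugate V (?R (h u)) ((h \<circ> i) a)
        \<longleftrightarrow> j u = g \<and> rr (iv u) = i (A.rr a) \<and> i b = cj (R u) (i a)"
      if u: "u \<in> carrier U" and a: "a \<in> carrier A" "b \<in> carrier A" for u
      using RD(1)[OF u] u a by (simp add: kh tr(2) hrr hcj heq)
    then show ?thesis unfolding W.acts_def acts_def V by auto
  qed
  note acts_eq = this
  show "E' \<in> admissible_exts A G \<psi>"
    unfolding E'_def k_def[symmetric] W.admissible_exts_iff
    by (intro exI[of _ ?R] conjI sec ballI) (simp only: acts_eq kernel_acts)
  show "equivalent_ext A (U, i, j) E'"
    unfolding E'_def equivalent_ext.simps k_def[symmetric] using h kh by (intro bexI[of _ h]) auto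
qed

text \<open>\<open>u\<close> can be recovered from its coordinates in \<open>A\<close> and
  \<open>G\<close>: \<open>c u\<close> has the idempotent of \<open>u\<close>, this and the degree
  determine \<open>R u\<close>, and \<open>u\<close> is \<open>c u\<close> times
  \<open>R u\<close>.\<close>

lemma transport_to_type:
  fixes e :: "'a \<times> 'g \<Rightarrow> 'v"
  assumes e: "inj_on e (carrier A \<times> carrier G)"
  obtains E' :: "('a, 'v, 'g) ext" where "E' \<in> admissible_exts A G \<psi>" "equivalent_ext A (U, i, j) E'"
proof -
  define c where "c u = u \<otimes> iv (R u)" for u
  define h where "h u = e (\<iota> (c u), j u)" for u
  note RD = sectionD[OF sectionR]
  have c: "u = c u \<otimes> R u" "c u \<in> N" "rr (c u) = rr u" if u: "u \<in> carrier U" for u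
    using factor[OF u RD(1)[OF u]] RD(2,3)[OF u] by (simp_all add: c_def)
  have inj: "inj_on h (carrier U)"
  proof (rule inj_onI)
    fix u v assume u: "u \<in> carrier U" "v \<in> carrier U" and eq: "h u = h v"
    have "(\<iota> (c u), j u) = (\<iota> (c v), j v)"
      by (rule inj_onD[OF e]) (use eq u c(2) inv_props in \<open>auto simp: h_def\<close>)
    then have jj: "j u = j v" and "\<iota> (c u) = \<iota> (c v)" by simp_all
    then have cc: "c u = c v" using inv_props(2)[OF c(2)] u by metis
    then have "rr u = rr v" using c(3) u by metis
    then have "R u = R v" using RD(4)[OF u(2,1)] jj by simp
    then show "u = v" using c(1) u cc by metis
  qed
  define V :: "'v monoid" where "V = \<lparr>carrier = h ` carrier U,
    mult = (\<lambda>x y. h (inv_into (carrier U) h x \<otimes> inv_into (carrier U) h y)), one = undefined\<rparr>"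
  have "h \<in> iso U V"
    using inj by (auto simp: iso_def hom_def V_def bij_betw_def)
  from transport[OF this] show thesis by (rule that)
qed

abbreviation K where "K c \<equiv> coboundaries B G \<Theta> 2 #>\<^bsub>cochains B G \<Theta> 2\<^esub> c"

text \<open>Applying \<open>\<Gamma>2\<close>, which is injective, turns the coset relation into the
  criterion of \<open>twisted_iso_iff\<close>; by \<open>\<Gamma>1_surj\<close> every
  \<open>\<phi>\<close> there comes from a cochain of degree 1.\<close>

lemma coset_eq_iff:
  assumes c: "c \<in> C2" "d \<in> C2"
  shows "K c = K d \<longleftrightarrow> (\<exists>\<phi>. cochain1 \<phi> \<and> (\<forall>u\<in>carrier U. \<forall>v\<in>carrier U. \<Gamma>2 c u v = \<Gamma>2 d u v \<otimes> delta1 \<phi> u v))"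
proof -
  interpret C2: group "cochains B G \<Theta> 2" by (rule group_C2)
  note sub = coboundaries_subgroup
  note D = cochain2D(1)[OF \<Gamma>2_cochain]
  have "K c = K d \<longleftrightarrow> c \<in> K d"
    using C2.repr_independence[OF _ c(2) sub] C2.rcos_self[OF c(1) sub] by metis
  also have "\<dots> \<longleftrightarrow> (\<exists>f\<in>C1. c = coboundary B G \<Theta> (Suc 0) f \<otimes>\<^bsub>cochains B G \<Theta> 2\<^esub> d)"
    by (auto simp: r_coset_def coboundaries_def)
  also have "\<dots> \<longleftrightarrow> (\<exists>f\<in>C1. \<forall>u\<in>carrier U. \<forall>v\<in>carrier U. \<Gamma>2 c u v = \<Gamma>2 d u v \<otimes> delta1 (\<Gamma>1 f) u v)"
  proof (intro bex_cong refl)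
    fix f assume f: "f \<in> C1"
    note cf = coboundary1[OF f]
    have fd: "coboundary B G \<Theta> (Suc 0) f \<otimes>\<^bsub>cochains B G \<Theta> 2\<^esub> d \<in> C2" using cf(1) c(2) by (rule C2.m_closed)
    have val: "\<Gamma>2 (coboundary B G \<Theta> (Suc 0) f \<otimes>\<^bsub>cochains B G \<Theta> 2\<^esub> d) u v = \<Gamma>2 d u v \<otimes> delta1 (\<Gamma>1 f) u v"
      if u: "u \<in> carrier U" "v \<in> carrier U" for u v
      using \<Gamma>2_mult[OF cf(1) c(2) u] cf(2)[OF u] D[OF cf(1) u] D[OF c(2) u] by (simp add: Z_mult_comm)
    show "c = coboundary B G \<Theta> (Suc 0) f \<otimes>\<^bsub>cochains B G \<Theta> 2\<^esub> d \<longleftrightarrow>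
        (\<forall>u\<in>carrier U. \<forall>v\<in>carrier U. \<Gamma>2 c u v = \<Gamma>2 d u v \<otimes> delta1 (\<Gamma>1 f) u v)"
      using \<Gamma>2_inj[OF c(1) fd] val by auto
  qed
  also have "\<dots> \<longleftrightarrow> (\<exists>\<phi>. cochain1 \<phi> \<and> (\<forall>u\<in>carrier U. \<forall>v\<in>carrier U. \<Gamma>2 c u v = \<Gamma>2 d u v \<otimes> delta1 \<phi> u v))"
  proof
    assume "\<exists>f\<in>C1. \<forall>u\<in>carrier U. \<forall>v\<in>carrier U. \<Gamma>2 c u v = \<Gamma>2 d u v \<otimes> delta1 (\<Gamma>1 f) u v"
    then show "\<exists>\<phi>. cochain1 \<phi> \<and> (\<forall>u\<in>carrier U. \<forall>v\<in>carrier U. \<Gamma>2 c u v = \<Gamma>2 d u v \<otimes> delta1 \<phi> u v)"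
      using \<Gamma>1_cochain by blast
  next
    assume "\<exists>\<phi>. cochain1 \<phi> \<and> (\<forall>u\<in>carrier U. \<forall>v\<in>carrier U. \<Gamma>2 c u v = \<Gamma>2 d u v \<otimes> delta1 \<phi> u v)"
    then obtain \<phi> where p: "cochain1 \<phi>" "\<forall>u\<in>carrier U. \<forall>v\<in>carrier U. \<Gamma>2 c u v = \<Gamma>2 d u v \<otimes> delta1 \<phi> u v" by blast
    obtain f where f: "f \<in> C1" "\<And>u. u \<in> carrier U \<Longrightarrow> \<Gamma>1 f u = \<phi> u" using \<Gamma>1_surj[OF p(1)] by blast
    have "delta1 (\<Gamma>1 f) u v = delta1 \<phi> u v" if "u \<in> carrier U" "v \<in> carrier U" for u v
      using that f(2) by (simp add: delta1_def m_closed)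
    then show "\<exists>f\<in>C1. \<forall>u\<in>carrier U. \<forall>v\<in>carrier U. \<Gamma>2 c u v = \<Gamma>2 d u v \<otimes> delta1 (\<Gamma>1 f) u v"
      using p(2) by (intro bexI[OF _ f(1)]) simp
  qed
  finally show ?thesis .
qed

definition normalized_cocycles where "normalized_cocycles = {c \<in> C2. cocycle2 (\<Gamma>2 c) \<and> normalized (\<Gamma>2 c)}"
definition twisted_ext where "twisted_ext c = (U\<lparr>mult := twist (\<Gamma>2 c)\<rparr>, i, j)"

text \<open>A cocycle that is not normalized gives no extension with the same \<open>i\<close>;
  \<open>normalization\<close> supplies a representative in each class that does.\<close>

lemma cohomology_carrier: "carrier (cohomology B G \<Theta> 2) = K ` normalized_cocycles"
proof -
  have "carrier (cohomology B G \<Theta> 2) = K ` cocycles B G \<Theta> 2"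
    by (auto simp: cohomology_def FactGroup_def RCOSETS_def r_coset_def)
  also have "\<dots> = K ` normalized_cocycles"
  proof (intro equalityI subsetI)
    fix X assume "X \<in> K ` cocycles B G \<Theta> 2"
    then obtain c where c: "X = K c" "c \<in> C2" "cocycle2 (\<Gamma>2 c)" using cocycles_iff by blast
    obtain \<phi> where p: "cochain1 \<phi>" "cocycle2 (\<lambda>u v. \<Gamma>2 c u v \<otimes> delta1 \<phi> u v)"
      "normalized (\<lambda>u v. \<Gamma>2 c u v \<otimes> delta1 \<phi> u v)" using normalization[OF c(3)] by blast
    have "cochain2 (\<lambda>u v. \<Gamma>2 c u v \<otimes> delta1 \<phi> u v)" using p(2) unfolding cocycle2_def by blast
    then obtain d where d: "d \<in> C2" "\<And>u v. \<lbrakk>u \<in> carrier U; v \<in> carrier U\<rbrakk> \<Longrightarrow> \<Gamma>2 d u v = \<Gamma>2 c u v \<otimes> delta1 \<phi> u v"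
      by (rule \<Gamma>2_surj) blast
    have "d \<in> normalized_cocycles" using d p(2,3) \<Gamma>2_cochain[OF d(1)] by (simp add: normalized_cocycles_def cocycle2_def normalized_def m_closed)
    moreover have "K d = K c" unfolding coset_eq_iff[OF d(1) c(2)] using p(1) d(2) by blast
    ultimately show "X \<in> K ` normalized_cocycles" using c(1) by blast
  next
    fix X assume "X \<in> K ` normalized_cocycles" then show "X \<in> K ` cocycles B G \<Theta> 2" using cocycles_iff by (auto simp: normalized_cocycles_def)
  qed
  finally show ?thesis .
qed

lemma twisted_normalized: "c \<in> normalized_cocycles \<Longrightarrow> twisted U G j (twist (\<Gamma>2 c))"
  by (auto simp: normalized_cocycles_def intro: twisted_twist)

lemma twisted_ext_admissible: "c \<in> normalized_cocycles \<Longrightarrow> twisted_ext c \<in> admissible_exts A G \<psi>"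
  unfolding twisted_ext_def by (rule twisted_admissible[OF twisted_normalized])

text \<open>Fixing every \<open>i a\<close> means fixing \<open>N\<close> pointwise, so equivalences
  are the isomorphisms treated in \<open>twisted_iso_iff\<close>.\<close>

lemma twisted_ext_equivalent_iff: assumes c: "c \<in> normalized_cocycles" "d \<in> normalized_cocycles"
  shows "equivalent_ext A (twisted_ext c) (twisted_ext d) \<longleftrightarrow> K c = K d"
proof -
  have cd: "c \<in> C2" "d \<in> C2" "cocycle2 (\<Gamma>2 c)" "cocycle2 (\<Gamma>2 d)" using c by (auto simp: normalized_cocycles_def)
  have "equivalent_ext A (twisted_ext c) (twisted_ext d) \<longleftrightarrow> (\<exists>\<mu>\<in>iso (U\<lparr>mult := twist (\<Gamma>2 c)\<rparr>) (U\<lparr>mult := twist (\<Gamma>2 d)\<rparr>).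
      (\<forall>a\<in>N. \<mu> a = a) \<and> (\<forall>u\<in>carrier U. j (\<mu> u) = j u))"
    unfolding twisted_ext_def by (simp flip: i_image)
  also have "\<dots> \<longleftrightarrow> K c = K d"
    unfolding twisted_iso_iff[OF twisted_normalized[OF c(1)] twisted_normalized[OF c(2)]] coset_eq_iff[OF cd(1,2)]
    using factor_set_twist[OF cd(3)] factor_set_twist[OF cd(4)] by (intro ex_cong1) auto
  finally show ?thesis .
qed

lemma equivalent_to_twisted_ext:
  fixes E' :: "('a, 'v, 'g) ext"
  assumes E': "E' \<in> admissible_exts A G \<psi>"
  shows "\<exists>c\<in>normalized_cocycles. equivalent_ext A E' (twisted_ext c)"
proof -
  obtain V i' j' where E'_def: "E' = (V, i', j')" by (cases E')
  obtain R' where "kernel_ext A V G j' i' \<psi> R'"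
    using kernel_ext_of_admissible[OF kernel] E' unfolding E'_def by blast
  then interpret W: two_kernel_ext A U G j i \<psi> R V j' i' R'
    by (intro two_kernel_ext.intro kernel_ext_axioms)
  obtain s where s: "twisted U G j s" "equivalent_ext A (V, i', j') (U\<lparr>mult := s\<rparr>, i, j)"
    by (rule W.equivalent_to_twisted)
  interpret s: twisted U G j s by fact
  obtain c where c: "c \<in> C2" "\<And>u v. \<lbrakk>u \<in> carrier U; v \<in> carrier U\<rbrakk> \<Longrightarrow> \<Gamma>2 c u v = twist_factor U s u v"
    using \<Gamma>2_surj[OF s.factor_set_cochain2] by blast
  have cZ: "c \<in> normalized_cocycles"
    using c s.factor_set_cocycle2 s.factor_set_normalized \<Gamma>2_cochain[OF c(1)]
    by (simp add: normalized_cocycles_def cocycle2_def normalized_def m_closed)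
  \<comment> \<open>The product \<open>s\<close> and the twist by \<open>c\<close> agree on
    \<open>carrier U\<close> but not necessarily off it, so the two extensions are equivalent rather
    than equal.\<close>
  have "id \<in> iso (U\<lparr>mult := s\<rparr>) (U\<lparr>mult := twist (\<Gamma>2 c)\<rparr>)"
    using c(2) s.factor_set_props(1) s.star_closed by (auto simp: iso_def hom_def)
  then have "equivalent_ext A (U\<lparr>mult := s\<rparr>, i, j) (twisted_ext c)"
    unfolding twisted_ext_def equivalent_ext.simps by (intro bexI[of _ id]) simp_all
  moreover have "group_extension A G (V, i', j')" by (rule W.V.group_extension)
  ultimately have "equivalent_ext A (V, i', j') (twisted_ext c)" by (rule equivalent_ext_trans[OF s(2)])
  then show ?thesis using cZ E'_def by blast
qed

text \<open>Twisted extensions live in the type of \<open>U\<close>, the classes in another one. An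
  extension is therefore judged by a twisted extension equivalent to it, and surjectivity requires
  moving a twisted extension into the given type along \<open>e\<close>.\<close>

theorem classes_cohomology:
  fixes e :: "'a \<times> 'g \<Rightarrow> 'v"
  assumes e: "inj_on e (carrier A \<times> carrier G)"
  shows "\<exists>\<Phi>. bij_betw \<Phi> (admissible_ext_classes A G \<psi> :: ('a, 'v, 'g) ext set set)
    (carrier (cohomology B G \<Theta> 2))"
proof -
  let ?X = "admissible_exts A G \<psi> :: ('a, 'v, 'g) ext set"
  let ?r = "{(E, E'). E \<in> ?X \<and> E' \<in> ?X \<and> equivalent_ext A E E'}"
  have ge: "group_extension A G E" if "E \<in> admissible_exts A G \<psi>" for E :: "('a, 'x, 'g) ext"
    using that by (cases E) (simp add: admissible_exts_def)
  \<comment> \<open>The cocycle is a choice, its coset is not: by \<open>eq\<close> the coset is a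
    complete invariant of the equivalence class.\<close>
  define q where "q E = (SOME c. c \<in> normalized_cocycles \<and> equivalent_ext A E (twisted_ext c))" for E :: "('a, 'v, 'g) ext"
  have q: "q E \<in> normalized_cocycles \<and> equivalent_ext A E (twisted_ext (q E))" if "E \<in> ?X" for E
  proof -
    have "\<exists>c. c \<in> normalized_cocycles \<and> equivalent_ext A E (twisted_ext c)" using equivalent_to_twisted_ext[OF that] by blast
    then show ?thesis unfolding q_def by (rule someI_ex)
  qed
  have eq: "equivalent_ext A E E' \<longleftrightarrow> K (q E) = K (q E')" if E: "E \<in> ?X" "E' \<in> ?X" for E E'
  proof -
    note qE = q[OF E(1)] and qE' = q[OF E(2)]
    have T: "group_extension A G (twisted_ext (q E))" "group_extension A G (twisted_ext (q E'))"
      using twisted_ext_admissible qE qE' ge by blast+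
    note sE = equivalent_ext_sym[OF ge[OF E(1)]] and sE' = equivalent_ext_sym[OF ge[OF E(2)]]
    have "equivalent_ext A E E' \<longleftrightarrow> equivalent_ext A (twisted_ext (q E)) (twisted_ext (q E'))"
    proof
      assume "equivalent_ext A E E'"
      then have "equivalent_ext A E (twisted_ext (q E'))" using equivalent_ext_trans[OF _ _ ge[OF E(1)]] qE' by blast
      then show "equivalent_ext A (twisted_ext (q E)) (twisted_ext (q E'))" using equivalent_ext_trans[OF _ _ T(1)] sE qE by blast
    next
      assume "equivalent_ext A (twisted_ext (q E)) (twisted_ext (q E'))"
      then have "equivalent_ext A E (twisted_ext (q E'))" using equivalent_ext_trans[OF _ _ ge[OF E(1)]] qE by blast
      then show "equivalent_ext A E E'" using equivalent_ext_trans[OF _ _ ge[OF E(1)]] sE' qE' by blast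
    qed
    then show ?thesis using twisted_ext_equivalent_iff qE qE' by simp
  qed
  have img: "(\<lambda>E. K (q E)) ` ?X = K ` normalized_cocycles"
  proof (intro equalityI subsetI)
    fix Y assume "Y \<in> K ` normalized_cocycles"
    then obtain c where c: "c \<in> normalized_cocycles" "Y = K c" by blast
    obtain R' where "kernel_ext A (U\<lparr>mult := twist (\<Gamma>2 c)\<rparr>) G j i \<psi> R'"
      using kernel_ext_of_admissible[OF kernel] twisted_ext_admissible[OF c(1)] unfolding twisted_ext_def by blast
    then obtain E where E: "E \<in> ?X" "equivalent_ext A (twisted_ext c) E"
      unfolding twisted_ext_def by (rule kernel_ext.transport_to_type[OF _ e]) blast
    have "equivalent_ext A (twisted_ext c) (twisted_ext (q E))"
      using equivalent_ext_trans[OF E(2) _ ge[OF twisted_ext_admissible[OF c(1)]]] q[OF E(1)] by blast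
    then have "Y = K (q E)" using twisted_ext_equivalent_iff[OF c(1)] q[OF E(1)] c(2) by simp
    then show "Y \<in> (\<lambda>E. K (q E)) ` ?X" using E(1) by blast
  qed (use q in blast)
  have cl: "?r `` {E} = {E' \<in> ?X. K (q E') = K (q E)}" if "E \<in> ?X" for E
    using that eq[OF that] by auto
  define \<Phi> where "\<Phi> Q = K (q (SOME E. E \<in> Q))" for Q
  have \<Phi>: "\<Phi> (?r `` {E}) = K (q E)" if E: "E \<in> ?X" for E
  proof -
    have "E \<in> ?r `` {E}" unfolding cl[OF E] using E by simp
    then have "(SOME E'. E' \<in> ?r `` {E}) \<in> ?r `` {E}" by (rule someI)
    then show ?thesis unfolding \<Phi>_def cl[OF E] by simp
  qed
  have "bij_betw \<Phi> (?X // ?r) (K ` normalized_cocycles)"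
  proof (rule bij_betw_imageI)
    show "inj_on \<Phi> (?X // ?r)"
    proof (rule inj_onI)
      fix P Q assume "P \<in> ?X // ?r" "Q \<in> ?X // ?r" and h: "\<Phi> P = \<Phi> Q"
      then obtain E E' where E: "E \<in> ?X" "P = ?r `` {E}" "E' \<in> ?X" "Q = ?r `` {E'}" by (auto elim!: quotientE)
      then have "K (q E) = K (q E')" using h \<Phi> by simp
      then show "P = Q" unfolding E(2,4) cl[OF E(1)] cl[OF E(3)] by simp
    qed
    have "?X // ?r = (\<lambda>E. ?r `` {E}) ` ?X" unfolding quotient_def by blast
    then have "\<Phi> ` (?X // ?r) = (\<lambda>E. \<Phi> (?r `` {E})) ` ?X" by (simp only: image_image)
    also have "\<dots> = (\<lambda>E. K (q E)) ` ?X" by (rule image_cong[OF refl \<Phi>])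
    finally show "\<Phi> ` (?X // ?r) = K ` normalized_cocycles" using img by simp
  qed
  then show ?thesis unfolding admissible_ext_classes_def cohomology_carrier by blast
qed

end

theorem theorem2p22:
  fixes A :: "('a, 'm) monoid_scheme"
    and G :: "('g, 'n) monoid_scheme"
    and \<psi> :: "'g \<Rightarrow> ('a \<rightharpoonup> 'a) set"
    and e :: "'a \<times> 'g \<Rightarrow> 'u"
  assumes "abstract_kernel A G \<psi>"
    and "\<exists>E :: ('a, 'w, 'g) ext. E \<in> admissible_exts A G \<psi>"
    and "inj_on e (carrier A \<times> carrier G)"
  shows "\<exists>\<Phi>. bij_betw \<Phi> (admissible_ext_classes A G \<psi> :: ('a, 'u, 'g) ext set set)
    (carrier (cohomology (center_sg A) G (center_action A G \<psi>) 2))"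
proof -
  \<comment> \<open>The given extension serves as base point; its type is independent of the one in
    which the classes are formed.\<close>
  obtain W :: "'w monoid" and i j where "(W, i, j) \<in> admissible_exts A G \<psi>" using assms(2) by (metis prod_cases3)
  then obtain R where "kernel_ext A W G j i \<psi> R" using kernel_ext_of_admissible[OF assms(1)] by blast
  then show ?thesis by (rule kernel_ext.classes_cohomology[OF _ assms(3)])
qed

end
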